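(* Let $n\ge 5$, $-n<\alpha<n-4$, $p>1$, and suppose $(p,\alpha,\beta,n)$ satisfies $$\frac{n+\alpha}{2}+\frac{n+\beta}{p+1}=n-2.$$ Let $\lambda,\mu$ be real numbers such that one of the following three conditions holds: $(C_1)$ $\mu\ge 0$ and $\lambda\le (n-2)(2+\alpha)-2\sqrt{\mu}$; $(C_2)$ $0\le\mu\le\left(\frac{n-4-\alpha}{2}\right)^4$ and $(n-2)(2+\alpha)+2\sqrt{\mu}\le\lambda\le\frac{4\mu}{(n-4-\alpha)^2}+\frac{(n+\alpha)^2}{4}$; $(C_3)$ $\mu\le 0$ and $\lambda\le\frac{4\mu}{(n-4-\alpha)^2}+\frac{(n+\alpha)^2}{4}$. Then in $\mathcal{N}^2_{rad}(\mathbb{R}^n,\alpha)$ the problem $$\Delta(|x|^{-\alpha}\Delta u)+\lambda\,\mathrm{div}(|x|^{-\alpha-2}\nabla u)+\mu|x|^{-\alpha-4}u=|x|^{\beta}u^{p}\quad\text{in }\mathbb{R}^n\setminus\{0\}$$ admits a unique positive solution $u$. Moreover: (i) If $\alpha=\beta>-2$ and $$\frac{\lambda}{(n-2)^2}=\frac{(p+1)^4-16\pm\sqrt{[(p+1)^4-16]^2+(p+1)^2(p+3)^4[(p+1)^2+4]^2\frac{\mu}{(n-2)^4}}}{2(p+1)^2(p+3)^2},$$ then the unique solution can be explicitly given by $$u(x)=u_1(x):=\frac{C_1}{2^{m_1}}|x|^{-\left(\frac{n-4-\alpha}{2}+\nu_1m_1\right)}(1+|x|^{2\nu_1})^{m_1},$$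 with $m_1=-\frac{n-4-\alpha}{2+\alpha}$, $\nu_1=\frac{2+\alpha}{2}\sqrt{1-\frac{2\lambda}{(n-2)^2+(2+\alpha)^2}}$, $C_1^{p-1}=m_1(m_1-1)(m_1-2)(m_1-3)\nu_1^4$. (ii) If $(n+\alpha)(n+\beta)=(n-4-\alpha)^2$ with $\alpha<-2$ and $$\frac{\lambda}{(n-2)^2}=\frac{(p+1)^2[16-(p+1)^4]\pm\sqrt{(p+1)^4[(p+1)^4-16]^2+16(p+1)^2(p+3)^4[(p+1)^2+4]^2\frac{\mu}{(n-2)^4}}}{8(p+1)^2(p+3)^2},$$ then the unique solution is given by $$u(x)=u_2(x):=\frac{C_2}{2^{m_2}}|x|^{-\left(\frac{n-4-\alpha}{2}+\nu_2m_2\right)}(1+|x|^{2\nu_2})^{m_2},$$ with $m_2=\frac{n+\alpha}{2+\alpha}$, $\nu_2=-\frac{2+\alpha}{2}\sqrt{1-\frac{2\lambda}{(n-2)^2+(2+\alpha)^2}}$, $C_2^{p-1}=m_2(m_2-1)(m_2-2)(m_2-3)\nu_2^4$.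
   Context: For $u\in C^\infty_{0,rad}(\mathbb{R}^n\setminus\{0\})=\{u\in C_0^\infty(\mathbb{R}^n\setminus\{0\}):u(x)=u(|x|)\}$ put $$\|u\|_\alpha^2:=\int_{\mathbb{R}^n}\left(|x|^{-\alpha}|\Delta u|^2-\lambda|x|^{-\alpha-2}|\nabla u|^2+\mu|x|^{-\alpha-4}u^2\right)dx .$$ Under any of the conditions $(C_1)$–$(C_3)$, $\|\cdot\|_\alpha$ is a norm on $C^\infty_{0,rad}(\mathbb{R}^n\setminus\{0\})$, and $\mathcal{N}^2_{rad}(\mathbb{R}^n,\alpha)$ denotes the completion of $C^\infty_{0,rad}(\mathbb{R}^n\setminus\{0\})$ in this norm.
   Formalization: Uniqueness is up to the dilations u ↦ τ^{(n−4−α)/2}u(τx), τ>0, which preserve the problem; the equality case λ = 4μ/(n−4−α)² + (n+α)²/4 is excluded, since no positive radial solution exists there. *)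

theory Defs
  imports "HOL-Analysis.Analysis"
begin

definition pderiv_at :: "'n \<Rightarrow> (real ^ 'n \<Rightarrow> real) \<Rightarrow> real ^ 'n::finite \<Rightarrow> real" where
  "pderiv_at i u x = deriv (\<lambda>t. u (x + t *\<^sub>R axis i 1)) 0"

definition grad :: "(real ^ 'n \<Rightarrow> real) \<Rightarrow> real ^ 'n::finite \<Rightarrow> real ^ 'n" where
  "grad u x = (\<chi> i. pderiv_at i u x)"

definition divg :: "(real ^ 'n \<Rightarrow> real ^ 'n) \<Rightarrow> real ^ 'n::finite \<Rightarrow> real" where
  "divg F x = (\<Sum>i\<in>UNIV. pderiv_at i (\<lambda>y. F y $ i) x)"

definition laplacian :: "(real ^ 'n \<Rightarrow> real) \<Rightarrow> real ^ 'n::finite \<Rightarrow> real" where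
  "laplacian u x = divg (grad u) x"

text \<open>Only used for open sets \<open>S\<close>, where the partial derivatives depend on \<open>u\<close> on \<open>S\<close> alone.\<close>

primrec Ck_on :: "nat \<Rightarrow> (real ^ 'n) set \<Rightarrow> (real ^ 'n::finite \<Rightarrow> real) \<Rightarrow> bool" where
  "Ck_on 0 S u \<longleftrightarrow> continuous_on S u"
| "Ck_on (Suc k) S u \<longleftrightarrow> u differentiable_on S \<and> (\<forall>i. Ck_on k S (pderiv_at i u))"

text \<open>Functions on the punctured space are total functions here; a test function has compact
  support in \<open>- {0}\<close> and hence vanishes near the origin.\<close>

definition test_rad :: "(real ^ 'n::finite \<Rightarrow> real) set" where
  "test_rad = {u. (\<forall>k. Ck_on k UNIV u) \<and>
     compact (closure {x. u x \<noteq> 0}) \<and> closure {x. u x \<noteq> 0} \<subseteq> - {0} \<and>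
     (\<forall>x y. norm x = norm y \<longrightarrow> u x = u y)}"

definition norm_alpha :: "real \<Rightarrow> real \<Rightarrow> real \<Rightarrow> (real ^ 'n::finite \<Rightarrow> real) \<Rightarrow> real" where
  "norm_alpha \<alpha> lam \<mu> u = sqrt (LINT x|lborel.
     norm x powr (-\<alpha>) * (laplacian u x)\<^sup>2
     - lam * norm x powr (-\<alpha> - 2) * (norm (grad u x))\<^sup>2
     + \<mu> * norm x powr (-\<alpha> - 4) * (u x)\<^sup>2)"

definition tendsto_L1loc :: "(nat \<Rightarrow> real ^ 'n \<Rightarrow> real) \<Rightarrow> (real ^ 'n::finite \<Rightarrow> real) \<Rightarrow> bool" where
  "tendsto_L1loc \<phi> u \<longleftrightarrow> (\<forall>K. compact K \<and> K \<subseteq> - {0} \<longrightarrow>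
     set_integrable lborel K u \<and>
     (\<lambda>k. LINT x:K|lborel. \<bar>\<phi> k x - u x\<bar>) \<longlonglongrightarrow> 0)"

definition test_Cauchy :: "real \<Rightarrow> real \<Rightarrow> real \<Rightarrow> (nat \<Rightarrow> real ^ 'n::finite \<Rightarrow> real) \<Rightarrow> bool" where
  "test_Cauchy \<alpha> lam \<mu> \<phi> \<longleftrightarrow> (\<forall>k. \<phi> k \<in> test_rad) \<and>
     (\<forall>e>0. \<exists>M. \<forall>k\<ge>M. \<forall>l\<ge>M. norm_alpha \<alpha> lam \<mu> (\<lambda>x. \<phi> k x - \<phi> l x) < e)"

text \<open>
  \<open>N\<close> is the completion of \<open>test_rad\<close> in \<open>norm_alpha\<close>, realised as a space of functions (not
  identified almost everywhere): mapping a Cauchy sequence to its limit in L1loc of the punctured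
  space is well defined and injective on equivalence classes, and \<open>N\<close> is its range.

  The realisation fails if \<open>lam = 4 \<mu> / (n - 4 - \<alpha>)^2 + (n + \<alpha>)^2 / 4\<close>: in the variable
  \<open>v(t) = |x| powr ((n - 4 - \<alpha>) / 2) * u(x)\<close>, \<open>t = - ln |x|\<close>, the norm then controls only
  \<open>v'\<close> and \<open>v''\<close>, and a Cauchy sequence determines its limit at best up to an additive
  constant in \<open>v\<close>.
\<close>

definition is_N2_rad :: "real \<Rightarrow> real \<Rightarrow> real \<Rightarrow> (real ^ 'n::finite \<Rightarrow> real) set \<Rightarrow> bool" where
  "is_N2_rad \<alpha> lam \<mu> N \<longleftrightarrow>
     (\<forall>\<phi>. test_Cauchy \<alpha> lam \<mu> \<phi> \<longrightarrow> (\<exists>u\<in>N. tendsto_L1loc \<phi> u)) \<and>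
     (\<forall>\<phi> :: nat \<Rightarrow> real ^ 'n \<Rightarrow> real. test_Cauchy \<alpha> lam \<mu> \<phi> \<and> tendsto_L1loc \<phi> (\<lambda>x. 0) \<longrightarrow>
        (\<lambda>k. norm_alpha \<alpha> lam \<mu> (\<phi> k)) \<longlonglongrightarrow> 0) \<and>
     N = {u. \<exists>\<phi>. test_Cauchy \<alpha> lam \<mu> \<phi> \<and> tendsto_L1loc \<phi> u}"

definition positive_solution ::
  "real \<Rightarrow> real \<Rightarrow> real \<Rightarrow> real \<Rightarrow> real \<Rightarrow> (real ^ 'n::finite \<Rightarrow> real) \<Rightarrow> bool" where
  "positive_solution \<alpha> \<beta> lam \<mu> p u \<longleftrightarrow> Ck_on 4 (- {0}) u \<and> (\<forall>x. x \<noteq> 0 \<longrightarrow> u x > 0 \<and>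
     laplacian (\<lambda>y. norm y powr (-\<alpha>) * laplacian u y) x
     + lam * divg (\<lambda>y. norm y powr (-\<alpha> - 2) *\<^sub>R grad u y) x
     + \<mu> * norm x powr (-\<alpha> - 4) * u x
     = norm x powr \<beta> * u x powr p)"

text \<open>On the critical hyperbola the equation, positivity and the norm are invariant under
  \<open>u \<mapsto> \<tau> powr ((n - 4 - \<alpha>) / 2) * u (\<tau> x)\<close> for \<open>\<tau> > 0\<close>, so
  uniqueness means uniqueness up to these dilations.\<close>

definition unique_positive_solution_in ::
  "(real ^ 'n::finite \<Rightarrow> real) set \<Rightarrow> real \<Rightarrow> real \<Rightarrow> real \<Rightarrow> real \<Rightarrow> real \<Rightarrow>
    (real ^ 'n \<Rightarrow> real) \<Rightarrow> bool" where
  "unique_positive_solution_in N \<alpha> \<beta> lam \<mu> p u \<longleftrightarrow>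
     u \<in> N \<and> positive_solution \<alpha> \<beta> lam \<mu> p u \<and>
     (\<forall>w\<in>N. positive_solution \<alpha> \<beta> lam \<mu> p w \<longrightarrow>
        (\<exists>\<tau>>0. \<forall>x. x \<noteq> 0 \<longrightarrow>
           w x = \<tau> powr ((real CARD('n) - 4 - \<alpha>) / 2) * u (\<tau> *\<^sub>R x)))"

end

theory Submission
  imports Defs "HOL-Probability.Helly_Selection"
begin

text \<open>
  In the variable \<open>t = - ln |x|\<close>, with \<open>a = (n - 4 - \<alpha>) / 2\<close>, \<open>b = (n + \<alpha>) / 2\<close> and
  \<open>u = |x| powr (- a) * v(t)\<close>, the critical problem becomes the autonomous equation
  \<open>v'''' - A v'' + B v = v powr p\<close> and the squared norm becomes a multiple of
  \<open>\<integral> (v''\<^sup>2 + A v'\<^sup>2 + B v\<^sup>2) dt\<close>, where \<open>A = a\<^sup>2 + b\<^sup>2 - \<lambda>\<close> and \<open>B = a\<^sup>2 b\<^sup>2 - \<lambda> a\<^sup>2 + \<mu>\<close>.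
  Under each of the three conditions the linear operator factors as \<open>(D\<^sup>2 - k\<^sup>2) (D\<^sup>2 - l\<^sup>2)\<close> with
  real \<open>k, l\<close>; these do not vanish, since for \<open>B = 0\<close> the completion is not a function space. A
  positive solution lies in the completion if and only if \<open>v\<close> is homoclinic to \<open>0\<close>.

  Existence: maximise \<open>\<integral> f (G\<^sub>k * G\<^sub>l * f)\<close>, where \<open>G\<^sub>c\<close> is the Green function of \<open>c\<^sup>2 - D\<^sup>2\<close>, over
  even, radially nonincreasing \<open>f \<ge> 0\<close> with \<open>\<integral> f powr q \<le> 1\<close>, \<open>q = (p + 1) / p\<close>. Monotonicity
  gives a common majorant and pointwise convergent subsequences, hence a maximiser \<open>f\<close>, and a
  multiple of \<open>f powr (1 / p)\<close> is a homoclinic solution.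

  Uniqueness up to translation: the factorisation into first-order operators gives a comparison
  principle, by which two bounded positive solutions with the same value and slope at a point
  coincide. Hence a homoclinic solution is symmetric about its only critical point, and two of them
  that are not translates of each other are ordered near \<open>-\<infinity>\<close>. If they are translated so that their
  expansions at \<open>-\<infinity>\<close> have the same leading term, the comparison principle rules this out.

  The explicit solutions are the multiples of \<open>cosh (\<nu> t) powr m\<close>, \<open>m = - 4 / (p - 1)\<close>, which solve
  the equation if \<open>B (a\<^sup>2 + b\<^sup>2)\<^sup>2 = a\<^sup>2 b\<^sup>2 A\<^sup>2\<close>; this is the quadratic equation for \<open>\<lambda>\<close> in (i) and (ii).
\<close>

section \<open>Linear differential inequalities\<close>

text \<open>Existence meets two obstacles: the line offers no compactness, and a maximiser among
  monotone functions admits only one-sided variations. Both yield to one feature: \<open>Kop\<close>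
  preserves even nonincreasing functions. Hence the potential \<open>S\<close> of the maximiser, and
  every truncated power of it, is again a competitor up to a factor, and the one-sided inequality
  tested with such a power is a dual-norm bound on \<open>S\<close> that forces equality in Young's
  inequality. For uniqueness, the fourth-order operator has no maximum principle of its own. Written
  as a chain of first-order factors it has nonnegative couplings, so data in the nonnegative cone
  stay there, while boundedness forbids the growth of the last component; together they make the two
  solutions equal. The order \<open>k <= l\<close> matters at -infinity: there exp (k t) is the
  slowest mode, a solution has a nonzero coefficient in it, and a translation in t rescales that
  coefficient, so two solutions can be normalised alike. Translations in t are the dilations of u
  modulo which uniqueness is stated.\<close>

lemma exp_weight_deriv:
  fixes f :: "real \<Rightarrow> real"
  assumes "(f has_real_derivative D) (at t)"
  shows "((\<lambda>t. exp (c * t) * f t) has_real_derivative exp (c * t) * (D + c * f t)) (at t)"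
  by (auto intro!: derivative_eq_intros assms simp: algebra_simps)

lemma nondecreasing_below:
  fixes f :: "real \<Rightarrow> real"
  assumes "\<And>t. t \<le> T \<Longrightarrow> (f has_real_derivative f' t) (at t)"
    and "\<And>t. t \<le> T \<Longrightarrow> f' t \<ge> 0" and "s \<le> t" "t \<le> T"
  shows "f s \<le> f t"
  using DERIV_nonneg_imp_nondecreasing[of s t f] assms by (meson order_trans)

lemma bounded_exp_weight_at_bot:
  fixes f :: "real \<Rightarrow> real"
  assumes "\<And>t. \<bar>f t\<bar> \<le> M" "c > 0"
  shows "((\<lambda>t. exp (c * t) * f t) \<longlongrightarrow> 0) at_bot"
proof (rule tendsto_0_le[where K = M and f = "\<lambda>t. exp (c * t)"])
  have "filterlim (\<lambda>t. c * t) at_bot at_bot"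
    by (rule filterlim_tendsto_pos_mult_at_bot[OF tendsto_const assms(2) filterlim_ident])
  then show "((\<lambda>t. exp (c * t)) \<longlongrightarrow> 0) at_bot"
    by (rule filterlim_compose[OF exp_at_bot])
  show "\<forall>\<^sub>F t in at_bot. norm (exp (c * t) * f t) \<le> norm (exp (c * t)) * M"
    using assms(1) by (auto simp: abs_mult)
qed

lemma bounded_exp_weight_at_top:
  fixes f :: "real \<Rightarrow> real"
  assumes "\<And>t. \<bar>f t\<bar> \<le> M" "c < 0"
  shows "((\<lambda>t. exp (c * t) * f t) \<longlongrightarrow> 0) at_top"
proof -
  have "((\<lambda>t. exp ((-c) * t) * f (- t)) \<longlongrightarrow> 0) at_bot"
    using assms by (intro bounded_exp_weight_at_bot) auto
  then show ?thesis
    by (simp add: filterlim_at_bot_mirror)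
qed

lemma ge_limit_at_bot:
  fixes f :: "real \<Rightarrow> real"
  assumes lim: "(f \<longlongrightarrow> L) at_bot"
    and D: "\<And>t. t \<le> T \<Longrightarrow> (f has_real_derivative f' t) (at t)"
    and pos: "\<And>t. t \<le> T \<Longrightarrow> f' t \<ge> 0" and t: "t \<le> T"
  shows "L \<le> f t"
proof (rule tendsto_upperbound[OF lim])
  show "\<forall>\<^sub>F s in at_bot. f s \<le> f t"
    using eventually_le_at_bot[of t]
    by eventually_elim (rule nondecreasing_below[of T f f'], use D pos t in auto)
qed auto

lemma gt_limit_at_bot:
  fixes f :: "real \<Rightarrow> real"
  assumes lim: "(f \<longlongrightarrow> L) at_bot"
    and D: "\<And>t. t \<le> T \<Longrightarrow> (f has_real_derivative f' t) (at t)"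
    and pos: "\<And>t. t \<le> T \<Longrightarrow> f' t > 0" and t: "t \<le> T"
  shows "L < f t"
proof -
  have "L \<le> f (t - 1)"
    by (rule ge_limit_at_bot[OF lim, of T f']) (use D pos t in \<open>auto intro: less_imp_le\<close>)
  also have "f (t - 1) < f t"
  proof (rule DERIV_pos_imp_increasing[where f = f])
    fix x assume "t - 1 \<le> x" "x \<le> t"
    then have "x \<le> T" using t by linarith
    then show "\<exists>y. (f has_real_derivative y) (at x) \<and> 0 < y" using D pos by blast
  qed simp
  finally show ?thesis .
qed

lemma nonpos_of_exp_growth:
  fixes f :: "real \<Rightarrow> real"
  assumes D: "\<And>t. t \<ge> t0 \<Longrightarrow> (f has_real_derivative f' t) (at t)"
    and ge: "\<And>t. t \<ge> t0 \<Longrightarrow> f' t \<ge> c * f t" and c: "c > 0"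
    and bd: "\<And>t. \<bar>f t\<bar> \<le> M" and t: "t \<ge> t0"
  shows "f t \<le> 0"
proof -
  let ?g = "\<lambda>t. exp ((-c) * t) * f t"
  have lim: "(?g \<longlongrightarrow> 0) at_top"
    using bounded_exp_weight_at_top[OF bd, of "-c"] c by auto
  have "?g t \<le> 0"
  proof (rule tendsto_lowerbound[OF lim])
    have "?g t \<le> ?g s" if "s \<ge> t" for s
    proof (rule DERIV_nonneg_imp_nondecreasing[OF that])
      fix x assume "t \<le> x" "x \<le> s"
      then have x: "x \<ge> t0" using t by auto
      show "\<exists>y. (?g has_real_derivative y) (at x) \<and> 0 \<le> y"
        by (rule exI[of _ "exp (- c * x) * (f' x + (-c) * f x)"], rule conjI,
            rule exp_weight_deriv[OF D[OF x]])
           (use ge[OF x] in simp)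
    qed
    then show "\<forall>\<^sub>F s in at_top. ?g t \<le> ?g s"
      using eventually_ge_at_top[of t] by (rule eventually_mono[rotated])
  qed auto
  then show ?thesis by (simp add: mult_le_0_iff)
qed

text \<open>With \<open>f'' - c\<^sup>2 f = (D + c) (D - c) f\<close>, the first factor is integrated from \<open>-\<infinity>\<close>.\<close>

lemma exp_growth_of_second_order:
  fixes f :: "real \<Rightarrow> real"
  assumes D1: "\<And>t. t \<le> T \<Longrightarrow> (f has_real_derivative f1 t) (at t)"
    and D2: "\<And>t. t \<le> T \<Longrightarrow> (f1 has_real_derivative f2 t) (at t)"
    and ge: "\<And>t. t \<le> T \<Longrightarrow> f2 t \<ge> c\<^sup>2 * f t" and c: "c > 0"
    and bd: "\<And>t. \<bar>f t\<bar> \<le> M" "\<And>t. \<bar>f1 t\<bar> \<le> M" and t: "t \<le> T"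
  shows "c * f t \<le> f1 t"
proof -
  define P where "P t = f1 t - c * f t" for t
  have bP: "\<bar>P t\<bar> \<le> M + c * M" for t
  proof -
    have "c * \<bar>f t\<bar> \<le> c * M" using bd c by (intro mult_left_mono) auto
    then have "\<bar>c * f t\<bar> \<le> c * M" using c by (simp add: abs_mult)
    then show ?thesis unfolding P_def using bd(2)[of t] by linarith
  qed
  have "0 \<le> exp (c * t) * P t"
  proof (rule ge_limit_at_bot[where T = T, OF bounded_exp_weight_at_bot[OF bP c]])
    fix s assume s: "s \<le> T"
    have "(P has_real_derivative f2 s - c * f1 s) (at s)"
      unfolding P_def by (auto intro!: derivative_eq_intros D1 D2 s)
    from exp_weight_deriv[OF this, of c]
    show "((\<lambda>t. exp (c * t) * P t) has_real_derivative
            exp (c * s) * (f2 s - c * f1 s + c * P s)) (at s)" .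
    show "0 \<le> exp (c * s) * (f2 s - c * f1 s + c * P s)"
      using ge[OF s] by (simp add: P_def algebra_simps power2_eq_square)
  qed (rule t)
  then show ?thesis by (simp add: P_def zero_le_mult_iff)
qed

text \<open>The remaining factor D - c is integrated towards +infinity: from f' >= c f a positive
  value would grow exponentially, which boundedness excludes.\<close>

lemma nonpos_of_second_order:
  fixes f :: "real \<Rightarrow> real"
  assumes D1: "\<And>t. (f has_real_derivative f1 t) (at t)"
    and D2: "\<And>t. (f1 has_real_derivative f2 t) (at t)"
    and ge: "\<And>t. f2 t \<ge> c\<^sup>2 * f t" and c: "c > 0"
    and bd: "\<And>t. \<bar>f t\<bar> \<le> M" "\<And>t. \<bar>f1 t\<bar> \<le> M"
  shows "f t \<le> 0"
  by (rule nonpos_of_exp_growth[of t, where f' = f1 and c = c and M = M])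
     (use exp_growth_of_second_order[OF D1 D2 ge c bd] c bd D1 in auto)

text \<open>By f' >= c f the function exp (- c t) f is nondecreasing up to T, so f is compared with
  its value at T.\<close>

lemma exp_decay_of_second_order:
  fixes f :: "real \<Rightarrow> real"
  assumes D1: "\<And>t. t \<le> T \<Longrightarrow> (f has_real_derivative f1 t) (at t)"
    and D2: "\<And>t. t \<le> T \<Longrightarrow> (f1 has_real_derivative f2 t) (at t)"
    and ge: "\<And>t. t \<le> T \<Longrightarrow> f2 t \<ge> c\<^sup>2 * f t" and c: "c > 0"
    and bd: "\<And>t. \<bar>f t\<bar> \<le> M" "\<And>t. \<bar>f1 t\<bar> \<le> M" and t: "t \<le> T"
  shows "f t \<le> f T * exp (c * (t - T))"
proof -
  have "exp ((-c) * t) * f t \<le> exp ((-c) * T) * f T"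
  proof (rule nondecreasing_below[where f = "\<lambda>t. exp ((-c) * t) * f t"
        and f' = "\<lambda>t. exp ((-c) * t) * (f1 t + (-c) * f t)" and T = T])
    fix s assume s: "s \<le> T"
    show "((\<lambda>t. exp ((-c) * t) * f t) has_real_derivative exp ((-c) * s) * (f1 s + (-c) * f s)) (at s)"
      by (rule exp_weight_deriv[OF D1[OF s]])
    show "0 \<le> exp ((-c) * s) * (f1 s + (-c) * f s)"
      using exp_growth_of_second_order[OF D1 D2 ge c bd s] by simp
  qed (use t in auto)
  then have "exp (c * t) * (exp ((-c) * t) * f t) \<le> exp (c * t) * (exp ((-c) * T) * f T)"
    by (rule mult_left_mono) simp
  moreover have "exp (c * t) * (exp ((-c) * t) * f t) = f t"
    by (simp add: mult.assoc[symmetric] exp_minus)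
  moreover have "exp (c * t) * (exp ((-c) * T) * f T) = f T * exp (c * (t - T))"
    by (simp add: exp_minus exp_diff right_diff_distrib divide_simps)
  ultimately show ?thesis by linarith
qed

text \<open>An interpolation argument of Landau type for s = v'' - A v, whose second derivative is
  the bounded quantity. Second differences of v bound s at some point of every window of length 2;
  the mean value theorem between two such points bounds s' somewhere nearby, and the bound on s''
  carries this to every t.\<close>

lemma bounded_derivatives:
  fixes v :: "real \<Rightarrow> real"
  assumes D: "\<And>t. (v has_real_derivative v1 t) (at t)" "\<And>t. (v1 has_real_derivative v2 t) (at t)"
    "\<And>t. (v2 has_real_derivative v3 t) (at t)" "\<And>t. (v3 has_real_derivative v4 t) (at t)"
    and V: "\<And>t. \<bar>v t\<bar> \<le> V" and F: "\<And>t. \<bar>v4 t - A * v2 t\<bar> \<le> M"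
  shows "\<exists>C. \<forall>t. \<bar>v t\<bar> \<le> C \<and> \<bar>v1 t\<bar> \<le> C \<and> \<bar>v2 t\<bar> \<le> C \<and> \<bar>v3 t\<bar> \<le> C"
proof -
  define s where "s t = v2 t - A * v t" for t
  define s1 where "s1 t = v3 t - A * v1 t" for t
  \<comment> \<open>A second difference of v with unit step is at most 4 V in absolute value and
    equals v'' at some intermediate point.\<close>
  define S where "S = 4 * V + \<bar>A\<bar> * V"
  have V0: "V \<ge> 0" and M0: "M \<ge> 0" using V[of 0] F[of 0] by linarith+
  have ds: "(s has_real_derivative s1 t) (at t)" for t
    unfolding s_def s1_def by (auto intro!: derivative_eq_intros D)
  have ds1: "(s1 has_real_derivative v4 t - A * v2 t) (at t)" for t
    unfolding s1_def by (auto intro!: derivative_eq_intros D)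
  have AV: "\<bar>A * v t\<bar> \<le> \<bar>A\<bar> * V" for t
    using V[of t] by (simp add: abs_mult mult_left_mono)
  have pt: "\<exists>\<eta>. t < \<eta> \<and> \<eta> < t + 2 \<and> \<bar>s \<eta>\<bar> \<le> S" for t
  proof -
    have "\<exists>z>t. z < t + 1 \<and> (v (t + 1 + 1) - v (t + 1)) - (v (t + 1) - v t)
        = (t + 1 - t) * (v1 (z + 1) - v1 z)"
    proof (rule MVT2[where f = "\<lambda>t. v (t + 1) - v t" and f' = "\<lambda>t. v1 (t + 1) - v1 t"])
      fix x
      have "((\<lambda>t. v (t + 1)) has_real_derivative v1 (x + 1)) (at x)"
        using D(1)[of "x + 1"] DERIV_shift by blast
      then show "((\<lambda>t. v (t + 1) - v t) has_real_derivative v1 (x + 1) - v1 x) (at x)"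
        by (auto intro!: derivative_eq_intros D)
    qed auto
    then obtain z where z: "t < z" "z < t + 1" "v (t + 2) - 2 * v (t + 1) + v t = v1 (z + 1) - v1 z"
      by (auto simp: algebra_simps)
    have "\<exists>y>z. y < z + 1 \<and> v1 (z + 1) - v1 z = (z + 1 - z) * v2 y"
      by (rule MVT2) (use D in auto)
    then obtain y where y: "z < y" "y < z + 1" "v1 (z + 1) - v1 z = v2 y" by auto
    have "\<bar>v2 y\<bar> \<le> 4 * V"
      using z(3) y(3) V[of t] V[of "t + 1"] V[of "t + 2"] by linarith
    then have "\<bar>s y\<bar> \<le> S" using AV[of y] unfolding s_def S_def by linarith
    then show ?thesis using y z by (intro exI[of _ y]) auto
  qed
  have s1b: "\<bar>s1 t\<bar> \<le> 2 * S + 5 * M" for t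
  proof -
    obtain x where x: "t < x" "x < t + 2" "\<bar>s x\<bar> \<le> S" using pt by blast
    \<comment> \<open>The two windows are separated by 1, so y - x > 1 and the difference quotient
      of s does not exceed 2 S.\<close>
    obtain y where y: "t + 3 < y" "y < t + 3 + 2" "\<bar>s y\<bar> \<le> S" using pt by blast
    have "\<exists>z>x. z < y \<and> s y - s x = (y - x) * s1 z"
      by (rule MVT2) (use ds x y in auto)
    then obtain z where z: "x < z" "z < y" "s y - s x = (y - x) * s1 z" by auto
    have "1 * \<bar>s1 z\<bar> \<le> (y - x) * \<bar>s1 z\<bar>" using x y by (intro mult_right_mono) auto
    also have "\<dots> = \<bar>s y - s x\<bar>" using z x y by (simp add: abs_mult)
    also have "\<dots> \<le> 2 * S" using x y by linarith
    finally have 1: "\<bar>s1 z\<bar> \<le> 2 * S" by simp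
    have "\<exists>q>t. q < z \<and> s1 z - s1 t = (z - t) * (v4 q - A * v2 q)"
      by (rule MVT2) (use ds1 x z in auto)
    then obtain q where q: "s1 z - s1 t = (z - t) * (v4 q - A * v2 q)" by auto
    have "(z - t) * \<bar>v4 q - A * v2 q\<bar> \<le> 5 * M"
      using F[of q] x y z by (intro mult_mono) auto
    then have "\<bar>s1 z - s1 t\<bar> \<le> 5 * M" using q x z by (simp add: abs_mult)
    then show ?thesis using 1 by linarith
  qed
  have sb: "\<bar>s t\<bar> \<le> S + 2 * (2 * S + 5 * M)" for t
  proof -
    obtain x where x: "t < x" "x < t + 2" "\<bar>s x\<bar> \<le> S" using pt by blast
    have "\<exists>z>t. z < x \<and> s x - s t = (x - t) * s1 z" by (rule MVT2) (use ds x in auto)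
    then obtain z where z: "s x - s t = (x - t) * s1 z" by auto
    have "(x - t) * \<bar>s1 z\<bar> \<le> 2 * (2 * S + 5 * M)"
      using s1b[of z] x by (intro mult_mono) auto
    then have "\<bar>s x - s t\<bar> \<le> 2 * (2 * S + 5 * M)" using z x by (simp add: abs_mult)
    then show ?thesis using x by linarith
  qed
  define C2 where "C2 = S + 2 * (2 * S + 5 * M) + \<bar>A\<bar> * V"
  have v2b: "\<bar>v2 t\<bar> \<le> C2" for t
    using sb[of t] AV[of t] unfolding s_def C2_def by linarith
  have v1b: "\<bar>v1 t\<bar> \<le> 2 * V + C2" for t
  proof -
    have "\<exists>z>t. z < t + 1 \<and> v (t + 1) - v t = (t + 1 - t) * v1 z" by (rule MVT2) (use D in auto)
    then obtain z where z: "t < z" "z < t + 1" "v (t + 1) - v t = v1 z" by auto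
    have "\<exists>q>t. q < z \<and> v1 z - v1 t = (z - t) * v2 q" by (rule MVT2) (use D z in auto)
    then obtain q where q: "v1 z - v1 t = (z - t) * v2 q" by auto
    have "(z - t) * \<bar>v2 q\<bar> \<le> 1 * C2"
      using v2b[of q] z by (intro mult_mono) auto
    then have "\<bar>v1 z - v1 t\<bar> \<le> C2" using q z by (simp add: abs_mult)
    then show ?thesis using z V[of t] V[of "t + 1"] by linarith
  qed
  have v3b: "\<bar>v3 t\<bar> \<le> 2 * S + 5 * M + \<bar>A\<bar> * (2 * V + C2)" for t
  proof -
    have "\<bar>A * v1 t\<bar> \<le> \<bar>A\<bar> * (2 * V + C2)" using v1b[of t] by (simp add: abs_mult mult_left_mono)
    then show ?thesis using s1b[of t] unfolding s1_def by linarith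
  qed
  show ?thesis
    by (rule exI[of _ "Max {V, C2, 2 * V + C2, 2 * S + 5 * M + \<bar>A\<bar> * (2 * V + C2)}"])
       (use V v2b v1b v3b in \<open>auto simp: le_max_iff_disj\<close>)
qed

section \<open>Noncrossing of bounded positive solutions\<close>

text \<open>Squaring the negative part makes it continuously differentiable across 0, so leaving a
  cone can be measured by a differentiable quantity.\<close>

lemma sq_min_zero_deriv:
  fixes f :: "real \<Rightarrow> real"
  assumes "(f has_real_derivative f') (at t)"
  shows "((\<lambda>t. (min (f t) 0)\<^sup>2) has_real_derivative 2 * min (f t) 0 * f') (at t)"
proof -
  have "((\<lambda>x::real. (min x 0)\<^sup>2) has_real_derivative 2 * min x 0) (at x)" for x
  proof (cases x "0::real" rule: linorder_cases)
    case less
    have "((\<lambda>x::real. x\<^sup>2) has_real_derivative 2 * min x 0) (at x)"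
      using less by (auto intro!: derivative_eq_intros)
    then show ?thesis
      by (rule has_field_derivative_transform_within_open[of _ _ _ "{..<0}"])
         (use less in \<open>auto simp: min_def\<close>)
  next
    case greater
    have "((\<lambda>x::real. 0) has_real_derivative 2 * min x 0) (at x)"
      using greater by (auto intro!: derivative_eq_intros)
    then show ?thesis
      by (rule has_field_derivative_transform_within_open[of _ _ _ "{0<..}"])
         (use greater in \<open>auto simp: min_def\<close>)
  next
    case equal
    have "((\<lambda>y::real. ((min y 0)\<^sup>2 - (min 0 0)\<^sup>2) / (y - 0)) \<longlongrightarrow> 0) (at 0)"
    proof (rule tendsto_0_le[where f = "\<lambda>y. y" and K = 1])
      show "\<forall>\<^sub>F y::real in at 0. norm (((min y 0)\<^sup>2 - (min 0 0)\<^sup>2) / (y - 0)) \<le> norm y * 1"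
        by (rule always_eventually) (auto simp: min_def power2_eq_square)
    qed (rule tendsto_ident_at)
    then show ?thesis using equal by (simp add: has_field_derivative_iff)
  qed
  from DERIV_chain2[OF this assms] show ?thesis .
qed

text \<open>The left side is the derivative of the squared negative part of x along x' = y + c x. As
  y couples with a positive sign, only its negative part can push x below 0.\<close>

lemma mult_min_zero_le:
  fixes x y c :: real
  shows "2 * min x 0 * (y + c * x) \<le> (min x 0)\<^sup>2 + (min y 0)\<^sup>2 + 2 * c * (min x 0)\<^sup>2"
proof -
  have 1: "min x 0 * x = (min x 0)\<^sup>2" by (auto simp: min_def power2_eq_square)
  have "min x 0 * y \<le> min x 0 * min y 0" by (intro mult_left_mono_neg) auto
  moreover have "2 * (min x 0 * min y 0) \<le> (min x 0)\<^sup>2 + (min y 0)\<^sup>2"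
    using zero_le_power2[of "min x 0 - min y 0"] by (simp add: power2_diff)
  moreover have "2 * min x 0 * (y + c * x) = 2 * (min x 0 * y) + 2 * c * (min x 0 * x)"
    by (simp add: algebra_simps)
  ultimately show ?thesis unfolding 1 by linarith
qed

text \<open>Arithmetic for a Gronwall bound: a, b, c, e stand for the squared negative parts of the
  four components and T1 to T4 for their derivatives. The constant is generous, so that everything
  discarded has a visible sign.\<close>

lemma cooperative_sum_le:
  fixes a b c e k l L :: real
  assumes "T1 \<le> a + b + 2 * (- k) * a" "T2 \<le> b + c + 2 * k * b" "T3 \<le> c + e + 2 * (- l) * c"
    "T4 \<le> L * (e + a) + 2 * l * e" and "k > 0" "l > 0" "L \<ge> 0" and "0 \<le> a" "0 \<le> b" "0 \<le> c" "0 \<le> e"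
  shows "T1 + T2 + T3 + T4 \<le> (2 + 2 * k + 2 * l + L) * (a + b + c + e)"
proof -
  have "0 \<le> k * a" "0 \<le> k * c" "0 \<le> k * e" "0 \<le> l * a" "0 \<le> l * b" "0 \<le> l * c" "0 \<le> L * b" "0 \<le> L * c"
    using assms by simp_all
  then have "0 \<le> a + e + 4 * (k * a) + 2 * (k * c) + 2 * (k * e) + 2 * (l * a) + 2 * (l * b) + 4 * (l * c)
      + L * b + L * c"
    using assms by (intro add_nonneg_nonneg) simp_all
  also have "\<dots> = (2 + 2 * k + 2 * l + L) * (a + b + c + e) - ((a + b + 2 * (- k) * a)
      + (b + c + 2 * k * b) + (c + e + 2 * (- l) * c) + (L * (e + a) + 2 * l * e))"
    by (simp add: algebra_simps)
  finally have "(a + b + 2 * (- k) * a) + (b + c + 2 * k * b) + (c + e + 2 * (- l) * c)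
      + (L * (e + a) + 2 * l * e) \<le> (2 + 2 * k + 2 * l + L) * (a + b + c + e)"
    by simp
  with add_mono[OF add_mono[OF add_mono[OF assms(1,2)] assms(3)] assms(4)] show ?thesis
    by (rule order_trans)
qed

text \<open>The operator factors as \<open>(D - l) (D + l) (D - k) (D + k)\<close>; for the successive factors
  \<open>d, z, w, y\<close> the equation is a cooperative first-order system, which preserves the
  nonnegative cone.\<close>

lemma cone_forward:
  fixes d d1 d2 d3 h :: "real \<Rightarrow> real"
  assumes D: "\<And>t. (d has_real_derivative d1 t) (at t)" "\<And>t. (d1 has_real_derivative d2 t) (at t)"
    "\<And>t. (d2 has_real_derivative d3 t) (at t)"
    "\<And>t. (d3 has_real_derivative (k\<^sup>2 + l\<^sup>2) * d2 t - k\<^sup>2 * l\<^sup>2 * d t + h t) (at t)"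
    and kl: "k > 0" "l > 0" and L: "L \<ge> 0"
    and h: "\<And>t. h t \<ge> L * min (d t) 0" "\<And>t. d t > 0 \<Longrightarrow> h t > 0"
    and bd: "\<And>t. \<bar>d t\<bar> \<le> M" "\<And>t. \<bar>d1 t\<bar> \<le> M" "\<And>t. \<bar>d2 t\<bar> \<le> M" "\<And>t. \<bar>d3 t\<bar> \<le> M"
    and init: "d t0 \<ge> 0" "d1 t0 + k * d t0 \<ge> 0" "d2 t0 - k\<^sup>2 * d t0 \<ge> 0"
      "d3 t0 - k\<^sup>2 * d1 t0 + l * (d2 t0 - k\<^sup>2 * d t0) \<ge> 0"
    and t: "t \<ge> t0"
  shows "d t = 0"
proof -
  define z where "z t = d1 t + k * d t" for t
  define w where "w t = d2 t - k\<^sup>2 * d t" for t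
  define y where "y t = d3 t - k\<^sup>2 * d1 t + l * w t" for t
  have dd: "(d has_real_derivative z t + (- k) * d t) (at t)" for t
    using D(1)[of t] by (simp add: z_def)
  have dz: "(z has_real_derivative w t + k * z t) (at t)" for t
    unfolding z_def w_def
    by (auto intro!: derivative_eq_intros D simp: algebra_simps power2_eq_square)
  have dw: "(w has_real_derivative y t + (- l) * w t) (at t)" for t
    unfolding w_def y_def
    by (auto intro!: derivative_eq_intros D simp: algebra_simps power2_eq_square)
  have dy: "(y has_real_derivative h t + l * y t) (at t)" for t
    unfolding y_def w_def
    by (auto intro!: derivative_eq_intros D simp: algebra_simps power2_eq_square)
  \<comment> \<open>\<open>N\<close> vanishes exactly when all four components are nonnegative. The
    Gronwall inequality N' <= C N with N t0 = 0 keeps it at 0.\<close>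
  define N where "N t = (min (d t) 0)\<^sup>2 + (min (z t) 0)\<^sup>2 + (min (w t) 0)\<^sup>2 + (min (y t) 0)\<^sup>2" for t
  define N' where "N' t = 2 * min (d t) 0 * (z t + (- k) * d t) + 2 * min (z t) 0 * (w t + k * z t)
      + 2 * min (w t) 0 * (y t + (- l) * w t) + 2 * min (y t) 0 * (h t + l * y t)" for t
  have dN: "(N has_real_derivative N' t) (at t)" for t
    unfolding N_def N'_def by (intro DERIV_add sq_min_zero_deriv dd dz dw dy)
  define C where "C = 2 + 2 * k + 2 * l + L"
  have N'le: "N' t \<le> C * N t" for t
  proof -
    have "2 * min (y t) 0 * (h t + l * y t) \<le> 2 * min (y t) 0 * (L * min (d t) 0 + l * y t)"
      using h(1)[of t] by (intro mult_left_mono_neg) auto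
    moreover have "2 * min (y t) 0 * (L * min (d t) 0 + l * y t)
        = L * (2 * min (y t) 0 * min (d t) 0) + 2 * l * (min (y t) 0)\<^sup>2"
      by (auto simp: min_def power2_eq_square algebra_simps)
    moreover have "2 * min (y t) 0 * min (d t) 0 \<le> (min (y t) 0)\<^sup>2 + (min (d t) 0)\<^sup>2"
      using zero_le_power2[of "min (y t) 0 - min (d t) 0"] by (simp add: power2_diff)
    then have "L * (2 * min (y t) 0 * min (d t) 0) \<le> L * ((min (y t) 0)\<^sup>2 + (min (d t) 0)\<^sup>2)"
      using L by (rule mult_left_mono)
    ultimately have "2 * min (y t) 0 * (h t + l * y t)
        \<le> L * ((min (y t) 0)\<^sup>2 + (min (d t) 0)\<^sup>2) + 2 * l * (min (y t) 0)\<^sup>2"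
      by linarith
    from cooperative_sum_le[OF mult_min_zero_le mult_min_zero_le mult_min_zero_le this kl L]
    show ?thesis unfolding N'_def N_def C_def by simp
  qed
  have nonneg: "d t \<ge> 0 \<and> z t \<ge> 0 \<and> w t \<ge> 0 \<and> y t \<ge> 0" if t: "t \<ge> t0" for t
  proof -
    have "exp ((-C) * t) * N t \<le> exp ((-C) * t0) * N t0"
    proof (rule DERIV_nonpos_imp_nonincreasing[OF t, of "\<lambda>t. exp ((-C) * t) * N t"])
      fix x
      show "\<exists>y. ((\<lambda>t. exp ((-C) * t) * N t) has_real_derivative y) (at x) \<and> y \<le> 0"
        by (rule exI[of _ "exp ((-C) * x) * (N' x + (-C) * N x)"], rule conjI,
            rule exp_weight_deriv[OF dN])
           (use N'le[of x] in \<open>simp add: mult_le_0_iff\<close>)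
    qed
    also have "N t0 = 0" using init by (simp add: N_def z_def w_def y_def)
    finally have "N t \<le> 0" by (simp add: mult_le_0_iff)
    moreover have "0 \<le> (min (d t) 0)\<^sup>2" "0 \<le> (min (z t) 0)\<^sup>2" "0 \<le> (min (w t) 0)\<^sup>2" "0 \<le> (min (y t) 0)\<^sup>2"
      by auto
    ultimately have "(min (d t) 0)\<^sup>2 = 0" "(min (z t) 0)\<^sup>2 = 0" "(min (w t) 0)\<^sup>2 = 0" "(min (y t) 0)\<^sup>2 = 0"
      unfolding N_def by linarith+
    then show ?thesis by (auto simp: min_def split: if_splits)
  qed
  have M0: "M \<ge> 0" using bd(1)[of 0] by linarith
  have wb: "\<bar>w t\<bar> \<le> M + k\<^sup>2 * M" for t
  proof -
    have "\<bar>k\<^sup>2 * d t\<bar> \<le> k\<^sup>2 * M" using bd(1)[of t] by (simp add: abs_mult mult_left_mono)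
    then show ?thesis using bd(3)[of t] unfolding w_def by linarith
  qed
  have yb: "\<bar>y t\<bar> \<le> M + k\<^sup>2 * M + l * (M + k\<^sup>2 * M)" for t
  proof -
    have "\<bar>k\<^sup>2 * d1 t\<bar> \<le> k\<^sup>2 * M" using bd(2)[of t] by (simp add: abs_mult mult_left_mono)
    moreover have "\<bar>l * w t\<bar> \<le> l * (M + k\<^sup>2 * M)" using wb[of t] kl by (simp add: abs_mult mult_left_mono)
    ultimately show ?thesis using bd(4)[of t] unfolding y_def by linarith
  qed
  \<comment> \<open>On the cone y' >= l y, so a positive value of the bounded function y would grow
    exponentially.\<close>
  have y0: "y t = 0" if t: "t \<ge> t0" for t
  proof -
    have "y t \<le> 0"
    proof (rule nonpos_of_exp_growth[OF dy _ kl(2) yb t])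
      fix s assume "s \<ge> t0"
      then have "d s \<ge> 0" using nonneg by blast
      then show "h s + l * y s \<ge> l * y s" using h(1)[of s] by simp
    qed
    then show ?thesis using nonneg[OF t] by linarith
  qed
  \<comment> \<open>A positive d makes y' = h positive, although y vanishes at t and everywhere to
    its right.\<close>
  have "\<not> d t > 0"
  proof
    assume "d t > 0"
    then have "h t + l * y t > 0" using h(2) y0[OF t] by simp
    from DERIV_pos_inc_right[OF dy this] obtain e where
      e: "e > 0" "\<And>h. h > 0 \<Longrightarrow> h < e \<Longrightarrow> y t < y (t + h)" by blast
    then have "y t < y (t + e / 2)" by simp
    then show False using y0[OF t] y0[of "t + e / 2"] t e by simp
  qed
  then show ?thesis using nonneg[OF t] by linarith
qed

text \<open>The derivatives are carried as explicit functions so that shifts and reflections act on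
  them termwise. The common bound excludes the growing modes, and the comparison arguments live on
  it.\<close>

definition bounded_positive_sol ::
  "real \<Rightarrow> real \<Rightarrow> real \<Rightarrow> (real \<Rightarrow> real) \<Rightarrow> (real \<Rightarrow> real) \<Rightarrow> (real \<Rightarrow> real) \<Rightarrow> (real \<Rightarrow> real) \<Rightarrow> bool" where
  "bounded_positive_sol k l p v v1 v2 v3 \<longleftrightarrow> (\<forall>t. v t > 0)
     \<and> (\<forall>t. (v has_real_derivative v1 t) (at t)) \<and> (\<forall>t. (v1 has_real_derivative v2 t) (at t))
     \<and> (\<forall>t. (v2 has_real_derivative v3 t) (at t))
     \<and> (\<forall>t. (v3 has_real_derivative (k\<^sup>2 + l\<^sup>2) * v2 t - k\<^sup>2 * l\<^sup>2 * v t + v t powr p) (at t))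
     \<and> (\<exists>M. \<forall>t. \<bar>v t\<bar> \<le> M \<and> \<bar>v1 t\<bar> \<le> M \<and> \<bar>v2 t\<bar> \<le> M \<and> \<bar>v3 t\<bar> \<le> M)"

lemma bounded_positive_solD:
  assumes "bounded_positive_sol k l p v v1 v2 v3"
  shows "\<And>t. v t > 0" "\<And>t. (v has_real_derivative v1 t) (at t)"
    "\<And>t. (v1 has_real_derivative v2 t) (at t)" "\<And>t. (v2 has_real_derivative v3 t) (at t)"
    "\<And>t. (v3 has_real_derivative (k\<^sup>2 + l\<^sup>2) * v2 t - k\<^sup>2 * l\<^sup>2 * v t + v t powr p) (at t)"
    "\<exists>M. \<forall>t. \<bar>v t\<bar> \<le> M \<and> \<bar>v1 t\<bar> \<le> M \<and> \<bar>v2 t\<bar> \<le> M \<and> \<bar>v3 t\<bar> \<le> M"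
  using assms unfolding bounded_positive_sol_def by blast+

lemma bounded_positive_sol_swap:
  "bounded_positive_sol k l p v v1 v2 v3 \<longleftrightarrow> bounded_positive_sol l k p v v1 v2 v3"
  unfolding bounded_positive_sol_def by (simp add: add.commute mult.commute)

lemma bounded_positive_sol_shift:
  assumes "bounded_positive_sol k l p v v1 v2 v3"
  shows "bounded_positive_sol k l p (\<lambda>t. v (t + s)) (\<lambda>t. v1 (t + s)) (\<lambda>t. v2 (t + s)) (\<lambda>t. v3 (t + s))"
proof -
  note S = bounded_positive_solD[OF assms]
  show ?thesis
    unfolding bounded_positive_sol_def
  proof (intro conjI allI)
    show "\<exists>M. \<forall>t. \<bar>v (t + s)\<bar> \<le> M \<and> \<bar>v1 (t + s)\<bar> \<le> M \<and> \<bar>v2 (t + s)\<bar> \<le> M \<and> \<bar>v3 (t + s)\<bar> \<le> M"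
      using S(6) by blast
  qed (use S(1-5) in \<open>auto simp flip: DERIV_shift\<close>)
qed

lemma reflect_deriv:
  fixes f :: "real \<Rightarrow> real"
  assumes "\<And>t. (f has_real_derivative f' t) (at t)"
  shows "((\<lambda>t. f (s - t)) has_real_derivative - f' (s - t)) (at t)"
    and "((\<lambda>t. - f (s - t)) has_real_derivative f' (s - t)) (at t)"
proof -
  have 1: "((\<lambda>t. s - t) has_real_derivative - 1) (at t)" by (auto intro!: derivative_eq_intros)
  show A: "((\<lambda>t. f (s - t)) has_real_derivative - f' (s - t)) (at t)"
    using DERIV_chain2[OF assms 1] by simp
  show "((\<lambda>t. - f (s - t)) has_real_derivative f' (s - t)) (at t)"
    using DERIV_minus[OF A] by simp
qed

lemma bounded_positive_sol_reflect:
  assumes "bounded_positive_sol k l p v v1 v2 v3"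
  shows "bounded_positive_sol k l p (\<lambda>t. v (s - t)) (\<lambda>t. - v1 (s - t)) (\<lambda>t. v2 (s - t)) (\<lambda>t. - v3 (s - t))"
proof -
  note S = bounded_positive_solD[OF assms]
  obtain M where M: "\<forall>t. \<bar>v t\<bar> \<le> M \<and> \<bar>v1 t\<bar> \<le> M \<and> \<bar>v2 t\<bar> \<le> M \<and> \<bar>v3 t\<bar> \<le> M"
    using S(6) by blast
  show ?thesis
    unfolding bounded_positive_sol_def
    by (intro conjI allI reflect_deriv S(1-5) exI[of _ M])
       (use M in auto)
qed

lemma powr_diff_le:
  fixes x y p M :: real
  assumes "0 < x" "x \<le> y" "y \<le> M" "p > 1"
  shows "y powr p - x powr p \<le> p * M powr (p - 1) * (y - x)"
proof (cases "x = y")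
  case False
  have "\<exists>z>x. z < y \<and> y powr p - x powr p = (y - x) * (p * z powr (p - 1))"
    by (rule MVT2) (use assms False in \<open>auto intro!: has_real_derivative_powr\<close>)
  then obtain z where z: "x < z" "z < y" "y powr p - x powr p = (y - x) * (p * z powr (p - 1))" by auto
  have "z powr (p - 1) \<le> M powr (p - 1)" using z assms by (intro powr_mono2) auto
  then have "(y - x) * (p * z powr (p - 1)) \<le> (y - x) * (p * M powr (p - 1))"
    using assms by (intro mult_left_mono) auto
  then show ?thesis using z by (simp add: mult_ac)
qed auto

text \<open>The forcing term for the difference d = v - u is v^p - u^p. It is positive where v > u
  by monotonicity; where v < u it is bounded below by a multiple of d, with the Lipschitz constant
  of x^p on the range of u.\<close>

lemma bounded_positive_sol_cone:
  assumes v: "bounded_positive_sol k l p v v1 v2 v3" and u: "bounded_positive_sol k l p u u1 u2 u3"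
    and kl: "k > 0" "l > 0" and p: "p > 1"
    and init: "v t0 - u t0 \<ge> 0" "v1 t0 - u1 t0 + k * (v t0 - u t0) \<ge> 0"
      "v2 t0 - u2 t0 - k\<^sup>2 * (v t0 - u t0) \<ge> 0"
      "v3 t0 - u3 t0 - k\<^sup>2 * (v1 t0 - u1 t0) + l * (v2 t0 - u2 t0 - k\<^sup>2 * (v t0 - u t0)) \<ge> 0"
    and t: "t \<ge> t0"
  shows "v t = u t"
proof -
  note V = bounded_positive_solD[OF v] and U = bounded_positive_solD[OF u]
  obtain M where M: "\<And>t. \<bar>v t\<bar> \<le> M" "\<And>t. \<bar>v1 t\<bar> \<le> M" "\<And>t. \<bar>v2 t\<bar> \<le> M" "\<And>t. \<bar>v3 t\<bar> \<le> M" using V(6) by blast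
  obtain K where K: "\<And>t. \<bar>u t\<bar> \<le> K" "\<And>t. \<bar>u1 t\<bar> \<le> K" "\<And>t. \<bar>u2 t\<bar> \<le> K" "\<And>t. \<bar>u3 t\<bar> \<le> K" using U(6) by blast
  have b: "\<bar>v t - u t\<bar> \<le> M + K \<and> \<bar>v1 t - u1 t\<bar> \<le> M + K \<and> \<bar>v2 t - u2 t\<bar> \<le> M + K \<and> \<bar>v3 t - u3 t\<bar> \<le> M + K" for t
    by (intro conjI order_trans[OF abs_triangle_ineq4] add_mono M K)
  have "v t - u t = 0"
  proof (rule cone_forward[where k = k and l = l and ?t0.0 = t0 and d = "\<lambda>t. v t - u t"
        and ?d1.0 = "\<lambda>t. v1 t - u1 t" and ?d2.0 = "\<lambda>t. v2 t - u2 t" and ?d3.0 = "\<lambda>t. v3 t - u3 t"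
        and h = "\<lambda>t. v t powr p - u t powr p" and L = "p * K powr (p - 1)" and M = "M + K"])
    show "((\<lambda>t. v3 t - u3 t) has_real_derivative
        (k\<^sup>2 + l\<^sup>2) * (v2 t - u2 t) - k\<^sup>2 * l\<^sup>2 * (v t - u t) + (v t powr p - u t powr p)) (at t)" for t
      using DERIV_diff[OF V(5)[of t] U(5)[of t]] by (simp add: algebra_simps)
    show "p * K powr (p - 1) * min (v t - u t) 0 \<le> v t powr p - u t powr p" for t
    proof (cases "u t \<le> v t")
      case True
      then show ?thesis using U(1)[of t] p by (simp add: min_def powr_mono2)
    next
      case False
      have "u t powr p - v t powr p \<le> p * K powr (p - 1) * (u t - v t)"
        by (rule powr_diff_le) (use V(1)[of t] K(1)[of t] False p in auto)
      then show ?thesis using False by (simp add: min_def algebra_simps)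
    qed
    show "v t - u t > 0 \<Longrightarrow> v t powr p - u t powr p > 0" for t
      using U(1)[of t] p by (simp add: powr_less_mono2)
    show "((\<lambda>t. v t - u t) has_real_derivative v1 t - u1 t) (at t)"
      "((\<lambda>t. v1 t - u1 t) has_real_derivative v2 t - u2 t) (at t)"
      "((\<lambda>t. v2 t - u2 t) has_real_derivative v3 t - u3 t) (at t)" for t
      by (intro DERIV_diff V U)+
    show "0 \<le> p * K powr (p - 1)" using p by simp
    show "\<bar>v t - u t\<bar> \<le> M + K" "\<bar>v1 t - u1 t\<bar> \<le> M + K" "\<bar>v2 t - u2 t\<bar> \<le> M + K"
      "\<bar>v3 t - u3 t\<bar> \<le> M + K" for t
      using b[of t] by auto
  qed (fact kl init t)+
  then show ?thesis by simp
qed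

lemma deriv_eq_of_eq_Ioi:
  fixes f g :: "real \<Rightarrow> real"
  assumes "\<And>t. (f has_real_derivative f' t) (at t)" "\<And>t. (g has_real_derivative g' t) (at t)"
    and "\<And>t. t > t0 \<Longrightarrow> f t = g t" and "t > t0"
  shows "f' t = g' t"
proof -
  have "(g has_real_derivative f' t) (at t)"
    by (rule has_field_derivative_transform_within_open[OF assms(1)[of t], of "{t0<..}"])
       (use assms in auto)
  then show ?thesis using assms(2) DERIV_unique by blast
qed

text \<open>Agreement to the right of t0 gives vanishing differences of all derivatives there, that
  is, admissible data for the time-reversed equation, which then covers the left half-line.\<close>

lemma bounded_positive_sol_cone_eq:
  assumes v: "bounded_positive_sol k l p v v1 v2 v3" and u: "bounded_positive_sol k l p u u1 u2 u3"
    and kl: "k > 0" "l > 0" and p: "p > 1"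
    and init: "v t0 - u t0 \<ge> 0" "v1 t0 - u1 t0 + k * (v t0 - u t0) \<ge> 0"
      "v2 t0 - u2 t0 - k\<^sup>2 * (v t0 - u t0) \<ge> 0"
      "v3 t0 - u3 t0 - k\<^sup>2 * (v1 t0 - u1 t0) + l * (v2 t0 - u2 t0 - k\<^sup>2 * (v t0 - u t0)) \<ge> 0"
  shows "v = u"
proof
  note V = bounded_positive_solD[OF v] and U = bounded_positive_solD[OF u]
  fix t
  have eq: "v s = u s" if "s \<ge> t0" for s
    by (rule bounded_positive_sol_cone[OF v u kl p init that])
  have eq1: "v1 s = u1 s" if "s > t0" for s
    by (rule deriv_eq_of_eq_Ioi[OF V(2) U(2) _ that]) (use eq in auto)
  have eq2: "v2 s = u2 s" if "s > t0" for s
    by (rule deriv_eq_of_eq_Ioi[OF V(3) U(3) eq1 that])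
  have eq3: "v3 s = u3 s" if "s > t0" for s
    by (rule deriv_eq_of_eq_Ioi[OF V(4) U(4) eq2 that])
  show "v t = u t"
  proof (cases "t \<ge> t0")
    case False
    \<comment> \<open>The derivatives are known to agree only strictly to the right of t0, so the
      reversed problem starts at t0 + 1, which reflection turns into - t0 - 1.\<close>
    have "v (0 - (- t)) = u (0 - (- t))"
      by (rule bounded_positive_sol_cone[OF bounded_positive_sol_reflect[OF v, of 0]
            bounded_positive_sol_reflect[OF u, of 0] kl p, of "- t0 - 1"])
         (use eq[of "t0 + 1"] eq1[of "t0 + 1"] eq2[of "t0 + 1"] eq3[of "t0 + 1"] False
          in \<open>auto simp: algebra_simps\<close>)
    then show ?thesis by simp
  qed (rule eq)
qed

text \<open>If value and slope agree, then, up to exchanging the solutions and reversing time, the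
  differences of the second and third derivatives are both nonnegative.\<close>

lemma bounded_positive_sol_noncrossing:
  assumes v: "bounded_positive_sol k l p v v1 v2 v3" and u: "bounded_positive_sol k l p u u1 u2 u3"
    and kl: "k > 0" "l > 0" and p: "p > 1" and eq: "v t0 = u t0" "v1 t0 = u1 t0"
  shows "v = u"
proof -
  have *: "v = u" if v: "bounded_positive_sol k l p v v1 v2 v3" and u: "bounded_positive_sol k l p u u1 u2 u3"
      and eq: "v t0 = u t0" "v1 t0 = u1 t0" and ge: "v2 t0 \<ge> u2 t0"
    for v v1 v2 v3 u u1 u2 u3 :: "real \<Rightarrow> real"
  proof (cases "v3 t0 \<ge> u3 t0")
    case True
    show ?thesis
      by (rule bounded_positive_sol_cone_eq[OF v u kl p, of t0]) (use True eq ge kl in auto)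
  next
    case False
    have "(\<lambda>t. v (0 - t)) = (\<lambda>t. u (0 - t))"
      by (rule bounded_positive_sol_cone_eq[OF bounded_positive_sol_reflect[OF v, of 0]
            bounded_positive_sol_reflect[OF u, of 0] kl p, of "- t0"]) (use False eq ge kl in auto)
    then have "v (0 - (- t)) = u (0 - (- t))" for t by meson
    then show ?thesis by auto
  qed
  show ?thesis
  proof (cases "v2 t0 \<ge> u2 t0")
    case True
    then show ?thesis by (intro *[OF v u eq])
  next
    case False
    then show ?thesis using *[OF u v] eq by simp
  qed
qed

section \<open>Uniqueness of homoclinic solutions\<close>

definition homoclinic_sol ::
  "real \<Rightarrow> real \<Rightarrow> real \<Rightarrow> (real \<Rightarrow> real) \<Rightarrow> (real \<Rightarrow> real) \<Rightarrow> (real \<Rightarrow> real) \<Rightarrow> (real \<Rightarrow> real) \<Rightarrow> bool" where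
  "homoclinic_sol k l p v v1 v2 v3 \<longleftrightarrow> bounded_positive_sol k l p v v1 v2 v3
     \<and> (v \<longlongrightarrow> 0) at_top \<and> (v \<longlongrightarrow> 0) at_bot"

lemma homoclinic_solD:
  assumes "homoclinic_sol k l p v v1 v2 v3"
  shows "bounded_positive_sol k l p v v1 v2 v3" "(v \<longlongrightarrow> 0) at_top" "(v \<longlongrightarrow> 0) at_bot"
  using assms unfolding homoclinic_sol_def by blast+

lemma homoclinic_sol_shift:
  assumes "homoclinic_sol k l p v v1 v2 v3"
  shows "homoclinic_sol k l p (\<lambda>t. v (t + s)) (\<lambda>t. v1 (t + s)) (\<lambda>t. v2 (t + s)) (\<lambda>t. v3 (t + s))"
proof -
  note H = homoclinic_solD[OF assms]
  have 1: "filterlim (\<lambda>t. t + s) at_top (at_top :: real filter)"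
    using filterlim_tendsto_add_at_top[OF tendsto_const filterlim_ident, of s] by (simp add: add.commute)
  have 2: "filterlim (\<lambda>t. t + s) at_bot (at_bot :: real filter)"
    unfolding filterlim_at_bot
  proof
    fix Z show "\<forall>\<^sub>F t in at_bot. t + s \<le> Z"
      using eventually_le_at_bot[of "Z - s"] by eventually_elim simp
  qed
  show ?thesis
    unfolding homoclinic_sol_def
    using bounded_positive_sol_shift[OF H(1)] filterlim_compose[OF H(2) 1] filterlim_compose[OF H(3) 2]
    by blast
qed

lemma homoclinic_sol_reflect:
  assumes "homoclinic_sol k l p v v1 v2 v3"
  shows "homoclinic_sol k l p (\<lambda>t. v (- t)) (\<lambda>t. - v1 (- t)) (\<lambda>t. v2 (- t)) (\<lambda>t. - v3 (- t))"
proof -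
  note H = homoclinic_solD[OF assms]
  show ?thesis
    unfolding homoclinic_sol_def
    using bounded_positive_sol_reflect[OF H(1), of 0]
      filterlim_compose[OF H(3) filterlim_uminus_at_bot_at_top]
      filterlim_compose[OF H(2) filterlim_uminus_at_top_at_bot] by simp
qed

lemma vanishing_at_infinity_attains_max:
  fixes v :: "real \<Rightarrow> real"
  assumes pos: "\<And>t. v t > 0" and D: "\<And>t. (v has_real_derivative v1 t) (at t)"
    and lim: "(v \<longlongrightarrow> 0) at_top" "(v \<longlongrightarrow> 0) at_bot"
  shows "\<exists>m. \<forall>t. v t \<le> v m"
proof -
  have "\<forall>\<^sub>F t in at_top. v t < v 0" "\<forall>\<^sub>F t in at_bot. v t < v 0"
    using order_tendstoD(2)[OF lim(1), of "v 0"] order_tendstoD(2)[OF lim(2), of "v 0"] pos by auto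
  then obtain a b where ab: "\<And>t. t \<ge> b \<Longrightarrow> v t < v 0" "\<And>t. t \<le> a \<Longrightarrow> v t < v 0"
    unfolding eventually_at_top_linorder eventually_at_bot_linorder by blast
  have a: "a < 0" and b: "b > 0" using ab(1)[of 0] ab(2)[of 0] by force+
  have "continuous_on {a..b} v"
    by (rule DERIV_continuous_on) (use D has_field_derivative_at_within in blast)
  then have "\<exists>m\<in>{a..b}. \<forall>t\<in>{a..b}. v t \<le> v m"
    by (intro continuous_attains_sup) (use a b in auto)
  then obtain m where m: "\<And>t. t \<in> {a..b} \<Longrightarrow> v t \<le> v m" by blast
  have "v t \<le> v m" for t
    using m[of t] m[of 0] ab(1)[of t] ab(2)[of t] a b by (cases "t < a"; cases "t > b") auto
  then show ?thesis by blast
qed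

text \<open>The bounds are automatic: v is bounded by its maximum, the equation then bounds v'''' -
  (k^2 + l^2) v'', and interpolation yields the derivatives in between.\<close>

lemma homoclinic_solI:
  assumes pos: "\<And>t. v t > 0"
    and D: "\<And>t. (v has_real_derivative v1 t) (at t)" "\<And>t. (v1 has_real_derivative v2 t) (at t)"
      "\<And>t. (v2 has_real_derivative v3 t) (at t)"
      "\<And>t. (v3 has_real_derivative (k\<^sup>2 + l\<^sup>2) * v2 t - k\<^sup>2 * l\<^sup>2 * v t + v t powr p) (at t)"
    and lim: "(v \<longlongrightarrow> 0) at_top" "(v \<longlongrightarrow> 0) at_bot" and p: "p > 1"
  shows "homoclinic_sol k l p v v1 v2 v3"
proof -
  obtain m where m: "\<And>t. v t \<le> v m"
    using vanishing_at_infinity_attains_max[OF pos D(1) lim] by blast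
  have "\<exists>C. \<forall>t. \<bar>v t\<bar> \<le> C \<and> \<bar>v1 t\<bar> \<le> C \<and> \<bar>v2 t\<bar> \<le> C \<and> \<bar>v3 t\<bar> \<le> C"
  proof (rule bounded_derivatives[OF D])
    show "\<bar>v t\<bar> \<le> v m" for t using m[of t] pos[of t] by simp
    show "\<bar>(k\<^sup>2 + l\<^sup>2) * v2 t - k\<^sup>2 * l\<^sup>2 * v t + v t powr p - (k\<^sup>2 + l\<^sup>2) * v2 t\<bar>
        \<le> k\<^sup>2 * l\<^sup>2 * v m + v m powr p" for t
    proof -
      have "v t powr p \<le> v m powr p" using m[of t] pos[of t] p by (intro powr_mono2) auto
      moreover have "k\<^sup>2 * l\<^sup>2 * v t \<le> k\<^sup>2 * l\<^sup>2 * v m" using m[of t] by (intro mult_left_mono) auto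
      moreover have "0 \<le> k\<^sup>2 * l\<^sup>2 * v t" using pos[of t] by simp
      moreover have "0 \<le> v t powr p" by simp
      ultimately show ?thesis by linarith
    qed
  qed
  then show ?thesis
    unfolding homoclinic_sol_def bounded_positive_sol_def using pos D lim by simp
qed

text \<open>At a critical point v and its reflection share value and slope, so noncrossing
  identifies them.\<close>

lemma symmetric_at_critical_point:
  assumes v: "bounded_positive_sol k l p v v1 v2 v3" and kl: "k > 0" "l > 0" and p: "p > 1"
    and crit: "v1 m = 0"
  shows "v (2 * m - t) = v t"
proof -
  have "(\<lambda>t. v (2 * m - t)) = v"
    by (rule bounded_positive_sol_noncrossing[OF bounded_positive_sol_reflect[OF v, of "2 * m"] v kl p, of m])
       (use crit in auto)
  from fun_cong[OF this, of t] show ?thesis .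
qed

text \<open>Reflections at two critical points compose to a period 2 (m - m'), and a periodic
  function that tends to 0 cannot be positive.\<close>

lemma homoclinic_critical_point_unique:
  assumes v: "homoclinic_sol k l p v v1 v2 v3" and kl: "k > 0" "l > 0" and p: "p > 1"
    and crit: "v1 m = 0" "v1 m' = 0"
  shows "m = m'"
proof (rule ccontr)
  assume ne: "m \<noteq> m'"
  note H = homoclinic_solD[OF v] and V = bounded_positive_solD[OF homoclinic_solD(1)[OF v]]
  note S = symmetric_at_critical_point[OF H(1) kl p]
  have per: "v (t + 2 * (m - m')) = v t" for t
  proof -
    have "v (2 * m - (2 * m' - t)) = v t" using S[OF crit(1)] S[OF crit(2)] by simp
    then show ?thesis by (simp add: algebra_simps)
  qed
  have it: "v (real j * (2 * (m - m'))) = v 0" for j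
  proof (induction j)
    case (Suc j)
    then show ?case using per[of "real j * (2 * (m - m'))"] by (simp add: algebra_simps)
  qed simp
  have "(\<lambda>j. v (real j * (2 * (m - m')))) \<longlonglongrightarrow> 0"
  proof (cases "m > m'")
    case True
    have "filterlim (\<lambda>j. real j * (2 * (m - m'))) at_top sequentially"
      by (rule filterlim_at_top_mult_tendsto_pos[OF tendsto_const _ filterlim_real_sequentially]) (use True in simp)
    then show ?thesis by (rule filterlim_compose[OF H(2)])
  next
    case False
    have "filterlim (\<lambda>j. real j * (2 * (m' - m))) at_top sequentially"
      by (rule filterlim_at_top_mult_tendsto_pos[OF tendsto_const _ filterlim_real_sequentially]) (use False ne in simp)
    then have "filterlim (\<lambda>j. - (real j * (2 * (m' - m)))) at_bot sequentially"
      by (simp add: filterlim_uminus_at_top)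
    then have "filterlim (\<lambda>j. real j * (2 * (m - m'))) at_bot sequentially"
      by (simp add: algebra_simps)
    then show ?thesis by (rule filterlim_compose[OF H(3)])
  qed
  then have "(\<lambda>j::nat. v 0) \<longlonglongrightarrow> 0" unfolding it .
  then show False using V(1)[of 0] by (simp add: LIMSEQ_const_iff)
qed

text \<open>The maximum is the only critical point, so the slope keeps its sign to the left of it;
  the mean slope between t and the maximum is nonnegative, which fixes that sign.\<close>

lemma homoclinic_increasing:
  assumes v: "homoclinic_sol k l p v v1 v2 v3" and kl: "k > 0" "l > 0" and p: "p > 1"
  obtains m where "v1 m = 0" "\<And>t. t < m \<Longrightarrow> v1 t > 0" "\<And>t. v (2 * m - t) = v t"
proof -
  note H = homoclinic_solD[OF v] and V = bounded_positive_solD[OF homoclinic_solD(1)[OF v]]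
  obtain m where m: "\<And>t. v t \<le> v m" using vanishing_at_infinity_attains_max[OF V(1,2) H(2,3)] by blast
  have 0: "v1 m = 0"
    using DERIV_local_max[OF V(2), of 1 m] m by auto
  have "v1 t > 0" if t: "t < m" for t
  proof -
    have "\<exists>z>t. z < m \<and> v m - v t = (m - t) * v1 z" by (rule MVT2) (use V t in auto)
    then obtain z where z: "t < z" "z < m" "v m - v t = (m - t) * v1 z" by auto
    have "0 \<le> (m - t) * v1 z" using m[of t] z by simp
    then have "v1 z \<ge> 0" using t by (simp add: zero_le_mult_iff)
    show ?thesis
    proof (rule ccontr)
      assume "\<not> ?thesis"
      then have "v1 t \<le> 0" by simp
      then have "\<exists>x\<ge>t. x \<le> z \<and> v1 x = 0"
        by (intro IVT) (use \<open>v1 z \<ge> 0\<close> z V(3) DERIV_isCont in auto)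
      then obtain x where "x \<le> z" "v1 x = 0" by blast
      then show False using homoclinic_critical_point_unique[OF v kl p 0, of x] z by simp
    qed
  qed
  then show ?thesis using that[OF 0] symmetric_at_critical_point[OF H(1) kl p 0] by blast
qed

text \<open>The function f = v'' - l^2 v satisfies f'' - k^2 f = v^p >= 0 and is bounded, so the
  one-dimensional maximum principle applies.\<close>

lemma homoclinic_second_factor_neg:
  assumes v: "bounded_positive_sol k l p v v1 v2 v3" and kl: "k > 0" "l > 0"
  shows "v2 t - l\<^sup>2 * v t \<le> 0"
proof -
  note V = bounded_positive_solD[OF v]
  obtain M where M: "\<And>t. \<bar>v t\<bar> \<le> M" "\<And>t. \<bar>v1 t\<bar> \<le> M" "\<And>t. \<bar>v2 t\<bar> \<le> M" "\<And>t. \<bar>v3 t\<bar> \<le> M" using V(6) by blast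
  have b: "\<bar>x - l\<^sup>2 * y\<bar> \<le> M + l\<^sup>2 * M" if "\<bar>x\<bar> \<le> M" "\<bar>y\<bar> \<le> M" for x y
    by (intro order_trans[OF abs_triangle_ineq4] add_mono that)
       (use that in \<open>simp add: abs_mult mult_left_mono\<close>)
  show ?thesis
  proof (rule nonpos_of_second_order[where f = "\<lambda>t. v2 t - l\<^sup>2 * v t" and ?f1.0 = "\<lambda>t. v3 t - l\<^sup>2 * v1 t"
        and ?f2.0 = "\<lambda>t. (k\<^sup>2 + l\<^sup>2) * v2 t - k\<^sup>2 * l\<^sup>2 * v t + v t powr p - l\<^sup>2 * v2 t" and c = k and M = "M + l\<^sup>2 * M"])
    show "k\<^sup>2 * (v2 t - l\<^sup>2 * v t) \<le> (k\<^sup>2 + l\<^sup>2) * v2 t - k\<^sup>2 * l\<^sup>2 * v t + v t powr p - l\<^sup>2 * v2 t" for t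
      by (simp add: algebra_simps)
    show "((\<lambda>t. v2 t - l\<^sup>2 * v t) has_real_derivative v3 t - l\<^sup>2 * v1 t) (at t)" for t
      by (intro DERIV_diff DERIV_cmult V)
    show "((\<lambda>t. v3 t - l\<^sup>2 * v1 t) has_real_derivative
        (k\<^sup>2 + l\<^sup>2) * v2 t - k\<^sup>2 * l\<^sup>2 * v t + v t powr p - l\<^sup>2 * v2 t) (at t)" for t
      by (intro DERIV_diff DERIV_cmult V)
  qed (use kl M b in auto)
qed

text \<open>For \<open>V = l\<^sup>2 v - v'' \<ge> 0\<close> the function \<open>Q = V + c v\<close> satisfies
  \<open>Q'' - (k\<^sup>2 - c) Q = (c (l\<^sup>2 - k\<^sup>2) + c\<^sup>2 - v powr (p - 1)) v\<close>.\<close>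

lemma homoclinic_decay_at_bot:
  assumes v: "homoclinic_sol k l p v v1 v2 v3" and kl: "0 < k" "k \<le> l" and p: "p > 1"
    and kap: "0 < \<kappa>" "\<kappa> < k"
  shows "\<exists>C T. C > 0 \<and> (\<forall>t\<le>T. v t \<le> C * exp (\<kappa> * t) \<and> \<bar>v2 t\<bar> \<le> C * exp (\<kappa> * t))"
proof -
  note H = homoclinic_solD[OF v] and V = bounded_positive_solD[OF homoclinic_solD(1)[OF v]]
  have l: "l > 0" using kl by linarith
  \<comment> \<open>With this c the operator for Q is D^2 - \<kappa>^2. Its right-hand side is
    nonnegative once v^(p-1) <= c^2, since l >= k; this holds far to the left because v tends to
    0.\<close>
  define c where "c = k\<^sup>2 - \<kappa>\<^sup>2"
  have c: "c > 0" using kap by (simp add: c_def power_strict_mono)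
  have "\<forall>\<^sub>F t in at_bot. v t < (c\<^sup>2) powr (1 / (p - 1))"
    by (rule order_tendstoD(2)[OF H(3)]) (use c in simp)
  then obtain T where T: "\<And>t. t \<le> T \<Longrightarrow> v t < (c\<^sup>2) powr (1 / (p - 1))"
    unfolding eventually_at_bot_linorder by blast
  have small: "v t powr (p - 1) \<le> c\<^sup>2" if "t \<le> T" for t
  proof -
    have "v t powr (p - 1) \<le> ((c\<^sup>2) powr (1 / (p - 1))) powr (p - 1)"
      by (rule powr_mono2) (use p V(1)[of t] T[OF that] in auto)
    also have "\<dots> = c\<^sup>2" using p c by (simp add: powr_powr)
    finally show ?thesis .
  qed
  obtain M where M: "\<And>t. \<bar>v t\<bar> \<le> M" "\<And>t. \<bar>v1 t\<bar> \<le> M" "\<And>t. \<bar>v2 t\<bar> \<le> M" "\<And>t. \<bar>v3 t\<bar> \<le> M" using V(6) by blast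
  define Q where "Q t = l\<^sup>2 * v t - v2 t + c * v t" for t
  define Q1 where "Q1 t = l\<^sup>2 * v1 t - v3 t + c * v1 t" for t
  define Q2 where "Q2 t = l\<^sup>2 * v2 t - ((k\<^sup>2 + l\<^sup>2) * v2 t - k\<^sup>2 * l\<^sup>2 * v t + v t powr p) + c * v2 t" for t
  have Qd: "(Q has_real_derivative Q1 t) (at t)" "(Q1 has_real_derivative Q2 t) (at t)" for t
    unfolding Q_def Q1_def Q2_def by (intro DERIV_diff DERIV_add DERIV_cmult V)+
  have b: "\<bar>l\<^sup>2 * x - y + c * x\<bar> \<le> l\<^sup>2 * M + M + c * M" if "\<bar>x\<bar> \<le> M" "\<bar>y\<bar> \<le> M" for x y
    by (intro order_trans[OF abs_triangle_ineq] add_mono order_trans[OF abs_triangle_ineq4] that)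
       (use that c in \<open>auto simp: abs_mult mult_left_mono\<close>)
  have ge: "Q2 t \<ge> \<kappa>\<^sup>2 * Q t" if t: "t \<le> T" for t
  proof -
    have "v t powr p = v t powr (p - 1) * v t"
      using V(1)[of t] by (simp add: powr_diff)
    also have "\<dots> \<le> c\<^sup>2 * v t" using small[OF t] V(1)[of t] by (intro mult_right_mono) auto
    finally have 1: "v t powr p \<le> c\<^sup>2 * v t" .
    have "0 \<le> c * (l\<^sup>2 - k\<^sup>2) * v t" using c kl V(1)[of t] by (simp add: power_mono)
    moreover have "Q2 t - \<kappa>\<^sup>2 * Q t = c * (l\<^sup>2 - k\<^sup>2) * v t + c\<^sup>2 * v t - v t powr p"
      unfolding Q2_def Q_def c_def by (simp add: algebra_simps power2_eq_square)
    ultimately show ?thesis using 1 by linarith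
  qed
  have le: "Q t \<le> Q T * exp (\<kappa> * (t - T))" if t: "t \<le> T" for t
    by (rule exp_decay_of_second_order[OF Qd ge kap(1) _ _ t, where M = "l\<^sup>2 * M + M + c * M"])
       (auto simp: Q_def Q1_def intro!: b M)
  define C0 where "C0 = Q T * exp (- \<kappa> * T)"
  have le': "Q t \<le> C0 * exp (\<kappa> * t)" if t: "t \<le> T" for t
    using le[OF t] by (simp add: C0_def mult.assoc right_diff_distrib exp_diff exp_minus divide_inverse mult_ac)
  have W: "l\<^sup>2 * v t - v2 t \<ge> 0" for t
    using homoclinic_second_factor_neg[OF H(1) kl(1) l, of t] by linarith
  \<comment> \<open>Both summands of Q are nonnegative, so the decay of Q passes to each of them and
    hence to v and v''.\<close>
  have vQ: "c * v t \<le> Q t" "l\<^sup>2 * v t - v2 t \<le> Q t" "0 < Q t" for t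
    using W[of t] c V(1)[of t] by (simp_all add: Q_def add_nonneg_pos)
  have C0: "C0 > 0" unfolding C0_def using vQ(3) by simp
  have v: "v t \<le> C0 / c * exp (\<kappa> * t)" if t: "t \<le> T" for t
    using vQ(1)[of t] le'[OF t] c by (simp add: field_simps)
  have v2: "\<bar>v2 t\<bar> \<le> (C0 + l\<^sup>2 * (C0 / c)) * exp (\<kappa> * t)" if t: "t \<le> T" for t
  proof -
    have "l\<^sup>2 * v t \<le> l\<^sup>2 * (C0 / c * exp (\<kappa> * t))" using v[OF t] by (intro mult_left_mono) auto
    moreover have "0 \<le> l\<^sup>2 * v t" using V(1)[of t] by simp
    moreover have "(C0 + l\<^sup>2 * (C0 / c)) * exp (\<kappa> * t) = C0 * exp (\<kappa> * t) + l\<^sup>2 * (C0 / c * exp (\<kappa> * t))"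
      by (simp add: algebra_simps)
    ultimately show ?thesis using vQ(2)[of t] W[of t] le'[OF t] C0 c
      by (simp add: abs_le_iff)
  qed
  show ?thesis
  proof (intro exI conjI allI impI)
    fix t assume t: "t \<le> T"
    have "C0 / c * exp (\<kappa> * t) \<le> (C0 / c + (C0 + l\<^sup>2 * (C0 / c))) * exp (\<kappa> * t)"
      "(C0 + l\<^sup>2 * (C0 / c)) * exp (\<kappa> * t) \<le> (C0 / c + (C0 + l\<^sup>2 * (C0 / c))) * exp (\<kappa> * t)"
      using C0 c by (intro mult_right_mono; simp)+
    then show "v t \<le> (C0 / c + (C0 + l\<^sup>2 * (C0 / c))) * exp (\<kappa> * t)"
      "\<bar>v2 t\<bar> \<le> (C0 / c + (C0 + l\<^sup>2 * (C0 / c))) * exp (\<kappa> * t)"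
      using v[OF t] v2[OF t] by linarith+
  qed (use C0 c in \<open>simp add: add_pos_nonneg\<close>)
qed

lemma mono_bounded_below_convergent_at_bot:
  fixes f :: "real \<Rightarrow> real"
  assumes mono: "\<And>s t. s \<le> t \<Longrightarrow> f s \<le> f t" and bd: "\<And>t. B \<le> f t"
  obtains L where "(f \<longlongrightarrow> L) at_bot"
proof (rule that, rule order_tendstoI)
  have bb: "bdd_below (range f)" using bd by (auto intro!: bdd_belowI)
  fix a
  {
    assume a: "a < Inf (range f)"
    have "a < f t" for t
      using a cINF_lower[OF bb, of t] by simp
    then show "\<forall>\<^sub>F t in at_bot. a < f t" by simp
  next
    assume "a > Inf (range f)"
    then obtain s where s: "f s < a" using cInf_less_iff[OF _ bb] by auto
    show "\<forall>\<^sub>F t in at_bot. f t < a"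
      using eventually_le_at_bot[of s] by eventually_elim (use mono s in force)
  }
qed

text \<open>\<open>exp (- k t)\<close> times this expression has derivative \<open>exp (- k t) * v powr p\<close>; its limit at
  \<open>-\<infinity>\<close> determines the coefficient of the slowest mode \<open>exp (k t)\<close> of the solution.\<close>

definition slow_mode ::
  "real \<Rightarrow> real \<Rightarrow> (real \<Rightarrow> real) \<Rightarrow> (real \<Rightarrow> real) \<Rightarrow> (real \<Rightarrow> real) \<Rightarrow> (real \<Rightarrow> real) \<Rightarrow> real \<Rightarrow> real" where
  "slow_mode k l v v1 v2 v3 t = v3 t + k * v2 t - l\<^sup>2 * v1 t - k * l\<^sup>2 * v t"

text \<open>\<open>slow_mode\<close> is (D + k) (D^2 - l^2) v, and the one remaining factor D - k of
  the operator maps it to v^p.\<close>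

lemma slow_mode_deriv:
  assumes "bounded_positive_sol k l p v v1 v2 v3"
  shows "((\<lambda>t. exp ((-k) * t) * slow_mode k l v v1 v2 v3 t) has_real_derivative exp ((-k) * t) * v t powr p) (at t)"
proof -
  note V = bounded_positive_solD[OF assms]
  have "(slow_mode k l v v1 v2 v3 has_real_derivative
      (k\<^sup>2 + l\<^sup>2) * v2 t - k\<^sup>2 * l\<^sup>2 * v t + v t powr p + k * v3 t - l\<^sup>2 * v2 t - k * l\<^sup>2 * v1 t) (at t)"
    unfolding slow_mode_def by (intro DERIV_diff DERIV_add DERIV_cmult V)
  from exp_weight_deriv[OF this, of "-k"] show ?thesis
    by (rule DERIV_cong) (simp add: slow_mode_def algebra_simps power2_eq_square)
qed

lemma slow_mode_bounded:
  assumes v: "bounded_positive_sol k l p v v1 v2 v3"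
  shows "\<exists>M. \<forall>t. \<bar>slow_mode k l v v1 v2 v3 t\<bar> \<le> M"
proof -
  obtain M where M: "\<And>t. \<bar>v t\<bar> \<le> M" "\<And>t. \<bar>v1 t\<bar> \<le> M" "\<And>t. \<bar>v2 t\<bar> \<le> M" "\<And>t. \<bar>v3 t\<bar> \<le> M"
    using bounded_positive_solD(6)[OF v] by blast
  have "\<bar>slow_mode k l v v1 v2 v3 t\<bar> \<le> M + \<bar>k\<bar> * M + l\<^sup>2 * M + \<bar>k * l\<^sup>2\<bar> * M" for t
    unfolding slow_mode_def
    by (intro order_trans[OF abs_triangle_ineq4] add_mono order_trans[OF abs_triangle_ineq] M)
       (use M[of t] in \<open>simp_all add: abs_mult mult_left_mono mult_mono\<close>)
  then show ?thesis by blast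
qed

text \<open>The weighted slow mode is strictly increasing and tends to 0 at +infinity, so its limit
  at -infinity, if finite, is negative. Finiteness holds because the decay of v makes exp (- k t)
  v^p integrable near -infinity.\<close>

lemma slow_mode_limit:
  assumes v: "homoclinic_sol k l p v v1 v2 v3" and kl: "0 < k" "k \<le> l" and p: "p > 1"
  obtains c where "c > 0" "((\<lambda>t. exp ((-k) * t) * slow_mode k l v v1 v2 v3 t) \<longlongrightarrow> - c) at_bot"
proof -
  note H = homoclinic_solD[OF v] and V = bounded_positive_solD[OF homoclinic_solD(1)[OF v]]
  let ?E = "\<lambda>t. exp ((-k) * t) * slow_mode k l v v1 v2 v3 t"
  note dE = slow_mode_deriv[OF H(1)]
  have pos: "0 < exp ((-k) * t) * v t powr p" for t using V(1)[of t] by simp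
  have mono: "?E s \<le> ?E t" if "s \<le> t" for s t
    by (rule nondecreasing_below[where T = t and f = ?E, OF dE]) (use pos that in \<open>auto intro: less_imp_le\<close>)
  \<comment> \<open>The midpoint of k / p and k: a rate above k / p makes exp (- k t) v^p decay at
    -infinity, and rates below k are the available ones.\<close>
  define \<kappa> where "\<kappa> = k * (p + 1) / (2 * p)"
  have kap: "0 < \<kappa>" "\<kappa> < k" using kl p by (simp_all add: \<kappa>_def field_simps add_pos_pos)
  have pk: "p * \<kappa> - k = k * (p - 1) / 2" using p by (simp add: \<kappa>_def field_simps)
  define \<epsilon> where "\<epsilon> = p * \<kappa> - k"
  have eps: "\<epsilon> > 0" unfolding \<epsilon>_def pk using kl p by simp
  obtain C T where "C > 0 \<and> (\<forall>t\<le>T. v t \<le> C * exp (\<kappa> * t) \<and> \<bar>v2 t\<bar> \<le> C * exp (\<kappa> * t))"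
    using homoclinic_decay_at_bot[OF v kl p kap] by blast
  then have CT: "\<And>t. t \<le> T \<Longrightarrow> v t \<le> C * exp (\<kappa> * t)"
      "\<And>t. t \<le> T \<Longrightarrow> \<bar>v2 t\<bar> \<le> C * exp (\<kappa> * t)" "C > 0" by auto
  have le: "exp ((-k) * t) * v t powr p \<le> C powr p * exp (\<epsilon> * t)" if "t \<le> T" for t
  proof -
    have "v t powr p \<le> (C * exp (\<kappa> * t)) powr p"
      using V(1)[of t] p CT(1)[OF that] by (intro powr_mono2) auto
    also have "\<dots> = C powr p * exp (p * \<kappa> * t)" using CT(3) by (simp add: powr_mult exp_powr_real mult_ac)
    finally have "exp ((-k) * t) * v t powr p \<le> exp ((-k) * t) * (C powr p * exp (p * \<kappa> * t))"
      by (intro mult_left_mono) auto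
    also have "\<dots> = C powr p * exp (\<epsilon> * t)"
      by (simp add: \<epsilon>_def left_diff_distrib exp_diff exp_minus field_simps)
    finally show ?thesis .
  qed
  \<comment> \<open>A primitive of the majorant minus the weighted slow mode. It is nondecreasing up
    to T, which bounds the slow mode from below there.\<close>
  define G where "G t = C powr p / \<epsilon> * exp (\<epsilon> * t) - ?E t" for t
  have dG: "(G has_real_derivative C powr p * exp (\<epsilon> * t) - exp ((-k) * t) * v t powr p) (at t)" for t
    unfolding G_def
    by (rule DERIV_diff[OF _ dE]) (use eps in \<open>auto intro!: derivative_eq_intros simp: field_simps\<close>)
  have bd: "- G T \<le> ?E t" for t
  proof (cases "t \<le> T")
    case True
    have "G t \<le> G T" by (rule nondecreasing_below[OF dG]) (use le True in auto)
    moreover have "0 \<le> C powr p / \<epsilon> * exp (\<epsilon> * t)" using eps by simp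
    ultimately show ?thesis unfolding G_def by linarith
  next
    case False
    have "- G T \<le> ?E T" using eps by (simp add: G_def)
    also have "\<dots> \<le> ?E t" by (rule mono) (use False in simp)
    finally show ?thesis .
  qed
  obtain L where L: "(?E \<longlongrightarrow> L) at_bot" using mono_bounded_below_convergent_at_bot[of ?E, OF mono bd] by blast
  obtain M where M: "\<And>t. \<bar>slow_mode k l v v1 v2 v3 t\<bar> \<le> M" using slow_mode_bounded[OF H(1)] by blast
  have "L < ?E 0" by (rule gt_limit_at_bot[OF L dE, of 0]) (use pos in auto)
  also have "?E 0 \<le> 0"
  proof (rule tendsto_lowerbound)
    show "(?E \<longlongrightarrow> 0) at_top" by (rule bounded_exp_weight_at_top[OF M]) (use kl in simp)
    show "\<forall>\<^sub>F t in at_top. ?E 0 \<le> ?E t" using eventually_ge_at_top[of 0] by eventually_elim (rule mono)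
  qed auto
  finally show ?thesis using that[of "- L"] L by simp
qed

text \<open>With equal leading coefficients the weighted difference of the slow modes starts from 0
  at -infinity and increases while u < v. Integrating the other factors one by one from there puts
  the data of v - u at T into the cone, so v = u, a contradiction.\<close>

lemma homoclinic_not_ordered:
  assumes v: "homoclinic_sol k l p v v1 v2 v3" and u: "homoclinic_sol k l p u u1 u2 u3"
    and kl: "0 < k" "k \<le> l" and p: "p > 1"
    and lim: "((\<lambda>t. exp ((-k) * t) * slow_mode k l v v1 v2 v3 t) \<longlongrightarrow> c) at_bot"
      "((\<lambda>t. exp ((-k) * t) * slow_mode k l u u1 u2 u3 t) \<longlongrightarrow> c) at_bot"
    and gt: "\<And>t. t \<le> T \<Longrightarrow> u t < v t"
  shows False
proof -
  note H = homoclinic_solD[OF v] and V = bounded_positive_solD[OF homoclinic_solD(1)[OF v]]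
  note I = homoclinic_solD[OF u] and U = bounded_positive_solD[OF homoclinic_solD(1)[OF u]]
  have l: "l > 0" using kl by linarith
  define d d1 d2 d3 where "d t = v t - u t" and "d1 t = v1 t - u1 t" and "d2 t = v2 t - u2 t" and "d3 t = v3 t - u3 t" for t
  note dd = d_def d1_def d2_def d3_def
  have D: "(d has_real_derivative d1 t) (at t)" "(d1 has_real_derivative d2 t) (at t)"
     "(d2 has_real_derivative d3 t) (at t)" for t
    unfolding dd by (intro DERIV_diff V U)+
  obtain M where M: "\<And>t. \<bar>v t\<bar> \<le> M" "\<And>t. \<bar>v1 t\<bar> \<le> M" "\<And>t. \<bar>v2 t\<bar> \<le> M" "\<And>t. \<bar>v3 t\<bar> \<le> M" using V(6) by blast
  obtain K where K: "\<And>t. \<bar>u t\<bar> \<le> K" "\<And>t. \<bar>u1 t\<bar> \<le> K" "\<And>t. \<bar>u2 t\<bar> \<le> K" "\<And>t. \<bar>u3 t\<bar> \<le> K" using U(6) by blast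
  have b: "\<bar>d t\<bar> \<le> M + K" "\<bar>d2 t\<bar> \<le> M + K" for t
    unfolding dd by (intro order_trans[OF abs_triangle_ineq4] add_mono M K)+
  define Y where "Y t = slow_mode k l v v1 v2 v3 t - slow_mode k l u u1 u2 u3 t" for t
  have Y: "Y t = d3 t - l\<^sup>2 * d1 t + k * (d2 t - l\<^sup>2 * d t)" for t
    unfolding Y_def slow_mode_def dd by (simp add: algebra_simps)
  have limY: "((\<lambda>t. exp ((-k) * t) * Y t) \<longlongrightarrow> 0) at_bot"
    using tendsto_diff[OF lim] by (simp add: Y_def right_diff_distrib)
  have dY: "((\<lambda>t. exp ((-k) * t) * Y t) has_real_derivative
      exp ((-k) * t) * v t powr p - exp ((-k) * t) * u t powr p) (at t)" for t
    using DERIV_diff[OF slow_mode_deriv[OF H(1), of t] slow_mode_deriv[OF I(1), of t]]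
    by (simp add: Y_def right_diff_distrib)
  have Ypos: "Y t > 0" if t: "t \<le> T" for t
  proof -
    have "0 < exp ((-k) * t) * Y t"
    proof (rule gt_limit_at_bot[OF limY dY _ t])
      fix s assume "s \<le> T"
      then have "u s powr p < v s powr p" using gt[of s] U(1)[of s] p by (intro powr_less_mono2) auto
      then show "0 < exp ((-k) * s) * v s powr p - exp ((-k) * s) * u s powr p" by simp
    qed
    then show ?thesis by (simp add: zero_less_mult_iff)
  qed
  define w where "w t = d2 t - l\<^sup>2 * d t" for t
  have dw: "(w has_real_derivative d3 t - l\<^sup>2 * d1 t) (at t)" for t
    unfolding w_def by (intro DERIV_diff DERIV_cmult D)
  have wb: "\<bar>w t\<bar> \<le> (M + K) + l\<^sup>2 * (M + K)" for t
    unfolding w_def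
    by (intro order_trans[OF abs_triangle_ineq4] add_mono b) (use b[of t] in \<open>simp add: abs_mult mult_left_mono\<close>)
  have wpos: "w t > 0" if t: "t \<le> T" for t
  proof -
    have "0 < exp (k * t) * w t"
    proof (rule gt_limit_at_bot[OF bounded_exp_weight_at_bot[OF wb kl(1)] exp_weight_deriv[OF dw] _ t])
      fix s assume "s \<le> T"
      then show "0 < exp (k * s) * (d3 s - l\<^sup>2 * d1 s + k * w s)"
        using Ypos[of s] unfolding Y w_def by simp
    qed
    then show ?thesis by (simp add: zero_less_mult_iff)
  qed
  define z where "z t = d1 t + l * d t" for t
  have dz: "(z has_real_derivative d2 t + l * d1 t) (at t)" for t
    unfolding z_def by (intro DERIV_add DERIV_cmult D)
  \<comment> \<open>Here z' = l z + w with w > 0, and exp (- l t) z is not known to vanish at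
    -infinity. Instead, a negative value of z would persist backwards in time, and integrating z =
    d' + l d from -infinity would then make d negative.\<close>
  have znonneg: "z t \<ge> 0" if t: "t \<le> T" for t
  proof (rule ccontr)
    assume "\<not> ?thesis"
    then have zt: "z t < 0" by simp
    have zneg: "z s < 0" if s: "s \<le> t" for s
    proof -
      have "exp ((-l) * s) * z s \<le> exp ((-l) * t) * z t"
      proof (rule nondecreasing_below[where f = "\<lambda>t. exp ((-l) * t) * z t", OF exp_weight_deriv[OF dz] _ s t])
        fix x assume "x \<le> T"
        then show "0 \<le> exp (- l * x) * (d2 x + l * d1 x + - l * z x)"
          using wpos[of x] by (simp add: w_def z_def algebra_simps power2_eq_square)
      qed
      also have "\<dots> < 0" using zt by (simp add: mult_less_0_iff)
      finally show ?thesis by (simp add: mult_less_0_iff)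
    qed
    have "0 < exp (l * t) * (- d t)"
    proof (rule gt_limit_at_bot[OF bounded_exp_weight_at_bot[where f = "\<lambda>t. - d t", OF _ l]
            exp_weight_deriv[OF DERIV_minus[OF D(1)]] _ order_refl[of t]])
      fix s assume "s \<le> t"
      then show "0 < exp (l * s) * (- d1 s + l * - d s)"
        using zneg[of s] by (simp add: z_def zero_less_mult_iff)
    next
      show "\<bar>- d s\<bar> \<le> M + K" for s using b(1)[of s] by simp
    qed
    then show False using gt[OF t] by (simp add: zero_less_mult_iff d_def)
  qed
  \<comment> \<open>The cone is the one for the exchanged roles of k and l, because D^2 - l^2 was
    split off first.\<close>
  have "v = u"
  proof (rule bounded_positive_sol_cone_eq[of l k p v v1 v2 v3 u u1 u2 u3 T])
    show "bounded_positive_sol l k p v v1 v2 v3" "bounded_positive_sol l k p u u1 u2 u3"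
      using H(1) I(1) bounded_positive_sol_swap by blast+
    show "0 \<le> v1 T - u1 T + l * (v T - u T)" using znonneg[of T] by (simp add: z_def dd)
    show "0 \<le> v2 T - u2 T - l\<^sup>2 * (v T - u T)" using wpos[of T] by (simp add: w_def dd)
    show "0 \<le> v3 T - u3 T - l\<^sup>2 * (v1 T - u1 T) + k * (v2 T - u2 T - l\<^sup>2 * (v T - u T))"
      using Ypos[of T] by (simp add: Y dd)
    show "0 \<le> v T - u T" using gt[of T] by simp
  qed (use kl l p in auto)
  then show False using gt[of T] by simp
qed

text \<open>Between two zeros, Rolle's theorem applied to \<open>u\<^sup>-\<^sup>1 \<circ> v - id\<close> yields points with equal value
  and slope, so \<open>v\<close> is a translate of \<open>u\<close>.\<close>

lemma translate_of_two_zeros: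
  assumes v: "bounded_positive_sol k l p v v1 v2 v3" and u: "bounded_positive_sol k l p u u1 u2 u3"
    and kl: "k > 0" "l > 0" and p: "p > 1"
    and incv: "\<And>t. t < m \<Longrightarrow> v1 t > 0" and incu: "\<And>t. t < m \<Longrightarrow> u1 t > 0"
    and t: "t1 < t2" "t2 < m" and eq: "v t1 = u t1" "v t2 = u t2"
  shows "\<exists>s. v = (\<lambda>t. u (t + s))"
proof -
  note V = bounded_positive_solD[OF v] and U = bounded_positive_solD[OF u]
  have mu: "u x < u y" if "x < y" "y < m" for x y
    by (rule DERIV_pos_imp_increasing[OF that(1), of u]) (use U(2) incu that in force)
  have mv: "v x < v y" if "x < y" "y < m" for x y
    by (rule DERIV_pos_imp_increasing[OF that(1), of v]) (use V(2) incv that in force)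
  have inj: "inj_on u {..<m}"
    by (rule inj_onI) (use mu in \<open>metis lessThan_iff less_irrefl linorder_neqE_linordered_idom\<close>)
  define g where "g = inv_into {..<m} u"
  have gu: "g (u s) = s" if "s < m" for s
    unfolding g_def using inv_into_f_f[OF inj] that by simp
  have ex: "\<exists>s. t1 \<le> s \<and> s \<le> t2 \<and> u s = v x" if "t1 \<le> x" "x \<le> t2" for x
  proof (rule IVT)
    show "u t1 \<le> v x" using eq(1) mv[of t1 x] that t by (cases "t1 = x") auto
    show "v x \<le> u t2" using eq(2) mv[of x t2] that t by (cases "t2 = x") auto
  qed (use t U(2) DERIV_isCont in auto)
  have dg: "(g has_real_derivative inverse (u1 s)) (at (u s))" if s: "s < m" for s
  proof (rule DERIV_inverse_function[where f = u and a = "u (s - 1)" and b = "u ((s + m) / 2)"])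
    show "(u has_real_derivative u1 s) (at (g (u s)))" using U(2) gu[OF s] by simp
    show "u1 s \<noteq> 0" using incu[OF s] by simp
    show "u (s - 1) < u s" "u s < u ((s + m) / 2)" by (intro mu; use s in simp)+
    show "isCont g (u s)"
      by (rule isCont_inverse_function2[of "s - 1" s "(s + m) / 2"])
         (use s gu DERIV_isCont[OF U(2)] in \<open>auto simp: field_simps\<close>)
    fix y assume y: "u (s - 1) < y" "y < u ((s + m) / 2)"
    have "\<exists>x\<ge>s - 1. x \<le> (s + m) / 2 \<and> u x = y"
      by (rule IVT) (use y s U(2) DERIV_isCont in auto)
    then obtain x where "x \<le> (s + m) / 2" "u x = y" by blast
    then show "u (g y) = y" using gu[of x] s by auto
  qed
  have "\<exists>z>t1. z < t2 \<and> (g (v t2) - t2) - (g (v t1) - t1) = (t2 - t1) * (inverse (u1 (g (v z))) * v1 z - 1)"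
  proof (rule MVT2[OF t(1)])
    fix x assume x: "t1 \<le> x" "x \<le> t2"
    from ex[OF this] obtain s where s: "t1 \<le> s" "s \<le> t2" "u s = v x" by blast
    then have sm: "s < m" using t by simp
    have "((\<lambda>x. g (v x)) has_real_derivative inverse (u1 s) * v1 x) (at x)"
      using DERIV_chain2[OF _ V(2)[of x], of g "inverse (u1 s)"] dg[OF sm] s(3) by simp
    then show "((\<lambda>x. g (v x) - x) has_real_derivative inverse (u1 (g (v x))) * v1 x - 1) (at x)"
      using gu[OF sm] s(3) by (auto intro!: derivative_eq_intros)
  qed
  moreover have "g (v t1) = t1" "g (v t2) = t2" using gu eq t by auto
  ultimately obtain z where z: "t1 < z" "z < t2" "inverse (u1 (g (v z))) * v1 z = 1"
    using t by auto
  from ex[of z] z obtain s where s: "t1 \<le> s" "s \<le> t2" "u s = v z" by auto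
  have "s < m" using s t by simp
  then have "v1 z = u1 s" using z(3) gu[of s] s(3) incu[of s] by (simp add: field_simps)
  then have "v = (\<lambda>t. u (t + (s - z)))"
    using s by (intro bounded_positive_sol_noncrossing[OF v bounded_positive_sol_shift[OF u] kl p, of z]) auto
  then show ?thesis by blast
qed

text \<open>If the solutions are not translates, their difference has at most one zero where both
  increase, hence a constant sign near -infinity, and both signs are excluded by the ordered
  case.\<close>

lemma homoclinic_unique_normalized:
  assumes v: "homoclinic_sol k l p v v1 v2 v3" and u: "homoclinic_sol k l p u u1 u2 u3"
    and kl: "0 < k" "k \<le> l" and p: "p > 1"
    and lim: "((\<lambda>t. exp ((-k) * t) * slow_mode k l v v1 v2 v3 t) \<longlongrightarrow> c) at_bot"
      "((\<lambda>t. exp ((-k) * t) * slow_mode k l u u1 u2 u3 t) \<longlongrightarrow> c) at_bot"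
  shows "\<exists>s. v = (\<lambda>t. u (t + s))"
proof (rule ccontr)
  assume no: "\<not> ?thesis"
  have l: "l > 0" using kl by linarith
  note H = homoclinic_solD[OF v] and V = bounded_positive_solD[OF homoclinic_solD(1)[OF v]]
  note I = homoclinic_solD[OF u] and U = bounded_positive_solD[OF homoclinic_solD(1)[OF u]]
  obtain mv where mv: "\<And>t. t < mv \<Longrightarrow> v1 t > 0" using homoclinic_increasing[OF v kl(1) l p] by metis
  obtain mu where mu: "\<And>t. t < mu \<Longrightarrow> u1 t > 0" using homoclinic_increasing[OF u kl(1) l p] by metis
  define m where "m = min mv mu"
  have two: False if "t1 < t2" "t2 < m" "v t1 = u t1" "v t2 = u t2" for t1 t2
    using translate_of_two_zeros[OF H(1) I(1) kl(1) l p, of m t1 t2] mv mu that no by (auto simp: m_def)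
  obtain T where T: "\<And>t. t \<le> T \<Longrightarrow> v t \<noteq> u t"
  proof (cases "\<exists>t<m. v t = u t")
    case True
    then obtain t where "t < m" "v t = u t" by blast
    then show ?thesis using two[of _ t] that[of "t - 1"] by fastforce
  next
    case False
    then show ?thesis using that[of "m - 1"] by force
  qed
  have sgn: False if "v a < u a" "u b < v b" "a \<le> T" "b \<le> T" for a b
  proof -
    have c: "continuous_on {min a b..max a b} (\<lambda>t. v t - u t)"
      by (intro continuous_on_diff DERIV_continuous_on)
         (use V(2) U(2) has_field_derivative_at_within in blast)+
    have "connected ((\<lambda>t. v t - u t) ` {min a b..max a b})"
      by (rule connected_continuous_image[OF c]) simp
    moreover have "v a - u a \<in> (\<lambda>t. v t - u t) ` {min a b..max a b}" "v b - u b \<in> (\<lambda>t. v t - u t) ` {min a b..max a b}"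
      by auto
    ultimately have "0 \<in> (\<lambda>t. v t - u t) ` {min a b..max a b}"
      unfolding connected_iff_interval using that by (meson diff_le_0_iff_le diff_ge_0_iff_ge less_imp_le)
    then show False using T that by auto
  qed
  show False
  proof (cases "u T < v T")
    case True
    then have "u t < v t" if "t \<le> T" for t
      using sgn[of t T] T[OF that] that by force
    then show False by (rule homoclinic_not_ordered[OF v u kl p lim])
  next
    case False
    then have "v T < u T" using T[of T] by force
    then have "v t < u t" if "t \<le> T" for t
      using sgn[of T t] T[OF that] that by force
    then show False by (rule homoclinic_not_ordered[OF u v kl p lim(2,1)])
  qed
qed

theorem homoclinic_unique:
  assumes v: "homoclinic_sol k l p v v1 v2 v3" and u: "homoclinic_sol k l p u u1 u2 u3"
    and kl: "0 < k" "k \<le> l" and p: "p > 1"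
  shows "\<exists>s. v = (\<lambda>t. u (t + s))"
proof -
  let ?E = "\<lambda>v v1 v2 v3 t. exp ((-k) * t) * slow_mode k l v v1 v2 v3 t"
  obtain c where c: "c > 0" "(?E v v1 v2 v3 \<longlongrightarrow> - c) at_bot" using slow_mode_limit[OF v kl p] .
  obtain e where e: "e > 0" "(?E u u1 u2 u3 \<longlongrightarrow> - e) at_bot" using slow_mode_limit[OF u kl p] .
  \<comment> \<open>A translation by s multiplies the limit of the weighted slow mode by exp (k s).
    Since c and e are positive, this s carries - e to - c.\<close>
  define s where "s = ln (c / e) / k"
  have ks: "exp (k * s) * e = c" using kl c e by (simp add: s_def)
  let ?u = "\<lambda>t. u (t + s)"
  have 2: "filterlim (\<lambda>t. t + s) at_bot (at_bot :: real filter)"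
    unfolding filterlim_at_bot
  proof
    fix Z show "\<forall>\<^sub>F t in at_bot. t + s \<le> Z"
      using eventually_le_at_bot[of "Z - s"] by eventually_elim simp
  qed
  have "((\<lambda>t. exp (k * s) * ?E u u1 u2 u3 (t + s)) \<longlongrightarrow> exp (k * s) * (- e)) at_bot"
    by (intro tendsto_intros filterlim_compose[OF e(2) 2])
  also have "(\<lambda>t. exp (k * s) * ?E u u1 u2 u3 (t + s))
      = ?E ?u (\<lambda>t. u1 (t + s)) (\<lambda>t. u2 (t + s)) (\<lambda>t. u3 (t + s))"
  proof
    fix t
    have "exp (k * s) * exp ((-k) * (t + s)) = exp ((-k) * t)"
      by (simp add: exp_add[symmetric] algebra_simps)
    then show "exp (k * s) * ?E u u1 u2 u3 (t + s)
        = ?E ?u (\<lambda>t. u1 (t + s)) (\<lambda>t. u2 (t + s)) (\<lambda>t. u3 (t + s)) t"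
      by (simp only: slow_mode_def mult.assoc[symmetric])
  qed
  also have "exp (k * s) * (- e) = - c" using ks by simp
  finally have "\<exists>r. v = (\<lambda>t. ?u (t + r))"
    by (rule homoclinic_unique_normalized[OF v homoclinic_sol_shift[OF u] kl p c(2)])
  then obtain r where "v = (\<lambda>t. u (t + r + s))" by blast
  then have "v = (\<lambda>t. u (t + (r + s)))" by (simp add: add.assoc)
  then show ?thesis by blast
qed

text \<open>The slope is recovered from v and v'' by mean values over a unit interval, which costs
  the factor 3. The rate k / 2 is one convenient choice below k.\<close>

lemma homoclinic_decay_at_bot':
  assumes v: "homoclinic_sol k l p v v1 v2 v3" and kl: "0 < k" "k \<le> l" and p: "p > 1"
  shows "\<exists>C T. C > 0 \<and> (\<forall>t\<le>T. \<bar>v t\<bar> \<le> C * exp (k / 2 * t) \<and> \<bar>v1 t\<bar> \<le> C * exp (k / 2 * t)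
    \<and> \<bar>v2 t\<bar> \<le> C * exp (k / 2 * t))"
proof -
  note H = homoclinic_solD[OF v] and V = bounded_positive_solD[OF homoclinic_solD(1)[OF v]]
  have k2: "0 < k / 2" "k / 2 < k" using kl by auto
  obtain C T where "C > 0 \<and> (\<forall>t\<le>T. v t \<le> C * exp (k / 2 * t) \<and> \<bar>v2 t\<bar> \<le> C * exp (k / 2 * t))"
    using homoclinic_decay_at_bot[OF v kl p k2] by blast
  then have CT: "\<And>t. t \<le> T \<Longrightarrow> v t \<le> C * exp (k / 2 * t)"
      "\<And>t. t \<le> T \<Longrightarrow> \<bar>v2 t\<bar> \<le> C * exp (k / 2 * t)" "C > 0" by auto
  have mono: "C * exp (k / 2 * s) \<le> C * exp (k / 2 * t)" if "s \<le> t" for s t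
    using CT(3) kl that by simp
  have v1: "\<bar>v1 t\<bar> \<le> 3 * C * exp (k / 2 * t)" if t: "t \<le> T" for t
  proof -
    have "\<exists>z>t - 1. z < t \<and> v t - v (t - 1) = (t - (t - 1)) * v1 z" by (rule MVT2) (use V in auto)
    then obtain z where z: "t - 1 < z" "z < t" "v t - v (t - 1) = v1 z" by auto
    have "\<exists>y>z. y < t \<and> v1 t - v1 z = (t - z) * v2 y" by (rule MVT2) (use V z in auto)
    then obtain y where y: "z < y" "y < t" "v1 t - v1 z = (t - z) * v2 y" by auto
    have "(t - z) * \<bar>v2 y\<bar> \<le> 1 * (C * exp (k / 2 * t))"
      using z y CT(2)[of y] t mono[of y t] by (intro mult_mono) auto
    then have "\<bar>v1 t - v1 z\<bar> \<le> C * exp (k / 2 * t)" using y z by (simp add: abs_mult)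
    moreover have "v t \<le> C * exp (k / 2 * t)" "v (t - 1) \<le> C * exp (k / 2 * t)"
      using CT(1)[of t] CT(1)[of "t - 1"] mono[of "t - 1" t] t by auto
    ultimately show ?thesis using z V(1)[of t] V(1)[of "t - 1"] by linarith
  qed
  have "\<bar>v t\<bar> \<le> 3 * C * exp (k / 2 * t) \<and> \<bar>v2 t\<bar> \<le> 3 * C * exp (k / 2 * t)" if t: "t \<le> T" for t
  proof -
    have "0 \<le> C * exp (k / 2 * t)" using CT(3) by simp
    then show ?thesis using CT(1,2)[OF t] V(1)[of t] by auto
  qed
  then show ?thesis using v1 CT(3) by (intro exI[of _ "3 * C"] exI[of _ T]) auto
qed

text \<open>The bound at +infinity is the bound at -infinity for the reflected solution; the compact
  range between them is absorbed into the constant.\<close>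

lemma homoclinic_decay:
  assumes v: "homoclinic_sol k l p v v1 v2 v3" and kl: "0 < k" "k \<le> l" and p: "p > 1"
  shows "\<exists>C>0. \<forall>t. \<bar>v t\<bar> \<le> C * exp (- (k / 2) * \<bar>t\<bar>) \<and> \<bar>v1 t\<bar> \<le> C * exp (- (k / 2) * \<bar>t\<bar>)
    \<and> \<bar>v2 t\<bar> \<le> C * exp (- (k / 2) * \<bar>t\<bar>)"
proof -
  note H = homoclinic_solD[OF v] and V = bounded_positive_solD[OF homoclinic_solD(1)[OF v]]
  obtain C T where "C > 0 \<and> (\<forall>t\<le>T. \<bar>v t\<bar> \<le> C * exp (k / 2 * t) \<and> \<bar>v1 t\<bar> \<le> C * exp (k / 2 * t)
      \<and> \<bar>v2 t\<bar> \<le> C * exp (k / 2 * t))"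
    using homoclinic_decay_at_bot'[OF v kl p] by blast
  then have CT: "\<And>t. t \<le> T \<Longrightarrow> \<bar>v t\<bar> \<le> C * exp (k / 2 * t)"
    "\<And>t. t \<le> T \<Longrightarrow> \<bar>v1 t\<bar> \<le> C * exp (k / 2 * t)"
    "\<And>t. t \<le> T \<Longrightarrow> \<bar>v2 t\<bar> \<le> C * exp (k / 2 * t)" "C > 0" by auto
  obtain C' T' where "C' > 0 \<and> (\<forall>t\<le>T'. \<bar>v (- t)\<bar> \<le> C' * exp (k / 2 * t) \<and> \<bar>- v1 (- t)\<bar> \<le> C' * exp (k / 2 * t)
      \<and> \<bar>v2 (- t)\<bar> \<le> C' * exp (k / 2 * t))"
    using homoclinic_decay_at_bot'[OF homoclinic_sol_reflect[OF v] kl p] by blast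
  then have CT': "\<And>t. t \<le> T' \<Longrightarrow> \<bar>v (- t)\<bar> \<le> C' * exp (k / 2 * t)"
    "\<And>t. t \<le> T' \<Longrightarrow> \<bar>v1 (- t)\<bar> \<le> C' * exp (k / 2 * t)"
    "\<And>t. t \<le> T' \<Longrightarrow> \<bar>v2 (- t)\<bar> \<le> C' * exp (k / 2 * t)" "C' > 0" by auto
  obtain M where M: "\<And>t. \<bar>v t\<bar> \<le> M" "\<And>t. \<bar>v1 t\<bar> \<le> M" "\<And>t. \<bar>v2 t\<bar> \<le> M" "\<And>t. \<bar>v3 t\<bar> \<le> M" using V(6) by blast
  define S where "S = \<bar>T\<bar> + \<bar>T'\<bar>"
  define B where "B = C + C' + M * exp (k / 2 * S)"
  have M0: "M \<ge> 0" using M(1)[of 0] by linarith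
  have key: "\<bar>f t\<bar> \<le> B * exp (- (k / 2) * \<bar>t\<bar>)"
    if f: "\<And>t. t \<le> T \<Longrightarrow> \<bar>f t\<bar> \<le> C * exp (k / 2 * t)" "\<And>t. t \<le> T' \<Longrightarrow> \<bar>f (- t)\<bar> \<le> C' * exp (k / 2 * t)"
      "\<And>t. \<bar>f t\<bar> \<le> M" for f :: "real \<Rightarrow> real" and t
  proof -
    have B: "C \<le> B" "C' \<le> B" "M * exp (k / 2 * S) \<le> B" using CT(4) CT'(4) M0 by (simp_all add: B_def)
    consider "t < - S" | "t > S" | "\<bar>t\<bar> \<le> S" by linarith
    then show ?thesis
    proof cases
      case 1
      then have "t \<le> T" "t < 0" by (auto simp: S_def)
      then show ?thesis using order_trans[OF f(1)[of t] mult_right_mono[OF B(1), of "exp (k / 2 * t)"]] by simp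
    next
      case 2
      then have "- t \<le> T'" "t > 0" by (auto simp: S_def)
      then show ?thesis using order_trans[OF f(2)[of "- t"] mult_right_mono[OF B(2), of "exp (k / 2 * (- t))"]] by simp
    next
      case 3
      have "M * 1 \<le> M * exp (k / 2 * (S - \<bar>t\<bar>))" using 3 kl M0 by (intro mult_left_mono) auto
      also have "\<dots> = M * exp (k / 2 * S) * exp (- (k / 2) * \<bar>t\<bar>)"
        by (simp add: exp_add[symmetric] field_simps)
      also have "\<dots> \<le> B * exp (- (k / 2) * \<bar>t\<bar>)" using B(3) by (intro mult_right_mono) auto
      finally show ?thesis using f(3)[of t] by simp
    qed
  qed
  show ?thesis
  proof (intro exI[of _ B] conjI allI)
    show "\<bar>v t\<bar> \<le> B * exp (- (k / 2) * \<bar>t\<bar>)" for t by (rule key[OF CT(1) CT'(1) M(1)])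
    show "\<bar>v1 t\<bar> \<le> B * exp (- (k / 2) * \<bar>t\<bar>)" for t by (rule key[OF CT(2) CT'(2) M(2)])
    show "\<bar>v2 t\<bar> \<le> B * exp (- (k / 2) * \<bar>t\<bar>)" for t by (rule key[OF CT(3) CT'(3) M(3)])
  qed (use CT(4) CT'(4) M0 in \<open>simp add: B_def add_pos_nonneg\<close>)
qed

section \<open>Convolution with exponential kernels\<close>

definition ker :: "real \<Rightarrow> real \<Rightarrow> real" where
  "ker c t = exp (- c * \<bar>t\<bar>) / (2 * c)"

definition Kop :: "real \<Rightarrow> (real \<Rightarrow> real) \<Rightarrow> real \<Rightarrow> real" where
  "Kop c f t = (LINT s|lborel. ker c (t - s) * f s)"

text \<open>With \<theta> = 1 / q this is the majorant shared by all competitors of the variational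
  problem. The origin is exempt because \<open>0 powr r = 0\<close> would force f 0 <= 0
  there.\<close>

definition power_dominated :: "real \<Rightarrow> real \<Rightarrow> (real \<Rightarrow> real) \<Rightarrow> bool" where
  "power_dominated \<theta> C f \<longleftrightarrow> f \<in> borel_measurable borel \<and> (\<forall>t. 0 \<le> f t) \<and>
     (\<forall>t. t \<noteq> 0 \<longrightarrow> f t \<le> C * \<bar>t\<bar> powr (- \<theta>))"

lemma power_dominatedD:
  assumes "power_dominated \<theta> C f"
  shows "f \<in> borel_measurable borel" "\<And>t. 0 \<le> f t" "\<And>t. t \<noteq> 0 \<Longrightarrow> f t \<le> C * \<bar>t\<bar> powr (- \<theta>)"
    "f \<in> borel_measurable lborel" "C \<ge> 0"
proof -
  show 1: "f \<in> borel_measurable borel" "\<And>t. 0 \<le> f t" "\<And>t. t \<noteq> 0 \<Longrightarrow> f t \<le> C * \<bar>t\<bar> powr (- \<theta>)"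
    "f \<in> borel_measurable lborel"
    using assms unfolding power_dominated_def by auto
  show "C \<ge> 0" using 1(2)[of 1] 1(3)[of 1] by simp
qed

lemma ker_measurable [measurable]: "ker c \<in> borel_measurable borel"
  unfolding ker_def by measurable

lemma ker_pos: "c > 0 \<Longrightarrow> 0 < ker c t"
  by (simp add: ker_def)

lemma ker_le: "c > 0 \<Longrightarrow> ker c t \<le> 1 / (2 * c)"
  by (simp add: ker_def divide_right_mono)

lemma ker_commute: "ker c (t - s) = ker c (s - t)"
  by (simp add: ker_def abs_minus_commute)

lemma integrable_even_extension:
  fixes g :: "real \<Rightarrow> real"
  assumes "set_integrable lborel {0..} g"
  shows "integrable lborel (\<lambda>t. g \<bar>t\<bar>)"
proof -
  let ?h = "\<lambda>t. indicator {0..} t * g t"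
  have h: "integrable lborel ?h" using assms unfolding set_integrable_def by simp
  have h': "integrable lborel (\<lambda>t. ?h (- t))"
    using lborel_integrable_real_affine[OF h, of "-1" 0] by simp
  have meas: "(\<lambda>t. ?h \<bar>t\<bar>) \<in> borel_measurable lborel"
    using borel_measurable_integrable[OF h] by measurable
  have "integrable lborel (\<lambda>t. ?h \<bar>t\<bar>)"
  proof (rule Bochner_Integration.integrable_bound[OF Bochner_Integration.integrable_add[OF integrable_norm[OF h] integrable_norm[OF h']] meas])
    show "AE t in lborel. norm (?h \<bar>t\<bar>) \<le> norm (norm (?h t) + norm (?h (- t)))"
      by (rule AE_I2) (auto simp: abs_if indicator_def)
  qed
  then show ?thesis by simp
qed

lemma integrable_exp_abs:
  assumes "c > 0" shows "integrable lborel (\<lambda>t. exp (- c * \<bar>t\<bar>) :: real)"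
proof (rule integrable_even_extension)
  have "(\<lambda>t. exp (- c * t)) absolutely_integrable_on {0..}"
    by (rule nonnegative_absolutely_integrable_1[OF integrable_on_exp_minus_to_infinity[OF assms]]) simp
  then show "set_integrable lborel {0..} (\<lambda>t. exp (- c * t))"
    unfolding set_integrable_def by (subst (asm) integrable_completion) auto
qed

lemma integrable_ker_shift:
  assumes "c > 0" shows "integrable lborel (\<lambda>s. ker c (t - s))"
proof -
  have "integrable lborel (ker c)"
    unfolding ker_def by (intro integrable_divide integrable_exp_abs assms)
  from lborel_integrable_real_affine[OF this, of "-1" t] show ?thesis by simp
qed

lemma integral_ker_shift: "(LINT s|lborel. ker c (t - s)) = (LINT s|lborel. ker c s)"
  using lborel_integral_real_affine[of "-1" "ker c" t] by simp

context
  fixes \<theta> :: real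
  assumes th: "1 / 2 < \<theta>" "\<theta> < 1"
begin

text \<open>The singular part of the majorant, integrable because \<theta> < 1; away from it the
  majorant is at most 1.\<close>

definition "near t = (if \<bar>t\<bar> \<le> 1 then \<bar>t\<bar> powr (- \<theta>) else (0::real))"

lemma near_integrable: "integrable lborel near"
proof -
  let ?g = "\<lambda>t::real. indicator {0..1} t * t powr (- \<theta>)"
  have "(\<lambda>t. t powr (- \<theta>)) absolutely_integrable_on {0..1}"
    by (rule nonnegative_absolutely_integrable_1[OF integrable_on_powr_from_0]) (use th in auto)
  then have "integrable lborel ?g"
    unfolding set_integrable_def by (subst (asm) integrable_completion) auto
  then have "set_integrable lborel {0..} ?g"
    unfolding set_integrable_def by (rule Bochner_Integration.integrable_cong[THEN iffD1, rotated 2])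
       (auto simp: indicator_def)
  from integrable_even_extension[OF this] show ?thesis
    by (rule Bochner_Integration.integrable_cong[THEN iffD1, rotated 2]) (auto simp: near_def indicator_def)
qed

lemma power_le_near: "t \<noteq> 0 \<Longrightarrow> \<bar>t\<bar> powr (- \<theta>) \<le> near t + 1"
  unfolding near_def using th by (auto simp: powr_le_one_le powr_mono2' powr_le1 intro: order_trans[OF powr_mono2'[of _ 1]])

text \<open>The tail \<open>|t| powr (- 2 \<theta>)\<close> is integrable because \<open>2 \<theta> > 1\<close>.\<close>

lemma power_min_integrable: "integrable lborel (\<lambda>t. min 1 (\<bar>t\<bar> powr (- \<theta>)) * \<bar>t\<bar> powr (- \<theta>))"
proof -
  let ?g = "\<lambda>t::real. indicator {1..} t * t powr (- (2 * \<theta>))"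
  have "(\<lambda>t. t powr (- (2 * \<theta>))) absolutely_integrable_on {1..}"
    using has_integral_powr_to_inf[of "- (2 * \<theta>)" 1] th
    by (intro nonnegative_absolutely_integrable_1) auto
  then have "integrable lborel ?g"
    unfolding set_integrable_def by (subst (asm) integrable_completion) auto
  then have "set_integrable lborel {0..} ?g"
    unfolding set_integrable_def by (rule Bochner_Integration.integrable_cong[THEN iffD1, rotated 2])
       (auto simp: indicator_def)
  from integrable_even_extension[OF this] have g: "integrable lborel (\<lambda>t. ?g \<bar>t\<bar>)" .
  show ?thesis
  proof (rule Bochner_Integration.integrable_bound[OF Bochner_Integration.integrable_add[OF near_integrable g]])
    show "AE t in lborel. norm (min 1 (\<bar>t\<bar> powr (- \<theta>)) * \<bar>t\<bar> powr (- \<theta>)) \<le> norm (near t + ?g \<bar>t\<bar>)"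
    proof (rule AE_I2)
      fix t :: real
      show "norm (min 1 (\<bar>t\<bar> powr (- \<theta>)) * \<bar>t\<bar> powr (- \<theta>)) \<le> norm (near t + ?g \<bar>t\<bar>)"
      proof (cases "\<bar>t\<bar> \<le> 1")
        case True
        have "min 1 (\<bar>t\<bar> powr (- \<theta>)) * \<bar>t\<bar> powr (- \<theta>) \<le> 1 * \<bar>t\<bar> powr (- \<theta>)"
          by (intro mult_right_mono) auto
        then show ?thesis using True by (auto simp: near_def indicator_def abs_mult)
      next
        case False
        have "min 1 (\<bar>t\<bar> powr (- \<theta>)) * \<bar>t\<bar> powr (- \<theta>) \<le> \<bar>t\<bar> powr (- \<theta>) * \<bar>t\<bar> powr (- \<theta>)"
          by (intro mult_right_mono) auto
        also have "\<dots> = \<bar>t\<bar> powr (- (2 * \<theta>))" by (simp add: powr_add[symmetric])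
        finally show ?thesis using False by (auto simp: near_def indicator_def abs_mult)
      qed
    qed
  qed measurable
qed

text \<open>The kernel is bounded by 1 / (2 c) against the integrable singular part of the majorant,
  and is itself integrable against the constant 1.\<close>

lemma ker_mult_le:
  assumes f: "power_dominated \<theta> C f" and c: "c > 0" and s: "s \<noteq> 0"
  shows "ker c x * f s \<le> C * (near s / (2 * c) + ker c x)"
proof -
  note F = power_dominatedD[OF f]
  have nn: "0 \<le> near s" by (simp add: near_def)
  have "ker c x * f s \<le> ker c x * (C * (near s + 1))"
    using F(3)[OF s] power_le_near[OF s] F(5) ker_pos[OF c, of x]
    by (intro mult_left_mono order_trans[OF F(3)[OF s]]) auto
  also have "\<dots> = C * (near s * ker c x + ker c x)" by (simp add: algebra_simps)
  also have "\<dots> \<le> C * (near s * (1 / (2 * c)) + ker c x)"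
    using ker_le[OF c, of x] F(5) nn by (intro mult_left_mono add_right_mono) auto
  finally show ?thesis by simp
qed

lemma ker_mult_integrable:
  assumes f: "power_dominated \<theta> C f" and c: "c > 0"
  shows "integrable lborel (\<lambda>s. ker c (t - s) * f s)"
proof (rule Bochner_Integration.integrable_bound)
  show "integrable lborel (\<lambda>s. C * (near s / (2 * c) + ker c (t - s)))"
    by (intro integrable_mult_right Bochner_Integration.integrable_add integrable_divide near_integrable integrable_ker_shift c)
  show "(\<lambda>s. ker c (t - s) * f s) \<in> borel_measurable lborel"
    using power_dominatedD(1)[OF f] by measurable
  show "AE s in lborel. norm (ker c (t - s) * f s) \<le> norm (C * (near s / (2 * c) + ker c (t - s)))"
    using AE_lborel_singleton[of 0]
  proof eventually_elim
    case (elim s)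
    show ?case
      using ker_mult_le[OF f c elim, of "t - s"] power_dominatedD(2)[OF f, of s] ker_pos[OF c, of "t - s"] by simp
  qed
qed

definition "Kbound c = (LINT s|lborel. near s) / (2 * c) + (LINT s|lborel. ker c s)"

lemma Kop_nonneg: "power_dominated \<theta> C f \<Longrightarrow> c > 0 \<Longrightarrow> 0 \<le> Kop c f t"
  unfolding Kop_def using power_dominatedD(2) ker_pos
  by (intro integral_nonneg_AE AE_I2 mult_nonneg_nonneg) (auto intro: less_imp_le)

lemma Kop_le_Kbound:
  assumes f: "power_dominated \<theta> C f" and c: "c > 0"
  shows "Kop c f t \<le> C * Kbound c"
proof -
  have "Kop c f t \<le> (LINT s|lborel. C * (near s / (2 * c) + ker c (t - s)))"
    unfolding Kop_def
  proof (rule integral_mono_AE[OF ker_mult_integrable[OF f c]])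
    show "integrable lborel (\<lambda>s. C * (near s / (2 * c) + ker c (t - s)))"
      by (intro integrable_mult_right Bochner_Integration.integrable_add integrable_divide near_integrable integrable_ker_shift c)
    show "AE s in lborel. ker c (t - s) * f s \<le> C * (near s / (2 * c) + ker c (t - s))"
      using AE_lborel_singleton[of 0] by eventually_elim (rule ker_mult_le[OF f c])
  qed
  also have "\<dots> = C * ((LINT s|lborel. near s) / (2 * c) + (LINT s|lborel. ker c (t - s)))"
    by (subst integral_mult_right_zero, subst Bochner_Integration.integral_add)
       (auto intro!: integrable_divide near_integrable integrable_ker_shift c)
  finally show ?thesis unfolding Kbound_def integral_ker_shift .
qed

lemma powr_exp_le:
  assumes c: "c > 0" and t: "(t::real) > 0"
  shows "exp (- c * t) \<le> (1 + 1 / c) * t powr (- \<theta>)"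
proof -
  have "t powr \<theta> \<le> 1 + t"
  proof (cases "t \<le> 1")
    case True
    then have "t powr \<theta> \<le> 1 powr \<theta>" using t th by (intro powr_mono2) auto
    then show ?thesis using t by simp
  next
    case False
    then have "t powr \<theta> \<le> t powr 1" using th by (intro powr_mono) auto
    then show ?thesis using t by simp
  qed
  then have "exp (- c * t) * t powr \<theta> \<le> exp (- c * t) * (1 + t)" by (intro mult_left_mono) auto
  moreover have "exp (- c * t) * (1 + t) = exp (- c * t) + t * exp (- c * t)" by (simp add: algebra_simps)
  moreover have "exp (- c * t) \<le> 1" using c t by simp
  moreover have "t * exp (- c * t) \<le> 1 / c"
  proof -
    have "c * t \<le> exp (c * t)" using exp_ge_add_one_self[of "c * t"] by linarith
    then show ?thesis using c by (simp add: exp_minus field_simps)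
  qed
  ultimately have "exp (- c * t) * t powr \<theta> \<le> 1 + 1 / c" by linarith
  then show ?thesis using t by (simp add: powr_minus field_simps)
qed

text \<open>The factor 2 powr \<theta> comes from the majorant at |t| / 2, the factor 1 + 4 / c from
  trading exp (- c |t| / 4) for a power, and the final 1 / 2 from the normalisations of
  \<open>ker c\<close> and \<open>ker (c / 2)\<close>.\<close>

definition "Kdecay c = 2 powr \<theta> * (LINT s|lborel. ker c s) + (1 + 4 / c) * Kbound (c / 2) / 2"

text \<open>Split at |s| = |t| / 2. Beyond it f s is at most the majorant at |t| / 2. Within it |t -
  s| >= |t| / 2, so half of the exponent turns into exp (- c |t| / 4), and the other half leaves a
  bounded convolution with \<open>ker (c / 2)\<close>.\<close>

lemma Kop_le_Kdecay:
  assumes f: "power_dominated \<theta> C f" and c: "c > 0" and t: "t \<noteq> 0"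
  shows "Kop c f t \<le> C * Kdecay c * \<bar>t\<bar> powr (- \<theta>)"
proof -
  note F = power_dominatedD[OF f]
  have c2: "c / 2 > 0" using c by simp
  let ?a = "C * (\<bar>t\<bar> / 2) powr (- \<theta>)" and ?e = "exp (- (c / 4) * \<bar>t\<bar>)"
  have int: "integrable lborel (\<lambda>s. ?a * ker c (t - s) + ?e / 2 * (ker (c / 2) (t - s) * f s))"
    by (intro integrable_mult_right Bochner_Integration.integrable_add integrable_ker_shift c ker_mult_integrable[OF f c2])
  have "Kop c f t \<le> (LINT s|lborel. ?a * ker c (t - s) + ?e / 2 * (ker (c / 2) (t - s) * f s))"
    unfolding Kop_def
  proof (rule integral_mono[OF ker_mult_integrable[OF f c] int])
    fix s
    have n1: "0 \<le> ?a * ker c (t - s)" using F(5) ker_pos[OF c, of "t - s"] by simp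
    have n2: "0 \<le> ?e / 2 * (ker (c / 2) (t - s) * f s)" using F(2)[of s] ker_pos[OF c2, of "t - s"] by simp
    show "ker c (t - s) * f s \<le> ?a * ker c (t - s) + ?e / 2 * (ker (c / 2) (t - s) * f s)"
    proof (cases "\<bar>s\<bar> \<le> \<bar>t\<bar> / 2")
      case True
      have "\<bar>t\<bar> / 2 \<le> \<bar>t - s\<bar>" using True by linarith
      then have "c * (\<bar>t\<bar> / 2) \<le> c * \<bar>t - s\<bar>" using c by (intro mult_left_mono) auto
      then have "exp (- c * \<bar>t - s\<bar>) \<le> exp (- (c / 4) * \<bar>t\<bar> + - (c / 2) * \<bar>t - s\<bar>)"
        by simp
      then have "exp (- c * \<bar>t - s\<bar>) \<le> ?e * exp (- (c / 2) * \<bar>t - s\<bar>)"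
        by (simp only: exp_add)
      from divide_right_mono[OF this, of "2 * c"]
      have "ker c (t - s) \<le> ?e / 2 * ker (c / 2) (t - s)"
        using c by (simp add: ker_def)
      then have "ker c (t - s) * f s \<le> ?e / 2 * ker (c / 2) (t - s) * f s"
        using F(2)[of s] by (intro mult_right_mono) auto
      then show ?thesis using n1 by (simp add: mult.assoc)
    next
      case False
      have s: "s \<noteq> 0" using False t by auto
      have "\<bar>s\<bar> powr (- \<theta>) \<le> (\<bar>t\<bar> / 2) powr (- \<theta>)"
        using False t th by (intro powr_mono2') auto
      then have "f s \<le> ?a" using F(3)[OF s] F(5) by (meson mult_left_mono order_trans)
      then have "ker c (t - s) * f s \<le> ker c (t - s) * ?a"
        using ker_pos[OF c, of "t - s"] by (intro mult_left_mono) auto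
      then show ?thesis using n2 by (simp add: mult_ac)
    qed
  qed
  also have "\<dots> = ?a * (LINT s|lborel. ker c s) + ?e / 2 * Kop (c / 2) f t"
    unfolding Kop_def integral_ker_shift[of c t, symmetric]
    by (subst Bochner_Integration.integral_add)
       (auto intro!: integrable_mult_right integrable_ker_shift c ker_mult_integrable[OF f c2])
  also have "\<dots> \<le> ?a * (LINT s|lborel. ker c s) + (1 + 4 / c) * \<bar>t\<bar> powr (- \<theta>) / 2 * (C * Kbound (c / 2))"
    using powr_exp_le[of "c / 4" "\<bar>t\<bar>"] c t Kop_nonneg[OF f c2, of t] Kop_le_Kbound[OF f c2, of t]
    by (intro add_left_mono mult_mono) auto
  also have "(\<bar>t\<bar> / 2) powr (- \<theta>) = 2 powr \<theta> * \<bar>t\<bar> powr (- \<theta>)"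
    by (simp add: powr_divide powr_minus field_simps)
  finally show ?thesis by (simp add: Kdecay_def algebra_simps)
qed

lemma Kop_measurable:
  assumes "f \<in> borel_measurable borel" shows "Kop c f \<in> borel_measurable borel"
proof -
  have [measurable]: "f \<in> borel_measurable lborel" using assms by simp
  have "(\<lambda>t. LINT s|lborel. ker c (t - s) * f s) \<in> borel_measurable lborel"
    by measurable
  then show ?thesis unfolding Kop_def[abs_def] by simp
qed

lemma Kop_power_dominated:
  assumes f: "power_dominated \<theta> C f" and c: "c > 0"
  shows "power_dominated \<theta> (C * Kdecay c) (Kop c f)"
  unfolding power_dominated_def
  using Kop_measurable[OF power_dominatedD(1)[OF f]] Kop_nonneg[OF f c] Kop_le_Kdecay[OF f c] by blast

text \<open>\<open>Kop c f\<close> is bounded near the origin and decays like |t|^(-\<theta>) at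
  infinity. The product with g therefore has an integrable singularity and a tail of order |t|^(-2
  \<theta>).\<close>

lemma Kop_mult_le:
  assumes f: "power_dominated \<theta> C f" and c: "c > 0" and g: "power_dominated \<theta> C' g" and t: "t \<noteq> 0"
  shows "g t * Kop c f t \<le> C' * (C * max (Kbound c) (Kdecay c)) * (min 1 (\<bar>t\<bar> powr (- \<theta>)) * \<bar>t\<bar> powr (- \<theta>))"
proof -
  note F = power_dominatedD[OF f] and G = power_dominatedD[OF g]
  let ?m = "C * max (Kbound c) (Kdecay c)"
  have 1: "C * Kbound c \<le> ?m" "C * Kdecay c \<le> ?m" using F(5) by (auto intro: mult_left_mono)
  have "Kop c f t \<le> ?m" using Kop_le_Kbound[OF f c, of t] 1 by linarith
  moreover have "Kop c f t \<le> ?m * \<bar>t\<bar> powr (- \<theta>)"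
    using Kop_le_Kdecay[OF f c t] mult_right_mono[OF 1(2), of "\<bar>t\<bar> powr (- \<theta>)"] by simp
  ultimately have "Kop c f t \<le> ?m * min 1 (\<bar>t\<bar> powr (- \<theta>))" by (simp add: min_def)
  then have "g t * Kop c f t \<le> (C' * \<bar>t\<bar> powr (- \<theta>)) * (?m * min 1 (\<bar>t\<bar> powr (- \<theta>)))"
    using G(3)[OF t] G(2)[of t] G(5) Kop_nonneg[OF f c, of t] by (intro mult_mono) auto
  then show ?thesis by (simp add: mult_ac)
qed

lemma mult_Kop_integrable:
  assumes f: "power_dominated \<theta> C f" and c: "c > 0" and g: "power_dominated \<theta> C' g"
  shows "integrable lborel (\<lambda>t. g t * Kop c f t)"
proof (rule Bochner_Integration.integrable_bound)
  show "integrable lborel (\<lambda>t. C' * (C * max (Kbound c) (Kdecay c)) * (min 1 (\<bar>t\<bar> powr (- \<theta>)) * \<bar>t\<bar> powr (- \<theta>)))"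
    by (intro integrable_mult_right power_min_integrable)
  show "(\<lambda>t. g t * Kop c f t) \<in> borel_measurable lborel"
    using power_dominatedD(1)[OF g] Kop_measurable[OF power_dominatedD(1)[OF f]] by simp
  show "AE t in lborel. norm (g t * Kop c f t)
      \<le> norm (C' * (C * max (Kbound c) (Kdecay c)) * (min 1 (\<bar>t\<bar> powr (- \<theta>)) * \<bar>t\<bar> powr (- \<theta>)))"
    using AE_lborel_singleton[of 0]
  proof eventually_elim
    case (elim t)
    have "0 \<le> g t * Kop c f t" using power_dominatedD(2)[OF g, of t] Kop_nonneg[OF f c, of t] by simp
    then show ?case using Kop_mult_le[OF f c g elim] by simp
  qed
qed

lemma Kop_symmetric:
  assumes f: "power_dominated \<theta> C f" and c: "c > 0" and g: "power_dominated \<theta> C' g"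
  shows "(LINT t|lborel. g t * Kop c f t) = (LINT t|lborel. f t * Kop c g t)"
proof -
  note F = power_dominatedD[OF f] and G = power_dominatedD[OF g]
  have [measurable]: "f \<in> borel_measurable borel" "g \<in> borel_measurable borel" by fact+
  have norm: "norm (g t * (ker c (t - s) * f s)) = g t * (ker c (t - s) * f s)" for s t
    using F(2)[of s] G(2)[of t] ker_pos[OF c, of "t - s"] by simp
  have int: "integrable (lborel \<Otimes>\<^sub>M lborel) (\<lambda>(t, s). g t * (ker c (t - s) * f s))"
  proof (rule lborel_pair.Fubini_integrable)
    show "(\<lambda>(t, s). g t * (ker c (t - s) * f s)) \<in> borel_measurable (lborel \<Otimes>\<^sub>M lborel)"
      by measurable
    have "integrable lborel (\<lambda>t. LINT s|lborel. g t * (ker c (t - s) * f s))"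
      using mult_Kop_integrable[OF f c g] by (simp add: Kop_def)
    then show "integrable lborel (\<lambda>t. LINT s|lborel. norm (case (t, s) of (t, s) \<Rightarrow> g t * (ker c (t - s) * f s)))"
      by (simp only: prod.case norm)
    show "AE t in lborel. integrable lborel (\<lambda>s. case (t, s) of (t, s) \<Rightarrow> g t * (ker c (t - s) * f s))"
      using ker_mult_integrable[OF f c] by (intro AE_I2) auto
  qed
  have "(LINT t|lborel. g t * Kop c f t) = (LINT t|lborel. LINT s|lborel. g t * (ker c (t - s) * f s))"
    by (simp add: Kop_def)
  also have "\<dots> = (LINT s|lborel. LINT t|lborel. g t * (ker c (t - s) * f s))"
    using lborel_pair.Fubini_integral[OF int] by simp
  also have "\<dots> = (LINT s|lborel. f s * Kop c g s)"
    unfolding Kop_def by (simp add: mult_ac ker_commute flip: integral_mult_right_zero)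
  finally show ?thesis .
qed

end

lemma Kop_even:
  assumes ev: "\<And>t. f (- t) = f t"
  shows "Kop c f (- t) = Kop c f t"
proof -
  have "Kop c f (- t) = (LINT s|lborel. ker c (- t - (0 + (-1) * s)) * f (0 + (-1) * s))"
    unfolding Kop_def by (subst lborel_integral_real_affine[of "-1" _ 0]) simp_all
  also have "\<dots> = Kop c f t"
    unfolding Kop_def by (simp add: ev ker_commute[of c s t for s])
  finally show ?thesis .
qed

context
  fixes \<theta> :: real
  assumes th: "1 / 2 < \<theta>" "\<theta> < 1"
begin

lemma Kop_add:
  assumes f: "power_dominated \<theta> C f" and g: "power_dominated \<theta> C' g" and c: "c > 0"
  shows "Kop c (\<lambda>t. a * f t + b * g t) t = a * Kop c f t + b * Kop c g t"
proof -
  note I = ker_mult_integrable[OF th f c, of t] ker_mult_integrable[OF th g c, of t]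
  have "Kop c (\<lambda>t. a * f t + b * g t) t = (LINT s|lborel. a * (ker c (t - s) * f s) + b * (ker c (t - s) * g s))"
    unfolding Kop_def by (rule Bochner_Integration.integral_cong) (simp_all add: algebra_simps)
  also have "\<dots> = a * Kop c f t + b * Kop c g t"
    unfolding Kop_def using I by simp
  finally show ?thesis .
qed

text \<open>A Harnack inequality for the kernel. It passes to the convolution, whose continuity
  follows although f is merely measurable.\<close>

lemma ker_shift_le:
  assumes "c > 0" shows "ker c x \<le> exp (c * \<bar>x - y\<bar>) * ker c y"
proof -
  have "c * \<bar>y\<bar> \<le> c * (\<bar>x - y\<bar> + \<bar>x\<bar>)" using assms by (intro mult_left_mono) auto
  then have "exp (- c * \<bar>x\<bar>) \<le> exp (c * \<bar>x - y\<bar> + - c * \<bar>y\<bar>)" by (simp add: algebra_simps)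
  then have "exp (- c * \<bar>x\<bar>) \<le> exp (c * \<bar>x - y\<bar>) * exp (- c * \<bar>y\<bar>)" by (simp only: exp_add)
  from divide_right_mono[OF this, of "2 * c"] show ?thesis
    using assms by (simp add: ker_def)
qed

lemma Kop_shift_le:
  assumes f: "power_dominated \<theta> C f" and c: "c > 0"
  shows "Kop c f t \<le> exp (c * \<bar>t - s\<bar>) * Kop c f s"
proof -
  have "Kop c f t \<le> (LINT r|lborel. exp (c * \<bar>t - s\<bar>) * (ker c (s - r) * f r))"
    unfolding Kop_def
  proof (rule integral_mono[OF ker_mult_integrable[OF th f c]])
    show "integrable lborel (\<lambda>r. exp (c * \<bar>t - s\<bar>) * (ker c (s - r) * f r))"
      by (intro integrable_mult_right ker_mult_integrable[OF th f c])
    show "ker c (t - r) * f r \<le> exp (c * \<bar>t - s\<bar>) * (ker c (s - r) * f r)" for r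
      using mult_right_mono[OF ker_shift_le[OF c, of "t - r" "s - r"] power_dominatedD(2)[OF f, of r]]
      by (simp add: mult.assoc)
  qed
  then show ?thesis unfolding Kop_def by simp
qed

lemma Kop_isCont:
  assumes f: "power_dominated \<theta> C f" and c: "c > 0"
  shows "isCont (Kop c f) t"
  unfolding isCont_def
proof (rule tendsto_sandwich)
  show "\<forall>\<^sub>F s in at t. exp (- (c * \<bar>t - s\<bar>)) * Kop c f t \<le> Kop c f s"
  proof (rule always_eventually, rule allI)
    fix s
    have "exp (- (c * \<bar>t - s\<bar>)) * Kop c f t \<le> exp (- (c * \<bar>t - s\<bar>)) * (exp (c * \<bar>t - s\<bar>) * Kop c f s)"
      by (intro mult_left_mono Kop_shift_le[OF f c]) simp
    then show "exp (- (c * \<bar>t - s\<bar>)) * Kop c f t \<le> Kop c f s"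
      by (simp add: mult.assoc[symmetric] exp_minus)
  qed
  show "\<forall>\<^sub>F s in at t. Kop c f s \<le> exp (c * \<bar>s - t\<bar>) * Kop c f t"
    using Kop_shift_le[OF f c] by simp
  have "((\<lambda>s. exp (- (c * \<bar>t - s\<bar>)) * Kop c f t) \<longlongrightarrow> exp (- (c * \<bar>t - t\<bar>)) * Kop c f t) (at t)"
    by (intro tendsto_intros)
  then show "((\<lambda>s. exp (- (c * \<bar>t - s\<bar>)) * Kop c f t) \<longlongrightarrow> Kop c f t) (at t)" by simp
  have "((\<lambda>s. exp (c * \<bar>s - t\<bar>) * Kop c f t) \<longlongrightarrow> exp (c * \<bar>t - t\<bar>) * Kop c f t) (at t)"
    by (intro tendsto_intros)
  then show "((\<lambda>s. exp (c * \<bar>s - t\<bar>) * Kop c f t) \<longlongrightarrow> Kop c f t) (at t)" by simp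
qed

lemma Kop_tendsto:
  assumes f: "\<And>j. power_dominated \<theta> C (f j)" and g: "power_dominated \<theta> C g" and c: "c > 0"
    and lim: "AE t in lborel. (\<lambda>j. f j t) \<longlonglongrightarrow> g t"
  shows "(\<lambda>j. Kop c (f j) t) \<longlonglongrightarrow> Kop c g t"
  unfolding Kop_def
proof (rule integral_dominated_convergence[where w = "\<lambda>s. C * (near \<theta> s / (2 * c) + ker c (t - s))"])
  show "integrable lborel (\<lambda>s. C * (near \<theta> s / (2 * c) + ker c (t - s)))"
    by (intro integrable_mult_right Bochner_Integration.integrable_add integrable_divide
        near_integrable[OF th] integrable_ker_shift c)
  show "AE s in lborel. norm (ker c (t - s) * f j s) \<le> C * (near \<theta> s / (2 * c) + ker c (t - s))" for j
    using AE_lborel_singleton[of 0]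
  proof eventually_elim
    case (elim s)
    show ?case
      using ker_mult_le[OF th f c elim, of "t - s"] power_dominatedD(2)[OF f, of j s] ker_pos[OF c, of "t - s"]
      by simp
  qed
  show "AE s in lborel. (\<lambda>j. ker c (t - s) * f j s) \<longlonglongrightarrow> ker c (t - s) * g s"
    using lim by eventually_elim (intro tendsto_intros)
qed (use power_dominatedD(1)[OF f] power_dominatedD(1)[OF g] in measurable)

lemma mult_Kop_tendsto:
  assumes f: "\<And>j. power_dominated \<theta> C (f j)" and g: "power_dominated \<theta> C g" and c: "c > 0"
    and h: "\<And>j. power_dominated \<theta> C' (h j)" and h0: "power_dominated \<theta> C' h0"
    and lim: "AE t in lborel. (\<lambda>j. f j t) \<longlonglongrightarrow> g t" "AE t in lborel. (\<lambda>j. h j t) \<longlonglongrightarrow> h0 t"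
  shows "(\<lambda>j. LINT t|lborel. h j t * Kop c (f j) t) \<longlonglongrightarrow> (LINT t|lborel. h0 t * Kop c g t)"
proof (rule integral_dominated_convergence[where
      w = "\<lambda>t. C' * (C * max (Kbound \<theta> c) (Kdecay \<theta> c)) * (min 1 (\<bar>t\<bar> powr (- \<theta>)) * \<bar>t\<bar> powr (- \<theta>))"])
  show "integrable lborel (\<lambda>t. C' * (C * max (Kbound \<theta> c) (Kdecay \<theta> c)) * (min 1 (\<bar>t\<bar> powr (- \<theta>)) * \<bar>t\<bar> powr (- \<theta>)))"
    by (intro integrable_mult_right power_min_integrable[OF th])
  show "AE t in lborel. norm (h j t * Kop c (f j) t)
      \<le> C' * (C * max (Kbound \<theta> c) (Kdecay \<theta> c)) * (min 1 (\<bar>t\<bar> powr (- \<theta>)) * \<bar>t\<bar> powr (- \<theta>))" for j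
    using AE_lborel_singleton[of 0]
  proof eventually_elim
    case (elim t)
    have "0 \<le> h j t * Kop c (f j) t" using power_dominatedD(2)[OF h, of j t] Kop_nonneg[OF th f c, of j t] by simp
    then show ?case using Kop_mult_le[OF th f c h elim] by simp
  qed
  show "AE t in lborel. (\<lambda>j. h j t * Kop c (f j) t) \<longlonglongrightarrow> h0 t * Kop c g t"
    using lim(2) by eventually_elim (intro tendsto_intros Kop_tendsto[OF f g c lim(1)])
qed (use power_dominatedD(1)[OF h] power_dominatedD(1)[OF h0] Kop_measurable[OF th power_dominatedD(1)[OF f]]
    Kop_measurable[OF th power_dominatedD(1)[OF g]] in simp_all)

text \<open>Reflecting at the midpoint \<open>m\<close> of \<open>t\<close> and \<open>r\<close> turns the difference into an integral of
  a product of two differences of equal sign.\<close>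

lemma Kop_antimono:
  assumes f: "power_dominated \<theta> C f" and c: "c > 0" and ev: "\<And>t. f (- t) = f t"
    and anti: "\<And>s t. 0 < s \<Longrightarrow> s \<le> t \<Longrightarrow> f t \<le> f s" and t: "0 \<le> t" "t \<le> r"
  shows "Kop c f r \<le> Kop c f t"
proof -
  define m where "m = (t + r) / 2"
  let ?k = "\<lambda>s. ker c (t - s) - ker c (r - s)"
  have int: "integrable lborel (\<lambda>s. ?k s * f s)"
    using Bochner_Integration.integrable_diff[OF ker_mult_integrable[OF th f c, of t] ker_mult_integrable[OF th f c, of r]]
    by (simp add: left_diff_distrib)
  have m2: "2 * m = t + r" by (simp add: m_def)
  have kk: "?k (2 * m - s) = - ?k s" for s
  proof -
    have "t - (2 * m - s) = s - r" "r - (2 * m - s) = s - t" using m2 by simp_all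
    then show ?thesis by (simp only: ker_commute[of c s])
  qed
  have "(LINT s|lborel. ?k s * f s) = (LINT s|lborel. ?k (2 * m - s) * f (2 * m - s))"
    using lborel_integral_real_affine[of "-1" "\<lambda>s. ?k s * f s" "2 * m"] by simp
  then have refl: "(LINT s|lborel. ?k s * f s) = (LINT s|lborel. - (?k s * f (2 * m - s)))"
    by (simp only: kk mult_minus_left)
  have int': "integrable lborel (\<lambda>s. - (?k s * f (2 * m - s)))"
  proof -
    have "integrable lborel (\<lambda>s. ?k (2 * m - s) * f (2 * m - s))"
      using lborel_integrable_real_affine[OF int, of "-1" "2 * m"] by simp
    then show ?thesis by (simp only: kk mult_minus_left)
  qed
  have "0 \<le> (LINT s|lborel. ?k s * f s + - (?k s * f (2 * m - s)))"
  proof (rule integral_nonneg_AE)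
    have fmono: "f x \<le> f y" if "y \<noteq> 0" "\<bar>y\<bar> \<le> \<bar>x\<bar>" for x y
      using anti[of "\<bar>y\<bar>" "\<bar>x\<bar>"] that ev[of x] ev[of y] by (auto simp: abs_if split: if_splits)
    have kmono: "ker c x \<le> ker c y" if "\<bar>y\<bar> \<le> \<bar>x\<bar>" for x y
      using that c by (simp add: ker_def divide_right_mono)
    \<comment> \<open>At s = 0 and s = 2 m one of the two arguments of f is the origin, where
      monotonicity is not assumed.\<close>
    show "AE s in lborel. 0 \<le> ?k s * f s + - (?k s * f (2 * m - s))"
      using AE_lborel_singleton[of 0] AE_lborel_singleton[of "2 * m"]
    proof eventually_elim
      case (elim s)
      have "0 \<le> ?k s * (f s - f (2 * m - s))"
      proof (cases "s \<le> m")
        case True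
        then have "ker c (r - s) \<le> ker c (t - s)" using t True m2 by (intro kmono) linarith
        moreover have "f (2 * m - s) \<le> f s" using t True elim m2 by (intro fmono) (simp, linarith)
        ultimately show ?thesis by simp
      next
        case False
        then have "ker c (t - s) \<le> ker c (r - s)" using t False m2 by (intro kmono) linarith
        moreover have "f s \<le> f (2 * m - s)" using t False elim m2 by (intro fmono) (simp, linarith)
        ultimately show ?thesis by (simp add: mult_nonpos_nonpos)
      qed
      then show ?case by (simp add: algebra_simps)
    qed
  qed
  also have "\<dots> = 2 * (LINT s|lborel. ?k s * f s)"
    by (subst Bochner_Integration.integral_add[OF int int'], subst refl[symmetric]) simp
  also have "(LINT s|lborel. ?k s * f s) = Kop c f t - Kop c f r"
    unfolding Kop_def
    by (subst Bochner_Integration.integral_diff[symmetric, OF ker_mult_integrable[OF th f c] ker_mult_integrable[OF th f c]])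
       (simp add: left_diff_distrib)
  finally show ?thesis by simp
qed

lemma Kop_pos:
  assumes f: "power_dominated \<theta> C f" and c: "c > 0" and ne: "\<not> (AE t in lborel. f t = 0)"
  shows "0 < Kop c f t"
proof (rule ccontr)
  assume "\<not> ?thesis"
  then have "Kop c f t = 0" using Kop_nonneg[OF th f c, of t] by simp
  then have "AE s in lborel. ker c (t - s) * f s = 0"
    unfolding Kop_def
    using integral_nonneg_eq_0_iff_AE[OF ker_mult_integrable[OF th f c, of t]]
      power_dominatedD(2)[OF f] ker_pos[OF c] by (simp add: less_imp_le)
  then have "AE s in lborel. f s = 0"
    by eventually_elim (use ker_pos[OF c, THEN less_imp_neq] in \<open>metis mult_eq_0_iff\<close>)
  then show False using ne by blast
qed

end

section \<open>Differentiating the convolution\<close>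

lemma tail_integral_deriv:
  fixes g :: "real \<Rightarrow> real"
  assumes cont: "continuous_on UNIV g" and int: "\<And>t. set_integrable lborel {..t} g"
  shows "((\<lambda>t. LINT s:{..t}|lborel. g s) has_real_derivative g t) (at t)"
proof -
  have cont': "continuous_on A g" for A using cont continuous_on_subset by blast
  have eq: "(LINT s:{..x}|lborel. g s) = (LINT s:{..t - 1}|lborel. g s) + integral {t - 1..x} g"
    if x: "t - 1 \<le> x" for x
  proof -
    have i2: "set_integrable lborel {t - 1..x} g" "set_integrable lborel {t - 1<..x} g"
      by (rule set_integrable_subset[OF int[of x]]; auto)+
    have "(LINT s:{..x}|lborel. g s) = (LINT s:{..t - 1} \<union> {t - 1<..x}|lborel. g s)"
      using x by (simp add: ivl_disj_un)
    also have "\<dots> = (LINT s:{..t - 1}|lborel. g s) + (LINT s:{t - 1<..x}|lborel. g s)"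
      by (rule set_integral_Un[OF _ int i2(2)]) auto
    also have "(LINT s:{t - 1<..x}|lborel. g s) = (LINT s:{t - 1..x}|lborel. g s)"
      unfolding set_lebesgue_integral_def
    proof (rule integral_cong_AE)
      show "AE s in lborel. indicator {t - 1<..x} s *\<^sub>R g s = indicator {t - 1..x} s *\<^sub>R g s"
        using AE_lborel_singleton[of "t - 1"] by eventually_elim (auto simp: indicator_def)
    qed (use i2 in \<open>auto simp: set_integrable_def\<close>)
    also have "\<dots> = integral {t - 1..x} g" by (rule set_borel_integral_eq_integral(2)[OF i2(1)])
    finally show ?thesis .
  qed
  have "((\<lambda>x. integral {t - 1..x} g) has_real_derivative g t) (at t within {t - 1..t + 1})"
    by (rule integral_has_real_derivative[OF cont']) simp
  then have "((\<lambda>x. integral {t - 1..x} g) has_real_derivative g t) (at t)"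
    by (subst (asm) at_within_Icc_at) auto
  then have "((\<lambda>x. (LINT s:{..t - 1}|lborel. g s) + integral {t - 1..x} g) has_real_derivative g t) (at t)"
    by (auto intro!: derivative_eq_intros)
  then show ?thesis
    by (rule has_field_derivative_transform_within_open[of _ _ _ "{t - 1<..}"])
       (simp, simp, rule eq[symmetric], simp)
qed

lemma upper_tail_integral_deriv:
  fixes g :: "real \<Rightarrow> real"
  assumes cont: "continuous_on UNIV g" and int: "\<And>t. set_integrable lborel {t..} g"
  shows "((\<lambda>t. LINT s:{t..}|lborel. g s) has_real_derivative - g t) (at t)"
proof -
  have ind: "indicator {t..} (- s) = (indicator {..- t} s :: real)" for s t :: real
    by (auto split: split_indicator)
  have eq: "(LINT s:{t..}|lborel. g s) = (LINT s:{..- t}|lborel. g (- s))" for t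
    unfolding set_lebesgue_integral_def
    using lborel_integral_real_affine[of "-1" "\<lambda>s. indicator {t..} s *\<^sub>R g s" 0] by (simp add: ind)
  have int': "set_integrable lborel {..t} (\<lambda>s. g (- s))" for t
    using lborel_integrable_real_affine[OF int[of "- t", unfolded set_integrable_def], of "-1" 0]
    unfolding set_integrable_def by (simp add: ind)
  have c: "continuous_on UNIV (\<lambda>s. g (- s))"
    by (intro continuous_on_compose2[OF cont] continuous_intros) auto
  have m: "(uminus has_real_derivative - 1) (at t)" by (auto intro!: derivative_eq_intros)
  show ?thesis
    unfolding eq using DERIV_chain2[OF tail_integral_deriv[OF c int'] m] by simp
qed

text \<open>Splitting at s = t writes the convolution as exp (- c t) A t + exp (c t) B t, up to the
  factor 1 / (2 c), with one-sided integrals A and B. Their boundary terms cancel in the first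
  derivative and add up to - f in the second.\<close>

lemma Kop_second_deriv:
  assumes cont: "continuous_on UNIV f" and int: "\<And>t. integrable lborel (\<lambda>s. ker c (t - s) * f s)" and c: "c > 0"
  obtains g' where "\<And>t. (Kop c f has_real_derivative g' t) (at t)"
    "\<And>t. (g' has_real_derivative c\<^sup>2 * Kop c f t - f t) (at t)"
proof -
  let ?a = "\<lambda>s. exp (c * s) * f s" and ?b = "\<lambda>s. exp (- c * s) * f s"
  define A where "A t = (LINT s:{..t}|lborel. ?a s)" for t
  define B where "B t = (LINT s:{t..}|lborel. ?b s)" for t
  have [measurable]: "f \<in> borel_measurable borel" using cont by (rule borel_measurable_continuous_onI)
  have ee: "exp (- c * t) * (exp (c * t) * x) = x" "exp (c * t) * (exp (- c * t) * x) = x" for t x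
    by (simp_all add: mult.assoc[symmetric] exp_minus)
  have cc: "2 * c * x * (y / (2 * c) * z) = x * (y * z)" for x y z using c by simp
  have ka: "ker c (t - s) * f s = exp (- c * t) / (2 * c) * ?a s" if "s \<le> t" for s t
    using that by (simp add: ker_def exp_add[symmetric] algebra_simps)
  have kb: "ker c (t - s) * f s = exp (c * t) / (2 * c) * ?b s" if "t \<le> s" for s t
    using that by (simp add: ker_def exp_add[symmetric] algebra_simps)
  have intS: "set_integrable lborel S (\<lambda>s. ker c (t - s) * f s)" if "S \<in> sets lborel" for S t
    unfolding set_integrable_def by (rule integrable_mult_indicator[OF that int])
  have intA: "set_integrable lborel {..t} ?a" for t
  proof -
    have "set_integrable lborel {..t} (\<lambda>s. (2 * c * exp (c * t)) * (ker c (t - s) * f s))"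
      by (intro set_integrable_mult_right intS) simp
    moreover have "set_integrable lborel {..t} (\<lambda>s. (2 * c * exp (c * t)) * (ker c (t - s) * f s))
        = set_integrable lborel {..t} ?a"
    proof (rule set_integrable_cong[OF refl refl])
      fix s assume "s \<in> {..t}"
      then show "(2 * c * exp (c * t)) * (ker c (t - s) * f s) = ?a s"
        by (simp only: ka cc ee atMost_iff atLeast_iff)
    qed
    ultimately show ?thesis by blast
  qed
  have intB: "set_integrable lborel {t..} ?b" for t
  proof -
    have "set_integrable lborel {t..} (\<lambda>s. (2 * c * exp (- c * t)) * (ker c (t - s) * f s))"
      by (intro set_integrable_mult_right intS) simp
    moreover have "set_integrable lborel {t..} (\<lambda>s. (2 * c * exp (- c * t)) * (ker c (t - s) * f s))
        = set_integrable lborel {t..} ?b"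
    proof (rule set_integrable_cong[OF refl refl])
      fix s assume "s \<in> {t..}"
      then show "(2 * c * exp (- c * t)) * (ker c (t - s) * f s) = ?b s"
        by (simp only: kb cc ee atMost_iff atLeast_iff)
    qed
    ultimately show ?thesis by blast
  qed
  have K: "Kop c f t = exp (- c * t) / (2 * c) * A t + exp (c * t) / (2 * c) * B t" for t
  proof -
    have "Kop c f t = (LINT s:{..t} \<union> {t<..}|lborel. ker c (t - s) * f s)"
    proof -
      have "{..t} \<union> {t<..} = (UNIV :: real set)" by auto
      then show ?thesis unfolding Kop_def set_lebesgue_integral_def by simp
    qed
    also have "\<dots> = (LINT s:{..t}|lborel. ker c (t - s) * f s) + (LINT s:{t<..}|lborel. ker c (t - s) * f s)"
      by (rule set_integral_Un[OF _ intS intS]) auto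
    also have "(LINT s:{t<..}|lborel. ker c (t - s) * f s) = (LINT s:{t..}|lborel. ker c (t - s) * f s)"
      unfolding set_lebesgue_integral_def
    proof (rule integral_cong_AE)
      show "AE s in lborel. indicator {t<..} s *\<^sub>R (ker c (t - s) * f s) = indicator {t..} s *\<^sub>R (ker c (t - s) * f s)"
        using AE_lborel_singleton[of t] by eventually_elim (auto simp: indicator_def)
    qed measurable
    also have "(LINT s:{t..}|lborel. ker c (t - s) * f s) = (LINT s:{t..}|lborel. exp (c * t) / (2 * c) * ?b s)"
      by (rule set_lebesgue_integral_cong) (auto simp: kb)
    also have "(LINT s:{..t}|lborel. ker c (t - s) * f s) = (LINT s:{..t}|lborel. exp (- c * t) / (2 * c) * ?a s)"
      by (rule set_lebesgue_integral_cong) (auto simp: ka)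
    finally show ?thesis unfolding A_def B_def by (simp only: set_integral_mult_right)
  qed
  have dA: "(A has_real_derivative ?a t) (at t)" for t
    unfolding A_def by (rule tail_integral_deriv[OF _ intA]) (intro continuous_intros cont)
  have dB: "(B has_real_derivative - ?b t) (at t)" for t
    unfolding B_def by (rule upper_tail_integral_deriv[OF _ intB]) (intro continuous_intros cont)
  define g' where "g' t = - exp (- c * t) / 2 * A t + exp (c * t) / 2 * B t" for t
  have 1: "(Kop c f has_real_derivative g' t) (at t)" for t
  proof -
    have "((\<lambda>t. exp (- c * t) / (2 * c) * A t + exp (c * t) / (2 * c) * B t) has_real_derivative
        (- c * exp (- c * t) / (2 * c) * A t + exp (- c * t) / (2 * c) * ?a t)
        + (c * exp (c * t) / (2 * c) * B t + exp (c * t) / (2 * c) * (- ?b t))) (at t)"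
      using c by (auto intro!: derivative_eq_intros dA dB simp: field_simps)
    moreover have e: "exp (- c * t) / (2 * c) * ?a t = f t / (2 * c)" "exp (c * t) / (2 * c) * (- ?b t) = - f t / (2 * c)"
      using ee(1)[of t "f t"] ee(2)[of t "f t"] by (simp_all add: mult.assoc)
    have "(- c * exp (- c * t) / (2 * c) * A t + exp (- c * t) / (2 * c) * ?a t)
        + (c * exp (c * t) / (2 * c) * B t + exp (c * t) / (2 * c) * (- ?b t)) = g' t"
      unfolding e using c by (simp add: g'_def)
    ultimately have "((\<lambda>t. exp (- c * t) / (2 * c) * A t + exp (c * t) / (2 * c) * B t) has_real_derivative g' t) (at t)"
      by (simp only:)
    then show ?thesis by (simp add: K[abs_def])
  qed
  have 2: "(g' has_real_derivative c\<^sup>2 * Kop c f t - f t) (at t)" for t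
  proof -
    have "(g' has_real_derivative
        (c * exp (- c * t) / 2 * A t + (- exp (- c * t) / 2) * ?a t)
        + (c * exp (c * t) / 2 * B t + exp (c * t) / 2 * (- ?b t))) (at t)"
      unfolding g'_def using c by (auto intro!: derivative_eq_intros dA dB simp: field_simps)
    moreover have e: "(- exp (- c * t) / 2) * ?a t = - f t / 2" "exp (c * t) / 2 * (- ?b t) = - f t / 2"
      using ee(1)[of t "f t"] ee(2)[of t "f t"] by (simp_all add: mult.assoc)
    have "(c * exp (- c * t) / 2 * A t + (- exp (- c * t) / 2) * ?a t)
        + (c * exp (c * t) / 2 * B t + exp (c * t) / 2 * (- ?b t)) = c\<^sup>2 * Kop c f t - f t"
      unfolding e K using c by (simp add: field_simps power2_eq_square)
    ultimately show ?thesis by (simp only:)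
  qed
  show ?thesis by (rule that[OF 1 2])
qed

section \<open>Existence of homoclinic solutions\<close>

text \<open>Monotonicity starts strictly to the right of 0 because limits in the class may be
  unbounded at the origin and receive a default value there. Right continuity is what Helly's
  theorem asks for. The constraint is a nonnegative integral, so that it survives Fatou's lemma and
  yields integrability by itself.\<close>

definition admissible :: "real \<Rightarrow> (real \<Rightarrow> real) \<Rightarrow> bool" where
  "admissible q f \<longleftrightarrow> f \<in> borel_measurable borel \<and> (\<forall>t. 0 \<le> f t) \<and> (\<forall>t. f (- t) = f t)
     \<and> (\<forall>s t. 0 < s \<longrightarrow> s \<le> t \<longrightarrow> f t \<le> f s) \<and> (\<forall>t>0. continuous (at_right t) f)
     \<and> (\<integral>\<^sup>+t. ennreal (f t powr q) \<partial>lborel) \<le> 1"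

lemma admissibleD:
  assumes "admissible q f"
  shows "f \<in> borel_measurable borel" "\<And>t. 0 \<le> f t" "\<And>t. f (- t) = f t"
    "\<And>s t. 0 < s \<Longrightarrow> s \<le> t \<Longrightarrow> f t \<le> f s" "\<And>t. t > 0 \<Longrightarrow> continuous (at_right t) f"
    "(\<integral>\<^sup>+t. ennreal (f t powr q) \<partial>lborel) \<le> 1"
  using assms unfolding admissible_def by blast+

text \<open>A Chebyshev argument: f >= f t on [-|t|, |t|] up to the origin, so the constraint gives
  2 |t| (f t)^q <= 1.\<close>

lemma admissible_dominated:
  assumes f: "admissible q f" and q: "q > 0"
  shows "power_dominated (1 / q) 1 f"
proof -
  note F = admissibleD[OF f]
  have "f t \<le> 1 * \<bar>t\<bar> powr (- (1 / q))" if t: "t \<noteq> 0" for t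
  proof -
    let ?a = "\<bar>t\<bar>"
    have a: "?a > 0" using t by simp
    have ft: "f ?a = f t" using F(3)[of t] by (simp add: abs_if)
    have "ennreal (f t powr q) * emeasure lborel {- ?a..?a}
        = (\<integral>\<^sup>+s. ennreal (f t powr q) * indicator {- ?a..?a} s \<partial>lborel)"
      by (simp add: nn_integral_cmult_indicator)
    also have "\<dots> \<le> (\<integral>\<^sup>+s. ennreal (f s powr q) \<partial>lborel)"
    proof (rule nn_integral_mono_AE)
      show "AE s in lborel. ennreal (f t powr q) * indicator {- ?a..?a} s \<le> ennreal (f s powr q)"
        using AE_lborel_singleton[of 0]
      proof eventually_elim
        case (elim s)
        show ?case
        proof (cases "\<bar>s\<bar> \<le> ?a")
          case True
          have "f ?a \<le> f \<bar>s\<bar>" using elim True by (intro F(4)) auto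
          moreover have "f \<bar>s\<bar> = f s" using F(3)[of s] by (simp add: abs_if)
          ultimately have "f t powr q \<le> f s powr q" using ft F(2)[of t] q by (intro powr_mono2) auto
          then show ?thesis by (simp add: indicator_def ennreal_leI)
        qed (auto simp: indicator_def)
      qed
    qed
    also have "\<dots> \<le> 1" by (rule F(6))
    finally have "ennreal (f t powr q * (2 * ?a)) \<le> ennreal 1"
      using a by (simp add: ennreal_mult' flip: ennreal_1)
    then have "f t powr q * (2 * ?a) \<le> 1" by (subst (asm) ennreal_le_iff) auto
    moreover have "0 \<le> f t powr q * ?a" by simp
    ultimately have "f t powr q * ?a \<le> 1" by simp
    then have "f t powr q \<le> 1 / ?a" using a by (simp add: field_simps)
    then have "(f t powr q) powr (1 / q) \<le> (1 / ?a) powr (1 / q)" using q by (intro powr_mono2) auto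
    also have "(f t powr q) powr (1 / q) = f t" using q F(2)[of t] by (simp add: powr_powr)
    also have "(1 / ?a) powr (1 / q) = ?a powr (- (1 / q))" using a by (simp add: powr_divide powr_minus_divide)
    finally show ?thesis by simp
  qed
  then show ?thesis using F(1,2) unfolding power_dominated_def by blast
qed

lemma filterlim_at_right_compose:
  fixes g :: "real \<Rightarrow> real"
  assumes "isCont g x" "\<And>y. x < y \<Longrightarrow> g x < g y"
  shows "filterlim g (at_right (g x)) (at_right x)"
  unfolding filterlim_at
proof
  show "\<forall>\<^sub>F y in at_right x. g y \<in> {g x<..} \<and> g y \<noteq> g x"
    using eventually_at_right_less[of x] by eventually_elim (use assms(2) in force)
  show "(g \<longlongrightarrow> g x) (at_right x)"
    using assms(1) unfolding isCont_def by (rule filterlim_mono) (auto simp: at_le)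
qed

text \<open>Helly's theorem concerns bounded nondecreasing functions on the whole line. The variable
  x = ln t turns the half-line into the line, y / (1 + y) bounds the values and the sign reverses
  the monotonicity. A limit has countably many jumps, which is harmless almost everywhere; the
  constraint passes to the limit by Fatou.\<close>

lemma admissible_compact:
  assumes f: "\<And>j. admissible q (f j)" and q: "q > 0"
  shows "\<exists>r g. strict_mono (r :: nat \<Rightarrow> nat) \<and> admissible q g \<and> (AE t in lborel. (\<lambda>j. f (r j) t) \<longlonglongrightarrow> g t)"
proof -
  note A = admissibleD[OF f]
  define \<phi> where "\<phi> y = y / (1 + y)" for y :: real
  define F where "F j x = - \<phi> (f j (exp x))" for j x
  have phi_mono: "\<phi> x \<le> \<phi> y" if "0 \<le> x" "x \<le> y" for x y
    using that by (simp add: \<phi>_def field_simps)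
  have phi_bd: "0 \<le> \<phi> y" "\<phi> y < 1" if "0 \<le> y" for y
    using that by (auto simp: \<phi>_def field_simps)
  have "\<exists>s. strict_mono (s :: nat \<Rightarrow> nat) \<and> (\<exists>G. (\<forall>x. continuous (at_right x) G) \<and> mono G \<and> (\<forall>x. \<bar>G x\<bar> \<le> 1) \<and>
    (\<forall>x. continuous (at x) G \<longrightarrow> (\<lambda>n. F (s n) x) \<longlonglongrightarrow> G x))"
  proof (rule Helly_selection)
    fix j :: nat and x :: real
    have 1: "(f j \<longlongrightarrow> f j (exp x)) (at_right (exp x))"
      using A(5)[of "exp x" j] by (simp add: continuous_within)
    have "filterlim exp (at_right (exp x)) (at_right x)"
      by (rule filterlim_at_right_compose) auto
    then have "((\<lambda>x. f j (exp x)) \<longlongrightarrow> f j (exp x)) (at_right x)"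
      by (rule filterlim_compose[OF 1])
    then have "((\<lambda>x. - (f j (exp x) / (1 + f j (exp x)))) \<longlongrightarrow> - (f j (exp x) / (1 + f j (exp x)))) (at_right x)"
      using A(2)[of j "exp x"] by (intro tendsto_intros) auto
    then show "continuous (at_right x) (F j)" unfolding continuous_within F_def \<phi>_def by simp
    show "mono (F j)" unfolding F_def by (intro monoI le_imp_neg_le phi_mono A) auto
    show "\<bar>F j x\<bar> \<le> 1" unfolding F_def using phi_bd[OF A(2), of j "exp x"] by simp
  qed
  then obtain r G where r: "strict_mono (r :: nat \<Rightarrow> nat)" and Gr: "\<And>x. continuous (at_right x) G" and G: "mono G"
    and lim: "\<And>x. isCont G x \<Longrightarrow> (\<lambda>n. F (r n) x) \<longlonglongrightarrow> G x" by blast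
  have cp: "\<exists>x. a < x \<and> x < b \<and> isCont G x" if "a < b" for a b
    using open_minus_countable[OF mono_ctble_discont[OF G], of "{a<..<b}"] that by auto
  have G0: "G x \<le> 0" for x
  proof -
    obtain y where y: "x < y" "isCont G y" using cp[of x "x + 1"] by auto
    have "G y \<le> 0" by (rule LIMSEQ_le_const2[OF lim[OF y(2)]]) (use phi_bd A(2) in \<open>auto simp: F_def\<close>)
    then show ?thesis using monoD[OF G, of x y] y by simp
  qed
  \<comment> \<open>The limit must stay above -1, the image of an infinite value; the common
    majorant at a point further left guarantees this.\<close>
  have G1: "- 1 < G x" for x
  proof -
    obtain y where y: "y < x" "isCont G y" using cp[of "x - 1" x] by auto
    let ?D = "exp y powr (- (1 / q))"
    have "- \<phi> ?D \<le> G y"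
    proof (rule LIMSEQ_le_const[OF lim[OF y(2)]], intro exI allI impI)
      fix n
      have "f (r n) (exp y) \<le> ?D"
        using power_dominatedD(3)[OF admissible_dominated[OF f q], of "exp y"] by simp
      then show "- \<phi> ?D \<le> F (r n) y" unfolding F_def by (intro le_imp_neg_le phi_mono A)
    qed
    moreover have "\<phi> ?D < 1" by (rule phi_bd) simp
    ultimately show ?thesis using monoD[OF G, of y x] y by simp
  qed
  define \<psi> where "\<psi> y = - y / (1 + y)" for y :: real
  have psi_phi: "\<psi> (- \<phi> y) = y" if "0 \<le> y" for y
    using that by (simp add: \<psi>_def \<phi>_def field_simps)
  have psi_mono: "\<psi> y \<le> \<psi> x" if "- 1 < x" "x \<le> y" for x y
    using that by (simp add: \<psi>_def field_simps)
  define g where "g t = (if t = 0 then 0 else \<psi> (G (ln \<bar>t\<bar>)))" for t :: real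
  have conv: "(\<lambda>j. f (r j) t) \<longlonglongrightarrow> g t" if t: "t \<noteq> 0" "isCont G (ln \<bar>t\<bar>)" for t
  proof -
    have "(\<lambda>j. \<psi> (F (r j) (ln \<bar>t\<bar>))) \<longlonglongrightarrow> \<psi> (G (ln \<bar>t\<bar>))"
      unfolding \<psi>_def using G1[of "ln \<bar>t\<bar>"] by (intro tendsto_intros lim[OF t(2)]) auto
    moreover have "\<psi> (F j (ln \<bar>t\<bar>)) = f j t" for j
      unfolding F_def psi_phi[OF A(2)] using t A(3)[of j t] by (simp add: abs_if)
    ultimately show ?thesis using t by (simp add: g_def)
  qed
  let ?C = "{x. \<not> isCont G x}"
  have AEc: "AE t in lborel. t \<notin> {0} \<union> exp ` ?C \<union> (\<lambda>x. - exp x) ` ?C"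
    using mono_ctble_discont[OF G] by (intro AE_not_in countable_imp_null_set_lborel) auto
  then have AE: "AE t in lborel. (\<lambda>j. f (r j) t) \<longlonglongrightarrow> g t"
  proof eventually_elim
    case (elim t)
    then have t: "t \<noteq> 0" by simp
    have "isCont G (ln \<bar>t\<bar>)"
    proof (rule ccontr)
      assume "\<not> isCont G (ln \<bar>t\<bar>)"
      then have "exp (ln \<bar>t\<bar>) \<in> exp ` ?C" "- exp (ln \<bar>t\<bar>) \<in> (\<lambda>x. - exp x) ` ?C" by auto
      then show False using elim t by (auto simp: abs_if split: if_splits)
    qed
    then show ?case using conv t by blast
  qed
  have gm: "g \<in> borel_measurable borel"
    using borel_measurable_mono[OF G] unfolding g_def[abs_def] \<psi>_def by measurable
  have fm: "f j \<in> borel_measurable borel" for j by (rule A(1))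
  have "admissible q g"
    unfolding admissible_def
  proof (intro conjI allI impI gm)
    show "0 \<le> g t" for t
      using G0[of "ln \<bar>t\<bar>"] G1[of "ln \<bar>t\<bar>"] by (auto simp: g_def \<psi>_def divide_nonpos_pos)
    show "g (- t) = g t" for t by (simp add: g_def)
    show "g t \<le> g s" if "0 < s" "s \<le> t" for s t
      using that psi_mono[OF G1 monoD[OF G], of "ln s" "ln t"] by (simp add: g_def)
    show "continuous (at_right t) g" if t: "0 < t" for t
    proof -
      have 1: "(G \<longlongrightarrow> G (ln t)) (at_right (ln t))" using Gr[of "ln t"] by (simp add: continuous_within)
      have "filterlim ln (at_right (ln t)) (at_right t)"
        by (rule filterlim_at_right_compose) (use t in \<open>auto intro: DERIV_isCont[OF DERIV_ln]\<close>)
      then have "((\<lambda>t. G (ln t)) \<longlongrightarrow> G (ln t)) (at_right t)"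
        by (rule filterlim_compose[OF 1])
      then have "((\<lambda>t. - G (ln t) / (1 + G (ln t))) \<longlongrightarrow> - G (ln t) / (1 + G (ln t))) (at_right t)"
        using G1[of "ln t"] by (intro tendsto_intros) auto
      moreover have "\<forall>\<^sub>F s in at_right t. - G (ln s) / (1 + G (ln s)) = g s"
        using eventually_at_right_less[of t] by eventually_elim (use t in \<open>simp add: g_def \<psi>_def\<close>)
      ultimately have "(g \<longlongrightarrow> - G (ln t) / (1 + G (ln t))) (at_right t)"
        by (rule Lim_transform_eventually)
      then show ?thesis unfolding continuous_within using t by (simp add: g_def \<psi>_def)
    qed
    have "(\<integral>\<^sup>+t. ennreal (g t powr q) \<partial>lborel) = (\<integral>\<^sup>+t. liminf (\<lambda>j. ennreal (f (r j) t powr q)) \<partial>lborel)"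
    proof (rule nn_integral_cong_AE)
      show "AE t in lborel. ennreal (g t powr q) = liminf (\<lambda>j. ennreal (f (r j) t powr q))"
        using AE
      proof eventually_elim
        case (elim t)
        have "(\<lambda>j. ennreal (f (r j) t powr q)) \<longlonglongrightarrow> ennreal (g t powr q)"
          by (intro tendsto_ennrealI tendsto_powr' elim tendsto_const) (use q A(2) in auto)
        from lim_imp_Liminf[OF trivial_limit_sequentially this] show ?case by (rule sym)
      qed
    qed
    also have "\<dots> \<le> liminf (\<lambda>j. \<integral>\<^sup>+t. ennreal (f (r j) t powr q) \<partial>lborel)"
      by (rule nn_integral_liminf) (use fm in measurable)
    also have "\<dots> \<le> 1"
      by (intro Liminf_le always_eventually allI) (auto intro: A(6))
    finally show "(\<integral>\<^sup>+t. ennreal (g t powr q) \<partial>lborel) \<le> 1" .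
  qed
  then show ?thesis using r AE by blast
qed

definition energy :: "real \<Rightarrow> real \<Rightarrow> (real \<Rightarrow> real) \<Rightarrow> real" where
  "energy k l f = (LINT t|lborel. f t * Kop k (Kop l f) t)"

context
  fixes k l q :: real
  assumes kl: "k > 0" "l > 0" and q: "1 < q" "q < 2"
begin

lemma inv_q: "1 / 2 < 1 / q" "1 / q < 1"
  using q by (simp_all add: field_simps)

lemma dominated: "admissible q f \<Longrightarrow> power_dominated (1 / q) 1 f"
  using admissible_dominated[of q f] q by simp

lemma dominated_K: "admissible q f \<Longrightarrow> c > 0 \<Longrightarrow> power_dominated (1 / q) (1 * Kdecay (1 / q) c) (Kop c f)"
  by (rule Kop_power_dominated[OF inv_q dominated])

lemma energy_bounded: "\<exists>B. \<forall>f. admissible q f \<longrightarrow> energy k l f \<le> B"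
proof -
  let ?w = "\<lambda>t. 1 * (1 * Kdecay (1 / q) l * max (Kbound (1 / q) k) (Kdecay (1 / q) k))
      * (min 1 (\<bar>t\<bar> powr (- (1 / q))) * \<bar>t\<bar> powr (- (1 / q)))"
  have "energy k l f \<le> (LINT t|lborel. ?w t)" if f: "admissible q f" for f
    unfolding energy_def
  proof (rule integral_mono_AE)
    show "integrable lborel (\<lambda>t. f t * Kop k (Kop l f) t)"
      by (rule mult_Kop_integrable[OF inv_q dominated_K[OF f kl(2)] kl(1) dominated[OF f]])
    show "integrable lborel ?w"
      by (intro integrable_mult_right power_min_integrable[OF inv_q])
    show "AE t in lborel. f t * Kop k (Kop l f) t \<le> ?w t"
      using AE_lborel_singleton[of 0]
      by eventually_elim (rule Kop_mult_le[OF inv_q dominated_K[OF f kl(2)] kl(1) dominated[OF f]])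
  qed
  then show ?thesis by blast
qed

lemma energy_pos_iff:
  assumes f: "admissible q f" and ne: "\<not> (AE t in lborel. f t = 0)"
  shows "energy k l f > 0"
proof (rule ccontr)
  assume "\<not> ?thesis"
  note P = dominated_K[OF f kl(2)]
  have K: "Kop k (Kop l f) t > 0" for t
  proof (rule Kop_pos[OF inv_q P kl(1)])
    show "\<not> (AE t in lborel. Kop l f t = 0)"
      using Kop_pos[OF inv_q dominated[OF f] kl(2) ne] by (simp add: less_imp_neq[symmetric] eventually_False ae_filter_eq_bot_iff)
  qed
  have nn: "0 \<le> f t * Kop k (Kop l f) t" for t
    using admissibleD(2)[OF f, of t] K[of t] by simp
  have "energy k l f \<ge> 0" unfolding energy_def using nn by simp
  then have "energy k l f = 0" using \<open>\<not> energy k l f > 0\<close> by simp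
  then have "AE t in lborel. f t * Kop k (Kop l f) t = 0"
    unfolding energy_def
    using integral_nonneg_eq_0_iff_AE[OF mult_Kop_integrable[OF inv_q P kl(1) dominated[OF f]]] nn by simp
  then have "AE t in lborel. f t = 0"
    by eventually_elim (use K in \<open>metis less_irrefl mult_eq_0_iff\<close>)
  then show False using ne by blast
qed

text \<open>A nonzero competitor, which makes the supremum of the energy positive. The height 1 / 2
  on an interval of length 2 obeys the constraint since q > 1.\<close>

lemma admissible_box: "admissible q (\<lambda>t. if \<bar>t\<bar> < 1 then 1 / 2 else 0)"
  unfolding admissible_def
proof (intro conjI allI impI)
  show "continuous (at_right t) (\<lambda>t. if \<bar>t\<bar> < 1 then 1 / 2 else (0::real))" if t: "0 < t" for t :: real
  proof (cases "t < 1")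
    case True
    have "\<forall>\<^sub>F s in at_right t. s \<in> {t<..<1}" by (rule eventually_at_right_field[THEN iffD2]) (use True in auto)
    then have "\<forall>\<^sub>F s in at_right t. (1 / 2 :: real) = (if \<bar>s\<bar> < 1 then 1 / 2 else 0)"
      by eventually_elim (use t in auto)
    then show ?thesis unfolding continuous_within using True t
      by (auto intro: Lim_transform_eventually[OF tendsto_const])
  next
    case False
    have "\<forall>\<^sub>F s in at_right t. (0 :: real) = (if \<bar>s\<bar> < 1 then 1 / 2 else 0)"
      using eventually_at_right_less[of t] by eventually_elim (use False in auto)
    then show ?thesis unfolding continuous_within using False
      by (auto intro: Lim_transform_eventually[OF tendsto_const])
  qed
  have "(\<integral>\<^sup>+t. ennreal ((if \<bar>t::real\<bar> < 1 then 1 / 2 else 0) powr q) \<partial>lborel)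
      = (\<integral>\<^sup>+t. ennreal ((1 / 2) powr q) * indicator {-1<..<1} (t::real) \<partial>lborel)"
    by (rule nn_integral_cong) (auto simp: indicator_def abs_if split: if_splits)
  also have "\<dots> = ennreal ((1 / 2) powr q) * ennreal 2"
    by (simp add: nn_integral_cmult_indicator)
  also have "\<dots> = ennreal (((1 / 2) powr q) * 2)" by (simp add: ennreal_mult)
  also have "\<dots> \<le> ennreal 1"
  proof (rule ennreal_leI)
    have "(1 / 2 :: real) powr q \<le> (1 / 2) powr 1" using q by (intro powr_mono') auto
    then show "(1 / 2 :: real) powr q * 2 \<le> 1" by simp
  qed
  finally show "(\<integral>\<^sup>+t. ennreal ((if \<bar>t::real\<bar> < 1 then 1 / 2 else 0) powr q) \<partial>lborel) \<le> 1" by simp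
qed auto

text \<open>The direct method: one majorant serves the whole class, so along a convergent
  subsequence the energies converge by dominated convergence and no mass escapes to
  infinity.\<close>

lemma energy_maximizer: "\<exists>f. admissible q f \<and> energy k l f > 0 \<and> (\<forall>g. admissible q g \<longrightarrow> energy k l g \<le> energy k l f)"
proof -
  let ?f0 = "\<lambda>t::real. if \<bar>t\<bar> < 1 then 1 / 2 else (0::real)"
  have ne: "\<not> (AE t in lborel. ?f0 t = 0)"
  proof
    assume "AE t in lborel. ?f0 t = 0"
    then have "AE t in lborel. t \<notin> {-1<..<1::real}" by eventually_elim (auto split: if_splits)
    moreover have "{t. \<not> t \<notin> {-1<..<1::real}} = {-1<..<1}" by auto
    ultimately have "emeasure lborel {-1<..<1::real} = 0"
      using AE_iff_measurable[of "{-1<..<1::real}" lborel "\<lambda>t. t \<notin> {-1<..<1}"] by simp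
    then show False by simp
  qed
  obtain B where B: "\<And>f. admissible q f \<Longrightarrow> energy k l f \<le> B" using energy_bounded by blast
  let ?S = "energy k l ` Collect (admissible q)"
  define M where "M = Sup ?S"
  have bdd: "bdd_above ?S" using B by (auto intro!: bdd_aboveI)
  have le: "energy k l f \<le> M" if "admissible q f" for f
    unfolding M_def using that bdd by (auto intro: cSup_upper)
  have "\<exists>f. admissible q f \<and> M - 1 / real (Suc j) < energy k l f" for j
    using less_cSup_iff[OF _ bdd, of "M - 1 / real (Suc j)"] admissible_box
    unfolding M_def[symmetric] by auto
  then obtain f where f: "\<And>j. admissible q (f j)" "\<And>j. M - 1 / real (Suc j) < energy k l (f j)" by metis
  obtain r g where r: "strict_mono (r :: nat \<Rightarrow> nat)" and g: "admissible q g"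
    and lim: "AE t in lborel. (\<lambda>j. f (r j) t) \<longlonglongrightarrow> g t"
    using admissible_compact[where f = f, OF f(1)] q by auto
  have "AE t in lborel. (\<lambda>j. Kop l (f (r j)) t) \<longlonglongrightarrow> Kop l g t"
    using Kop_tendsto[OF inv_q dominated[OF f(1)] dominated[OF g] kl(2) lim] by simp
  then have "(\<lambda>j. energy k l (f (r j))) \<longlonglongrightarrow> energy k l g"
    unfolding energy_def
    by (intro mult_Kop_tendsto[OF inv_q dominated_K[OF f(1) kl(2)] dominated_K[OF g kl(2)] kl(1)
          dominated[OF f(1)] dominated[OF g] _ lim])
  moreover have "(\<lambda>j. energy k l (f (r j))) \<longlonglongrightarrow> M"
  proof (rule tendsto_sandwich)
    have "(\<lambda>j. M - 1 / real (Suc j)) \<longlonglongrightarrow> M - 0"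
      by (intro tendsto_intros LIMSEQ_Suc lim_1_over_n)
    from LIMSEQ_subseq_LIMSEQ[OF this r] show "(\<lambda>j. M - 1 / real (Suc (r j))) \<longlonglongrightarrow> M"
      by (simp add: comp_def)
    show "\<forall>\<^sub>F j in sequentially. M - 1 / real (Suc (r j)) \<le> energy k l (f (r j))"
      using f(2) by (simp add: less_imp_le)
    show "\<forall>\<^sub>F j in sequentially. energy k l (f (r j)) \<le> M" using le f(1) by simp
  qed simp
  ultimately have "energy k l g = M" by (rule LIMSEQ_unique)
  moreover have "0 < M" using energy_pos_iff[OF admissible_box ne] le[OF admissible_box] by linarith
  ultimately show ?thesis using g le by metis
qed

end

section \<open>The Euler-Lagrange equation of the maximiser\<close>

lemma powr_convex_nonneg:
  fixes x y :: real
  assumes q: "q \<ge> 1" and xy: "x \<ge> 0" "y \<ge> 0" and e: "0 \<le> e" "e \<le> 1"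
  shows "((1 - e) * x + e * y) powr q \<le> (1 - e) * x powr q + e * y powr q"
proof -
  have small: "(c * z) powr q \<le> c * z powr q" if "0 \<le> c" "c \<le> 1" "z \<ge> 0" for c z :: real
  proof (cases "c = 0")
    case False
    have "c powr q \<le> c powr 1" using that q False by (intro powr_mono') auto
    then show ?thesis using that False by (simp add: powr_mult mult_right_mono)
  qed simp
  consider "x = 0" | "y = 0" | "x > 0" "y > 0" using xy by linarith
  then show ?thesis
  proof cases
    case 1
    then show ?thesis using small[of e y] e xy by simp
  next
    case 2
    then show ?thesis using small[of "1 - e" x] e xy by simp
  next
    case 3
    then show ?thesis
      using convex_onD[OF powr_convex[OF q], of e x y] e by simp
  qed
qed

text \<open>The function x^q / q - x b has its only critical point at x = b^p and takes at a the
  value it has at b^p. If the two points differed, the mean value theorem would give a critical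
  point strictly between them.\<close>

lemma Youngs_equality:
  fixes a b p :: real
  assumes p: "p > 1" and ab: "a \<ge> 0" "b > 0"
    and eq: "a * b = a powr ((p + 1) / p) / ((p + 1) / p) + b powr (p + 1) / (p + 1)"
  shows "a = b powr p"
proof (rule ccontr)
  assume ne: "a \<noteq> b powr p"
  define q where "q = (p + 1) / p"
  define \<phi> where "\<phi> x = x powr q / q - x * b" for x
  have q: "q > 1" "q - 1 = 1 / p" "p * q = p + 1" using p by (auto simp: q_def field_simps)
  have a: "a > 0"
  proof (rule ccontr)
    assume "\<not> a > 0"
    then have "a = 0" using ab by simp
    then have "b powr (p + 1) / (p + 1) = 0" using eq by simp
    then show False using ab p by simp
  qed
  have D: "(\<phi> has_real_derivative x powr (1 / p) - b) (at x)" if "x > 0" for x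
    unfolding \<phi>_def using q that
    by (auto intro!: derivative_eq_intros simp: q(2))
  have bp: "(b powr p) powr q = b powr (p + 1)" "b powr p * b = b powr (p + 1)"
    using q(3) ab by (simp_all add: powr_powr powr_add)
  have "1 / q = p / (p + 1)" using p by (simp add: q_def)
  then have "\<phi> (b powr p) = b powr (p + 1) * (p / (p + 1)) - b powr (p + 1)"
    unfolding \<phi>_def bp by (metis divide_inverse inverse_eq_divide)
  also have "\<dots> = - (b powr (p + 1) / (p + 1))" using p by (simp add: field_simps)
  also have "\<dots> = \<phi> a" using eq by (simp add: \<phi>_def q_def)
  finally have e: "\<phi> (b powr p) = \<phi> a" .
  have False if xy: "0 < x" "x < y" "\<phi> x = \<phi> y" "x = b powr p \<or> y = b powr p" for x y
  proof -
    have "\<exists>z>x. z < y \<and> \<phi> y - \<phi> x = (y - x) * (z powr (1 / p) - b)"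
      by (rule MVT2) (use xy D in auto)
    then obtain z where z: "x < z" "z < y" "z powr (1 / p) = b" using xy by auto
    have "z = (z powr (1 / p)) powr p" using z(1) xy(1) p by (simp add: powr_powr)
    also have "\<dots> = b powr p" using z(3) by simp
    finally have "z = b powr p" .
    then show False using z xy by auto
  qed
  from this[of a "b powr p"] this[of "b powr p" a] show False
    using e a ne ab by (metis linorder_neqE_linordered_idom powr_gt_zero less_irrefl)
qed

lemma Kop_scale: "Kop c (\<lambda>t. a * f t) t = a * Kop c f t"
proof -
  have "(\<lambda>s. ker c (t - s) * (a * f s)) = (\<lambda>s. a * (ker c (t - s) * f s))" by (simp add: fun_eq_iff)
  then show ?thesis by (simp only: Kop_def integral_mult_right_zero)
qed

lemma Kop_cong_AE:
  assumes "AE t in lborel. f t = g t" "f \<in> borel_measurable borel" "g \<in> borel_measurable borel"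
  shows "Kop c f = Kop c g"
proof
  fix t
  have [measurable]: "f \<in> borel_measurable borel" "g \<in> borel_measurable borel" by fact+
  show "Kop c f t = Kop c g t"
    unfolding Kop_def by (rule integral_cong_AE) (use assms(1) in auto)
qed

lemma Kop_Kop_ode:
  assumes kl: "k > 0" "l > 0" and cont: "continuous_on UNIV g"
    and int: "\<And>t. integrable lborel (\<lambda>s. ker l (t - s) * g s)"
    and int2: "\<And>t. integrable lborel (\<lambda>s. ker k (t - s) * Kop l g s)"
  shows "\<exists>P1 P2 P3. \<forall>t. (Kop k (Kop l g) has_real_derivative P1 t) (at t) \<and> (P1 has_real_derivative P2 t) (at t)
    \<and> (P2 has_real_derivative P3 t) (at t)
    \<and> (P3 has_real_derivative (k\<^sup>2 + l\<^sup>2) * P2 t - k\<^sup>2 * l\<^sup>2 * Kop k (Kop l g) t + g t) (at t)"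
proof -
  obtain G1 where G1: "\<And>t. (Kop l g has_real_derivative G1 t) (at t)"
    "\<And>t. (G1 has_real_derivative l\<^sup>2 * Kop l g t - g t) (at t)"
    by (rule Kop_second_deriv[OF cont int kl(2)]) blast
  have c: "continuous_on UNIV (Kop l g)"
    by (rule DERIV_continuous_on) (use G1(1) has_field_derivative_at_within in blast)
  obtain P1 where P1: "\<And>t. (Kop k (Kop l g) has_real_derivative P1 t) (at t)"
    "\<And>t. (P1 has_real_derivative k\<^sup>2 * Kop k (Kop l g) t - Kop l g t) (at t)"
    by (rule Kop_second_deriv[OF c int2 kl(1)]) blast
  have P2: "((\<lambda>t. k\<^sup>2 * Kop k (Kop l g) t - Kop l g t) has_real_derivative k\<^sup>2 * P1 t - G1 t) (at t)" for t
    by (intro DERIV_diff DERIV_cmult P1 G1)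
  have P3: "((\<lambda>t. k\<^sup>2 * P1 t - G1 t) has_real_derivative (k\<^sup>2 + l\<^sup>2) * (k\<^sup>2 * Kop k (Kop l g) t - Kop l g t)
      - k\<^sup>2 * l\<^sup>2 * Kop k (Kop l g) t + g t) (at t)" for t
    by (rule DERIV_cong[OF DERIV_diff[OF DERIV_cmult[OF P1(2)] G1(2)]]) (simp add: algebra_simps)
  show ?thesis
    by (intro exI[of _ P1] exI[of _ "\<lambda>t. k\<^sup>2 * Kop k (Kop l g) t - Kop l g t"]
        exI[of _ "\<lambda>t. k\<^sup>2 * P1 t - G1 t"] allI conjI P1 P2 P3)
qed

text \<open>Half the gradient of \<open>energy\<close>. Moving both convolutions to the other factor
  reverses their order, so the symmetric part of the bilinear form behind \<open>energy\<close> is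
  the pairing with this average.\<close>

definition symKop :: "real \<Rightarrow> real \<Rightarrow> (real \<Rightarrow> real) \<Rightarrow> real \<Rightarrow> real" where
  "symKop k l f t = (Kop k (Kop l f) t + Kop l (Kop k f) t) / 2"

context
  fixes k l q M :: real and f :: "real \<Rightarrow> real"
  assumes kl: "k > 0" "l > 0" and q: "1 < q" "q < 2"
    and f: "admissible q f" and M: "M = energy k l f" "M > 0"
    and max: "\<And>g. admissible q g \<Longrightarrow> energy k l g \<le> M"
  fixes S :: "real \<Rightarrow> real"
  defines S_eq: "S \<equiv> symKop k l f"
begin

lemmas S_def = symKop_def[of k l f, folded S_eq]

lemma f_nonzero: "\<not> (AE t in lborel. f t = 0)"
proof
  assume "AE t in lborel. f t = 0"
  then have "AE t in lborel. f t * Kop k (Kop l f) t = 0" by eventually_elim simp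
  then have "M = 0" unfolding M energy_def by (rule integral_eq_zero_AE)
  then show False using M by simp
qed

lemma dom_f: "power_dominated (1 / q) 1 f"
  by (rule dominated[OF kl q f])

lemma dom_K: "c > 0 \<Longrightarrow> power_dominated (1 / q) (1 * Kdecay (1 / q) c) (Kop c f)"
  by (rule dominated_K[OF kl q f])

lemma Kop_f_pos: "c > 0 \<Longrightarrow> Kop c f t > 0"
  by (rule Kop_pos[OF inv_q[OF kl q] dom_f _ f_nonzero])

lemma AE_False: "\<not> (AE t in (lborel :: real measure). False)"
  by (simp add: eventually_False ae_filter_eq_bot_iff)

lemma KK_pos: "c > 0 \<Longrightarrow> d > 0 \<Longrightarrow> Kop c (Kop d f) t > 0"
  by (rule Kop_pos[OF inv_q[OF kl q] dom_K])
     (use Kop_f_pos AE_False in \<open>auto simp: less_imp_neq[symmetric]\<close>)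

lemma S_pos: "S t > 0"
  unfolding S_def using KK_pos kl by (simp add: add_pos_pos)

lemma KK_cont: "c > 0 \<Longrightarrow> d > 0 \<Longrightarrow> isCont (Kop c (Kop d f)) t"
  by (rule Kop_isCont[OF inv_q[OF kl q] dom_K])

lemma S_cont: "isCont S t"
  unfolding S_eq symKop_def[abs_def] by (intro continuous_intros KK_cont kl) simp

lemma S_measurable: "S \<in> borel_measurable borel"
  by (intro borel_measurable_continuous_onI continuous_at_imp_continuous_on ballI S_cont)

lemma S_even: "S (- t) = S t"
  unfolding S_def by (simp add: Kop_even[where f = "Kop _ f"] Kop_even[where f = f] admissibleD(3)[OF f])

lemma KK_antimono:
  assumes "c > 0" "d > 0" "0 \<le> t" "t \<le> r" shows "Kop c (Kop d f) r \<le> Kop c (Kop d f) t"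
proof (rule Kop_antimono[OF inv_q[OF kl q] dom_K[OF assms(2)] assms(1) _ _ assms(3,4)])
  show "Kop d f (- t) = Kop d f t" for t by (rule Kop_even) (rule admissibleD(3)[OF f])
  show "Kop d f t \<le> Kop d f s" if "0 < s" "s \<le> t" for s t
    by (rule Kop_antimono[OF inv_q[OF kl q] dom_f assms(2)])
       (use that admissibleD[OF f] in auto)
qed

lemma S_antimono: "0 \<le> t \<Longrightarrow> t \<le> r \<Longrightarrow> S r \<le> S t"
  unfolding S_def using KK_antimono kl by (intro divide_right_mono add_mono) auto

lemma S_le: "\<exists>C. \<forall>t. t \<noteq> 0 \<longrightarrow> S t \<le> C * \<bar>t\<bar> powr (- (1 / q))"
proof -
  let ?C1 = "1 * Kdecay (1 / q) l * Kdecay (1 / q) k" and ?C2 = "1 * Kdecay (1 / q) k * Kdecay (1 / q) l"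
  have "S t \<le> (?C1 + ?C2) / 2 * \<bar>t\<bar> powr (- (1 / q))" if t: "t \<noteq> 0" for t
    unfolding S_def
    using Kop_le_Kdecay[OF inv_q[OF kl q] dom_K[OF kl(2)] kl(1) t] Kop_le_Kdecay[OF inv_q[OF kl q] dom_K[OF kl(1)] kl(2) t]
    by (simp add: algebra_simps)
  then show ?thesis by blast
qed

lemma mult_S_integrable:
  assumes "admissible q h" shows "integrable lborel (\<lambda>t. h t * S t)"
proof -
  have "integrable lborel (\<lambda>t. (h t * Kop k (Kop l f) t + h t * Kop l (Kop k f) t) / 2)"
    by (intro integrable_divide Bochner_Integration.integrable_add
        mult_Kop_integrable[OF inv_q[OF kl q] dom_K _ dominated[OF kl q assms]] kl)
  then show ?thesis by (simp add: S_def algebra_simps)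
qed

lemma admissible_convex:
  assumes h: "admissible q h" and e: "0 \<le> e" "e \<le> 1"
  shows "admissible q (\<lambda>t. (1 - e) * f t + e * h t)"
proof -
  note F = admissibleD[OF f] and H = admissibleD[OF h]
  have [measurable]: "f \<in> borel_measurable borel" "h \<in> borel_measurable borel" by (rule F H)+
  have "(\<integral>\<^sup>+t. ennreal (((1 - e) * f t + e * h t) powr q) \<partial>lborel)
      \<le> (\<integral>\<^sup>+t. ennreal (1 - e) * ennreal (f t powr q) + ennreal e * ennreal (h t powr q) \<partial>lborel)"
  proof (rule nn_integral_mono)
    fix t
    have "((1 - e) * f t + e * h t) powr q \<le> (1 - e) * f t powr q + e * h t powr q"
      using q e F(2)[of t] H(2)[of t] by (intro powr_convex_nonneg) auto
    then have "ennreal (((1 - e) * f t + e * h t) powr q) \<le> ennreal ((1 - e) * f t powr q + e * h t powr q)"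
      by (rule ennreal_leI)
    also have "\<dots> = ennreal (1 - e) * ennreal (f t powr q) + ennreal e * ennreal (h t powr q)"
      using e by (simp add: ennreal_plus ennreal_mult)
    finally show "ennreal (((1 - e) * f t + e * h t) powr q)
      \<le> ennreal (1 - e) * ennreal (f t powr q) + ennreal e * ennreal (h t powr q)" .
  qed
  also have "\<dots> = ennreal (1 - e) * (\<integral>\<^sup>+t. ennreal (f t powr q) \<partial>lborel)
      + ennreal e * (\<integral>\<^sup>+t. ennreal (h t powr q) \<partial>lborel)"
    by (subst nn_integral_add) (auto simp: nn_integral_cmult)
  also have "\<dots> \<le> ennreal (1 - e) * 1 + ennreal e * 1"
    by (intro add_mono mult_left_mono F H) auto
  also have "\<dots> = ennreal (1 - e + e)" using e by (subst ennreal_plus) auto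
  finally have 1: "(\<integral>\<^sup>+t. ennreal (((1 - e) * f t + e * h t) powr q) \<partial>lborel) \<le> 1" by simp
  show ?thesis
    unfolding admissible_def
  proof (intro conjI allI impI 1)
    show "0 \<le> (1 - e) * f t + e * h t" for t using e F(2) H(2) by simp
    show "(1 - e) * f (- t) + e * h (- t) = (1 - e) * f t + e * h t" for t by (simp add: F(3) H(3))
    show "(1 - e) * f t + e * h t \<le> (1 - e) * f s + e * h s" if "0 < s" "s \<le> t" for s t
      using e F(4)[OF that] H(4)[OF that] by (intro add_mono mult_left_mono) auto
    show "continuous (at_right t) (\<lambda>t. (1 - e) * f t + e * h t)" if "0 < t" for t
      by (intro continuous_intros F(5) H(5) that)
  qed measurable
qed

text \<open>The first variation: moving from f towards h by e changes the energy by 2 e (X - M) to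
  first order, where X is the integral of h S. The term in e^2 from h alone is nonnegative, so X > M
  would beat the maximum.\<close>

lemma integral_mult_S_le:
  assumes h: "admissible q h"
  shows "(LINT t|lborel. h t * S t) \<le> M"
proof (rule ccontr)
  assume no: "\<not> ?thesis"
  define X where "X = (LINT t|lborel. h t * S t)"
  have XM: "X > M" using no X_def by simp
  note th = inv_q[OF kl q] and df = dom_f and dh = dominated[OF kl q h]
  note dKf = dom_K and dKh = dominated_K[OF kl q h]
  define b where "b g1 g2 = (LINT t|lborel. g1 t * Kop k (Kop l g2) t)" for g1 g2
  have I: "integrable lborel (\<lambda>t. f t * Kop k (Kop l f) t)" "integrable lborel (\<lambda>t. f t * Kop k (Kop l h) t)"
     "integrable lborel (\<lambda>t. h t * Kop k (Kop l f) t)" "integrable lborel (\<lambda>t. h t * Kop k (Kop l h) t)"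
     "integrable lborel (\<lambda>t. h t * Kop l (Kop k f) t)"
    by (rule mult_Kop_integrable[OF th dKf[OF kl(2)] kl(1) df] mult_Kop_integrable[OF th dKh[OF kl(2)] kl(1) df]
        mult_Kop_integrable[OF th dKf[OF kl(2)] kl(1) dh] mult_Kop_integrable[OF th dKh[OF kl(2)] kl(1) dh]
        mult_Kop_integrable[OF th dKf[OF kl(1)] kl(2) dh])+
  have "b f h = (LINT t|lborel. Kop l h t * Kop k f t)"
    unfolding b_def by (rule Kop_symmetric[OF th dKh[OF kl(2)] kl(1) df])
  also have "\<dots> = (LINT t|lborel. Kop k f t * Kop l h t)" by (simp add: mult.commute)
  also have "\<dots> = (LINT t|lborel. h t * Kop l (Kop k f) t)"
    by (rule Kop_symmetric[OF th dh kl(2) dKf[OF kl(1)]])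
  finally have bfh: "b f h = (LINT t|lborel. h t * Kop l (Kop k f) t)" .
  have "X = (LINT t|lborel. (h t * Kop k (Kop l f) t + h t * Kop l (Kop k f) t) / 2)"
    unfolding X_def S_def by (simp add: algebra_simps)
  also have "\<dots> = (b h f + b f h) / 2"
    unfolding bfh unfolding b_def using I by simp
  finally have X2: "b h f + b f h = 2 * X" by simp
  have bhh: "b h h \<ge> 0"
    unfolding b_def using admissibleD(2)[OF h] Kop_nonneg[OF th dKh kl(1)] kl by simp
  \<comment> \<open>This step is so short that the second-order loss, at most 2 e X after division,
    stays below the first-order gain 2 (X - M).\<close>
  define e where "e = min (1 / 2) ((X - M) / (2 * X))"
  have e: "0 < e" "e \<le> 1" "e < 1" using XM M by (auto simp: e_def)
  have "energy k l (\<lambda>t. (1 - e) * f t + e * h t) = (LINT t|lborel. (1 - e)\<^sup>2 * (f t * Kop k (Kop l f) t)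
     + (1 - e) * e * (f t * Kop k (Kop l h) t) + (1 - e) * e * (h t * Kop k (Kop l f) t)
     + e\<^sup>2 * (h t * Kop k (Kop l h) t))"
  proof -
    have 1: "Kop l (\<lambda>t. (1 - e) * f t + e * h t) = (\<lambda>t. (1 - e) * Kop l f t + e * Kop l h t)"
      by (rule ext) (rule Kop_add[OF th df dh kl(2)])
    have 2: "Kop k (\<lambda>t. (1 - e) * Kop l f t + e * Kop l h t) t = (1 - e) * Kop k (Kop l f) t + e * Kop k (Kop l h) t" for t
      by (rule Kop_add[OF th dKf[OF kl(2)] dKh[OF kl(2)] kl(1)])
    show ?thesis unfolding energy_def 1 2
      by (rule Bochner_Integration.integral_cong) (simp_all add: algebra_simps power2_eq_square)
  qed
  also have "\<dots> = (1 - e)\<^sup>2 * b f f + (1 - e) * e * b f h + (1 - e) * e * b h f + e\<^sup>2 * b h h"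
    unfolding b_def using I by simp
  also have "\<dots> = (1 - e)\<^sup>2 * M + 2 * ((1 - e) * e) * X + e\<^sup>2 * b h h"
  proof -
    have "(1 - e) * e * b f h + (1 - e) * e * b h f = (1 - e) * e * (b h f + b f h)" by (simp add: algebra_simps)
    moreover have "b f f = M" by (simp add: b_def M energy_def)
    ultimately show ?thesis unfolding X2 by (simp add: algebra_simps)
  qed
  finally have "(1 - e)\<^sup>2 * M + 2 * ((1 - e) * e) * X + e\<^sup>2 * b h h \<le> M"
    using max[OF admissible_convex[OF h, of e]] e by simp
  moreover have "0 \<le> e\<^sup>2 * b h h" using bhh by simp
  ultimately have "e * (2 * (1 - e) * X) \<le> e * ((2 - e) * M)"
    by (simp add: algebra_simps power2_eq_square)
  then have "2 * (1 - e) * X \<le> (2 - e) * M" using e by simp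
  then have "2 * (X - M) \<le> e * (2 * X) - e * M" by (simp add: algebra_simps)
  also have "\<dots> \<le> e * (2 * X)" using e M by simp
  also have "\<dots> \<le> (X - M) / (2 * X) * (2 * X)" using XM M by (intro mult_right_mono) (auto simp: e_def)
  also have "\<dots> = X - M" using XM M by simp
  finally show False using XM by simp
qed

text \<open>The variation inequality is tested with the extremal of Hoelder's inequality, a
  normalised power of S. Cutting off at R makes its integral finite beforehand, and it is admissible
  because S is positive, even and nonincreasing.\<close>

lemma S_powr_le:
  assumes R: "R > 0"
  shows "(\<integral>\<^sup>+t. ennreal (S t powr (q / (q - 1))) * indicator {-R<..<R} t \<partial>lborel) \<le> ennreal (M powr (q / (q - 1)))"
proof -
  define r where "r = q / (q - 1)"
  have r: "r > 1" "(r - 1) * q = r" "1 / r = 1 - 1 / q" using q by (auto simp: r_def field_simps)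
  define g where "g t = indicator {-R<..<R} t * S t powr r" for t
  have gm: "g \<in> borel_measurable borel" unfolding g_def using S_measurable by measurable
  have gi: "integrable lborel g"
  proof (rule integrableI_bounded_set[where A = "{-R..R}" and B = "S 0 powr r"])
    show "AE x in lborel. x \<in> {- R..R} \<longrightarrow> norm (g x) \<le> S 0 powr r"
    proof (rule AE_I2, rule impI)
      fix x
      have "S \<bar>x\<bar> = S x" by (simp add: abs_if S_even)
      then have "S x \<le> S 0" using S_antimono[of 0 "\<bar>x\<bar>"] by simp
      then have "S x powr r \<le> S 0 powr r" using S_pos[of x] r by (intro powr_mono2) auto
      then show "norm (g x) \<le> S 0 powr r" by (simp add: g_def indicator_def)
    qed
  qed (use gm R in \<open>auto simp: g_def indicator_def\<close>)
  define a where "a = (LINT t|lborel. g t)"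
  have a0: "a \<ge> 0" unfolding a_def g_def by simp
  have "a \<noteq> 0"
  proof
    assume "a = 0"
    then have "AE t in lborel. g t = 0"
      unfolding a_def using integral_nonneg_eq_0_iff_AE[OF gi] by (simp add: g_def)
    then have "AE t in lborel. t \<notin> {-R<..<R}"
      by eventually_elim (use S_pos in \<open>auto simp: g_def indicator_def less_imp_neq[symmetric] split: if_splits\<close>)
    moreover have "{t. \<not> t \<notin> {-R<..<R}} = {-R<..<R}" by auto
    ultimately have "emeasure lborel {-R<..<R} = 0"
      using AE_iff_measurable[of "{-R<..<R}" lborel "\<lambda>t. t \<notin> {-R<..<R}"] by simp
    then show False using R by simp
  qed
  then have a: "a > 0" using a0 by simp
  \<comment> \<open>Since (r - 1) q = r, the factor a^(-1/q) turns the integral of h^q into exactly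
    1.\<close>
  define h where "h t = (if \<bar>t\<bar> < R then a powr (- (1 / q)) * S t powr (r - 1) else 0)" for t
  have hm: "h \<in> borel_measurable borel" unfolding h_def using S_measurable by measurable
  have aq: "(a powr (- (1 / q))) powr q = 1 / a"
  proof -
    have "(a powr (- (1 / q))) powr q = a powr (- (1 / q) * q)" by (rule powr_powr)
    also have "- (1 / q) * q = - 1" using q by simp
    finally show ?thesis using a by (simp add: powr_minus_divide)
  qed
  have hq: "h t powr q = g t / a" for t
  proof (cases "\<bar>t\<bar> < R")
    case True
    then have "t \<in> {-R<..<R}" by auto
    then have "g t = S t powr r" by (simp add: g_def)
    moreover have "h t powr q = 1 / a * S t powr r"
      using True a q(1) by (simp add: h_def powr_mult aq powr_powr r(2))
    ultimately show ?thesis by simp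
  next
    case False
    then have "t \<notin> {-R<..<R}" by auto
    then show ?thesis using False by (simp add: g_def h_def)
  qed
  have "admissible q h"
    unfolding admissible_def
  proof (intro conjI allI impI hm)
    show "0 \<le> h t" "h (- t) = h t" for t by (simp_all add: h_def S_even)
    show "h t \<le> h s" if "0 < s" "s \<le> t" for s t
    proof (cases "t < R")
      case True
      have "S t powr (r - 1) \<le> S s powr (r - 1)"
        using that S_pos[of t] S_antimono[of s t] r by (intro powr_mono2) auto
      then show ?thesis using that True by (simp add: h_def mult_left_mono)
    qed (use that in \<open>simp add: h_def\<close>)
    show "continuous (at_right t) h" if t: "0 < t" for t
    proof (cases "t < R")
      case True
      have "isCont (\<lambda>t. a powr (- (1 / q)) * S t powr (r - 1)) t"
        using S_pos[of t] by (intro continuous_intros S_cont) auto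
      then have "((\<lambda>t. a powr (- (1 / q)) * S t powr (r - 1)) \<longlongrightarrow> a powr (- (1 / q)) * S t powr (r - 1)) (at_right t)"
        unfolding isCont_def by (rule filterlim_mono) (auto simp: at_le)
      moreover have "\<forall>\<^sub>F s in at_right t. s \<in> {t<..<R}" by (rule eventually_at_right_field[THEN iffD2]) (use True in auto)
      then have "\<forall>\<^sub>F s in at_right t. a powr (- (1 / q)) * S s powr (r - 1) = h s"
        by eventually_elim (use t in \<open>auto simp: h_def\<close>)
      ultimately have "(h \<longlongrightarrow> a powr (- (1 / q)) * S t powr (r - 1)) (at_right t)"
        by (rule Lim_transform_eventually)
      then show ?thesis unfolding continuous_within using True t by (simp add: h_def)
    next
      case False
      have "\<forall>\<^sub>F s in at_right t. 0 = h s"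
        using eventually_at_right_less[of t] by eventually_elim (use False in \<open>auto simp: h_def\<close>)
      then show ?thesis unfolding continuous_within using False
        by (auto simp: h_def intro: Lim_transform_eventually[OF tendsto_const])
    qed
    have "(\<integral>\<^sup>+t. ennreal (h t powr q) \<partial>lborel) = ennreal (LINT t|lborel. g t / a)"
      unfolding hq by (rule nn_integral_eq_integral[OF integrable_divide[OF gi]]) (use a in \<open>simp add: g_def\<close>)
    also have "(LINT t|lborel. g t / a) = 1" using a by (simp add: a_def)
    finally show "(\<integral>\<^sup>+t. ennreal (h t powr q) \<partial>lborel) \<le> 1" by simp
  qed
  then have "(LINT t|lborel. h t * S t) \<le> M" by (rule integral_mult_S_le)
  also have "(\<lambda>t. h t * S t) = (\<lambda>t. a powr (- (1 / q)) * g t)"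
  proof
    fix t
    have "S t powr (r - 1) * S t = S t powr r" using S_pos[of t] by (simp add: powr_diff)
    then show "h t * S t = a powr (- (1 / q)) * g t"
      by (auto simp: h_def g_def indicator_def abs_less_iff)
  qed
  also have "(LINT t|lborel. a powr (- (1 / q)) * g t) = a powr (- (1 / q)) * a"
    by (simp add: a_def)
  also have "\<dots> = a powr (- (1 / q) + 1)" unfolding powr_add using a by simp
  also have "- (1 / q) + 1 = 1 / r" using r(3) by simp
  finally have "a powr (1 / r) \<le> M" .
  then have "(a powr (1 / r)) powr r \<le> M powr r" using r by (intro powr_mono2) auto
  also have "(a powr (1 / r)) powr r = a" using a r(1) by (simp add: powr_powr)
  finally have "a \<le> M powr r" .
  have "(\<integral>\<^sup>+t. ennreal (S t powr r) * indicator {-R<..<R} t \<partial>lborel) = (\<integral>\<^sup>+t. ennreal (g t) \<partial>lborel)"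
    by (rule nn_integral_cong) (simp add: g_def indicator_def)
  also have "\<dots> = ennreal a" unfolding a_def by (rule nn_integral_eq_integral[OF gi]) (simp add: g_def)
  also have "\<dots> \<le> ennreal (M powr r)" using \<open>a \<le> M powr r\<close> by (rule ennreal_leI)
  finally show ?thesis unfolding r_def .
qed

lemma S_powr_integral_le:
  "(\<integral>\<^sup>+t. ennreal (S t powr (q / (q - 1))) \<partial>lborel) \<le> ennreal (M powr (q / (q - 1)))"
proof -
  let ?g = "\<lambda>n t. ennreal (S t powr (q / (q - 1))) * indicator {- real (Suc n)<..<real (Suc n)} t"
  have [measurable]: "S \<in> borel_measurable borel" by (rule S_measurable)
  have "(\<integral>\<^sup>+t. ennreal (S t powr (q / (q - 1))) \<partial>lborel) = (\<integral>\<^sup>+t. liminf (\<lambda>n. ?g n t) \<partial>lborel)"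
  proof (rule nn_integral_cong)
    fix t :: real
    obtain N where N: "\<bar>t\<bar> < real N" using reals_Archimedean2 by blast
    have "\<forall>\<^sub>F n in sequentially. ?g n t = ennreal (S t powr (q / (q - 1)))"
      using eventually_ge_at_top[of N]
    proof eventually_elim
      case (elim n)
      then have "real N \<le> real (Suc n)" by simp
      then have "t \<in> {- real (Suc n)<..<real (Suc n)}" using N by auto
      then show ?case by (simp only: indicator_simps mult_1_right)
    qed
    then have "(\<lambda>n. ?g n t) \<longlonglongrightarrow> ennreal (S t powr (q / (q - 1)))" by (rule tendsto_eventually)
    from lim_imp_Liminf[OF trivial_limit_sequentially this]
    show "ennreal (S t powr (q / (q - 1))) = liminf (\<lambda>n. ?g n t)" by (rule sym)
  qed
  also have "\<dots> \<le> liminf (\<lambda>n. \<integral>\<^sup>+t. ?g n t \<partial>lborel)"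
    by (rule nn_integral_liminf) measurable
  also have "\<dots> \<le> ennreal (M powr (q / (q - 1)))"
    by (intro Liminf_le always_eventually allI S_powr_le) (simp_all only: of_nat_0_less_iff zero_less_Suc trivial_limit_sequentially simp_thms)
  finally show ?thesis .
qed

text \<open>For y = S / M both f in L^q and y in L^(p+1) have norm at most 1, while the integral of
  f y is 1. Integrating Young's inequality leaves no slack, so it is an equality almost
  everywhere.\<close>

lemma f_eq_S_powr: "AE t in lborel. f t = (S t / M) powr (1 / (q - 1))"
proof -
  define p where "p = 1 / (q - 1)"
  define y where "y t = S t / M" for t
  have p: "p > 1" "(p + 1) / p = q" "q / (q - 1) = p + 1" using q by (auto simp: p_def field_simps)
  have y: "y t > 0" for t using S_pos[of t] M by (simp add: y_def)
  have [measurable]: "S \<in> borel_measurable borel" "f \<in> borel_measurable borel"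
    by (rule S_measurable admissibleD(1)[OF f])+
  have fq: "integrable lborel (\<lambda>t. f t powr q)" "(LINT t|lborel. f t powr q) \<le> 1"
  proof -
    show i: "integrable lborel (\<lambda>t. f t powr q)"
      using le_less_trans[OF admissibleD(6)[OF f]] by (intro integrableI_bounded) auto
    have "ennreal (LINT t|lborel. f t powr q) \<le> 1"
      using nn_integral_eq_integral[OF i] admissibleD(6)[OF f] by simp
    then show "(LINT t|lborel. f t powr q) \<le> 1" by simp
  qed
  have yp: "integrable lborel (\<lambda>t. y t powr (p + 1))" "(LINT t|lborel. y t powr (p + 1)) \<le> 1"
  proof -
    have Si: "integrable lborel (\<lambda>t. S t powr (p + 1))"
      using le_less_trans[OF S_powr_integral_le] unfolding p(3) by (intro integrableI_bounded) auto
    have eq: "y t powr (p + 1) = S t powr (p + 1) / M powr (p + 1)" for t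
      using S_pos[of t] M by (simp add: y_def powr_divide)
    show "integrable lborel (\<lambda>t. y t powr (p + 1))" unfolding eq using Si by (rule integrable_divide)
    have "ennreal (LINT t|lborel. S t powr (p + 1)) \<le> ennreal (M powr (p + 1))"
      using nn_integral_eq_integral[OF Si] S_powr_integral_le unfolding p(3) by simp
    then have "(LINT t|lborel. S t powr (p + 1)) \<le> M powr (p + 1)"
      by (subst (asm) ennreal_le_iff) auto
    then show "(LINT t|lborel. y t powr (p + 1)) \<le> 1" unfolding eq using M by simp
  qed
  have fy: "integrable lborel (\<lambda>t. f t * y t)" "(LINT t|lborel. f t * y t) = 1"
  proof -
    have "integrable lborel (\<lambda>t. f t * S t / M)" by (intro integrable_divide mult_S_integrable f)
    then show "integrable lborel (\<lambda>t. f t * y t)" by (simp add: y_def)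
    note th = inv_q[OF kl q]
    have I: "integrable lborel (\<lambda>t. f t * Kop k (Kop l f) t)" "integrable lborel (\<lambda>t. f t * Kop l (Kop k f) t)"
      by (rule mult_Kop_integrable[OF th dom_K[OF kl(2)] kl(1) dom_f]
          mult_Kop_integrable[OF th dom_K[OF kl(1)] kl(2) dom_f])+
    have "(LINT t|lborel. f t * Kop l (Kop k f) t) = (LINT t|lborel. Kop k f t * Kop l f t)"
      by (rule Kop_symmetric[OF th dom_K[OF kl(1)] kl(2) dom_f])
    also have "\<dots> = (LINT t|lborel. Kop l f t * Kop k f t)" by (simp add: mult.commute)
    also have "\<dots> = (LINT t|lborel. f t * Kop k (Kop l f) t)"
      by (rule Kop_symmetric[OF th dom_f kl(1) dom_K[OF kl(2)]])
    also have "\<dots> = M" by (simp add: M energy_def)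
    finally have 2: "(LINT t|lborel. f t * Kop l (Kop k f) t) = M" .
    have 1: "(LINT t|lborel. f t * Kop k (Kop l f) t) = M" by (simp add: M energy_def)
    have "(LINT t|lborel. f t * y t)
        = (LINT t|lborel. (f t * Kop k (Kop l f) t + f t * Kop l (Kop k f) t) / (2 * M))"
      unfolding y_def S_def by (simp add: algebra_simps add_divide_distrib)
    also have "\<dots> = (M + M) / (2 * M)" using I 1 2 by simp
    finally show "(LINT t|lborel. f t * y t) = 1" using M by simp
  qed
  define D where "D t = f t powr q / q + y t powr (p + 1) / (p + 1) - f t * y t" for t
  have Di: "integrable lborel D" unfolding D_def
    by (intro Bochner_Integration.integrable_diff Bochner_Integration.integrable_add integrable_divide fq yp fy)
  have conj: "1 / q + 1 / (p + 1) = 1" unfolding p(3)[symmetric] using q by (simp add: field_simps)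
  have D0: "0 \<le> D t" for t
    unfolding D_def using Youngs_inequality[of q "p + 1" "f t" "y t"] q p(1) conj y[of t] admissibleD(2)[OF f, of t]
    by simp
  have "(LINT t|lborel. D t) = (LINT t|lborel. f t powr q) / q + (LINT t|lborel. y t powr (p + 1)) / (p + 1) - 1"
    unfolding D_def using fq(1) yp(1) fy by simp
  also have "\<dots> \<le> 1 / q + 1 / (p + 1) - 1"
    using fq(2) yp(2) q p(1) by (intro diff_right_mono add_mono divide_right_mono) auto
  finally have "(LINT t|lborel. D t) \<le> 0" using conj by simp
  moreover have "(LINT t|lborel. D t) \<ge> 0" using D0 by simp
  ultimately have "(LINT t|lborel. D t) = 0" by simp
  then have "AE t in lborel. D t = 0" using integral_nonneg_eq_0_iff_AE[OF Di] D0 by simp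
  then show ?thesis
  proof eventually_elim
    case (elim t)
    have "f t = y t powr p"
      by (rule Youngs_equality[OF p(1) admissibleD(2)[OF f] y]) (use elim p(2) in \<open>simp add: D_def\<close>)
    then show ?case by (simp add: y_def p_def)
  qed
qed

end

theorem homoclinic_exists:
  fixes k l p :: real
  assumes kl: "k > 0" "l > 0" and p: "p > 1"
  shows "\<exists>v v1 v2 v3. (\<forall>t. v t > 0) \<and> (\<forall>t. (v has_real_derivative v1 t) (at t))
    \<and> (\<forall>t. (v1 has_real_derivative v2 t) (at t)) \<and> (\<forall>t. (v2 has_real_derivative v3 t) (at t))
    \<and> (\<forall>t. (v3 has_real_derivative (k\<^sup>2 + l\<^sup>2) * v2 t - k\<^sup>2 * l\<^sup>2 * v t + v t powr p) (at t))
    \<and> (v \<longlongrightarrow> 0) at_top \<and> (v \<longlongrightarrow> 0) at_bot"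
proof -
  define q where "q = (p + 1) / p"
  have q: "1 < q" "q < 2" "1 / (q - 1) = p" using p by (auto simp: q_def field_simps)
  obtain f where f: "admissible q f" "energy k l f > 0" "\<And>g. admissible q g \<Longrightarrow> energy k l g \<le> energy k l f"
    using energy_maximizer[OF kl q(1,2)] by blast
  define M where "M = energy k l f"
  have M: "M = energy k l f" "M > 0" using f by (auto simp: M_def)
  have mx: "\<And>g. admissible q g \<Longrightarrow> energy k l g \<le> M" using f(3) M_def by simp
  note ctx = kl q(1,2) f(1) M
  define S where "S = symKop k l f"
  have S: "S t > 0" "isCont S t" "S (- t) = S t" for t
    unfolding S_def by (rule S_pos[OF ctx] S_cont[OF ctx] S_even[OF ctx], rule mx, assumption)+
  have S_dec: "\<exists>C. \<forall>t. t \<noteq> 0 \<longrightarrow> S t \<le> C * \<bar>t\<bar> powr (- (1 / q))"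
    unfolding S_def by (rule S_le[OF ctx]) (rule mx)
  have fS: "AE t in lborel. f t = (S t / M) powr (1 / (q - 1))"
    unfolding S_def by (rule f_eq_S_powr[OF ctx]) (rule mx)
  \<comment> \<open>Chosen so that c^p M = c. Then v = c S / M equals c^p S, and v^p agrees with c^p
    f almost everywhere, which closes the fixed-point equation.\<close>
  define c where "c = M powr (- (1 / (p - 1)))"
  have c: "c > 0" "c powr p * M = c"
  proof -
    show "c > 0" using M by (simp add: c_def)
    have "c powr p = M powr (- (1 / (p - 1)) * p)" using M by (simp add: c_def powr_powr)
    also have "- (1 / (p - 1)) * p = - (1 / (p - 1)) - 1" using p by (simp add: field_simps)
    also have "M powr (- (1 / (p - 1)) - 1) = c / M" using M by (simp add: c_def powr_diff)
    finally show "c powr p * M = c" using M by simp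
  qed
  define v where "v t = c * (S t / M)" for t
  define g where "g t = v t powr p" for t
  have vpos: "v t > 0" for t using c M S(1)[of t] by (simp add: v_def)
  have M0: "M \<noteq> 0" using M(2) by simp
  have vcont: "isCont v t" for t unfolding v_def by (intro continuous_intros S(2) M0)
  have gcont: "continuous_on UNIV g"
    unfolding g_def
    by (intro continuous_at_imp_continuous_on ballI continuous_intros vcont) (use vpos in \<open>auto simp: less_imp_neq[symmetric]\<close>)
  have gm: "g \<in> borel_measurable borel" by (rule borel_measurable_continuous_onI[OF gcont])
  have fm: "f \<in> borel_measurable borel" by (rule admissibleD(1)[OF f(1)])
  \<comment> \<open>The maximiser is known only almost everywhere; under the convolutions it may be
    replaced by the continuous g, as differentiation requires.\<close>
  have AE: "AE t in lborel. c powr p * f t = g t"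
    using fS
  proof eventually_elim
    case (elim t)
    have "g t = c powr p * (S t / M) powr p"
      unfolding g_def v_def by (rule powr_mult)
    then show ?case using elim q(3) by simp
  qed
  have Kg: "Kop d g = (\<lambda>t. c powr p * Kop d f t)" for d
    using Kop_cong_AE[OF AE _ gm, of d] fm by (simp add: fun_eq_iff Kop_scale[symmetric])
  have KKg: "Kop e (Kop d g) t = c powr p * Kop e (Kop d f) t" for d e t
    unfolding Kg Kop_scale ..
  note th = inv_q[OF kl q(1,2)] and df = dominated[OF kl q(1,2) f(1)] and dK = dominated_K[OF kl q(1,2) f(1)]
  have ig: "integrable lborel (\<lambda>s. ker d (t - s) * g s)" if "d > 0" for d t
  proof -
    have "integrable lborel (\<lambda>s. c powr p * (ker d (t - s) * f s))"
      by (intro integrable_mult_right ker_mult_integrable[OF th df that])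
    then show ?thesis
      by (rule integrable_cong_AE_imp) (use AE gm in auto)
  qed
  have iKg: "integrable lborel (\<lambda>s. ker e (t - s) * Kop d g s)" if "d > 0" "e > 0" for d e t
  proof -
    have "integrable lborel (\<lambda>s. c powr p * (ker e (t - s) * Kop d f s))"
      by (intro integrable_mult_right ker_mult_integrable[OF th dK that(2)] that)
    then show ?thesis unfolding Kg by (simp add: mult_ac)
  qed
  have veq: "v t = (Kop k (Kop l g) t + Kop l (Kop k g) t) / 2" for t
  proof -
    have "(Kop k (Kop l g) t + Kop l (Kop k g) t) / 2 = c powr p * S t"
      unfolding KKg S_def symKop_def by (simp add: algebra_simps)
    also have "\<dots> = c powr p * M * (S t / M)" using M by simp
    finally show ?thesis by (simp add: v_def c(2))
  qed
  \<comment> \<open>Each order of the two convolutions solves the same linear equation with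
    right-hand side g, hence so does their average v.\<close>
  obtain P1 P2 P3 where P: "\<And>t. (Kop k (Kop l g) has_real_derivative P1 t) (at t)"
    "\<And>t. (P1 has_real_derivative P2 t) (at t)" "\<And>t. (P2 has_real_derivative P3 t) (at t)"
    "\<And>t. (P3 has_real_derivative (k\<^sup>2 + l\<^sup>2) * P2 t - k\<^sup>2 * l\<^sup>2 * Kop k (Kop l g) t + g t) (at t)"
    using Kop_Kop_ode[OF kl gcont ig[OF kl(2)] iKg[OF kl(2,1)]] by blast
  obtain Q1 Q2 Q3 where Q: "\<And>t. (Kop l (Kop k g) has_real_derivative Q1 t) (at t)"
    "\<And>t. (Q1 has_real_derivative Q2 t) (at t)" "\<And>t. (Q2 has_real_derivative Q3 t) (at t)"
    "\<And>t. (Q3 has_real_derivative (l\<^sup>2 + k\<^sup>2) * Q2 t - l\<^sup>2 * k\<^sup>2 * Kop l (Kop k g) t + g t) (at t)"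
    using Kop_Kop_ode[OF kl(2,1) gcont ig[OF kl(1)] iKg[OF kl(1,2)]] by blast
  have D: "(v has_real_derivative (P1 t + Q1 t) / 2) (at t)"
    "((\<lambda>t. (P1 t + Q1 t) / 2) has_real_derivative (P2 t + Q2 t) / 2) (at t)"
    "((\<lambda>t. (P2 t + Q2 t) / 2) has_real_derivative (P3 t + Q3 t) / 2) (at t)" for t
    unfolding veq[abs_def] by (intro DERIV_cdivide DERIV_add P Q)+
  have D4: "((\<lambda>t. (P3 t + Q3 t) / 2) has_real_derivative
      (k\<^sup>2 + l\<^sup>2) * ((P2 t + Q2 t) / 2) - k\<^sup>2 * l\<^sup>2 * v t + g t) (at t)" for t
    by (rule DERIV_cong[OF DERIV_cdivide[OF DERIV_add[OF P(4) Q(4)]]]) (simp add: veq field_simps)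
  have lim: "(v \<longlongrightarrow> 0) at_top"
  proof -
    obtain C where C: "\<And>t. t \<noteq> 0 \<Longrightarrow> S t \<le> C * \<bar>t\<bar> powr (- (1 / q))"
      using S_dec by blast
    have z: "((\<lambda>t::real. t powr (- (1 / q))) \<longlongrightarrow> 0) at_top"
      by (rule tendsto_neg_powr) (use q filterlim_ident in auto)
    have "((\<lambda>t. c * (C * t powr (- (1 / q)) / M)) \<longlongrightarrow> c * (C * 0 / M)) at_top"
      by (intro tendsto_intros z) (use M(2) in simp)
    then have lim0: "((\<lambda>t. c * (C * t powr (- (1 / q)) / M)) \<longlongrightarrow> 0) at_top" by simp
    show ?thesis
    proof (rule tendsto_sandwich[OF _ _ tendsto_const lim0])
      show "\<forall>\<^sub>F t in at_top. 0 \<le> v t" using vpos by (simp add: less_imp_le)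
      show "\<forall>\<^sub>F t in at_top. v t \<le> c * (C * t powr (- (1 / q)) / M)"
        using eventually_gt_at_top[of 0]
      proof eventually_elim
        case (elim t)
        then show ?case unfolding v_def using C[of t] c M
          by (intro mult_left_mono divide_right_mono) auto
      qed
    qed
  qed
  have "((\<lambda>t. v (- t)) \<longlongrightarrow> 0) at_bot"
    by (rule filterlim_compose[OF lim filterlim_uminus_at_top_at_bot])
  moreover have "(\<lambda>t. v (- t)) = v" by (simp add: v_def S(3) fun_eq_iff)
  ultimately have "(v \<longlongrightarrow> 0) at_bot" by (simp only:)
  then show ?thesis using vpos D D4[unfolded g_def] lim
    by (intro exI[of _ v] exI[of _ "\<lambda>t. (P1 t + Q1 t) / 2"] exI[of _ "\<lambda>t. (P2 t + Q2 t) / 2"]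
        exI[of _ "\<lambda>t. (P3 t + Q3 t) / 2"]) simp
qed

section \<open>Radial functions in logarithmic coordinates\<close>

lemma pderiv_at_eq:
  fixes u :: "real ^ 'n::finite \<Rightarrow> real"
  assumes "(u has_derivative u') (at x)"
  shows "((\<lambda>t. u (x + t *\<^sub>R axis i 1)) has_real_derivative u' (axis i 1)) (at 0)"
    and "pderiv_at i u x = u' (axis i 1)"
proof -
  have 1: "((\<lambda>t::real. x + t *\<^sub>R axis i 1) has_derivative (\<lambda>t. t *\<^sub>R axis i 1)) (at 0)"
    by (auto intro!: derivative_eq_intros)
  have "(u has_derivative u') (at (x + 0 *\<^sub>R axis i 1))" using assms by simp
  from has_derivative_compose[OF 1 this]
  have "((\<lambda>t. u (x + t *\<^sub>R axis i 1)) has_derivative (\<lambda>t. u' (t *\<^sub>R axis i 1))) (at 0)" .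
  moreover have "(\<lambda>t. u' (t *\<^sub>R axis i 1)) = (*) (u' (axis i 1))"
    using linear_scale[OF has_derivative_linear[OF assms]] by (auto simp: fun_eq_iff)
  ultimately show "((\<lambda>t. u (x + t *\<^sub>R axis i 1)) has_real_derivative u' (axis i 1)) (at 0)"
    by (simp add: has_field_derivative_def)
  then show "pderiv_at i u x = u' (axis i 1)"
    unfolding pderiv_at_def by (rule DERIV_imp_deriv)
qed

lemma pderiv_at_cong:
  fixes u w :: "real ^ 'n::finite \<Rightarrow> real"
  assumes "open S" "x \<in> S" "\<And>y. y \<in> S \<Longrightarrow> u y = w y"
  shows "pderiv_at i u x = pderiv_at i w x"
  unfolding pderiv_at_def
proof (rule deriv_cong_ev)
  have "open ((\<lambda>t::real. x + t *\<^sub>R axis i 1) -` S)"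
    by (intro open_vimage assms continuous_intros)
  then have "\<forall>\<^sub>F t in nhds 0. t \<in> (\<lambda>t::real. x + t *\<^sub>R axis i 1) -` S"
    using assms by (intro eventually_nhds_in_open) auto
  then show "\<forall>\<^sub>F t in nhds 0. u (x + t *\<^sub>R axis i 1) = w (x + t *\<^sub>R axis i 1)"
    by eventually_elim (use assms in auto)
qed simp

lemma has_derivative_of_differentiable_on:
  assumes "open S" "u differentiable_on S" "x \<in> S"
  shows "\<exists>u'. (u has_derivative u') (at x)"
  using assms by (simp add: differentiable_on_eq_differentiable_at differentiable_def)

lemma differentiable_on_cong_open:
  assumes "open S" "\<And>y. y \<in> S \<Longrightarrow> u y = w y" "u differentiable_on S"
  shows "w differentiable_on S"
  unfolding differentiable_on_eq_differentiable_at[OF assms(1)]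
proof
  fix x assume x: "x \<in> S"
  obtain u' where "(u has_derivative u') (at x)"
    using has_derivative_of_differentiable_on[OF assms(1,3) x] by blast
  then have "(w has_derivative u') (at x)"
    by (rule has_derivative_transform_within_open[OF _ assms(1) x]) (rule assms(2))
  then show "w differentiable (at x)" by (rule differentiableI)
qed

lemma Ck_on_cong:
  assumes "open S" "\<And>y. y \<in> S \<Longrightarrow> u y = w y"
  shows "Ck_on k S u \<longleftrightarrow> Ck_on k S w"
  using assms(2)
proof (induction k arbitrary: u w)
  case 0
  then show ?case by (simp cong: continuous_on_cong)
next
  case (Suc k)
  have "u differentiable_on S \<longleftrightarrow> w differentiable_on S"
    using Suc.prems differentiable_on_cong_open[OF assms(1), of u w]
      differentiable_on_cong_open[OF assms(1), of w u] by auto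
  moreover have "Ck_on k S (pderiv_at i u) \<longleftrightarrow> Ck_on k S (pderiv_at i w)" for i
    by (rule Suc.IH) (rule pderiv_at_cong[OF assms(1) _ Suc.prems])
  ultimately show ?case by simp
qed

lemma Ck_on_Suc_imp: "Ck_on (Suc k) S u \<Longrightarrow> Ck_on k S u"
proof (induction k arbitrary: u)
  case 0
  then show ?case by (simp add: differentiable_imp_continuous_on)
qed (metis Ck_on.simps(2))

text \<open>Glues a radial function on the punctured space to the zero function on a ball around the
  origin.\<close>

lemma Ck_on_Un:
  assumes "open S" "open T" "Ck_on k S u" "Ck_on k T u"
  shows "Ck_on k (S \<union> T) u"
  using assms(3,4)
proof (induction k arbitrary: u)
  case 0
  then show ?case using assms by (simp add: continuous_on_open_Un)
next
  case (Suc k)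
  then have "u differentiable_on (S \<union> T)"
    using assms(1,2) by (auto simp: differentiable_on_eq_differentiable_at open_Un)
  then show ?case using Suc by auto
qed

lemma Ck_on_zero: "Ck_on k (S :: (real ^ 'n::finite) set) (\<lambda>x. 0)"
proof (induction k)
  case (Suc k)
  have "pderiv_at i (\<lambda>x :: real ^ 'n. 0) = (\<lambda>x. 0)" for i
    by (rule ext, subst pderiv_at_eq(2)[where u' = "\<lambda>_. 0"]) auto
  then show ?case using Suc by simp
qed simp

lemma Ck_on_add:
  assumes S: "open S" and "Ck_on k S u" "Ck_on k S w"
  shows "Ck_on k S (\<lambda>x. u x + w x)"
  using assms(2,3)
proof (induction k arbitrary: u w)
  case (Suc k)
  have "pderiv_at i (\<lambda>x. u x + w x) x = pderiv_at i u x + pderiv_at i w x" if x: "x \<in> S" for i x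
  proof -
    obtain u' where u': "(u has_derivative u') (at x)"
      using has_derivative_of_differentiable_on[OF S _ x, of u] Suc.prems by auto
    obtain w' where w': "(w has_derivative w') (at x)"
      using has_derivative_of_differentiable_on[OF S _ x, of w] Suc.prems by auto
    show ?thesis
      using pderiv_at_eq(2)[OF has_derivative_add[OF u' w']] pderiv_at_eq(2)[OF u'] pderiv_at_eq(2)[OF w'] by simp
  qed
  then have "Ck_on k S (pderiv_at i (\<lambda>x. u x + w x)) \<longleftrightarrow> Ck_on k S (\<lambda>x. pderiv_at i u x + pderiv_at i w x)" for i
    by (rule Ck_on_cong[OF S])
  then show ?case using Suc by (simp add: differentiable_on_add)
qed (simp add: continuous_on_add)

lemma pderiv_at_coord_mult:
  fixes u :: "real ^ 'n::finite \<Rightarrow> real"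
  assumes "u differentiable (at x)"
  shows "pderiv_at j (\<lambda>x. x $ i * u x) x = (if i = j then u x else 0) + x $ i * pderiv_at j u x"
    and "(\<lambda>x. x $ i * u x) differentiable (at x)"
proof -
  obtain u' where u': "(u has_derivative u') (at x)" using assms by (auto simp: differentiable_def)
  have c: "((\<lambda>x::real^'n. x $ i) has_derivative (\<lambda>h. h $ i)) (at x)"
    by (intro has_derivative_bounded_linear bounded_linear_vec_nth has_derivative_ident bounded_linear_imp_has_derivative)
  have "((\<lambda>x. x $ i * u x) has_derivative (\<lambda>h. x $ i * u' h + h $ i * u x)) (at x)"
    by (rule has_derivative_mult[OF c u'])
  then show "pderiv_at j (\<lambda>x. x $ i * u x) x = (if i = j then u x else 0) + x $ i * pderiv_at j u x"
    "(\<lambda>x. x $ i * u x) differentiable (at x)"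
    using pderiv_at_eq(2)[OF u'] by (auto simp: pderiv_at_eq(2) differentiable_def axis_def)
qed

text \<open>A partial derivative of a radial function is a coordinate times a radial function, so
  this closure is what the induction for \<open>rad\<close> runs on.\<close>

lemma Ck_on_coord_mult:
  fixes u :: "real ^ 'n::finite \<Rightarrow> real"
  assumes S: "open S" and "Ck_on k S u"
  shows "Ck_on k S (\<lambda>x. x $ i * u x)"
  using assms(2)
proof (induction k arbitrary: u)
  case 0
  then show ?case by (auto intro!: continuous_intros)
next
  case (Suc k)
  have d: "u differentiable (at x)" if "x \<in> S" for x
    using Suc.prems that S by (auto simp: differentiable_on_eq_differentiable_at)
  have "Ck_on k S (pderiv_at j (\<lambda>x. x $ i * u x))
      \<longleftrightarrow> Ck_on k S (\<lambda>x. (if i = j then u x else 0) + x $ i * pderiv_at j u x)" for j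
    by (rule Ck_on_cong[OF S]) (rule pderiv_at_coord_mult(1)[OF d])
  moreover have "Ck_on k S (\<lambda>x. if i = j then u x else 0)" for j
    using Ck_on_Suc_imp[OF Suc.prems] Ck_on_zero by (cases "i = j") auto
  moreover have "Ck_on k S (\<lambda>x. x $ i * pderiv_at j u x)" for j
    using Suc by auto
  ultimately show ?case
    using Ck_on_add[OF S] d pderiv_at_coord_mult(2)[OF d] S
    by (auto simp: differentiable_on_eq_differentiable_at)
qed

section \<open>Smoothness of functions of one variable\<close>

primrec smooth1 :: "nat \<Rightarrow> (real \<Rightarrow> real) \<Rightarrow> bool" where
  "smooth1 0 f \<longleftrightarrow> continuous_on UNIV f"
| "smooth1 (Suc k) f \<longleftrightarrow> (\<exists>f'. (\<forall>t. (f has_real_derivative f' t) (at t)) \<and> smooth1 k f')"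

lemma smooth1_continuous: "smooth1 k f \<Longrightarrow> continuous_on UNIV f"
  by (cases k) (auto intro: DERIV_continuous_on has_field_derivative_at_within)

lemma smooth1_Suc_imp: "smooth1 (Suc k) f \<Longrightarrow> smooth1 k f"
proof (induction k arbitrary: f)
  case 0
  then show ?case using smooth1_continuous[of "Suc 0" f] by simp
qed (metis smooth1.simps(2))

lemma smooth1_add: "smooth1 k f \<Longrightarrow> smooth1 k g \<Longrightarrow> smooth1 k (\<lambda>t. f t + g t)"
proof (induction k arbitrary: f g)
  case (Suc k)
  then obtain f' g' where "\<forall>t. (f has_real_derivative f' t) (at t)" "smooth1 k f'"
    "\<forall>t. (g has_real_derivative g' t) (at t)" "smooth1 k g'" by auto
  with Suc.IH[of f' g'] show ?case
    by (auto intro!: exI[of _ "\<lambda>t. f' t + g' t"] DERIV_add)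
qed (simp add: continuous_on_add)

lemma smooth1_mult: "smooth1 k f \<Longrightarrow> smooth1 k g \<Longrightarrow> smooth1 k (\<lambda>t. f t * g t)"
proof (induction k arbitrary: f g)
  case (Suc k)
  then obtain f' g' where "\<forall>t. (f has_real_derivative f' t) (at t)" "smooth1 k f'"
    "\<forall>t. (g has_real_derivative g' t) (at t)" "smooth1 k g'" by auto
  moreover from this have "smooth1 k (\<lambda>t. f' t * g t + f t * g' t)"
    using Suc.prems smooth1_Suc_imp by (intro smooth1_add Suc.IH) auto
  ultimately show ?case
    by (auto intro!: exI[of _ "\<lambda>t. f' t * g t + f t * g' t"] derivative_eq_intros)
qed (simp add: continuous_on_mult)

lemma smooth1_const: "smooth1 k (\<lambda>t. c)"
proof (induction k arbitrary: c)
  case (Suc k)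
  then show ?case by (auto intro!: exI[of _ "\<lambda>t. 0"])
qed simp

lemma smooth1_cmult: "smooth1 k f \<Longrightarrow> smooth1 k (\<lambda>t. c * f t)"
  by (intro smooth1_mult smooth1_const)

lemma smooth1_diff: "smooth1 k f \<Longrightarrow> smooth1 k g \<Longrightarrow> smooth1 k (\<lambda>t. f t - g t)"
  using smooth1_add[of k f "\<lambda>t. (-1) * g t"] smooth1_cmult[of k g "-1"] by simp

lemma smooth1_affine: "smooth1 k f \<Longrightarrow> smooth1 k (\<lambda>t. f (a + b * t))"
proof (induction k arbitrary: f)
  case 0
  then show ?case by (auto intro!: continuous_on_compose2[of UNIV f] continuous_intros)
next
  case (Suc k)
  then obtain f' where f': "\<And>t. (f has_real_derivative f' t) (at t)" "smooth1 k f'" by auto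
  have "((\<lambda>t. f (a + b * t)) has_real_derivative b * f' (a + b * t)) (at t)" for t
  proof -
    have "((\<lambda>t. a + b * t) has_real_derivative b) (at t)" by (auto intro!: derivative_eq_intros)
    from DERIV_chain2[OF f'(1) this] show ?thesis by (simp add: mult.commute)
  qed
  then show ?case using Suc.IH[OF f'(2)] smooth1_cmult by (auto intro!: exI[of _ "\<lambda>t. b * f' (a + b * t)"])
qed

lemma smooth1_exp: "smooth1 k (\<lambda>t. exp (c * t))"
proof (induction k)
  case (Suc k)
  have "((\<lambda>t. exp (c * t)) has_real_derivative c * exp (c * t)) (at t)" for t
    by (auto intro!: derivative_eq_intros)
  then show ?case using smooth1_cmult[OF Suc] by (auto intro!: exI[of _ "\<lambda>t. c * exp (c * t)"])
qed (auto intro!: continuous_intros)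

lemma smooth1_powr:
  "smooth1 k f \<Longrightarrow> (\<And>t. f t > 0) \<Longrightarrow> smooth1 k (\<lambda>t. f t powr r)"
proof (induction k arbitrary: r)
  case 0
  then show ?case by (auto intro!: continuous_intros simp: less_imp_neq[symmetric])
next
  case (Suc k)
  then obtain f' where f': "\<And>t. (f has_real_derivative f' t) (at t)" "smooth1 k f'" by auto
  have "((\<lambda>t. f t powr r) has_real_derivative r * (f t powr (r - 1) * f' t)) (at t)" for t
    using DERIV_chain2[OF has_real_derivative_powr[OF Suc.prems(2), of r] f'(1)] by (simp add: mult_ac)
  moreover have "smooth1 k (\<lambda>t. r * (f t powr (r - 1) * f' t))"
    using Suc f'(2) smooth1_Suc_imp by (intro smooth1_cmult smooth1_mult) auto
  ultimately show ?case by (auto intro!: exI[of _ "\<lambda>t. r * (f t powr (r - 1) * f' t)"])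
qed

text \<open>The Emden-Fowler change of variables \<open>t = - ln |x|\<close>.\<close>

definition rad :: "real \<Rightarrow> (real \<Rightarrow> real) \<Rightarrow> real ^ 'n::finite \<Rightarrow> real" where
  "rad s v x = norm x powr s * v (- ln (norm x))"

lemma rad_has_derivative:
  fixes x :: "real ^ 'n::finite"
  assumes x: "x \<noteq> 0" and v: "(v has_real_derivative v') (at (- ln (norm x)))"
  shows "(rad s v has_derivative (\<lambda>h. (x \<bullet> h) * (norm x powr (s - 2) * (s * v (- ln (norm x)) - v')))) (at x)"
proof -
  let ?g = "\<lambda>r. r powr s * v (- ln r)"
  have r: "norm x > 0" using x by simp
  have dl: "((\<lambda>r. - ln r) has_real_derivative - (1 / norm x)) (at (norm x))"
    using r by (auto intro!: derivative_eq_intros simp: divide_inverse)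
  have "(?g has_real_derivative (s * norm x powr (s - 1)) * v (- ln (norm x)) + (v' * - (1 / norm x)) * norm x powr s) (at (norm x))"
    by (rule DERIV_mult[OF has_real_derivative_powr[OF r] DERIV_chain2[OF v dl]])
  also have "(s * norm x powr (s - 1)) * v (- ln (norm x)) + (v' * - (1 / norm x)) * norm x powr s
      = norm x powr (s - 1) * (s * v (- ln (norm x)) - v')"
    using r by (simp add: powr_diff field_simps)
  finally have g: "(?g has_derivative (\<lambda>h. h * (norm x powr (s - 1) * (s * v (- ln (norm x)) - v')))) (at (norm x))"
    by (simp add: has_field_derivative_def mult_commute_abs)
  have n: "(norm has_derivative (\<lambda>h. (x \<bullet> h) / norm x)) (at x)"
    using has_derivative_norm[OF x] by (simp add: sgn_div_norm inner_commute divide_inverse mult.commute)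
  have "((\<lambda>x. ?g (norm x)) has_derivative (\<lambda>h. (x \<bullet> h) / norm x * (norm x powr (s - 1) * (s * v (- ln (norm x)) - v')))) (at x)"
    using has_derivative_compose[OF n g] .
  moreover have "norm x powr (s - 2) = norm x powr (s - 1) / norm x"
    using r powr_diff[of "norm x" "s - 1" 1] by simp
  ultimately show ?thesis by (simp add: rad_def[abs_def])
qed

text \<open>The exponent drops by 2: one power is lost by differentiating and one by writing the
  direction as x_i / |x|, which keeps the coordinate as a polynomial factor.\<close>

lemma pderiv_at_rad:
  fixes x :: "real ^ 'n::finite"
  assumes x: "x \<noteq> 0" and v: "\<And>t. (v has_real_derivative v1 t) (at t)"
  shows "pderiv_at i (rad s v) x = x $ i * rad (s - 2) (\<lambda>t. s * v t - v1 t) x"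
  using pderiv_at_eq(2)[OF rad_has_derivative[OF x v], of i s] by (simp add: rad_def inner_axis)

lemma rad_differentiable:
  fixes x :: "real ^ 'n::finite"
  assumes "x \<noteq> 0" "\<And>t. (v has_real_derivative v1 t) (at t)"
  shows "rad s v differentiable (at x)"
  using rad_has_derivative[OF assms] differentiable_def by blast

lemma open_punctured: "open (- {0 :: real ^ 'n::finite})"
  by (simp add: open_Compl)

lemma Ck_on_rad: "smooth1 k v \<Longrightarrow> Ck_on k (- {0}) (rad s v :: real ^ 'n::finite \<Rightarrow> real)"
proof (induction k arbitrary: v s)
  case 0
  then show ?case
    unfolding rad_def[abs_def]
    by (auto intro!: continuous_intros continuous_on_compose2[of UNIV v])
next
  case (Suc k)
  then obtain v1 where v1: "\<And>t. (v has_real_derivative v1 t) (at t)" "smooth1 k v1" by auto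
  have "Ck_on k (- {0}) (pderiv_at i (rad s v :: real ^ 'n \<Rightarrow> real))
     \<longleftrightarrow> Ck_on k (- {0}) (\<lambda>x :: real ^ 'n. x $ i * rad (s - 2) (\<lambda>t. s * v t - v1 t) x)" for i
    by (rule Ck_on_cong[OF open_punctured]) (use pderiv_at_rad[OF _ v1(1)] in auto)
  moreover have "smooth1 k (\<lambda>t. s * v t - v1 t)"
    using Suc.prems v1(2) smooth1_Suc_imp by (intro smooth1_diff smooth1_cmult)
  then have "Ck_on k (- {0}) (\<lambda>x :: real ^ 'n. x $ i * rad (s - 2) (\<lambda>t. s * v t - v1 t) x)" for i
    by (intro Ck_on_coord_mult[OF open_punctured] Suc.IH)
  moreover have "(rad s v :: real ^ 'n \<Rightarrow> real) differentiable_on - {0}"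
    using rad_differentiable[OF _ v1(1)] by (auto simp: differentiable_on_eq_differentiable_at[OF open_punctured])
  ultimately show ?case by simp
qed

lemma smooth1_radial_profile:
  fixes w :: "real ^ 'n::finite \<Rightarrow> real"
  shows "Ck_on k (- {0}) w \<Longrightarrow> smooth1 k (\<lambda>t. w (exp (- t) *\<^sub>R axis i 1))"
proof (induction k arbitrary: w)
  case 0
  then show ?case
    by (auto intro!: continuous_on_compose2[of "- {0}" w] continuous_intros simp: axis_eq_0_iff)
next
  case (Suc k)
  have D: "((\<lambda>t. w (exp (- t) *\<^sub>R axis i 1)) has_real_derivative
      (-1) * exp ((-1) * t) * pderiv_at i w (exp (- t) *\<^sub>R axis i 1)) (at t)" for t
  proof -
    let ?x = "exp (- t) *\<^sub>R axis i 1 :: real ^ 'n"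
    have "?x \<in> - {0}" by (simp add: axis_eq_0_iff)
    then obtain w' where w': "(w has_derivative w') (at ?x)"
      using Suc.prems has_derivative_of_differentiable_on[OF open_punctured] by (metis Ck_on.simps(2))
    have c: "((\<lambda>t. exp (- t) *\<^sub>R axis i 1 :: real ^ 'n) has_derivative (\<lambda>h. (- exp (- t) * h) *\<^sub>R axis i 1)) (at t)"
      by (auto intro!: derivative_eq_intros)
    have "((\<lambda>t. w (exp (- t) *\<^sub>R axis i 1)) has_derivative (\<lambda>h. w' ((- exp (- t) * h) *\<^sub>R axis i 1))) (at t)"
      by (rule has_derivative_compose[OF c w'])
    moreover have "(\<lambda>h. w' ((- exp (- t) * h) *\<^sub>R axis i 1)) = (*) ((-1) * exp ((-1) * t) * pderiv_at i w ?x)"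
      using linear_scale[OF has_derivative_linear[OF w']] linear_neg[OF has_derivative_linear[OF w']]
        pderiv_at_eq(2)[OF w'] by (auto simp: fun_eq_iff)
    ultimately show ?thesis by (simp add: has_field_derivative_def)
  qed
  have "smooth1 k (\<lambda>t. (-1) * exp ((-1) * t) * pderiv_at i w (exp (- t) *\<^sub>R axis i 1))"
    using Suc by (intro smooth1_mult smooth1_exp smooth1_const) auto
  then show ?case using D unfolding smooth1.simps by (intro exI conjI allI)
qed

lemma norm_sq_rad:
  fixes x :: "real ^ 'n::finite"
  assumes "x \<noteq> 0" shows "(norm x)\<^sup>2 * rad (s - 2) v x = rad s v x"
  using assms by (simp add: rad_def powr_diff)

text \<open>For the field x times a radial function the divergence is n plus the Euler operator r
  d/dr, and on the profile of \<open>rad s\<close> that operator acts as s - d/dt.\<close>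

lemma divg_radial_field:
  fixes x :: "real ^ 'n::finite"
  assumes x: "x \<noteq> 0" and z: "\<And>t. (z has_real_derivative z1 t) (at t)"
    and F: "\<And>y i. y \<noteq> 0 \<Longrightarrow> F y $ i = y $ i * rad s z y"
  shows "divg F x = rad s (\<lambda>t. (real CARD('n) + s) * z t - z1 t) x"
proof -
  have "pderiv_at i (\<lambda>y. F y $ i) x = rad s z x + (x $ i)\<^sup>2 * rad (s - 2) (\<lambda>t. s * z t - z1 t) x" for i
  proof -
    have "pderiv_at i (\<lambda>y. F y $ i) x = pderiv_at i (\<lambda>y. y $ i * rad s z y) x"
      by (rule pderiv_at_cong[OF open_punctured]) (use x F in auto)
    then show ?thesis
      using pderiv_at_coord_mult(1)[OF rad_differentiable[OF x z], of i i s] pderiv_at_rad[OF x z, of i s]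
      by (simp add: power2_eq_square)
  qed
  then have "divg F x = (\<Sum>i\<in>(UNIV :: 'n set). rad s z x) + (\<Sum>i\<in>UNIV. (x $ i)\<^sup>2 * rad (s - 2) (\<lambda>t. s * z t - z1 t) x)"
    unfolding divg_def by (simp add: sum.distrib)
  also have "(\<Sum>i\<in>UNIV. (x $ i)\<^sup>2 * rad (s - 2) (\<lambda>t. s * z t - z1 t) x) = (norm x)\<^sup>2 * rad (s - 2) (\<lambda>t. s * z t - z1 t) x"
    by (simp add: norm_vec_def L2_set_def sum_nonneg sum_distrib_right)
  also have "\<dots> = rad s (\<lambda>t. s * z t - z1 t) x" by (rule norm_sq_rad[OF x])
  finally show ?thesis by (simp add: rad_def algebra_simps)
qed

lemma grad_rad:
  fixes x :: "real ^ 'n::finite"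
  assumes "x \<noteq> 0" "\<And>t. (v has_real_derivative v1 t) (at t)"
  shows "grad (rad s v) x $ i = x $ i * rad (s - 2) (\<lambda>t. s * v t - v1 t) x"
  unfolding grad_def using pderiv_at_rad[OF assms] by simp

lemma norm_grad_rad:
  fixes x :: "real ^ 'n::finite"
  assumes "x \<noteq> 0" "\<And>t. (v has_real_derivative v1 t) (at t)"
  shows "(norm (grad (rad s v) x))\<^sup>2 = (rad (s - 1) (\<lambda>t. s * v t - v1 t) x)\<^sup>2"
proof -
  have "grad (rad s v) x = rad (s - 2) (\<lambda>t. s * v t - v1 t) x *\<^sub>R x"
    by (simp add: vec_eq_iff grad_rad[OF assms])
  then have "norm (grad (rad s v) x) = \<bar>rad (s - 2) (\<lambda>t. s * v t - v1 t) x\<bar> * norm x" by simp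
  also have "\<dots> = \<bar>rad (s - 1) (\<lambda>t. s * v t - v1 t) x\<bar>"
  proof -
    have "norm x powr (s - 2) * norm x = norm x powr (s - 1)"
      using assms(1) powr_add[of "norm x" "s - 2" 1] by simp
    then show ?thesis by (simp add: rad_def abs_mult mult_ac)
  qed
  finally show ?thesis by simp
qed

lemma laplacian_rad:
  fixes x :: "real ^ 'n::finite"
  assumes x: "x \<noteq> 0" and v: "\<And>t. (v has_real_derivative v1 t) (at t)" "\<And>t. (v1 has_real_derivative v2 t) (at t)"
  shows "laplacian (rad s v) x = rad (s - 2) (\<lambda>t. v2 t - (2 * s + real CARD('n) - 2) * v1 t
     + s * (s + real CARD('n) - 2) * v t) x"
proof -
  have z: "((\<lambda>t. s * v t - v1 t) has_real_derivative s * v1 t - v2 t) (at t)" for t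
    by (intro DERIV_diff DERIV_cmult v)
  have "divg (grad (rad s v)) x = rad (s - 2) (\<lambda>t. (real CARD('n) + (s - 2)) * (s * v t - v1 t) - (s * v1 t - v2 t)) x"
    by (rule divg_radial_field[OF x z]) (rule grad_rad[OF _ v(1)])
  then show ?thesis unfolding laplacian_def by (simp add: rad_def algebra_simps)
qed

lemma laplacian_cong:
  fixes u w :: "real ^ 'n::finite \<Rightarrow> real"
  assumes "open S" "x \<in> S" "\<And>y. y \<in> S \<Longrightarrow> u y = w y"
  shows "laplacian u x = laplacian w x"
  unfolding laplacian_def divg_def
proof (rule sum.cong[OF refl])
  fix i
  show "pderiv_at i (\<lambda>y. grad u y $ i) x = pderiv_at i (\<lambda>y. grad w y $ i) x"
    by (rule pderiv_at_cong[OF assms(1,2)]) (simp add: grad_def pderiv_at_cong[OF assms(1) _ assms(3)])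
qed

lemma rad_mult_powr:
  fixes x :: "real ^ 'n::finite"
  shows "norm x powr r * rad s v x = rad (r + s) v x"
  by (simp add: rad_def powr_add)

text \<open>Throughout, \<open>a = (n - 4 - \<alpha>) / 2\<close> and \<open>b = (n + \<alpha>) / 2\<close>, that is
  \<open>n = a + b + 2\<close> and \<open>\<alpha> = b - a - 2\<close>.\<close>

lemma radial_operator:
  fixes x :: "real ^ 'n::finite" and v v1 v2 v3 v4 :: "real \<Rightarrow> real"
  assumes n: "real CARD('n) = a + b + 2" and x: "x \<noteq> 0"
    and D: "\<And>t. (v has_real_derivative v1 t) (at t)" "\<And>t. (v1 has_real_derivative v2 t) (at t)"
      "\<And>t. (v2 has_real_derivative v3 t) (at t)" "\<And>t. (v3 has_real_derivative v4 t) (at t)"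
    and u: "\<And>y. y \<noteq> 0 \<Longrightarrow> u y = rad (- a) v y"
  shows "laplacian (\<lambda>y. norm y powr (- (b - a - 2)) * laplacian u y) x
      + lam * divg (\<lambda>y. norm y powr (- (b - a - 2) - 2) *\<^sub>R grad u y) x
      + \<mu> * norm x powr (- (b - a - 2) - 4) * u x
    = rad (- b - 2) (\<lambda>t. v4 t - (a\<^sup>2 + b\<^sup>2 - lam) * v2 t + (a\<^sup>2 * b\<^sup>2 - lam * a\<^sup>2 + \<mu>) * v t) x"
proof -
  \<comment> \<open>The profile of the inner Laplacian, (D - b) (D + a) v. The outer one acts as (D
    + b) (D - a), which together gives (D^2 - a^2) (D^2 - b^2); the divergence term contributes
    \<open>lam\<close> times D^2 - a^2.\<close>
  let ?w = "\<lambda>t. v2 t - (b - a) * v1 t - a * b * v t"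
  let ?w1 = "\<lambda>t. v3 t - (b - a) * v2 t - a * b * v1 t"
  let ?w2 = "\<lambda>t. v4 t - (b - a) * v3 t - a * b * v2 t"
  have w: "(?w has_real_derivative ?w1 t) (at t)" "(?w1 has_real_derivative ?w2 t) (at t)" for t
    by (intro DERIV_diff DERIV_cmult D)+
  have lap: "laplacian u y = rad (- a - 2) ?w y" if y: "y \<noteq> 0" for y
  proof -
    have "laplacian u y = laplacian (rad (- a) v) y"
      by (rule laplacian_cong[OF open_punctured]) (use y u in auto)
    also have "\<dots> = rad (- a - 2) ?w y"
      unfolding laplacian_rad[OF y D(1,2)] n by (simp add: algebra_simps)
    finally show ?thesis .
  qed
  have "laplacian (\<lambda>y. norm y powr (- (b - a - 2)) * laplacian u y) x = laplacian (rad (- b) ?w) x"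
    by (rule laplacian_cong[OF open_punctured]) (use x lap in \<open>auto simp: rad_mult_powr\<close>)
  also have "\<dots> = rad (- b - 2) (\<lambda>t. ?w2 t + (b - a) * ?w1 t - a * b * ?w t) x"
    unfolding laplacian_rad[OF x w] n by (simp add: algebra_simps)
  finally have 1: "laplacian (\<lambda>y. norm y powr (- (b - a - 2)) * laplacian u y) x
    = rad (- b - 2) (\<lambda>t. ?w2 t + (b - a) * ?w1 t - a * b * ?w t) x" .
  have "divg (\<lambda>y. norm y powr (- (b - a - 2) - 2) *\<^sub>R grad u y) x
    = rad (- b - 2) (\<lambda>t. (real CARD('n) + (- b - 2)) * (- a * v t - v1 t) - (- a * v1 t - v2 t)) x"
  proof (rule divg_radial_field[OF x])
    show "((\<lambda>t. - a * v t - v1 t) has_real_derivative - a * v1 t - v2 t) (at t)" for t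
      by (intro DERIV_diff DERIV_cmult D)
    fix y :: "real ^ 'n" and i assume y: "y \<noteq> 0"
    have "grad u y $ i = pderiv_at i (rad (- a) v) y"
      unfolding grad_def by (simp, rule pderiv_at_cong[OF open_punctured]) (use y u in auto)
    also have "\<dots> = y $ i * rad (- a - 2) (\<lambda>t. - a * v t - v1 t) y"
      using pderiv_at_rad[OF y D(1), of i "- a"] by simp
    finally show "(norm y powr (- (b - a - 2) - 2) *\<^sub>R grad u y) $ i
        = y $ i * rad (- b - 2) (\<lambda>t. - a * v t - v1 t) y"
      using rad_mult_powr[of y "- (b - a - 2) - 2" "- a - 2"] by (simp add: mult.left_commute)
  qed
  then have 2: "divg (\<lambda>y. norm y powr (- (b - a - 2) - 2) *\<^sub>R grad u y) x
    = rad (- b - 2) (\<lambda>t. v2 t - a\<^sup>2 * v t) x"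
    unfolding n by (simp add: algebra_simps power2_eq_square)
  have 3: "norm x powr (- (b - a - 2) - 4) * u x = rad (- b - 2) v x"
    using u[OF x] rad_mult_powr[of x "- (b - a - 2) - 4" "- a" v] by simp
  show ?thesis
    unfolding 1 2 mult.assoc 3 rad_def by (simp add: algebra_simps power2_eq_square)
qed

text \<open>The relation for \<beta> is the critical hyperbola. It makes both sides carry the same
  power |x|^(-b-2), which cancels and leaves an autonomous equation.\<close>

lemma equation_iff_ode:
  fixes x :: "real ^ 'n::finite" and v v1 v2 v3 v4 :: "real \<Rightarrow> real"
  assumes n: "real CARD('n) = a + b + 2" and x: "x \<noteq> 0" and \<beta>: "\<beta> = a * p - b - 2"
    and D: "\<And>t. (v has_real_derivative v1 t) (at t)" "\<And>t. (v1 has_real_derivative v2 t) (at t)"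
      "\<And>t. (v2 has_real_derivative v3 t) (at t)" "\<And>t. (v3 has_real_derivative v4 t) (at t)"
    and u: "\<And>y. y \<noteq> 0 \<Longrightarrow> u y = rad (- a) v y" and pos: "\<And>t. v t > 0"
  shows "laplacian (\<lambda>y. norm y powr (- (b - a - 2)) * laplacian u y) x
      + lam * divg (\<lambda>y. norm y powr (- (b - a - 2) - 2) *\<^sub>R grad u y) x
      + \<mu> * norm x powr (- (b - a - 2) - 4) * u x = norm x powr \<beta> * u x powr p
    \<longleftrightarrow> v4 (- ln (norm x)) = (a\<^sup>2 + b\<^sup>2 - lam) * v2 (- ln (norm x))
      - (a\<^sup>2 * b\<^sup>2 - lam * a\<^sup>2 + \<mu>) * v (- ln (norm x)) + v (- ln (norm x)) powr p"
    (is "?L = ?R \<longleftrightarrow> _")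
proof -
  have op: "?L = rad (- b - 2) (\<lambda>t. v4 t - (a\<^sup>2 + b\<^sup>2 - lam) * v2 t + (a\<^sup>2 * b\<^sup>2 - lam * a\<^sup>2 + \<mu>) * v t) x"
    by (rule radial_operator[OF n x D]) (rule u)
  have R: "?R = norm x powr (- b - 2) * v (- ln (norm x)) powr p"
    using x u[OF x] \<beta> by (simp add: rad_def powr_mult powr_powr powr_add[symmetric] mult.assoc[symmetric])
  have nz: "norm x powr (- b - 2) \<noteq> 0" using x by simp
  have iff: "X - A * Y + B * Z = W \<longleftrightarrow> X = A * Y - B * Z + W" for A B X Y Z W :: real
    by (auto simp: algebra_simps)
  show ?thesis
    unfolding op rad_def R mult_cancel_left using nz iff by simp
qed

section \<open>Integration of radial functions\<close>

lemma measurable_log_norm [measurable]: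
  "(\<lambda>x :: real ^ 'n::finite. - ln (norm x)) \<in> borel_measurable borel"
  by measurable

text \<open>Polar coordinates reduce to the image of Lebesgue measure under \<open>t = - ln |x|\<close>, which is
  determined by the volumes of annuli.\<close>

lemma distr_log_norm:
  fixes V :: real
  defines "V \<equiv> unit_ball_vol (real CARD('n::finite))"
  shows "distr (lborel :: (real ^ 'n) measure) borel (\<lambda>x. - ln (norm x))
    = density lborel (\<lambda>t. ennreal (real CARD('n) * V * exp (- real CARD('n) * t)))" (is "?M = ?N")
proof -
  let ?n = "real CARD('n)" and ?L = "\<lambda>x :: real ^ 'n. - ln (norm x)"
  have V: "V \<ge> 0" by (simp add: V_def)
  have DIM: "DIM(real ^ 'n) = CARD('n)" by simp
  have n0: "?n > 0" by simp
  have M: "emeasure ?M {c<..d} = ennreal (V * exp (- ?n * c) - V * exp (- ?n * d))" if "c \<le> d" for c d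
  proof -
    have "emeasure ?M {c<..d} = emeasure lborel (?L -` {c<..d})"
      by (subst emeasure_distr) auto
    \<comment> \<open>Half-open intervals correspond to differences of open balls. The origin, where
      the logarithm has only a default value, is a null set.\<close>
    also have "\<dots> = emeasure lborel (ball (0 :: real ^ 'n) (exp (- c)) - ball 0 (exp (- d)))"
    proof (rule emeasure_eq_AE)
      show "AE x in lborel. x \<in> ?L -` {c<..d} \<longleftrightarrow> x \<in> ball 0 (exp (- c)) - ball 0 (exp (- d))"
        using AE_lborel_singleton[of 0]
      proof eventually_elim
        case (elim x)
        then have "exp (ln (norm x)) = norm x" by simp
        then have "norm x < exp (- c) \<longleftrightarrow> ln (norm x) < - c" "norm x < exp (- d) \<longleftrightarrow> ln (norm x) < - d"
          by (metis exp_less_cancel_iff)+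
        then show ?case by (auto simp: dist_norm)
      qed
    qed (use measurable_sets_borel[OF measurable_log_norm, of "{c<..d}"] in auto)
    also have "\<dots> = emeasure lborel (ball (0 :: real ^ 'n) (exp (- c))) - emeasure lborel (ball (0 :: real ^ 'n) (exp (- d)))"
      by (rule emeasure_Diff) (use that in \<open>auto simp: emeasure_ball intro!: subset_ball\<close>)
    also have "\<dots> = ennreal (V * exp (- ?n * c) - V * exp (- ?n * d))"
      using V by (simp add: emeasure_ball V_def ennreal_minus exp_of_nat_mult[symmetric])
    finally show ?thesis .
  qed
  have N: "emeasure ?N {c<..d} = ennreal (V * exp (- ?n * c) - V * exp (- ?n * d))" if "c \<le> d" for c d
  proof -
    have "emeasure ?N {c<..d} = (\<integral>\<^sup>+t. ennreal (?n * V * exp (- ?n * t)) * indicator {c<..d} t \<partial>lborel)"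
      by (subst emeasure_density) auto
    also have "\<dots> = (\<integral>\<^sup>+t. ennreal (?n * V * exp (- ?n * t)) * indicator {c..d} t \<partial>lborel)"
    proof (rule nn_integral_cong_AE)
      show "AE t in lborel. ennreal (?n * V * exp (- ?n * t)) * indicator {c<..d} t
          = ennreal (?n * V * exp (- ?n * t)) * indicator {c..d} t"
        using AE_lborel_singleton[of c] by eventually_elim (auto simp: indicator_def)
    qed
    also have "\<dots> = ennreal (- (V * exp (- ?n * d)) - - (V * exp (- ?n * c)))"
    proof (rule nn_integral_FTC_Icc)
      show "((\<lambda>t. - (V * exp (- ?n * t))) has_real_derivative ?n * V * exp (- ?n * t)) (at t)" for t
        by (auto intro!: derivative_eq_intros)
    qed (use that V in \<open>auto intro: mult_nonneg_nonneg\<close>)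
    finally show ?thesis by simp
  qed
  show ?thesis
  proof (rule measure_eqI_generator_eq[where E = "range (\<lambda>(c, d). {c<..d::real})" and \<Omega> = UNIV
        and A = "\<lambda>i. {- real i<..real i}"])
    show "Int_stable (range (\<lambda>(c, d). {c<..d::real}))"
      by (auto simp: Int_stable_def Int_greaterThanAtMost)
    show "sets ?M = sigma_sets UNIV (range (\<lambda>(c, d). {c<..d::real}))"
      by (simp add: borel_sigma_sets_Ioc)
    show "sets ?N = sigma_sets UNIV (range (\<lambda>(c, d). {c<..d::real}))"
      by (simp add: borel_sigma_sets_Ioc)
    show "emeasure ?M X = emeasure ?N X" if "X \<in> range (\<lambda>(c, d). {c<..d::real})" for X
    proof -
      from that obtain c d where X: "X = {c<..d}" by auto
      show ?thesis
      proof (cases "c \<le> d")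
        case True
        then show ?thesis unfolding X using M N by simp
      qed (simp add: X)
    qed
    show "(\<Union>i. {- real i<..real i}) = UNIV"
    proof (intro equalityI subsetI UNIV_I)
      fix t :: real
      obtain j where "\<bar>t\<bar> < real j" using reals_Archimedean2 by blast
      then have "t \<in> {- real j<..real j}" by auto
      then show "t \<in> (\<Union>i. {- real i<..real i})" by blast
    qed
    show "emeasure ?M {- real i<..real i} \<noteq> \<infinity>" for i by (subst M) auto
  qed auto
qed

text \<open>The weight |x|^(-n) cancels the density exp (- n t) of the image measure, so q is
  integrated against Lebesgue measure; the constant is the area of the unit sphere.\<close>

lemma radial_integral:
  fixes q :: "real \<Rightarrow> real" and f :: "real ^ 'n::finite \<Rightarrow> real"
  assumes q: "q \<in> borel_measurable borel" and fm: "f \<in> borel_measurable borel"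
    and f: "\<And>x. x \<noteq> 0 \<Longrightarrow> f x = norm x powr (- real CARD('n)) * q (- ln (norm x))"
  shows "integrable lborel f \<longleftrightarrow> integrable lborel q"
    and "(LINT x|lborel. f x) = real CARD('n) * unit_ball_vol (real CARD('n)) * (LINT t|lborel. q t)"
proof -
  let ?n = "real CARD('n)" and ?V = "unit_ball_vol (real CARD('n))"
  let ?L = "\<lambda>x :: real ^ 'n. - ln (norm x)" and ?d = "\<lambda>t. ?n * ?V * exp (- ?n * t)" and ?g = "\<lambda>t. exp (?n * t) * q t"
  have [measurable]: "q \<in> borel_measurable borel" "f \<in> borel_measurable borel" by fact+
  have nV: "?n * ?V > 0" by simp
  have AE: "AE x in lborel. f x = ?g (?L x)"
    using AE_lborel_singleton[of 0]
  proof eventually_elim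
    case (elim x)
    then show ?case by (simp add: f powr_def)
  qed
  have dg: "?d t *\<^sub>R ?g t = ?n * ?V * q t" for t
  proof -
    have "exp (- ?n * t) * exp (?n * t) = 1" by (simp add: exp_add[symmetric])
    then show ?thesis by (metis (no_types) mult.assoc mult_1 real_scaleR_def)
  qed
  have dm: "?d \<in> borel_measurable lborel" "?g \<in> borel_measurable lborel" "?g \<in> borel_measurable borel" by measurable
  have d0: "AE t in lborel. 0 \<le> ?d t" using nV by (intro AE_I2 mult_nonneg_nonneg) auto
  have "integrable lborel f \<longleftrightarrow> integrable lborel (\<lambda>x. ?g (?L x))"
    by (rule integrable_cong_AE) (use AE in auto)
  also have "\<dots> \<longleftrightarrow> integrable (distr lborel borel ?L) ?g"
    by (rule integrable_distr_eq[symmetric]) measurable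
  also have "\<dots> \<longleftrightarrow> integrable lborel (\<lambda>t. ?d t *\<^sub>R ?g t)"
    unfolding distr_log_norm by (rule integrable_density[OF dm(2,1) d0])
  also have "\<dots> \<longleftrightarrow> integrable lborel q"
    unfolding dg using nV by (metis integrable_mult_left_iff less_irrefl)
  finally show "integrable lborel f \<longleftrightarrow> integrable lborel q" .
  have "(LINT x|lborel. f x) = (LINT x|lborel. ?g (?L x))"
    by (rule integral_cong_AE) (use AE in auto)
  also have "\<dots> = integral\<^sup>L (distr lborel borel ?L) ?g"
    by (rule integral_distr[symmetric]) measurable
  also have "\<dots> = (LINT t|lborel. ?d t *\<^sub>R ?g t)"
    unfolding distr_log_norm by (rule integral_density[OF dm(2,1) d0])
  also have "\<dots> = ?n * ?V * (LINT t|lborel. q t)" unfolding dg by simp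
  finally show "(LINT x|lborel. f x) = ?n * ?V * (LINT t|lborel. q t)" .
qed

section \<open>The norm of radial functions\<close>

lemma compact_support_integrable:
  fixes g :: "real \<Rightarrow> real"
  assumes "continuous_on UNIV g" "\<And>t. \<bar>t\<bar> > R \<Longrightarrow> g t = 0"
  shows "integrable lborel g"
proof -
  have "integrable lborel (\<lambda>t. indicator {-R..R} t *\<^sub>R g t)"
    by (rule borel_integrable_compact) (use assms(1) continuous_on_subset in auto)
  also have "(\<lambda>t. indicator {-R..R} t *\<^sub>R g t) = g"
  proof
    fix t
    show "indicator {-R..R} t *\<^sub>R g t = g t"
    proof (cases "\<bar>t\<bar> > R")
      case True
      then show ?thesis using assms(2) by simp
    next
      case False
      then have "t \<in> {-R..R}" by auto
      then show ?thesis by simp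
    qed
  qed
  finally show ?thesis .
qed

lemma compact_support_deriv:
  fixes f :: "real \<Rightarrow> real"
  assumes D: "\<And>t. (f has_real_derivative f' t) (at t)" and z: "\<And>t. \<bar>t\<bar> > R \<Longrightarrow> f t = 0" and t: "\<bar>t\<bar> > R"
  shows "f' t = 0"
proof -
  have "open {t :: real. \<bar>t\<bar> > R}" by (intro open_Collect_less continuous_intros)
  then have "((\<lambda>_. 0) has_real_derivative f' t) (at t)"
    using has_field_derivative_transform_within_open[OF D, of "{t. \<bar>t\<bar> > R}" t "\<lambda>_. 0"] t z by auto
  then show ?thesis using DERIV_const DERIV_unique by blast
qed

lemma integral_deriv_compact_support:
  fixes f :: "real \<Rightarrow> real"
  assumes D: "\<And>t. (f has_real_derivative f' t) (at t)" and c: "continuous_on UNIV f'"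
    and z: "\<And>t. \<bar>t\<bar> > R \<Longrightarrow> f t = 0"
  shows "(LINT t|lborel. f' t) = 0"
proof -
  let ?S = "\<bar>R\<bar> + 1"
  have "(LINT t|lborel. f' t * indicator {-?S..?S} t) = f ?S - f (- ?S)"
    by (rule integral_FTC_Icc_real) (use D c in \<open>auto simp: continuous_on_eq_continuous_at\<close>)
  also have "\<dots> = 0" using z by simp
  also have "(\<lambda>t. f' t * indicator {-?S..?S} t) = f'"
  proof
    fix t show "f' t * indicator {-?S..?S} t = f' t"
    proof (cases "\<bar>t\<bar> > R")
      case True
      then show ?thesis using compact_support_deriv[OF D z] by simp
    next
      case False
      then have "t \<in> {-?S..?S}" by auto
      then show ?thesis by simp
    qed
  qed
  finally show ?thesis .
qed

definition profile_energy ::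
  "real \<Rightarrow> real \<Rightarrow> (real \<Rightarrow> real) \<Rightarrow> (real \<Rightarrow> real) \<Rightarrow> (real \<Rightarrow> real) \<Rightarrow> real" where
  "profile_energy A B v v1 v2 = (LINT t|lborel. (v2 t)\<^sup>2 + A * (v1 t)\<^sup>2 + B * (v t)\<^sup>2)"

lemma profile_integrand:
  fixes v :: "real \<Rightarrow> real"
  assumes D: "\<And>t. (v has_real_derivative v1 t) (at t)" "\<And>t. (v1 has_real_derivative v2 t) (at t)"
    and c2: "continuous_on UNIV v2" and z: "\<And>t. \<bar>t\<bar> > R \<Longrightarrow> v t = 0"
  shows "continuous_on UNIV v" "continuous_on UNIV v1" "\<And>t. \<bar>t\<bar> > R \<Longrightarrow> v1 t = 0" "\<And>t. \<bar>t\<bar> > R \<Longrightarrow> v2 t = 0"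
    "integrable lborel (\<lambda>t. (v2 t)\<^sup>2 + A * (v1 t)\<^sup>2 + B * (v t)\<^sup>2)"
proof -
  show c: "continuous_on UNIV v" "continuous_on UNIV v1"
    using D has_field_derivative_at_within by (blast intro: DERIV_continuous_on)+
  show z1: "\<And>t. \<bar>t\<bar> > R \<Longrightarrow> v1 t = 0" by (rule compact_support_deriv[OF D(1) z])
  show z2: "\<And>t. \<bar>t\<bar> > R \<Longrightarrow> v2 t = 0" by (rule compact_support_deriv[OF D(2) z1])
  show "integrable lborel (\<lambda>t. (v2 t)\<^sup>2 + A * (v1 t)\<^sup>2 + B * (v t)\<^sup>2)"
    by (rule compact_support_integrable[where R = R])
       (use z z1 z2 in \<open>auto intro!: continuous_intros c c2\<close>)
qed

text \<open>The cross terms form the derivative of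
  \<open>- (b - a) v'\<^sup>2 + (a b (b - a) - lam a) v\<^sup>2 - 2 a b v v'\<close>.\<close>

lemma norm_alpha_rad:
  fixes v :: "real \<Rightarrow> real"
  assumes n: "real CARD('n::finite) = a + b + 2"
    and D: "\<And>t. (v has_real_derivative v1 t) (at t)" "\<And>t. (v1 has_real_derivative v2 t) (at t)"
    and c2: "continuous_on UNIV v2" and z: "\<And>t. \<bar>t\<bar> > R \<Longrightarrow> v t = 0"
  shows "norm_alpha (b - a - 2) lam \<mu> (rad (- a) v :: real ^ 'n \<Rightarrow> real)
    = sqrt (real CARD('n) * unit_ball_vol (real CARD('n))
       * profile_energy (a\<^sup>2 + b\<^sup>2 - lam) (a\<^sup>2 * b\<^sup>2 - lam * a\<^sup>2 + \<mu>) v v1 v2)"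
proof -
  note P = profile_integrand[OF D c2 z]
  let ?q = "\<lambda>t. (v2 t - (b - a) * v1 t - a * b * v t)\<^sup>2 - lam * (- a * v t - v1 t)\<^sup>2 + \<mu> * (v t)\<^sup>2"
  let ?E = "\<lambda>t. (v2 t)\<^sup>2 + (a\<^sup>2 + b\<^sup>2 - lam) * (v1 t)\<^sup>2 + (a\<^sup>2 * b\<^sup>2 - lam * a\<^sup>2 + \<mu>) * (v t)\<^sup>2"
  let ?H = "\<lambda>t. - (b - a) * (v1 t)\<^sup>2 + (a * b * (b - a) - lam * a) * (v t)\<^sup>2 - 2 * a * b * (v t * v1 t)"
  let ?H' = "\<lambda>t. - (b - a) * (2 * (v1 t * v2 t)) + (a * b * (b - a) - lam * a) * (2 * (v t * v1 t))
    - 2 * a * b * (v1 t * v1 t + v t * v2 t)"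
  let ?f = "\<lambda>x :: real ^ 'n. norm x powr (- (b - a - 2)) * (laplacian (rad (- a) v) x)\<^sup>2
     - lam * norm x powr (- (b - a - 2) - 2) * (norm (grad (rad (- a) v) x))\<^sup>2
     + \<mu> * norm x powr (- (b - a - 2) - 4) * (rad (- a) v x)\<^sup>2"
  have qc: "continuous_on UNIV ?q" by (intro continuous_intros P c2)
  \<comment> \<open>The identity also holds at the origin, where all powers vanish by
    \<open>0 powr r = 0\<close>.\<close>
  have f: "?f x = norm x powr (- real CARD('n)) * ?q (- ln (norm x))" for x
  proof (cases "x = 0")
    case False
    have sq: "norm x powr r * (rad s w x)\<^sup>2 = norm x powr (r + 2 * s) * (w (- ln (norm x)))\<^sup>2" for r s w
    proof -
      have "(norm x powr s)\<^sup>2 = norm x powr (2 * s)"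
        by (simp add: power2_eq_square powr_add[symmetric])
      then show ?thesis by (simp add: rad_def power_mult_distrib powr_add)
    qed
    have lap: "laplacian (rad (- a) v) x = rad (- a - 2) (\<lambda>t. v2 t - (b - a) * v1 t - a * b * v t) x"
      unfolding laplacian_rad[OF False D] n by (simp add: algebra_simps)
    have e: "- (b - a - 2) + 2 * (- a - 2) = - (a + b + 2)" "- (b - a - 2) - 2 + 2 * (- a - 1) = - (a + b + 2)"
       "- (b - a - 2) - 4 + 2 * (- a) = - (a + b + 2)" by simp_all
    show ?thesis
      unfolding lap norm_grad_rad[OF False D(1)] mult.assoc sq n e by (simp add: algebra_simps)
  qed simp
  have qm: "?q \<in> borel_measurable borel" by (rule borel_measurable_continuous_onI[OF qc])
  have "?f \<in> borel_measurable borel" unfolding f using qm by measurable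
  from radial_integral(2)[OF qm this] f
  have "(LINT x|lborel. ?f x) = real CARD('n) * unit_ball_vol (real CARD('n)) * (LINT t|lborel. ?q t)" by blast
  moreover have "(LINT t|lborel. ?q t) = (LINT t|lborel. ?E t)"
  proof -
    have dH: "(?H has_real_derivative ?H' t) (at t)" for t
      by (auto intro!: derivative_eq_intros D simp: algebra_simps)
    have cH: "continuous_on UNIV ?H'" by (intro continuous_intros P c2)
    have "(LINT t|lborel. ?H' t) = 0"
      by (rule integral_deriv_compact_support[OF dH cH, of R]) (use z P(3) in simp)
    moreover have "integrable lborel ?H'"
      by (rule compact_support_integrable[OF cH, of R]) (use z P(3) in simp)
    moreover have "(\<lambda>t. ?q t) = (\<lambda>t. ?E t + ?H' t)"
      by (simp add: fun_eq_iff algebra_simps power2_eq_square)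
    ultimately show ?thesis using P(5) by simp
  qed
  ultimately show ?thesis unfolding norm_alpha_def profile_energy_def by simp
qed

text \<open>The one-dimensional Sobolev inequality: v^2 is the integral of 2 v v' from a point
  outside the support, and 2 v v' <= v^2 + v'^2 is controlled by the energy as A and B are
  positive.\<close>

lemma profile_sup_bound:
  fixes v :: "real \<Rightarrow> real"
  assumes D: "\<And>t. (v has_real_derivative v1 t) (at t)" "\<And>t. (v1 has_real_derivative v2 t) (at t)"
    and c2: "continuous_on UNIV v2" and z: "\<And>t. \<bar>t\<bar> > R \<Longrightarrow> v t = 0" and AB: "A > 0" "B > 0"
  shows "min A B * (v t)\<^sup>2 \<le> profile_energy A B v v1 v2"
proof -
  note P = profile_integrand[OF D c2 z]
  let ?S = "- \<bar>R\<bar> - \<bar>t\<bar> - 1"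
  have e0: "0 \<le> (v2 s)\<^sup>2 + A * (v1 s)\<^sup>2 + B * (v s)\<^sup>2" for s using AB by simp
  have c: "continuous_on UNIV (\<lambda>s. 2 * (v s * v1 s))" by (intro continuous_intros P)
  have "(LINT s|lborel. 2 * (v s * v1 s) * indicator {?S..t} s) = (v t)\<^sup>2 - (v ?S)\<^sup>2"
  proof (rule integral_FTC_Icc_real)
    show "((\<lambda>t. (v t)\<^sup>2) has_real_derivative 2 * (v s * v1 s)) (at s)" for s
      by (auto intro!: derivative_eq_intros D)
  qed (use c in \<open>auto simp: continuous_on_eq_continuous_at\<close>)
  also have "v ?S = 0" using z[of ?S] by simp
  finally have "min A B * (v t)\<^sup>2 = (LINT s|lborel. min A B * (2 * (v s * v1 s) * indicator {?S..t} s))"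
    by simp
  also have "\<dots> \<le> profile_energy A B v v1 v2"
    unfolding profile_energy_def
  proof (rule integral_mono'[OF P(5) _ e0])
    fix s
    have "2 * (v s * v1 s) \<le> (v s)\<^sup>2 + (v1 s)\<^sup>2" using zero_le_power2[of "v s - v1 s"] by (simp add: power2_diff)
    then have "min A B * (2 * (v s * v1 s)) \<le> min A B * ((v s)\<^sup>2 + (v1 s)\<^sup>2)" using AB by (intro mult_left_mono) auto
    also have "\<dots> = min A B * (v1 s)\<^sup>2 + min A B * (v s)\<^sup>2" by (simp add: algebra_simps)
    also have "\<dots> \<le> A * (v1 s)\<^sup>2 + B * (v s)\<^sup>2" by (intro add_mono mult_right_mono) auto
    finally have "min A B * (2 * (v s * v1 s)) \<le> (v2 s)\<^sup>2 + A * (v1 s)\<^sup>2 + B * (v s)\<^sup>2"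
      by (smt (verit) zero_le_power2)
    then show "min A B * (2 * (v s * v1 s) * indicator {?S..t} s) \<le> (v2 s)\<^sup>2 + A * (v1 s)\<^sup>2 + B * (v s)\<^sup>2"
      using e0[of s] by (simp add: indicator_def)
  qed
  finally show ?thesis .
qed

lemma norm_alpha_sup_bound:
  fixes v :: "real \<Rightarrow> real"
  assumes n: "real CARD('n::finite) = a + b + 2" and v: "smooth1 2 v" and z: "\<And>t. \<bar>t\<bar> > R \<Longrightarrow> v t = 0"
    and AB: "a\<^sup>2 + b\<^sup>2 - lam > 0" "a\<^sup>2 * b\<^sup>2 - lam * a\<^sup>2 + \<mu> > 0"
  defines "K \<equiv> sqrt (real CARD('n) * unit_ball_vol (real CARD('n)) * min (a\<^sup>2 + b\<^sup>2 - lam) (a\<^sup>2 * b\<^sup>2 - lam * a\<^sup>2 + \<mu>))"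
  shows "K * \<bar>v t\<bar> \<le> norm_alpha (b - a - 2) lam \<mu> (rad (- a) v :: real ^ 'n \<Rightarrow> real)" and "K > 0"
proof -
  let ?A = "a\<^sup>2 + b\<^sup>2 - lam" and ?B = "a\<^sup>2 * b\<^sup>2 - lam * a\<^sup>2 + \<mu>" and ?w = "real CARD('n) * unit_ball_vol (real CARD('n))"
  have w: "?w > 0" by simp
  obtain v1 v2 where D: "\<And>t. (v has_real_derivative v1 t) (at t)" "\<And>t. (v1 has_real_derivative v2 t) (at t)"
    "continuous_on UNIV v2"
    using v by (auto simp: numeral_2_eq_2)
  have "K * \<bar>v t\<bar> = sqrt (?w * (min ?A ?B * (v t)\<^sup>2))"
    unfolding K_def by (simp add: real_sqrt_mult mult.assoc)
  also have "\<dots> \<le> sqrt (?w * profile_energy ?A ?B v v1 v2)"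
    using profile_sup_bound[where R = R, OF D z AB, of t] w by (intro real_sqrt_le_mono mult_left_mono) auto
  also have "\<dots> = norm_alpha (b - a - 2) lam \<mu> (rad (- a) v :: real ^ 'n \<Rightarrow> real)"
    by (rule norm_alpha_rad[OF n D z, symmetric])
  finally show "K * \<bar>v t\<bar> \<le> norm_alpha (b - a - 2) lam \<mu> (rad (- a) v :: real ^ 'n \<Rightarrow> real)" .
  show "K > 0" unfolding K_def using AB w by (intro real_sqrt_gt_zero mult_pos_pos) auto
qed

lemma Ck_on_subset: "Ck_on k S u \<Longrightarrow> T \<subseteq> S \<Longrightarrow> Ck_on k T u"
  by (induction k arbitrary: u) (auto intro: continuous_on_subset differentiable_on_subset)

lemma test_rad_profile:
  fixes \<phi> :: "real ^ 'n::finite \<Rightarrow> real"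
  assumes \<phi>: "\<phi> \<in> test_rad"
  shows "\<exists>v R. (\<forall>k. smooth1 k v) \<and> (\<forall>t. \<bar>t\<bar> > R \<longrightarrow> v t = 0) \<and> \<phi> = rad (- a) v"
proof -
  let ?S = "closure {x. \<phi> x \<noteq> 0}"
  have smooth: "\<And>k. Ck_on k UNIV \<phi>" and comp: "compact ?S" and S0: "?S \<subseteq> - {0}"
    and radial: "\<And>x y. norm x = norm y \<Longrightarrow> \<phi> x = \<phi> y"
    using \<phi> unfolding test_rad_def by blast+
  define i :: 'n where "i = (SOME i. True)"
  define v where "v t = exp ((- a) * t) * \<phi> (exp (- t) *\<^sub>R axis i 1)" for t
  obtain M where M: "\<And>x. x \<in> ?S \<Longrightarrow> norm x \<le> M" using compact_imp_bounded[OF comp] bounded_iff by metis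
  have "open (- ?S)" "0 \<in> - ?S" using S0 by auto
  then obtain \<delta> where \<delta>: "\<delta> > 0" "ball 0 \<delta> \<subseteq> - ?S" unfolding open_contains_ball by blast
  have supp: "\<delta> \<le> norm x \<and> norm x \<le> M" if "\<phi> x \<noteq> 0" for x
  proof -
    have x: "x \<in> ?S" using closure_subset[of "{x. \<phi> x \<noteq> 0}"] that by auto
    then have "x \<notin> ball 0 \<delta>" using \<delta> by blast
    then show ?thesis using M[OF x] by simp
  qed
  have "v t = 0" if t: "\<bar>t\<bar> > \<bar>ln \<delta>\<bar> + \<bar>ln (max M 1)\<bar>" for t
  proof (rule ccontr)
    assume "v t \<noteq> 0"
    then have "\<phi> (exp (- t) *\<^sub>R axis i 1) \<noteq> 0" by (simp add: v_def)
    from supp[OF this] have 1: "\<delta> \<le> exp (- t)" "exp (- t) \<le> max M 1" by (auto simp: le_max_iff_disj)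
    have "ln \<delta> \<le> ln (exp (- t))" using 1(1) \<delta>(1) by (subst ln_le_cancel_iff) auto
    moreover have "ln (exp (- t)) \<le> ln (max M 1)" using 1(2) by (subst ln_le_cancel_iff) auto
    ultimately show False using t unfolding ln_exp by linarith
  qed
  moreover have "smooth1 k v" for k
  proof -
    have "Ck_on k (- {0}) \<phi>" by (rule Ck_on_subset[OF smooth]) simp
    then show ?thesis unfolding v_def
      by (intro smooth1_mult smooth1_exp smooth1_radial_profile)
  qed
  moreover have "\<phi> = rad (- a) v"
  proof
    fix x
    show "\<phi> x = rad (- a) v x"
    proof (cases "x = 0")
      case True
      have "\<phi> 0 = 0"
      proof (rule ccontr)
        assume "\<phi> 0 \<noteq> 0"
        then have "0 \<in> ?S" using closure_subset[of "{x. \<phi> x \<noteq> 0}"] by auto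
        then show False using S0 by blast
      qed
      then show ?thesis using True by (simp add: rad_def)
    next
      case False
      have "\<phi> (norm x *\<^sub>R axis i 1) = \<phi> x" by (rule radial) simp
      then show ?thesis using False by (simp add: rad_def v_def powr_def exp_minus)
    qed
  qed
  ultimately show ?thesis by blast
qed

text \<open>A profile with compact support makes the function vanish near the origin and for large
  |x|, so smoothness on the punctured space extends across 0.\<close>

lemma rad_in_test_rad:
  assumes v: "\<And>k. smooth1 k v" and z: "\<And>t. \<bar>t\<bar> > R \<Longrightarrow> v t = 0"
  shows "(rad s v :: real ^ 'n::finite \<Rightarrow> real) \<in> test_rad"
proof -
  let ?u = "rad s v :: real ^ 'n \<Rightarrow> real"
  let ?K = "cball (0 :: real ^ 'n) (exp \<bar>R\<bar>) - ball 0 (exp (- \<bar>R\<bar>))"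
  have supp: "x \<in> ?K" if "?u x \<noteq> 0" for x
  proof -
    have "norm x > 0" using that by (cases "x = 0") (auto simp: rad_def)
    moreover have "\<bar>- ln (norm x)\<bar> \<le> R" using that z[of "- ln (norm x)"] by (force simp: rad_def)
    then have "ln (norm x) \<le> \<bar>R\<bar>" "- \<bar>R\<bar> \<le> ln (norm x)" by linarith+
    ultimately have "norm x \<le> exp \<bar>R\<bar>" "exp (- \<bar>R\<bar>) \<le> norm x"
      by (metis exp_ln exp_le_cancel_iff)+
    then show ?thesis by (auto simp: dist_norm)
  qed
  have K: "compact ?K" by (intro compact_diff compact_cball open_ball)
  have cl: "closure {x. ?u x \<noteq> 0} \<subseteq> ?K"
    by (rule closure_minimal) (use supp compact_imp_closed[OF K] in auto)
  have "Ck_on k UNIV ?u" for k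
  proof -
    have "Ck_on k (ball (0 :: real ^ 'n) (exp (- \<bar>R\<bar>))) ?u"
      using Ck_on_cong[of "ball (0 :: real ^ 'n) (exp (- \<bar>R\<bar>))" ?u "\<lambda>_. 0" k] supp Ck_on_zero by blast
    then have "Ck_on k (- {0} \<union> ball (0 :: real ^ 'n) (exp (- \<bar>R\<bar>))) ?u"
      by (intro Ck_on_Un open_punctured Ck_on_rad v) auto
    moreover have "- {0} \<union> ball (0 :: real ^ 'n) (exp (- \<bar>R\<bar>)) = UNIV" by auto
    ultimately show ?thesis by simp
  qed
  moreover have "compact (closure {x. ?u x \<noteq> 0})"
    by (rule compact_closure[THEN iffD2], rule bounded_subset[OF compact_imp_bounded[OF K]]) (use supp in auto)
  moreover have "closure {x. ?u x \<noteq> 0} \<subseteq> - {0}" using cl by auto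
  moreover have "?u x = ?u y" if "norm x = norm y" for x y using that by (simp add: rad_def)
  ultimately show ?thesis unfolding test_rad_def by blast
qed

section \<open>Functions in the completion\<close>

definition flat :: "nat \<Rightarrow> real \<Rightarrow> real" where
  "flat j t = (if t \<le> 0 then 0 else exp (- (1 / t)) / t ^ j)"

text \<open>The point of the whole family in j: it is closed under differentiation up to linear
  combinations, so smoothness of exp (- 1 / t), extended by 0, is a plain induction. At 0 the
  exponential beats every power.\<close>

lemma flat_deriv: "(flat j has_real_derivative flat (j + 2) t - real j * flat (j + 1) t) (at t)"
proof (cases t "0::real" rule: linorder_cases)
  case less
  have "((\<lambda>_. 0) has_real_derivative flat (j + 2) t - real j * flat (j + 1) t) (at t)"
    using less by (simp add: flat_def)
  then show ?thesis
    by (rule has_field_derivative_transform_within_open[of _ _ _ "{..<0}"]) (use less in \<open>auto simp: flat_def\<close>)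
next
  case greater
  have "((\<lambda>t. exp (- (1 / t)) / t ^ j) has_real_derivative
      ((1 / t\<^sup>2) * exp (- (1 / t)) * t ^ j - exp (- (1 / t)) * (real j * t ^ (j - 1))) / (t ^ j * t ^ j)) (at t)"
    using greater by (auto intro!: derivative_eq_intros simp: power2_eq_square)
  also have "((1 / t\<^sup>2) * exp (- (1 / t)) * t ^ j - exp (- (1 / t)) * (real j * t ^ (j - 1))) / (t ^ j * t ^ j)
      = flat (j + 2) t - real j * flat (j + 1) t"
  proof (cases j)
    case 0
    then show ?thesis using greater by (simp add: flat_def power2_eq_square)
  next
    case (Suc i)
    then show ?thesis using greater by (simp add: flat_def field_simps power2_eq_square)
  qed
  finally show ?thesis
    by (rule has_field_derivative_transform_within_open[of _ _ _ "{0<..}"]) (use greater in \<open>auto simp: flat_def\<close>)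
next
  case equal
  have "((\<lambda>y. (flat j y - flat j 0) / (y - 0)) \<longlongrightarrow> 0) (at 0)"
  proof (rule filterlim_split_at)
    show "((\<lambda>y. (flat j y - flat j 0) / (y - 0)) \<longlongrightarrow> 0) (at_left 0)"
      by (rule tendsto_eventually) (auto simp: eventually_at_filter flat_def)
    have "((\<lambda>y :: real. inverse y ^ (j + 1) / exp (inverse y)) \<longlongrightarrow> 0) (at_right 0)"
      by (rule filterlim_compose[OF tendsto_power_div_exp_0 filterlim_inverse_at_top_right])
    moreover have "\<forall>\<^sub>F y in at_right 0. inverse y ^ (j + 1) / exp (inverse y) = (flat j y - flat j 0) / (y - 0)"
      by (auto simp: eventually_at_filter flat_def exp_minus field_simps)
    ultimately show "((\<lambda>y. (flat j y - flat j 0) / (y - 0)) \<longlongrightarrow> 0) (at_right 0)"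
      by (rule Lim_transform_eventually)
  qed
  then show ?thesis using equal by (simp add: has_field_derivative_iff flat_def)
qed

lemma smooth1_flat: "smooth1 k (flat j)"
proof (induction k arbitrary: j)
  case 0
  then show ?case using DERIV_isCont[OF flat_deriv] by (auto simp: continuous_on_eq_continuous_at)
next
  case (Suc k)
  have "smooth1 k (\<lambda>t. flat (j + 2) t - real j * flat (j + 1) t)"
    by (intro smooth1_diff smooth1_cmult Suc)
  then show ?case
    using flat_deriv[of j] by (auto intro!: exI[of _ "\<lambda>t. flat (j + 2) t - real j * flat (j + 1) t"])
qed

text \<open>The usual quotient of flat functions, with the reciprocal as \<open>powr (-1)\<close>
  and the reflection as \<open>1 + (-1) * t\<close> to fit \<open>smooth1_powr\<close> and
  \<open>smooth1_affine\<close>.\<close>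

definition step :: "real \<Rightarrow> real" where
  "step t = flat 0 t * (flat 0 t + flat 0 (1 + (-1) * t)) powr (-1)"

lemma step_denominator: "flat 0 t + flat 0 (1 + (-1) * t) > 0"
  by (cases "t \<le> 0") (auto simp: flat_def add_pos_pos)

lemma smooth1_step: "smooth1 k step"
  unfolding step_def[abs_def]
  by (intro smooth1_mult smooth1_powr smooth1_add smooth1_flat smooth1_affine step_denominator)

lemma step_values: "t \<le> 0 \<Longrightarrow> step t = 0" "t \<ge> 1 \<Longrightarrow> step t = 1"
  by (auto simp: step_def flat_def powr_minus)

lemma smooth_cutoff:
  obtains ct ct1 ct2 :: "real \<Rightarrow> real" and M where
    "\<And>k. smooth1 k ct" "\<And>t. (ct has_real_derivative ct1 t) (at t)" "\<And>t. (ct1 has_real_derivative ct2 t) (at t)"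
    "continuous_on UNIV ct2" "\<And>t. \<bar>t\<bar> \<le> 1 \<Longrightarrow> ct t = 1" "\<And>t. \<bar>t\<bar> > 2 \<Longrightarrow> ct t = 0"
    "\<And>t. \<bar>t\<bar> < 1 \<Longrightarrow> ct1 t = 0" "\<And>t. \<bar>t\<bar> < 1 \<Longrightarrow> ct2 t = 0"
    "\<And>t. \<bar>ct t\<bar> \<le> M" "\<And>t. \<bar>ct1 t\<bar> \<le> M" "\<And>t. \<bar>ct2 t\<bar> \<le> M"
    "\<And>t. \<bar>t\<bar> > 2 \<Longrightarrow> ct1 t = 0" "\<And>t. \<bar>t\<bar> > 2 \<Longrightarrow> ct2 t = 0"
proof -
  define ct where "ct t = step (2 + (-1) * t) * step (2 + 1 * t)" for t
  have s: "smooth1 k ct" for k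
    unfolding ct_def by (intro smooth1_mult smooth1_affine smooth1_step)
  have one: "ct t = 1" if "\<bar>t\<bar> \<le> 1" for t using that by (simp add: ct_def step_values)
  have zero: "ct t = 0" if "\<bar>t\<bar> > 2" for t using that by (cases "t > 0") (simp_all add: ct_def step_values)
  obtain ct1 ct2 where D: "\<And>t. (ct has_real_derivative ct1 t) (at t)" "\<And>t. (ct1 has_real_derivative ct2 t) (at t)"
    and c2: "continuous_on UNIV ct2"
    using s[of "Suc (Suc 0)"] by auto
  have loc: "f' t = 0" if "\<And>t. (f has_real_derivative f' t) (at t)" "\<And>t. \<bar>t\<bar> < 1 \<Longrightarrow> f t = c" "\<bar>t\<bar> < 1"
    for f f' :: "real \<Rightarrow> real" and c t
  proof -
    have "open {t :: real. \<bar>t\<bar> < 1}" by (intro open_Collect_less continuous_intros)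
    then have "((\<lambda>_. c) has_real_derivative f' t) (at t)"
      using has_field_derivative_transform_within_open[OF that(1), of "{t. \<bar>t\<bar> < 1}" t "\<lambda>_. c"] that by auto
    then show ?thesis using DERIV_const DERIV_unique by blast
  qed
  have l1: "ct1 t = 0" if "\<bar>t\<bar> < 1" for t by (rule loc[OF D(1) _ that, of 1]) (use one in simp)
  have l2: "ct2 t = 0" if "\<bar>t\<bar> < 1" for t by (rule loc[OF D(2) l1 that])
  have P: "continuous_on UNIV ct" "continuous_on UNIV ct1" "\<And>t. \<bar>t\<bar> > 2 \<Longrightarrow> ct1 t = 0" "\<And>t. \<bar>t\<bar> > 2 \<Longrightarrow> ct2 t = 0"
    by (rule profile_integrand(1-4)[where R = 2, OF D c2], erule zero, assumption?)+
  have bdd: "\<exists>M. \<forall>t. \<bar>f t\<bar> \<le> M" if "continuous_on UNIV f" "\<And>t. \<bar>t\<bar> > 2 \<Longrightarrow> f t = 0" for f :: "real \<Rightarrow> real"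
  proof -
    have "compact (f ` {-2..2})"
      by (intro compact_continuous_image continuous_on_subset[OF that(1)]) auto
    then obtain M where M: "\<And>t. t \<in> {-2..2} \<Longrightarrow> \<bar>f t\<bar> \<le> M"
      using compact_imp_bounded[of "f ` {-2..2}"] unfolding bounded_iff by (metis image_eqI real_norm_def)
    have "\<bar>f t\<bar> \<le> max M 0" for t
    proof (cases "\<bar>t\<bar> > 2")
      case False
      then have "t \<in> {-2..2}" by auto
      from M[OF this] show ?thesis by simp
    qed (simp add: that(2))
    then show ?thesis by blast
  qed
  have "\<exists>M. \<forall>t. \<bar>ct t\<bar> \<le> M" by (rule bdd[OF P(1)]) (rule zero)
  moreover have "\<exists>M. \<forall>t. \<bar>ct1 t\<bar> \<le> M" by (rule bdd[OF P(2)]) (rule P(3))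
  moreover have "\<exists>M. \<forall>t. \<bar>ct2 t\<bar> \<le> M" by (rule bdd[OF c2]) (rule P(4))
  ultimately obtain M0 M1 M2 where "\<And>t. \<bar>ct t\<bar> \<le> M0" "\<And>t. \<bar>ct1 t\<bar> \<le> M1" "\<And>t. \<bar>ct2 t\<bar> \<le> M2"
    by blast
  then have "\<And>t. \<bar>ct t\<bar> \<le> max M0 (max M1 M2)" "\<And>t. \<bar>ct1 t\<bar> \<le> max M0 (max M1 M2)" "\<And>t. \<bar>ct2 t\<bar> \<le> max M0 (max M1 M2)"
    by (simp_all add: le_max_iff_disj)
  then show ?thesis using that[OF s D c2 one zero l1 l2 _ _ _ P(3,4)] by blast
qed

section \<open>Local L1 limits of test functions\<close>

lemma compact_punctured_bounds:
  assumes "compact K" "K \<subseteq> - {0 :: real ^ 'n::finite}"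
  obtains R where "R > 0" "\<And>x. x \<in> K \<Longrightarrow> \<bar>- ln (norm x)\<bar> \<le> R"
proof -
  have "compact ((\<lambda>x. - ln (norm x)) ` K)"
    by (intro compact_continuous_image assms(1)) (use assms(2) in \<open>auto intro!: continuous_intros\<close>)
  then obtain R where "\<And>x. x \<in> K \<Longrightarrow> \<bar>- ln (norm x)\<bar> \<le> R"
    using compact_imp_bounded[of "(\<lambda>x. - ln (norm x)) ` K"] unfolding bounded_iff by (metis image_eqI real_norm_def)
  then have "\<And>x. x \<in> K \<Longrightarrow> \<bar>- ln (norm x)\<bar> \<le> max R 1" by (simp add: le_max_iff_disj)
  then show ?thesis using that[of "max R 1"] by simp
qed

lemma set_integrable_continuous_compact:
  fixes w :: "real ^ 'n::finite \<Rightarrow> real"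
  assumes "continuous_on (- {0}) w" "compact K" "K \<subseteq> - {0}"
  shows "set_integrable lborel K w"
  unfolding set_integrable_def
  by (rule borel_integrable_compact[OF assms(2) continuous_on_subset[OF assms(1,3)]])

lemma tendsto_L1loc_of_eventually_eq:
  fixes w :: "real ^ 'n::finite \<Rightarrow> real"
  assumes w: "continuous_on (- {0}) w"
    and eq: "\<And>R. \<forall>\<^sub>F k in sequentially. \<forall>x. x \<noteq> 0 \<longrightarrow> \<bar>- ln (norm x)\<bar> \<le> R \<longrightarrow> \<phi> k x = w x"
  shows "tendsto_L1loc \<phi> w"
  unfolding tendsto_L1loc_def
proof (intro allI impI conjI)
  fix K :: "(real ^ 'n) set" assume K: "compact K \<and> K \<subseteq> - {0}"
  then show "set_integrable lborel K w" using set_integrable_continuous_compact[OF w] by blast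
  obtain R where R: "\<And>x. x \<in> K \<Longrightarrow> \<bar>- ln (norm x)\<bar> \<le> R"
    using compact_punctured_bounds[of K] K by metis
  show "(\<lambda>k. LINT x:K|lborel. \<bar>\<phi> k x - w x\<bar>) \<longlonglongrightarrow> 0"
  proof (rule tendsto_eventually)
    show "\<forall>\<^sub>F k in sequentially. (LINT x:K|lborel. \<bar>\<phi> k x - w x\<bar>) = 0"
      using eq[of R]
    proof eventually_elim
      case (elim k)
      have "(LINT x:K|lborel. \<bar>\<phi> k x - w x\<bar>) = (LINT x:K|lborel. 0)"
        unfolding set_lebesgue_integral_def
        by (rule Bochner_Integration.integral_cong) (use elim R K in \<open>auto simp: indicator_def subset_iff\<close>)
      then show ?case by (simp add: set_lebesgue_integral_def)
    qed
  qed
qed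

text \<open>The approximants are the truncations ct (t / (k + 1)) v. Two of them with indices at
  least m agree for |t| < m + 1, so the energy of their difference is at most an exponential tail;
  on a compact set they are eventually equal to w.\<close>

lemma decaying_profile_in_completion:
  fixes w :: "real ^ 'n::finite \<Rightarrow> real" and v v1 v2 :: "real \<Rightarrow> real"
  assumes n: "real CARD('n) = a + b + 2" and smooth: "\<And>k. smooth1 k v"
    and D: "\<And>t. (v has_real_derivative v1 t) (at t)" "\<And>t. (v1 has_real_derivative v2 t) (at t)"
    and dec: "\<And>t. \<bar>v t\<bar> \<le> C * exp (- \<kappa> * \<bar>t\<bar>)" "\<And>t. \<bar>v1 t\<bar> \<le> C * exp (- \<kappa> * \<bar>t\<bar>)" "\<And>t. \<bar>v2 t\<bar> \<le> C * exp (- \<kappa> * \<bar>t\<bar>)"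
    and \<kappa>: "\<kappa> > 0" and w: "\<And>x. x \<noteq> 0 \<Longrightarrow> w x = rad (- a) v x"
  shows "\<exists>\<phi>. test_Cauchy (b - a - 2) lam \<mu> \<phi> \<and> tendsto_L1loc \<phi> w"
proof -
  obtain ct ct1 ct2 :: "real \<Rightarrow> real" and M where
    ct: "\<And>k. smooth1 k ct" "\<And>t. (ct has_real_derivative ct1 t) (at t)" "\<And>t. (ct1 has_real_derivative ct2 t) (at t)"
    "continuous_on UNIV ct2" "\<And>t. \<bar>t\<bar> \<le> 1 \<Longrightarrow> ct t = 1" "\<And>t. \<bar>t\<bar> > 2 \<Longrightarrow> ct t = 0"
    "\<And>t. \<bar>t\<bar> < 1 \<Longrightarrow> ct1 t = 0" "\<And>t. \<bar>t\<bar> < 1 \<Longrightarrow> ct2 t = 0"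
    "\<And>t. \<bar>ct t\<bar> \<le> M" "\<And>t. \<bar>ct1 t\<bar> \<le> M" "\<And>t. \<bar>ct2 t\<bar> \<le> M"
    "\<And>t. \<bar>t\<bar> > 2 \<Longrightarrow> ct1 t = 0" "\<And>t. \<bar>t\<bar> > 2 \<Longrightarrow> ct2 t = 0"
    by (rule smooth_cutoff) blast
  have M0: "M \<ge> 0" using ct(9)[of 0] by linarith
  have C0: "C \<ge> 0" using dec(1)[of 0] by simp
  define c where "c k = 1 / real (Suc k)" for k
  have c: "0 < c k" "c k \<le> 1" for k by (simp_all add: c_def)
  define X0 X1 X2 where "X0 k t = ct (0 + c k * t)" and "X1 k t = c k * ct1 (0 + c k * t)"
    and "X2 k t = c k * (c k * ct2 (0 + c k * t))" for k t
  have aff: "((\<lambda>t. 0 + c k * t) has_real_derivative c k) (at t)" for k t by (auto intro!: derivative_eq_intros)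
  have X: "(X0 k has_real_derivative X1 k t) (at t)" "(X1 k has_real_derivative X2 k t) (at t)" for k t
    unfolding X0_def X1_def X2_def
    using DERIV_chain2[OF ct(2) aff] DERIV_cmult[OF DERIV_chain2[OF ct(3) aff]] by (simp_all add: mult_ac)
  have Xc: "continuous_on UNIV (X2 k)" for k
    unfolding X2_def by (intro continuous_intros continuous_on_compose2[OF ct(4)]) auto
  have Xs: "smooth1 m (X0 k)" for m k unfolding X0_def by (intro smooth1_affine ct(1))
  have Xb: "\<bar>X0 k t\<bar> \<le> M" "\<bar>X1 k t\<bar> \<le> M" "\<bar>X2 k t\<bar> \<le> M" for k t
  proof -
    show "\<bar>X0 k t\<bar> \<le> M" unfolding X0_def by (rule ct(9))
    have "c k * \<bar>ct1 (0 + c k * t)\<bar> \<le> 1 * M" using c[of k] ct(10) by (intro mult_mono) auto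
    then show "\<bar>X1 k t\<bar> \<le> M" using c[of k] by (simp add: X1_def abs_mult)
    have "c k * (c k * \<bar>ct2 (0 + c k * t)\<bar>) \<le> 1 * (1 * M)" using c[of k] ct(11) M0 by (intro mult_mono) auto
    then show "\<bar>X2 k t\<bar> \<le> M" using c[of k] by (simp add: X2_def abs_mult)
  qed
  have ck: "\<bar>c k * t\<bar> = \<bar>t\<bar> / real (Suc k)" for k t by (simp add: c_def abs_mult)
  have Xin: "X0 k t = 1 \<and> X1 k t = 0 \<and> X2 k t = 0" if "\<bar>t\<bar> < real (Suc k)" for k t
  proof -
    have "\<bar>0 + c k * t\<bar> < 1" using that ck[of k t] by (simp add: divide_less_eq)
    then show ?thesis using ct(5,7,8) by (simp add: X0_def X1_def X2_def)
  qed
  have Xout: "X0 k t = 0" if "\<bar>t\<bar> > 2 * real (Suc k)" for k t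
  proof -
    have "\<bar>0 + c k * t\<bar> > 2" using that ck[of k t] by (simp add: less_divide_eq)
    then show ?thesis using ct(6) by (simp add: X0_def)
  qed
  define \<phi> where "\<phi> k = (rad (- a) (\<lambda>t. X0 k t * v t) :: real ^ 'n \<Rightarrow> real)" for k
  let ?A = "a\<^sup>2 + b\<^sup>2 - lam" and ?B = "a\<^sup>2 * b\<^sup>2 - lam * a\<^sup>2 + \<mu>" and ?w = "real CARD('n) * unit_ball_vol (real CARD('n))"
  define I where "I = (LINT t|lborel. exp (- \<kappa> * \<bar>t\<bar>))"
  \<comment> \<open>A difference of cutoffs and its derivatives are at most 2 M each, and the
    product rule for the second derivative has coefficients 1, 2, 1.\<close>
  define Q where "Q = 8 * M * C"
  define F where "F = ?w * ((1 + \<bar>?A\<bar> + \<bar>?B\<bar>) * Q\<^sup>2 * I)"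
  have test: "\<phi> k \<in> test_rad" for k
    unfolding \<phi>_def by (rule rad_in_test_rad[where R = "2 * real (Suc k)"]) (use Xs smooth smooth1_mult Xout in auto)
  have bound: "norm_alpha (b - a - 2) lam \<mu> (\<lambda>x. \<phi> k x - \<phi> l x) \<le> sqrt (F * exp (- \<kappa> * real m))"
    if m: "m \<le> k" "m \<le> l" for k l m
  proof -
    define e0 e1 e2 where "e0 t = X0 k t - X0 l t" and "e1 t = X1 k t - X1 l t" and "e2 t = X2 k t - X2 l t" for t
    have eb: "\<bar>e0 t\<bar> \<le> 2 * M" "\<bar>e1 t\<bar> \<le> 2 * M" "\<bar>e2 t\<bar> \<le> 2 * M" for t
      unfolding e0_def e1_def e2_def using Xb[of k t] Xb[of l t] by linarith+
    have ez: "e0 t = 0" "e1 t = 0" "e2 t = 0" if "\<bar>t\<bar> < real (Suc m)" for t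
    proof -
      have "\<bar>t\<bar> < real (Suc k)" "\<bar>t\<bar> < real (Suc l)" using that m by simp_all
      then show "e0 t = 0" "e1 t = 0" "e2 t = 0" using Xin unfolding e0_def e1_def e2_def by simp_all
    qed
    have eD: "(e0 has_real_derivative e1 t) (at t)" "(e1 has_real_derivative e2 t) (at t)" for t
      unfolding e0_def e1_def e2_def by (intro DERIV_diff X)+
    define g g1 g2 where "g t = e0 t * v t" and "g1 t = e1 t * v t + e0 t * v1 t"
      and "g2 t = e2 t * v t + 2 * (e1 t * v1 t) + e0 t * v2 t" for t
    have gD: "(g has_real_derivative g1 t) (at t)" "(g1 has_real_derivative g2 t) (at t)" for t
      unfolding g_def g1_def g2_def by (auto intro!: derivative_eq_intros eD D simp: algebra_simps)
    have vc: "continuous_on UNIV v" "continuous_on UNIV v1" "continuous_on UNIV v2"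
    proof -
      show "continuous_on UNIV v" "continuous_on UNIV v1"
        using D has_field_derivative_at_within by (blast intro: DERIV_continuous_on)+
      obtain u1 u2 where u: "\<And>t. (v has_real_derivative u1 t) (at t)" "\<And>t. (u1 has_real_derivative u2 t) (at t)" "continuous_on UNIV u2"
        using smooth[of "Suc (Suc 0)"] by auto
      have "u1 = v1" using u(1) D(1) DERIV_unique by blast
      then have "u2 = v2" using u(2) D(2) DERIV_unique by blast
      then show "continuous_on UNIV v2" using u(3) by simp
    qed
    have ec: "continuous_on UNIV e0" "continuous_on UNIV e1" "continuous_on UNIV e2"
    proof -
      show "continuous_on UNIV e0" "continuous_on UNIV e1"
        using eD has_field_derivative_at_within by (blast intro: DERIV_continuous_on)+
      show "continuous_on UNIV e2" unfolding e2_def by (intro continuous_intros Xc)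
    qed
    have g2c: "continuous_on UNIV g2" unfolding g2_def by (intro continuous_intros ec vc)
    have gz: "g t = 0" if "\<bar>t\<bar> > 2 * real (Suc k) + 2 * real (Suc l)" for t
      using that Xout[of k t] Xout[of l t] by (simp add: g_def e0_def)
    have eq: "(\<lambda>x. \<phi> k x - \<phi> l x) = rad (- a) g"
      by (auto simp: \<phi>_def g_def e0_def rad_def fun_eq_iff algebra_simps)
    have gb: "\<bar>g t\<bar> \<le> Q * exp (- \<kappa> * \<bar>t\<bar>) \<and> \<bar>g1 t\<bar> \<le> Q * exp (- \<kappa> * \<bar>t\<bar>) \<and> \<bar>g2 t\<bar> \<le> Q * exp (- \<kappa> * \<bar>t\<bar>)" for t
    proof -
      let ?x = "exp (- \<kappa> * \<bar>t\<bar>)"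
      have pr: "\<bar>x * y\<bar> \<le> 2 * (M * (C * ?x))" if "\<bar>x\<bar> \<le> 2 * M" "\<bar>y\<bar> \<le> C * ?x" for x y
      proof -
        have "\<bar>x\<bar> * \<bar>y\<bar> \<le> (2 * M) * (C * ?x)" using that M0 by (intro mult_mono) auto
        then show ?thesis by (simp add: abs_mult)
      qed
      have nn: "0 \<le> M * (C * ?x)" using M0 C0 by simp
      have Q: "Q * ?x = 8 * (M * (C * ?x))" by (simp add: Q_def)
      show ?thesis
        unfolding Q g_def g1_def g2_def
      proof (intro conjI)
        note h = pr[OF eb(1)[of t] dec(1)[of t]] pr[OF eb(2)[of t] dec(1)[of t]] pr[OF eb(3)[of t] dec(1)[of t]]
          pr[OF eb(1)[of t] dec(2)[of t]] pr[OF eb(2)[of t] dec(2)[of t]] pr[OF eb(1)[of t] dec(3)[of t]]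
        show "\<bar>e0 t * v t\<bar> \<le> 8 * (M * (C * ?x))" using h(1) nn by linarith
        show "\<bar>e1 t * v t + e0 t * v1 t\<bar> \<le> 8 * (M * (C * ?x))" using h(2,4) nn by linarith
        show "\<bar>e2 t * v t + 2 * (e1 t * v1 t) + e0 t * v2 t\<bar> \<le> 8 * (M * (C * ?x))"
          using h(3,5,6) nn by linarith
      qed
    qed
    have "profile_energy ?A ?B g g1 g2 \<le> (LINT t|lborel. (1 + \<bar>?A\<bar> + \<bar>?B\<bar>) * Q\<^sup>2 * exp (- \<kappa> * real m) * exp (- \<kappa> * \<bar>t\<bar>))"
      unfolding profile_energy_def
    proof (rule integral_mono[OF profile_integrand(5)[OF gD g2c gz]])
      show "integrable lborel (\<lambda>t. (1 + \<bar>?A\<bar> + \<bar>?B\<bar>) * Q\<^sup>2 * exp (- \<kappa> * real m) * exp (- \<kappa> * \<bar>t\<bar>))"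
        by (intro integrable_mult_right integrable_exp_abs \<kappa>)
      fix t
      let ?x = "exp (- \<kappa> * \<bar>t\<bar>)"
      show "(g2 t)\<^sup>2 + ?A * (g1 t)\<^sup>2 + ?B * (g t)\<^sup>2 \<le> (1 + \<bar>?A\<bar> + \<bar>?B\<bar>) * Q\<^sup>2 * exp (- \<kappa> * real m) * ?x"
      proof (cases "\<bar>t\<bar> < real (Suc m)")
        case True
        then show ?thesis using ez by (simp add: g_def g1_def g2_def)
      next
        case False
        have sq: "y\<^sup>2 \<le> (Q * ?x)\<^sup>2" if "\<bar>y\<bar> \<le> Q * ?x" for y using abs_le_square_iff[of y "Q * ?x"] that by auto
        have s: "(g2 t)\<^sup>2 \<le> (Q * ?x)\<^sup>2" "(g1 t)\<^sup>2 \<le> (Q * ?x)\<^sup>2" "(g t)\<^sup>2 \<le> (Q * ?x)\<^sup>2" using sq gb by blast+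
        have "?A * (g1 t)\<^sup>2 \<le> \<bar>?A\<bar> * (Q * ?x)\<^sup>2" "?B * (g t)\<^sup>2 \<le> \<bar>?B\<bar> * (Q * ?x)\<^sup>2"
          using s by (intro mult_mono; simp)+
        then have "(g2 t)\<^sup>2 + ?A * (g1 t)\<^sup>2 + ?B * (g t)\<^sup>2 \<le> (1 + \<bar>?A\<bar> + \<bar>?B\<bar>) * (Q * ?x)\<^sup>2"
          using s by (simp add: distrib_right)
        \<comment> \<open>Of the two exponential factors one becomes exp (- \<kappa> m) outside the
          inner interval; the other keeps the bound integrable.\<close>
        also have "(Q * ?x)\<^sup>2 = Q\<^sup>2 * (?x * ?x)" by (simp add: power2_eq_square)
        also have "(1 + \<bar>?A\<bar> + \<bar>?B\<bar>) * (Q\<^sup>2 * (?x * ?x)) \<le> (1 + \<bar>?A\<bar> + \<bar>?B\<bar>) * (Q\<^sup>2 * (exp (- \<kappa> * real m) * ?x))"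
          using False \<kappa> by (intro mult_left_mono mult_right_mono) auto
        finally show ?thesis by (simp add: mult.assoc)
      qed
    qed
    also have "\<dots> = (1 + \<bar>?A\<bar> + \<bar>?B\<bar>) * Q\<^sup>2 * exp (- \<kappa> * real m) * I" by (simp add: I_def)
    finally have "?w * profile_energy ?A ?B g g1 g2 \<le> ?w * ((1 + \<bar>?A\<bar> + \<bar>?B\<bar>) * Q\<^sup>2 * exp (- \<kappa> * real m) * I)"
      by (intro mult_left_mono) auto
    also have "\<dots> = F * exp (- \<kappa> * real m)" by (simp add: F_def mult_ac)
    finally have "sqrt (?w * profile_energy ?A ?B g g1 g2) \<le> sqrt (F * exp (- \<kappa> * real m))"
      by (rule real_sqrt_le_mono)
    moreover have "norm_alpha (b - a - 2) lam \<mu> (rad (- a) g :: real ^ 'n \<Rightarrow> real) = sqrt (?w * profile_energy ?A ?B g g1 g2)"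
      by (rule norm_alpha_rad[OF n gD g2c]) (rule gz)
    ultimately show ?thesis unfolding eq by simp
  qed
  have lim: "(\<lambda>m. sqrt (F * exp (- \<kappa> * real m))) \<longlonglongrightarrow> 0"
  proof -
    have "filterlim (\<lambda>m. (- \<kappa>) * real m) at_bot sequentially"
      by (rule filterlim_tendsto_neg_mult_at_bot[OF tendsto_const _ filterlim_real_sequentially]) (use \<kappa> in simp)
    then have "(\<lambda>m. exp (- \<kappa> * real m)) \<longlonglongrightarrow> 0" by (rule filterlim_compose[OF exp_at_bot])
    then have "(\<lambda>m. sqrt (F * exp (- \<kappa> * real m))) \<longlonglongrightarrow> sqrt (F * 0)" by (intro tendsto_intros)
    then show ?thesis by simp
  qed
  have "test_Cauchy (b - a - 2) lam \<mu> \<phi>"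
    unfolding test_Cauchy_def
  proof (intro conjI allI impI test)
    fix e :: real assume "e > 0"
    then obtain m where m: "sqrt (F * exp (- \<kappa> * real m)) < e"
      using order_tendstoD(2)[OF lim, of e] by (auto simp: eventually_sequentially)
    have "norm_alpha (b - a - 2) lam \<mu> (\<lambda>x. \<phi> k x - \<phi> l x) < e" if "k \<ge> m" "l \<ge> m" for k l
      using bound[OF that] m by linarith
    then show "\<exists>M. \<forall>k\<ge>M. \<forall>l\<ge>M. norm_alpha (b - a - 2) lam \<mu> (\<lambda>x. \<phi> k x - \<phi> l x) < e" by blast
  qed
  moreover have "tendsto_L1loc \<phi> w"
  proof (rule tendsto_L1loc_of_eventually_eq)
    have "Ck_on 0 (- {0}) (rad (- a) v :: real ^ 'n \<Rightarrow> real)" by (rule Ck_on_rad[OF smooth])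
    then show "continuous_on (- {0}) w"
      using continuous_on_cong[of "- {0}" "- {0}" w "rad (- a) v"] w by auto
    fix R
    obtain N :: nat where N: "R < real N" using reals_Archimedean2 by blast
    show "\<forall>\<^sub>F k in sequentially. \<forall>x. x \<noteq> 0 \<longrightarrow> \<bar>- ln (norm x)\<bar> \<le> R \<longrightarrow> \<phi> k x = w x"
      using eventually_ge_at_top[of N]
    proof eventually_elim
      case (elim k)
      have "\<phi> k x = w x" if "x \<noteq> 0" "\<bar>- ln (norm x)\<bar> \<le> R" for x
      proof -
        have "\<bar>- ln (norm x)\<bar> < real (Suc k)" using that N elim by simp
        then show ?thesis using Xin[of "- ln (norm x)" k] w[OF that(1)] by (simp add: \<phi>_def rad_def)
      qed
      then show ?case by blast
    qed
  qed
  ultimately show ?thesis by blast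
qed

lemma norm_alpha_rad':
  fixes v :: "real \<Rightarrow> real"
  assumes n: "real CARD('n::finite) = a + b + 2"
    and D: "\<And>t. (v has_real_derivative v1 t) (at t)" "\<And>t. (v1 has_real_derivative v2 t) (at t)"
    and c2: "continuous_on UNIV v2" and z: "\<forall>t. \<bar>t\<bar> > R \<longrightarrow> v t = 0"
  shows "norm_alpha (b - a - 2) lam \<mu> (rad (- a) v :: real ^ 'n \<Rightarrow> real)
    = sqrt (real CARD('n) * unit_ball_vol (real CARD('n))
       * profile_energy (a\<^sup>2 + b\<^sup>2 - lam) (a\<^sup>2 * b\<^sup>2 - lam * a\<^sup>2 + \<mu>) v v1 v2)"
  using norm_alpha_rad[OF n D c2, of R] z by blast

text \<open>On a ball where \<open>w\<close> stays away from the uniform limit, the \<open>L\<^sup>1\<close> distance cannot tend to zero.\<close>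

lemma L1loc_limit_eq:
  fixes w :: "real ^ 'n::finite \<Rightarrow> real"
  assumes w: "continuous_on (- {0}) w" and vc: "continuous_on UNIV v"
    and fc: "\<And>k. continuous_on (- {0}) (rad s (f k) :: real ^ 'n \<Rightarrow> real)"
    and unif: "\<And>e. e > 0 \<Longrightarrow> \<forall>\<^sub>F k in sequentially. \<forall>t. \<bar>f k t - v t\<bar> \<le> e"
    and L1: "tendsto_L1loc (\<lambda>k. rad s (f k)) w" and x: "x \<noteq> 0"
  shows "w x = rad s v x"
proof (rule ccontr)
  assume ne: "w x \<noteq> rad s v x"
  have rc: "continuous_on (- {0}) (rad s v :: real ^ 'n \<Rightarrow> real)"
    unfolding rad_def[abs_def] by (auto intro!: continuous_intros continuous_on_compose2[OF vc])
  \<comment> \<open>A third of the gap: on the ball the gap stays above 2 c, and a uniform error of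
    at most c leaves c.\<close>
  define c where "c = \<bar>w x - rad s v x\<bar> / 3"
  have c: "c > 0" using ne by (simp add: c_def)
  have g: "continuous_on (- {0}) (\<lambda>y. \<bar>w y - rad s v y\<bar>)" by (intro continuous_intros w rc)
  let ?S = "- {0} \<inter> (\<lambda>y. \<bar>w y - rad s v y\<bar>) -` {2 * c<..}"
  have "open ?S" by (rule continuous_open_preimage[OF g open_punctured]) simp
  moreover have "x \<in> ?S" using x c by (simp add: c_def)
  ultimately obtain d where d: "d > 0" "cball x d \<subseteq> ?S"
    using open_contains_cball by metis
  define K where "K = cball x d"
  have K: "compact K" "K \<subseteq> - {0}" "\<And>y. y \<in> K \<Longrightarrow> 2 * c < \<bar>w y - rad s v y\<bar>" using d(2) by (auto simp: K_def)
  have "compact ((\<lambda>y. norm y powr s) ` K)"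
    by (intro compact_continuous_image K(1)) (use K(2) in \<open>auto intro!: continuous_intros\<close>)
  then obtain B where B: "\<And>y. y \<in> K \<Longrightarrow> \<bar>norm y powr s\<bar> \<le> B"
    using compact_imp_bounded[of "(\<lambda>y. norm y powr s) ` K"] unfolding bounded_iff by (metis image_eqI real_norm_def)
  define B' where "B' = max B 1"
  have B': "B' > 0" "\<And>y. y \<in> K \<Longrightarrow> norm y powr s \<le> B'" using B by (auto simp: B'_def le_max_iff_disj)
  have lim: "(\<lambda>k. LINT y:K|lborel. \<bar>rad s (f k) y - w y\<bar>) \<longlonglongrightarrow> 0" and wi: "set_integrable lborel K w"
    using L1 K(1,2) unfolding tendsto_L1loc_def by blast+
  have m: "measure lborel K > 0" using d(1) by (simp add: K_def content_cball_pos)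
  have fin: "emeasure lborel K < \<infinity>" unfolding K_def by (rule emeasure_lborel_cball_finite)
  have Ks: "K \<in> sets lborel" by (simp add: K_def)
  have "c * measure lborel K \<le> 0"
  proof (rule tendsto_lowerbound[OF lim])
    have "\<forall>\<^sub>F k in sequentially. \<forall>t. \<bar>f k t - v t\<bar> \<le> c / B'" by (rule unif) (use c B' in simp)
    then show "\<forall>\<^sub>F k in sequentially. c * measure lborel K \<le> (LINT y:K|lborel. \<bar>rad s (f k) y - w y\<bar>)"
    proof eventually_elim
      case (elim k)
      have pw: "c \<le> \<bar>rad s (f k) y - w y\<bar>" if y: "y \<in> K" for y
      proof -
        have "\<bar>rad s (f k) y - rad s v y\<bar> = norm y powr s * \<bar>f k (- ln (norm y)) - v (- ln (norm y))\<bar>"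
          by (simp add: rad_def abs_mult flip: right_diff_distrib)
        also have "\<dots> \<le> B' * (c / B')" using B' y elim by (intro mult_mono) auto
        also have "\<dots> = c" using B' by simp
        finally show ?thesis using K(3)[OF y] by linarith
      qed
      have "set_integrable lborel K (rad s (f k))"
        by (rule set_integrable_continuous_compact[OF fc K(1,2)])
      then have i: "set_integrable lborel K (\<lambda>y. \<bar>rad s (f k) y - w y\<bar>)"
        using wi by (intro set_integrable_abs set_integral_diff(1))
      have "c * measure lborel K = (LINT y:K|lborel. c)"
        using fin Ks by (simp add: set_integral_const)
      also have "\<dots> \<le> (LINT y:K|lborel. \<bar>rad s (f k) y - w y\<bar>)"
        by (rule set_integral_mono[OF _ i pw])
           (use fin Ks in \<open>simp_all add: set_integrable_def\<close>)
      finally show ?case .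
    qed
  qed simp
  then show False using c m by (simp add: mult_le_0_iff)
qed

text \<open>The norm dominates the supremum of the profile, so the profiles of a Cauchy sequence
  converge uniformly. A uniform limit of compactly supported functions vanishes at both ends, and
  the local L1 limit identifies it with the continuous w.\<close>

lemma completion_profile:
  fixes w :: "real ^ 'n::finite \<Rightarrow> real"
  assumes n: "real CARD('n) = a + b + 2"
    and AB: "a\<^sup>2 + b\<^sup>2 - lam > 0" "a\<^sup>2 * b\<^sup>2 - lam * a\<^sup>2 + \<mu> > 0"
    and \<phi>: "test_Cauchy (b - a - 2) lam \<mu> \<phi>" "tendsto_L1loc \<phi> w" and w: "continuous_on (- {0}) w"
  shows "\<exists>v. continuous_on UNIV v \<and> (v \<longlongrightarrow> 0) at_top \<and> (v \<longlongrightarrow> 0) at_bot \<and> (\<forall>x. x \<noteq> 0 \<longrightarrow> w x = rad (- a) v x)"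
proof -
  have "\<forall>k. \<exists>v R. (\<forall>m. smooth1 m v) \<and> (\<forall>t. \<bar>t\<bar> > R \<longrightarrow> v t = 0) \<and> \<phi> k = rad (- a) v"
    using \<phi>(1) test_rad_profile unfolding test_Cauchy_def by blast
  then obtain f R where f: "\<And>k m. smooth1 m (f k)" "\<And>k t. \<bar>t\<bar> > R k \<Longrightarrow> f k t = 0" "\<And>k. \<phi> k = rad (- a) (f k)"
    by metis
  have feq: "\<phi> = (\<lambda>k. rad (- a) (f k))" using f(3) by blast
  define K where "K = sqrt (real CARD('n) * unit_ball_vol (real CARD('n)) * min (a\<^sup>2 + b\<^sup>2 - lam) (a\<^sup>2 * b\<^sup>2 - lam * a\<^sup>2 + \<mu>))"
  have K: "K > 0" and bound: "K * \<bar>f k t - f l t\<bar> \<le> norm_alpha (b - a - 2) lam \<mu> (\<lambda>x. \<phi> k x - \<phi> l x)" for k l t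
  proof -
    have s: "smooth1 2 (\<lambda>t. f k t - f l t)" by (intro smooth1_diff f(1))
    have z: "f k t - f l t = 0" if "\<bar>t\<bar> > max (R k) (R l)" for t using f(2)[of k t] f(2)[of l t] that by simp
    have e: "(\<lambda>x. \<phi> k x - \<phi> l x) = rad (- a) (\<lambda>t. f k t - f l t)"
      by (simp add: f(3) rad_def fun_eq_iff algebra_simps)
    show "K > 0" unfolding K_def by (rule norm_alpha_sup_bound(2)[where v = "\<lambda>t. f k t - f l t", OF n s _ AB]) (rule z)
    show "K * \<bar>f k t - f l t\<bar> \<le> norm_alpha (b - a - 2) lam \<mu> (\<lambda>x. \<phi> k x - \<phi> l x)"
      unfolding K_def e by (rule norm_alpha_sup_bound(1)[OF n s _ AB]) (rule z)
  qed
  have cauchy: "\<exists>M. \<forall>k\<ge>M. \<forall>l\<ge>M. \<forall>t. \<bar>f k t - f l t\<bar> < e" if e: "e > 0" for e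
  proof -
    have "K * e > 0" using K e by simp
    then obtain M where M: "\<forall>k\<ge>M. \<forall>l\<ge>M. norm_alpha (b - a - 2) lam \<mu> (\<lambda>x. \<phi> k x - \<phi> l x) < K * e"
      using \<phi>(1) unfolding test_Cauchy_def by blast
    have "\<bar>f k t - f l t\<bar> < e" if "k \<ge> M" "l \<ge> M" for k l t
    proof -
      have "K * \<bar>f k t - f l t\<bar> < K * e" using bound[of k t l] M that by (meson le_less_trans)
      then show ?thesis using K by simp
    qed
    then show ?thesis by blast
  qed
  have "uniformly_convergent_on UNIV f"
    unfolding uniformly_convergent_eq_Cauchy uniformly_Cauchy_on_def dist_real_def using cauchy by blast
  then obtain v where v: "uniform_limit UNIV f v sequentially" unfolding uniformly_convergent_on_def by blast
  have fc: "continuous_on UNIV (f k)" for k by (rule smooth1_continuous[OF f(1)])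
  have vc: "continuous_on UNIV v" by (rule uniform_limit_theorem[OF _ v]) (simp_all add: fc)
  have unif: "\<forall>\<^sub>F k in sequentially. \<forall>t. \<bar>f k t - v t\<bar> \<le> e" if "e > 0" for e
    using uniform_limitD[OF v that] by eventually_elim (auto simp: dist_real_def less_imp_le)
  have small: "\<exists>S. \<forall>t. \<bar>t\<bar> > S \<longrightarrow> \<bar>v t\<bar> < e" if e: "e > 0" for e
  proof -
    obtain k where k: "\<And>t. \<bar>f k t - v t\<bar> \<le> e / 2"
      using unif[of "e / 2"] e by (auto simp: eventually_sequentially)
    have "\<bar>v t\<bar> < e" if "\<bar>t\<bar> > R k" for t using k[of t] f(2)[OF that] e by simp
    then show ?thesis by blast
  qed
  have lim: "(v \<longlongrightarrow> 0) at_top" "(v \<longlongrightarrow> 0) at_bot"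
  proof -
    show "(v \<longlongrightarrow> 0) at_top"
    proof (rule tendstoI)
      fix e :: real assume "e > 0"
      then obtain S where S: "\<And>t. \<bar>t\<bar> > S \<Longrightarrow> \<bar>v t\<bar> < e" using small by blast
      show "\<forall>\<^sub>F t in at_top. dist (v t) 0 < e"
        using eventually_gt_at_top[of "\<bar>S\<bar>"] by eventually_elim (use S in auto)
    qed
    show "(v \<longlongrightarrow> 0) at_bot"
    proof (rule tendstoI)
      fix e :: real assume "e > 0"
      then obtain S where S: "\<And>t. \<bar>t\<bar> > S \<Longrightarrow> \<bar>v t\<bar> < e" using small by blast
      show "\<forall>\<^sub>F t in at_bot. dist (v t) 0 < e"
        using eventually_gt_at_bot[of "- \<bar>S\<bar>"] by eventually_elim (use S in auto)
    qed
  qed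
  have rc: "continuous_on (- {0}) (rad (- a) (f k) :: real ^ 'n \<Rightarrow> real)" for k
    using Ck_on_rad[of 0 "f k" "- a"] f(1) by simp
  have "w x = rad (- a) v x" if "x \<noteq> 0" for x
    by (rule L1loc_limit_eq[OF w vc rc unif \<phi>(2)[unfolded feq] that])
  then show ?thesis using vc lim by blast
qed

text \<open>If the zeroth-order coefficient vanishes, wide plateaus of growing height tend to zero in the norm.\<close>

lemma completion_degenerate:
  assumes n: "real CARD('n::finite) = a + b + 2" and A: "a\<^sup>2 + b\<^sup>2 - lam \<ge> 0" and B: "a\<^sup>2 * b\<^sup>2 - lam * a\<^sup>2 + \<mu> = 0"
  shows "\<exists>\<phi> :: nat \<Rightarrow> real ^ 'n \<Rightarrow> real. test_Cauchy (b - a - 2) lam \<mu> \<phi> \<and> \<not> (\<exists>u. tendsto_L1loc \<phi> u)"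
proof -
  obtain ct ct1 ct2 :: "real \<Rightarrow> real" and M where
    ct: "\<And>k. smooth1 k ct" "\<And>t. (ct has_real_derivative ct1 t) (at t)" "\<And>t. (ct1 has_real_derivative ct2 t) (at t)"
    "continuous_on UNIV ct2" "\<And>t. \<bar>t\<bar> \<le> 1 \<Longrightarrow> ct t = 1" "\<And>t. \<bar>t\<bar> > 2 \<Longrightarrow> ct t = 0"
    "\<And>t. \<bar>t\<bar> < 1 \<Longrightarrow> ct1 t = 0" "\<And>t. \<bar>t\<bar> < 1 \<Longrightarrow> ct2 t = 0"
    "\<And>t. \<bar>ct t\<bar> \<le> M" "\<And>t. \<bar>ct1 t\<bar> \<le> M" "\<And>t. \<bar>ct2 t\<bar> \<le> M"
    "\<And>t. \<bar>t\<bar> > 2 \<Longrightarrow> ct1 t = 0" "\<And>t. \<bar>t\<bar> > 2 \<Longrightarrow> ct2 t = 0"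
    by (rule smooth_cutoff) blast
  define h where "h j = real (Suc j)" for j
  \<comment> \<open>A plateau of height h with flanks of width of order h^4 has slope energy of
    order (h / h^4)^2 h^4 = h^(-2), which vanishes although the height grows.\<close>
  define c where "c j = 1 / h j ^ 4" for j
  have h: "h j \<ge> 1" for j by (simp add: h_def)
  have h4: "h j ^ 4 \<ge> 1" "h j ^ 4 > 0" for j using h[of j] by (auto intro: one_le_power less_le_trans[OF _ one_le_power])
  have c: "0 < c j" "c j \<le> 1" for j using h4[of j] by (auto simp: c_def)
  define g g1 g2 where "g j t = h j * ct (0 + c j * t)" and "g1 j t = h j * (c j * ct1 (0 + c j * t))"
    and "g2 j t = h j * (c j * (c j * ct2 (0 + c j * t)))" for j t
  have aff: "((\<lambda>t. 0 + c j * t) has_real_derivative c j) (at t)" for j t by (auto intro!: derivative_eq_intros)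
  have D: "(g j has_real_derivative g1 j t) (at t)" "(g1 j has_real_derivative g2 j t) (at t)" for j t
    unfolding g_def g1_def g2_def
    by (rule DERIV_cong[OF DERIV_cmult[OF DERIV_chain2[OF ct(2) aff[of j t]]]]
          DERIV_cong[OF DERIV_cmult[OF DERIV_cmult[OF DERIV_chain2[OF ct(3) aff[of j t]]]]], simp)+
  have g2c: "continuous_on UNIV (g2 j)" for j
    unfolding g2_def by (intro continuous_intros continuous_on_compose2[OF ct(4)]) auto
  have gs: "smooth1 m (g j)" for m j unfolding g_def by (intro smooth1_cmult smooth1_affine ct(1))
  have gz: "g j t = 0" if "\<bar>t\<bar> > 2 * h j ^ 4" for j t
  proof -
    have "\<bar>0 + c j * t\<bar> > 2" using that h4[of j] by (simp add: c_def abs_mult less_divide_eq)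
    then show ?thesis using ct(6) by (simp add: g_def)
  qed
  have g1: "\<bar>t\<bar> \<le> h j ^ 4 \<Longrightarrow> g j t = h j" for j t
    using ct(5)[of "0 + c j * t"] h4[of j] by (simp add: g_def c_def abs_mult divide_le_eq)
  let ?A = "a\<^sup>2 + b\<^sup>2 - lam" and ?w = "real CARD('n) * unit_ball_vol (real CARD('n))"
  define \<phi> where "\<phi> j = (rad (- a) (g j) :: real ^ 'n \<Rightarrow> real)" for j
  define F where "F = 4 * M\<^sup>2 * (1 + ?A)"
  have M0: "M \<ge> 0" using ct(9)[of 0] by linarith
  have F0: "F \<ge> 0" unfolding F_def using A by simp
  have ie: "integrable lborel (\<lambda>t. (g2 j t)\<^sup>2 + ?A * (g1 j t)\<^sup>2 + 0 * (g j t)\<^sup>2)" for j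
    by (rule profile_integrand(5)[OF D g2c, of "2 * h j ^ 4"]) (rule gz)
  have pe: "profile_energy ?A 0 (g j) (g1 j) (g2 j) \<le> F / (h j)\<^sup>2" for j
  proof -
    let ?S = "2 * h j ^ 4" and ?q = "M\<^sup>2 * (1 + ?A) * (h j * c j)\<^sup>2"
    have "profile_energy ?A 0 (g j) (g1 j) (g2 j) \<le> (LINT t|lborel. ?q * indicator {- ?S..?S} t)"
      unfolding profile_energy_def
    proof (rule integral_mono[OF ie])
      show "integrable lborel (\<lambda>t. ?q * indicator {- ?S..?S} t)" by simp
      fix t
      show "(g2 j t)\<^sup>2 + ?A * (g1 j t)\<^sup>2 + 0 * (g j t)\<^sup>2 \<le> ?q * indicator {- ?S..?S} t"
      proof (cases "\<bar>t\<bar> > ?S")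
        case True
        then have "\<bar>0 + c j * t\<bar> > 2" using h4[of j] by (simp add: c_def abs_mult less_divide_eq)
        then show ?thesis using ct(12,13) True A by (simp add: g1_def g2_def)
      next
        case False
        then have t: "t \<in> {- ?S..?S}" by auto
        have sq: "x\<^sup>2 \<le> M\<^sup>2" if "\<bar>x\<bar> \<le> M" for x using abs_le_square_iff[of x M] that M0 by simp
        have "(g2 j t)\<^sup>2 = (h j * c j)\<^sup>2 * ((c j)\<^sup>2 * (ct2 (0 + c j * t))\<^sup>2)" by (simp add: g2_def power_mult_distrib)
        also have "\<dots> \<le> (h j * c j)\<^sup>2 * (1 * M\<^sup>2)"
          using c[of j] sq[OF ct(11)] by (intro mult_left_mono mult_mono) (auto simp: power_le_one)
        finally have 1: "(g2 j t)\<^sup>2 \<le> (h j * c j)\<^sup>2 * M\<^sup>2" by simp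
        have "(g1 j t)\<^sup>2 = (h j * c j)\<^sup>2 * (ct1 (0 + c j * t))\<^sup>2" by (simp add: g1_def power_mult_distrib)
        also have "\<dots> \<le> (h j * c j)\<^sup>2 * M\<^sup>2" using sq[OF ct(10)] by (intro mult_left_mono) auto
        finally have "?A * (g1 j t)\<^sup>2 \<le> ?A * ((h j * c j)\<^sup>2 * M\<^sup>2)" using A by (intro mult_left_mono) auto
        with 1 t show ?thesis by (simp add: algebra_simps)
      qed
    qed
    also have "\<dots> = ?q * (4 * h j ^ 4)" using h4[of j] by simp
    also have "\<dots> = F / (h j)\<^sup>2"
      using h[of j] by (simp add: F_def c_def field_simps power2_eq_square power4_eq_xxxx)
    finally show ?thesis .
  qed
  have bound: "norm_alpha (b - a - 2) lam \<mu> (\<lambda>x. \<phi> k x - \<phi> l x) \<le> sqrt (?w * (4 * F / (h m)\<^sup>2))" if m: "m \<le> k" "m \<le> l" for k l m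
  proof -
    have e: "(\<lambda>x. \<phi> k x - \<phi> l x) = rad (- a) (\<lambda>t. g k t - g l t)"
      by (simp add: \<phi>_def rad_def fun_eq_iff algebra_simps)
    let ?E = "\<lambda>j t. (g2 j t)\<^sup>2 + ?A * (g1 j t)\<^sup>2 + 0 * (g j t)\<^sup>2"
    have Dk: "((\<lambda>t. g k t - g l t) has_real_derivative g1 k t - g1 l t) (at t)"
      "((\<lambda>t. g1 k t - g1 l t) has_real_derivative g2 k t - g2 l t) (at t)" for t
      by (intro DERIV_diff D)+
    have ck: "continuous_on UNIV (\<lambda>t. g2 k t - g2 l t)" by (intro continuous_intros g2c)
    have zk: "\<forall>t. \<bar>t\<bar> > max (2 * h k ^ 4) (2 * h l ^ 4) \<longrightarrow> g k t - g l t = 0" using gz by auto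
    have "profile_energy ?A 0 (\<lambda>t. g k t - g l t) (\<lambda>t. g1 k t - g1 l t) (\<lambda>t. g2 k t - g2 l t)
        \<le> (LINT t|lborel. 2 * ?E k t + 2 * ?E l t)"
      unfolding profile_energy_def
    proof (rule integral_mono)
      show "integrable lborel (\<lambda>t. 2 * ?E k t + 2 * ?E l t)"
        by (intro Bochner_Integration.integrable_add integrable_mult_right ie)
      show "integrable lborel (\<lambda>t. (g2 k t - g2 l t)\<^sup>2 + ?A * (g1 k t - g1 l t)\<^sup>2 + 0 * (g k t - g l t)\<^sup>2)"
        by (rule profile_integrand(5)[OF Dk ck, of "max (2 * h k ^ 4) (2 * h l ^ 4)"]) (use zk in blast)
      fix t
      have s: "(x - y)\<^sup>2 \<le> 2 * x\<^sup>2 + 2 * y\<^sup>2" for x y :: real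
        using zero_le_power2[of "x + y"] by (simp add: power2_sum power2_diff)
      have "(x - y)\<^sup>2 + q * (x' - y')\<^sup>2 + 0 * z \<le> 2 * (x\<^sup>2 + q * x'\<^sup>2 + 0 * z') + 2 * (y\<^sup>2 + q * y'\<^sup>2 + 0 * z'')"
        if "q \<ge> 0" for x y x' y' z z' z'' q :: real
        using s[of x y] mult_left_mono[OF s[of x' y'] that] by (simp add: algebra_simps)
      then show "(g2 k t - g2 l t)\<^sup>2 + ?A * (g1 k t - g1 l t)\<^sup>2 + 0 * (g k t - g l t)\<^sup>2 \<le> 2 * ?E k t + 2 * ?E l t"
        using A by blast
    qed
    also have "\<dots> = 2 * profile_energy ?A 0 (g k) (g1 k) (g2 k) + 2 * profile_energy ?A 0 (g l) (g1 l) (g2 l)"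
      unfolding profile_energy_def
      by (subst Bochner_Integration.integral_add[OF integrable_mult_right[OF ie] integrable_mult_right[OF ie]])
         (simp only: integral_mult_right_zero)
    also have "\<dots> \<le> 2 * (F / (h m)\<^sup>2) + 2 * (F / (h m)\<^sup>2)"
    proof -
      have "F / (h j)\<^sup>2 \<le> F / (h m)\<^sup>2" if "m \<le> j" for j
        using that h[of m] F0 by (intro divide_left_mono power_mono) (auto simp: h_def)
      then show ?thesis using pe[of k] pe[of l] m by (smt (verit))
    qed
    finally have "?w * profile_energy ?A 0 (\<lambda>t. g k t - g l t) (\<lambda>t. g1 k t - g1 l t) (\<lambda>t. g2 k t - g2 l t)
        \<le> ?w * (4 * F / (h m)\<^sup>2)" by (intro mult_left_mono) auto
    then show ?thesis unfolding e norm_alpha_rad'[OF n Dk ck zk] B by (rule real_sqrt_le_mono)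
  qed
  have lim: "(\<lambda>m. sqrt (?w * (4 * F / (h m)\<^sup>2))) \<longlonglongrightarrow> 0"
  proof -
    have "(\<lambda>m. 1 / h m) \<longlonglongrightarrow> 0" unfolding h_def by (intro LIMSEQ_Suc lim_1_over_n)
    then have "(\<lambda>m. sqrt (?w * (4 * F * (1 / h m)\<^sup>2))) \<longlonglongrightarrow> sqrt (?w * (4 * F * 0\<^sup>2))" by (intro tendsto_intros)
    then show ?thesis by (simp add: power_divide)
  qed
  have "test_Cauchy (b - a - 2) lam \<mu> \<phi>"
    unfolding test_Cauchy_def
  proof (intro conjI allI impI)
    show "\<phi> k \<in> test_rad" for k
      unfolding \<phi>_def by (rule rad_in_test_rad[where R = "2 * h k ^ 4"]) (use gs gz in auto)
    fix e :: real assume "e > 0"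
    then obtain m where m: "sqrt (?w * (4 * F / (h m)\<^sup>2)) < e"
      using order_tendstoD(2)[OF lim, of e] by (auto simp: eventually_sequentially)
    have "norm_alpha (b - a - 2) lam \<mu> (\<lambda>x. \<phi> k x - \<phi> l x) < e" if "k \<ge> m" "l \<ge> m" for k l
      using bound[OF that] m by linarith
    then show "\<exists>M. \<forall>k\<ge>M. \<forall>l\<ge>M. norm_alpha (b - a - 2) lam \<mu> (\<lambda>x. \<phi> k x - \<phi> l x) < e" by blast
  qed
  moreover have "\<not> tendsto_L1loc \<phi> u" for u
  proof
    assume u: "tendsto_L1loc \<phi> u"
    define e1 where "e1 = (axis (SOME i. True) 1 :: real ^ 'n)"
    \<comment> \<open>On this ball | ln |x| | <= ln 2 <= 1, so it lies under every plateau, where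
      the functions equal h k |x|^(-a). Their L1 norm on it is unbounded, which rules out a
      limit.\<close>
    define K where "K = cball e1 (1 / 2)"
    have Kn: "1 / 2 \<le> norm x \<and> norm x \<le> 2" if "x \<in> K" for x
    proof -
      have "dist e1 x \<le> 1 / 2" using that by (simp add: K_def)
      moreover have "norm e1 = 1" by (simp add: e1_def)
      ultimately show ?thesis using norm_triangle_ineq2[of e1 x] norm_triangle_ineq2[of x e1]
        by (simp add: dist_norm norm_minus_commute)
    qed
    have "0 \<notin> K" using Kn[of 0] by auto
    then have Kc: "compact K" "K \<subseteq> - {0}" by (auto simp: K_def)
    have lim: "(\<lambda>k. LINT x:K|lborel. \<bar>\<phi> k x - u x\<bar>) \<longlonglongrightarrow> 0" and ui: "set_integrable lborel K u"
      using u Kc unfolding tendsto_L1loc_def by blast+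
    have val: "\<phi> k x = h k * norm x powr (- a)" if "x \<in> K" for k x
    proof -
      have r: "1 / 2 \<le> norm x" "norm x \<le> 2" "norm x > 0" using Kn[OF that] by linarith+
      have "ln (1 / 2) \<le> ln (norm x)" by (subst ln_le_cancel_iff) (use r in simp_all)
      moreover have "ln (norm x) \<le> ln 2" by (subst ln_le_cancel_iff) (use r in simp_all)
      moreover have "ln (1 / 2 :: real) = - ln 2" by (simp add: ln_div)
      moreover have "ln 2 \<le> (1 :: real)" using ln_2_less_1 by simp
      ultimately have "\<bar>- ln (norm x)\<bar> \<le> h k ^ 4" using h4[of k] by linarith
      then show ?thesis using g1 by (simp add: \<phi>_def rad_def)
    qed
    define q where "q = (LINT x:K|lborel. norm x powr (- a))"
    have wi: "set_integrable lborel K (\<lambda>x. norm x powr (- a))"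
      by (rule set_integrable_continuous_compact[OF _ Kc]) (auto intro!: continuous_intros)
    have \<phi>i: "set_integrable lborel K (\<phi> k)" for k
      by (rule set_integrable_continuous_compact[OF _ Kc]) (use Ck_on_rad[of 0 "g k" "- a"] gs in \<open>simp add: \<phi>_def\<close>)
    have q0: "q > 0"
    proof -
      define r :: real where "r = min ((1 / 2) powr (- a)) (2 powr (- a))"
      have r: "r > 0" by (simp add: r_def)
      have "r \<le> norm x powr (- a)" if "x \<in> K" for x
      proof (cases "a \<ge> 0")
        case True
        then have "2 powr (- a) \<le> norm x powr (- a)" using Kn[OF that] by (intro powr_mono2') auto
        then show ?thesis by (simp add: r_def min_le_iff_disj)
      next
        case False
        then have "(1 / 2) powr (- a) \<le> norm x powr (- a)" using Kn[OF that] by (intro powr_mono2) auto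
        then show ?thesis by (simp add: r_def min_le_iff_disj)
      qed
      moreover have "set_integrable lborel K (\<lambda>x. r)"
        by (rule set_integrable_continuous_compact[OF _ Kc]) simp
      ultimately have "(LINT x:K|lborel. r) \<le> q" unfolding q_def by (intro set_integral_mono wi) auto
      moreover have "(LINT x:K|lborel. r) = r * measure lborel K"
        by (simp add: set_lebesgue_integral_def K_def)
      moreover have "measure lborel K > 0" by (simp add: K_def content_cball_pos)
      ultimately show ?thesis using r by (smt (verit) mult_pos_pos)
    qed
    have le: "h k * q \<le> (LINT x:K|lborel. \<bar>\<phi> k x - u x\<bar>) + (LINT x:K|lborel. \<bar>u x\<bar>)" for k
    proof -
      have i1: "set_integrable lborel K (\<lambda>x. \<bar>\<phi> k x - u x\<bar>)" "set_integrable lborel K (\<lambda>x. \<bar>u x\<bar>)"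
        using \<phi>i[of k] ui by (auto intro!: set_integrable_abs set_integral_diff(1))
      have "h k * q = (LINT x:K|lborel. h k * norm x powr (- a))" unfolding q_def by simp
      also have "\<dots> \<le> (LINT x:K|lborel. \<bar>\<phi> k x - u x\<bar> + \<bar>u x\<bar>)"
        by (rule set_integral_mono) (use wi i1 val in \<open>auto intro!: set_integral_add(1) simp flip: val\<close>)
      also have "\<dots> = (LINT x:K|lborel. \<bar>\<phi> k x - u x\<bar>) + (LINT x:K|lborel. \<bar>u x\<bar>)"
        by (rule set_integral_add(2)[OF i1])
      finally show ?thesis .
    qed
    define U where "U = (LINT x:K|lborel. \<bar>u x\<bar>)"
    obtain N where N: "\<And>k. k \<ge> N \<Longrightarrow> (LINT x:K|lborel. \<bar>\<phi> k x - u x\<bar>) < 1"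
      using order_tendstoD(2)[OF lim, of 1] by (auto simp: eventually_sequentially)
    obtain k where k: "(1 + U) / q < real k" using reals_Archimedean2 by blast
    have "(1 + U) / q < h (max k N)" using k by (simp add: h_def)
    then have "1 + U < h (max k N) * q" using q0 by (simp add: divide_less_eq)
    then show False using le[of "max k N"] N[of "max k N"] by (simp add: U_def)
  qed
  ultimately show ?thesis by blast
qed

section \<open>The critical problem\<close>

text \<open>Three identities carry the cases. B is a^2 times the gap in lam <= \<mu> / a^2 + b^2.
  The discriminant A^2 - 4 B equals (b^2 - a^2 - lam)^2 - 4 \<mu>, so the bounds with sqrt \<mu>
  give real roots. Finally a^2 A = a^4 - \<mu> + B passes the sign of B on to A when \<mu> <=
  a^4.\<close>

lemma characteristic_coefficients:
  fixes a b lam \<mu> :: real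
  assumes ab: "a > 0" "b > 0"
    and C: "(\<mu> \<ge> 0 \<and> lam \<le> b\<^sup>2 - a\<^sup>2 - 2 * sqrt \<mu>) \<or>
       (0 \<le> \<mu> \<and> \<mu> \<le> a ^ 4 \<and> b\<^sup>2 - a\<^sup>2 + 2 * sqrt \<mu> \<le> lam \<and> lam \<le> \<mu> / a\<^sup>2 + b\<^sup>2) \<or>
       (\<mu> \<le> 0 \<and> lam \<le> \<mu> / a\<^sup>2 + b\<^sup>2)"
  defines "A \<equiv> a\<^sup>2 + b\<^sup>2 - lam" and "B \<equiv> a\<^sup>2 * b\<^sup>2 - lam * a\<^sup>2 + \<mu>"
  shows "B \<ge> 0" "A \<ge> 0" "B > 0 \<Longrightarrow> A > 0" "4 * B \<le> A\<^sup>2"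
proof -
  have a2: "a\<^sup>2 > 0" using ab by simp
  have disc: "A\<^sup>2 - 4 * B = (b\<^sup>2 - a\<^sup>2 - lam)\<^sup>2 - 4 * \<mu>"
    unfolding A_def B_def by (simp add: algebra_simps power2_eq_square)
  have aA: "a\<^sup>2 * A = a ^ 4 - \<mu> + B"
    unfolding A_def B_def by (simp add: algebra_simps power2_eq_square power4_eq_xxxx)
  have "B \<ge> 0 \<and> A \<ge> 0 \<and> (B > 0 \<longrightarrow> A > 0) \<and> 4 * B \<le> A\<^sup>2"
  proof (cases "lam \<le> \<mu> / a\<^sup>2 + b\<^sup>2 \<and> \<mu> \<le> a ^ 4 \<and> 4 * \<mu> \<le> (b\<^sup>2 - a\<^sup>2 - lam)\<^sup>2")
    case True
    then have "a\<^sup>2 * lam \<le> a\<^sup>2 * (\<mu> / a\<^sup>2 + b\<^sup>2)" using a2 by (intro mult_left_mono) auto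
    also have "\<dots> = \<mu> + a\<^sup>2 * b\<^sup>2" using a2 by (simp add: distrib_left)
    finally have B: "B \<ge> 0" by (simp add: B_def mult.commute)
    have "a\<^sup>2 * A \<ge> 0" "B > 0 \<longrightarrow> a\<^sup>2 * A > 0" using aA B True by auto
    then have "A \<ge> 0" "B > 0 \<longrightarrow> A > 0" using a2 by (simp_all add: zero_le_mult_iff zero_less_mult_iff)
    then show ?thesis using B disc True by simp
  next
    case False
    show ?thesis
    proof (cases "\<mu> \<ge> 0 \<and> lam \<le> b\<^sup>2 - a\<^sup>2 - 2 * sqrt \<mu>")
      case True
      define s where "s = sqrt \<mu>"
      have s: "s \<ge> 0" "\<mu> = s\<^sup>2" using True by (auto simp: s_def)
      have l: "lam \<le> b\<^sup>2 - a\<^sup>2 - 2 * s" using True by (simp add: s_def)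
      have A: "A > 0" unfolding A_def using l s(1) a2 by linarith
      have "a\<^sup>2 * lam \<le> a\<^sup>2 * (b\<^sup>2 - a\<^sup>2 - 2 * s)" using l a2 by (intro mult_left_mono) auto
      then have "B \<ge> a\<^sup>2 * (a\<^sup>2 + 2 * s) + s\<^sup>2" by (simp add: B_def s(2) algebra_simps)
      moreover have "0 \<le> a\<^sup>2 * (a\<^sup>2 + 2 * s) + s\<^sup>2" using s by simp
      ultimately have B: "B \<ge> 0" by linarith
      have "(2 * s)\<^sup>2 \<le> (b\<^sup>2 - a\<^sup>2 - lam)\<^sup>2" using l s by (intro power_mono) auto
      then have "4 * B \<le> A\<^sup>2" using disc s by (simp add: power_mult_distrib)
      then show ?thesis using A B by simp
    next
      case nF: False
      have "4 * \<mu> \<le> (b\<^sup>2 - a\<^sup>2 - lam)\<^sup>2 \<and> \<mu> \<le> a ^ 4 \<and> lam \<le> \<mu> / a\<^sup>2 + b\<^sup>2"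
      proof (cases "\<mu> \<le> 0")
        case True
        have "0 \<le> (b\<^sup>2 - a\<^sup>2 - lam)\<^sup>2" "0 \<le> a ^ 4" using ab by simp_all
        then show ?thesis using True C nF by (auto intro: order_trans[of _ 0])
      next
        case F: False
        then have c2: "\<mu> \<le> a ^ 4" "b\<^sup>2 - a\<^sup>2 + 2 * sqrt \<mu> \<le> lam" "lam \<le> \<mu> / a\<^sup>2 + b\<^sup>2" using C nF by auto
        have "(2 * sqrt \<mu>)\<^sup>2 \<le> (lam - (b\<^sup>2 - a\<^sup>2))\<^sup>2" using c2 F by (intro power_mono) auto
        then have "4 * \<mu> \<le> (lam - (b\<^sup>2 - a\<^sup>2))\<^sup>2" using F by (simp add: power_mult_distrib)
        then show ?thesis using c2 by (simp add: power2_commute)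
      qed
      then show ?thesis using False by blast
    qed
  qed
  then show "B \<ge> 0" "A \<ge> 0" "B > 0 \<Longrightarrow> A > 0" "4 * B \<le> A\<^sup>2" by auto
qed

lemma characteristic_roots:
  fixes A B :: real
  assumes "A > 0" "B > 0" "4 * B \<le> A\<^sup>2"
  obtains k l where "0 < k" "k \<le> l" "k\<^sup>2 + l\<^sup>2 = A" "k\<^sup>2 * l\<^sup>2 = B"
proof -
  define S where "S = sqrt (A\<^sup>2 - 4 * B)"
  have S: "S \<ge> 0" "S\<^sup>2 = A\<^sup>2 - 4 * B" using assms by (auto simp: S_def)
  have "S < A" by (rule power2_less_imp_less) (use S assms in auto)
  define k l where "k = sqrt ((A - S) / 2)" and "l = sqrt ((A + S) / 2)"
  have k2: "k\<^sup>2 = (A - S) / 2" "l\<^sup>2 = (A + S) / 2" using S(1) assms \<open>S < A\<close> by (auto simp: k_def l_def)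
  have "0 < k" "k \<le> l" using S(1) \<open>S < A\<close> by (auto simp: k_def l_def)
  moreover have "k\<^sup>2 + l\<^sup>2 = A" unfolding k2 by (simp add: field_simps)
  moreover have "k\<^sup>2 * l\<^sup>2 = (A\<^sup>2 - S\<^sup>2) / 4" unfolding k2 by (simp add: field_simps power2_eq_square)
  ultimately show ?thesis using that S(2) by simp
qed

text \<open>A bootstrap through the equation. It expresses v'''' by v, v'' and v^p, so v and v'' are
  carried together; positivity keeps v^p as smooth as v.\<close>

lemma homoclinic_smooth:
  assumes "homoclinic_sol k l p v v1 v2 v3"
  shows "smooth1 m v"
proof -
  note V = bounded_positive_solD[OF homoclinic_solD(1)[OF assms]]
  have "smooth1 m v \<and> smooth1 m v2"
  proof (induction m)
    case 0
    then show ?case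
      using V(2,4) has_field_derivative_at_within by (auto intro: DERIV_continuous_on)
  next
    case (Suc m)
    have "smooth1 m (\<lambda>t. (k\<^sup>2 + l\<^sup>2) * v2 t - k\<^sup>2 * l\<^sup>2 * v t + v t powr p)"
      using Suc V(1) by (intro smooth1_add smooth1_diff smooth1_cmult smooth1_powr) auto
    then have "smooth1 (Suc m) v3" unfolding smooth1.simps using V(5) by (intro exI conjI allI)
    then have v2: "smooth1 (Suc (Suc m)) v2" using V(4) by auto
    then have "smooth1 (Suc (Suc (Suc m))) v1" using V(3) by auto
    then have "smooth1 (Suc (Suc (Suc (Suc m)))) v" using V(2) by auto
    then show ?case using v2 smooth1_Suc_imp by blast
  qed
  then show ?thesis by blast
qed

text \<open>Exponential decay puts u into the completion. Conversely a competitor in it has a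
  profile vanishing at both ends, so that profile is homoclinic and a translate of v.\<close>

lemma homoclinic_unique_positive_solution:
  fixes u :: "real ^ 'n::finite \<Rightarrow> real"
  assumes n: "real CARD('n) = a + b + 2" and p: "p > 1" and \<beta>: "\<beta> = a * p - b - 2"
    and kl: "0 < k" "k \<le> l" "k\<^sup>2 + l\<^sup>2 = a\<^sup>2 + b\<^sup>2 - lam" "k\<^sup>2 * l\<^sup>2 = a\<^sup>2 * b\<^sup>2 - lam * a\<^sup>2 + \<mu>"
    and v: "homoclinic_sol k l p v v1 v2 v3" and u: "\<And>x. x \<noteq> 0 \<Longrightarrow> u x = rad (- a) v x"
    and N: "N = {u. \<exists>\<phi>. test_Cauchy (b - a - 2) lam \<mu> \<phi> \<and> tendsto_L1loc \<phi> u}"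
  shows "unique_positive_solution_in N (b - a - 2) \<beta> lam \<mu> p u"
proof -
  note V = bounded_positive_solD[OF homoclinic_solD(1)[OF v]]
  have l: "l > 0" using kl by linarith
  have AB: "a\<^sup>2 + b\<^sup>2 - lam > 0" "a\<^sup>2 * b\<^sup>2 - lam * a\<^sup>2 + \<mu> > 0"
  proof -
    have "k\<^sup>2 > 0" "l\<^sup>2 > 0" using kl(1) l by auto
    then show "a\<^sup>2 + b\<^sup>2 - lam > 0" "a\<^sup>2 * b\<^sup>2 - lam * a\<^sup>2 + \<mu> > 0"
      unfolding kl(3,4)[symmetric] by (rule add_pos_pos, rule mult_pos_pos)
  qed
  have "u \<in> N"
  proof -
    obtain C where "\<forall>t. \<bar>v t\<bar> \<le> C * exp (- (k / 2) * \<bar>t\<bar>) \<and> \<bar>v1 t\<bar> \<le> C * exp (- (k / 2) * \<bar>t\<bar>)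
        \<and> \<bar>v2 t\<bar> \<le> C * exp (- (k / 2) * \<bar>t\<bar>)"
      using homoclinic_decay[OF v kl(1,2) p] by blast
    then have C: "\<And>t. \<bar>v t\<bar> \<le> C * exp (- (k / 2) * \<bar>t\<bar>)" "\<And>t. \<bar>v1 t\<bar> \<le> C * exp (- (k / 2) * \<bar>t\<bar>)"
        "\<And>t. \<bar>v2 t\<bar> \<le> C * exp (- (k / 2) * \<bar>t\<bar>)" by blast+
    have "k / 2 > 0" using kl by simp
    from decaying_profile_in_completion[OF n homoclinic_smooth[OF v] V(2,3) C this u]
    show ?thesis unfolding N by blast
  qed
  moreover have "positive_solution (b - a - 2) \<beta> lam \<mu> p u"
    unfolding positive_solution_def
  proof (intro conjI allI impI)
    show "Ck_on 4 (- {0}) u"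
      using Ck_on_cong[OF open_punctured, of u "rad (- a) v" 4] u Ck_on_rad[OF homoclinic_smooth[OF v]] by auto
    fix x :: "real ^ 'n" assume x: "x \<noteq> 0"
    show "u x > 0" using x V(1) by (simp add: u[OF x] rad_def)
    have "(k\<^sup>2 + l\<^sup>2) * v2 t - k\<^sup>2 * l\<^sup>2 * v t + v t powr p
        = (a\<^sup>2 + b\<^sup>2 - lam) * v2 t - (a\<^sup>2 * b\<^sup>2 - lam * a\<^sup>2 + \<mu>) * v t + v t powr p" for t
      unfolding kl ..
    then show "laplacian (\<lambda>y. norm y powr - (b - a - 2) * laplacian u y) x
        + lam * divg (\<lambda>y. norm y powr (- (b - a - 2) - 2) *\<^sub>R grad u y) x
        + \<mu> * norm x powr (- (b - a - 2) - 4) * u x = norm x powr \<beta> * u x powr p"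
      by (subst equation_iff_ode[OF n x \<beta> V(2,3,4,5) u V(1)]) auto
  qed
  moreover have "\<exists>\<tau>>0. \<forall>x. x \<noteq> 0 \<longrightarrow> w x = \<tau> powr ((real CARD('n) - 4 - (b - a - 2)) / 2) * u (\<tau> *\<^sub>R x)"
    if wN: "w \<in> N" and w: "positive_solution (b - a - 2) \<beta> lam \<mu> p w" for w
  proof -
    have w4: "Ck_on 4 (- {0}) w" and wpos: "\<And>x. x \<noteq> 0 \<Longrightarrow> w x > 0"
      and weq: "\<And>x. x \<noteq> 0 \<Longrightarrow> laplacian (\<lambda>y. norm y powr - (b - a - 2) * laplacian w y) x
        + lam * divg (\<lambda>y. norm y powr (- (b - a - 2) - 2) *\<^sub>R grad w y) x
        + \<mu> * norm x powr (- (b - a - 2) - 4) * w x = norm x powr \<beta> * w x powr p"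
      using w unfolding positive_solution_def by blast+
    have "Ck_on (Suc 3) (- {0}) w" using w4 by (simp add: eval_nat_numeral)
    then have "w differentiable_on - {0}" unfolding Ck_on.simps by blast
    then have wc: "continuous_on (- {0}) w" by (rule differentiable_imp_continuous_on)
    obtain \<phi> where \<phi>: "test_Cauchy (b - a - 2) lam \<mu> \<phi>" "tendsto_L1loc \<phi> w" using wN unfolding N by blast
    obtain f where f: "(f \<longlongrightarrow> 0) at_top" "(f \<longlongrightarrow> 0) at_bot" and wf: "\<And>x. x \<noteq> 0 \<Longrightarrow> w x = rad (- a) f x"
      using completion_profile[OF n AB \<phi> wc] by blast
    \<comment> \<open>The completion yields only a continuous profile; its smoothness is read off
      from w along a ray, here through a unit vector.\<close>
    define e where "e = (axis (SOME i. True) 1 :: real ^ 'n)"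
    have e: "norm e = 1" "e \<noteq> 0" by (auto simp: e_def axis_eq_0_iff)
    have ne: "exp (- t) *\<^sub>R e \<noteq> 0" "norm (exp (- t) *\<^sub>R e) = exp (- t)" for t using e by simp_all
    have fw: "f t = exp ((- a) * t) * w (exp (- t) *\<^sub>R e)" for t
    proof -
      have "exp (- t) powr (- a) = exp (a * t)" "exp ((- a) * t) * exp (a * t) = 1"
        by (simp_all add: powr_def flip: exp_add)
      then show ?thesis using wf[OF ne(1)[of t]] unfolding rad_def ne(2) by (simp flip: mult.assoc)
    qed
    have "smooth1 4 f"
      unfolding fw[abs_def] e_def by (intro smooth1_mult smooth1_exp smooth1_radial_profile w4)
    then obtain f1 f2 f3 f4 where F: "\<And>t. (f has_real_derivative f1 t) (at t)" "\<And>t. (f1 has_real_derivative f2 t) (at t)"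
      "\<And>t. (f2 has_real_derivative f3 t) (at t)" "\<And>t. (f3 has_real_derivative f4 t) (at t)"
      by (auto simp: eval_nat_numeral)
    have fpos: "f t > 0" for t unfolding fw using wpos[OF ne(1)[of t]] by simp
    have "f4 t = (k\<^sup>2 + l\<^sup>2) * f2 t - k\<^sup>2 * l\<^sup>2 * f t + f t powr p" for t
    proof -
      have "- ln (norm (exp (- t) *\<^sub>R e)) = t" unfolding ne(2) by simp
      then show ?thesis
        using iffD1[OF equation_iff_ode[OF n ne(1) \<beta> F wf fpos] weq[OF ne(1)], of t] unfolding kl by simp
    qed
    then have "homoclinic_sol k l p f f1 f2 f3"
      using F fpos f p by (intro homoclinic_solI) auto
    then obtain s where s: "f = (\<lambda>t. v (t + s))" using homoclinic_unique[OF _ v kl(1,2) p] by blast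
    \<comment> \<open>The translation by s in t = - ln |x| is the dilation by \<tau> = exp (-
      s).\<close>
    have "w x = exp (- s) powr ((real CARD('n) - 4 - (b - a - 2)) / 2) * u (exp (- s) *\<^sub>R x)" if x: "x \<noteq> 0" for x
    proof -
      have x': "exp (- s) *\<^sub>R x \<noteq> 0" using x by simp
      have "- ln (norm (exp (- s) *\<^sub>R x)) = - ln (norm x) + s" using x by (simp add: ln_mult)
      then have "u (exp (- s) *\<^sub>R x) = exp (- s) powr (- a) * norm x powr (- a) * v (- ln (norm x) + s)"
        unfolding u[OF x'] rad_def by (simp add: powr_mult)
      moreover have a: "(real CARD('n) - 4 - (b - a - 2)) / 2 = a" using n by simp
      moreover have "exp (- s) powr a * exp (- s) powr (- a) = 1" by (simp add: powr_add[symmetric])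
      ultimately show ?thesis unfolding wf[OF x] rad_def s a by (simp add: mult.assoc[symmetric])
    qed
    then show ?thesis by (intro exI[of _ "exp (- s)"]) auto
  qed
  ultimately show ?thesis unfolding unique_positive_solution_in_def by blast
qed

section \<open>Explicit solutions\<close>

lemma cosh_powr_deriv:
  fixes \<nu> :: real
  shows "((\<lambda>t. cosh (\<nu> * t) powr r) has_real_derivative r * \<nu> * (cosh (\<nu> * t) powr (r - 1) * sinh (\<nu> * t))) (at t)"
proof -
  have "((\<lambda>t. cosh (\<nu> * t)) has_real_derivative sinh (\<nu> * t) * \<nu>) (at t)"
    by (auto intro!: derivative_eq_intros)
  from DERIV_chain2[OF has_real_derivative_powr[OF cosh_real_pos, of r] this] show ?thesis
    by (simp add: mult_ac)
qed

lemma cosh_powr_sinh_deriv: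
  fixes \<nu> :: real
  shows "((\<lambda>t. cosh (\<nu> * t) powr (r - 1) * sinh (\<nu> * t)) has_real_derivative
     \<nu> * (r * cosh (\<nu> * t) powr r - (r - 1) * cosh (\<nu> * t) powr (r - 2))) (at t)"
proof -
  let ?c = "cosh (\<nu> * t)" and ?s = "sinh (\<nu> * t)"
  have "((\<lambda>t. sinh (\<nu> * t)) has_real_derivative ?c * \<nu>) (at t)"
    by (auto intro!: derivative_eq_intros)
  from DERIV_mult[OF cosh_powr_deriv[of \<nu> "r - 1" t] this]
  have "((\<lambda>t. cosh (\<nu> * t) powr (r - 1) * sinh (\<nu> * t)) has_real_derivative
     (r - 1) * \<nu> * (?c powr (r - 1 - 1) * ?s) * ?s + ?c * \<nu> * ?c powr (r - 1)) (at t)" .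
  moreover have "?c powr (r - 1) * ?c = ?c powr r" "?c powr (r - 2) * ?c\<^sup>2 = ?c powr r"
    using cosh_real_pos[of "\<nu> * t"] by (simp_all add: powr_diff)
  moreover have "?s * ?s = ?c\<^sup>2 - 1" using cosh_square_eq[of "\<nu> * t"] by (simp add: power2_eq_square)
  ultimately show ?thesis
  proof (elim DERIV_cong)
    assume c: "?c powr (r - 1) * ?c = ?c powr r" "?c powr (r - 2) * ?c\<^sup>2 = ?c powr r" "?s * ?s = ?c\<^sup>2 - 1"
    have "(r - 1) * \<nu> * (?c powr (r - 1 - 1) * ?s) * ?s + ?c * \<nu> * ?c powr (r - 1)
        = (r - 1) * \<nu> * (?c powr (r - 2) * (?s * ?s)) + \<nu> * (?c powr (r - 1) * ?c)"
      by simp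
    also have "\<dots> = \<nu> * (r * ?c powr r - (r - 1) * ?c powr (r - 2))"
      unfolding c(1,3) right_diff_distrib[of "?c powr (r - 2)"] c(2) by (simp add: algebra_simps)
    finally show "(r - 1) * \<nu> * (?c powr (r - 1 - 1) * ?s) * ?s + ?c * \<nu> * ?c powr (r - 1)
        = \<nu> * (r * ?c powr r - (r - 1) * ?c powr (r - 2))" .
  qed
qed

text \<open>D^2 - m^2 \<nu>^2 maps cosh^m to a multiple of cosh^(m-2), and D^2 - (m - 2)^2 \<nu>^2
  maps that to a multiple of cosh^(m-4). The relation m (p - 1) = - 4 makes this cosh^(m p), and the
  constant fixes C.\<close>

lemma explicit_homoclinic:
  fixes m \<nu> C p k l :: real
  assumes m: "m < 0" and \<nu>: "\<nu> > 0" and C: "C > 0" and p: "p > 1" "m * (p - 1) = - 4"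
    and Cp: "C powr (p - 1) = m * (m - 1) * (m - 2) * (m - 3) * \<nu> ^ 4"
    and kl: "k\<^sup>2 + l\<^sup>2 = (m\<^sup>2 + (m - 2)\<^sup>2) * \<nu>\<^sup>2" "k\<^sup>2 * l\<^sup>2 = m\<^sup>2 * (m - 2)\<^sup>2 * \<nu> ^ 4"
  shows "\<exists>v1 v2 v3. homoclinic_sol k l p (\<lambda>t. C * cosh (\<nu> * t) powr m) v1 v2 v3"
proof -
  let ?c = "\<lambda>t. cosh (\<nu> * t)" and ?s = "\<lambda>t. sinh (\<nu> * t)"
  let ?v = "\<lambda>t. C * ?c t powr m" and ?v1 = "\<lambda>t. C * (m * \<nu>) * (?c t powr (m - 1) * ?s t)"
  let ?v2 = "\<lambda>t. C * (m * \<nu>) * \<nu> * (m * ?c t powr m - (m - 1) * ?c t powr (m - 2))"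
  let ?v3 = "\<lambda>t. C * (m * \<nu>) * \<nu> * (m * (m * \<nu> * (?c t powr (m - 1) * ?s t))
     - (m - 1) * ((m - 2) * \<nu> * (?c t powr (m - 2 - 1) * ?s t)))"
  let ?v4 = "\<lambda>t. C * (m * \<nu>) * \<nu> * (m * (m * \<nu> * (\<nu> * (m * ?c t powr m - (m - 1) * ?c t powr (m - 2))))
     - (m - 1) * ((m - 2) * \<nu> * (\<nu> * ((m - 2) * ?c t powr (m - 2) - (m - 2 - 1) * ?c t powr (m - 2 - 2)))))"
  have D: "(?v has_real_derivative ?v1 t) (at t)" "(?v1 has_real_derivative ?v2 t) (at t)"
    "(?v2 has_real_derivative ?v3 t) (at t)" "(?v3 has_real_derivative ?v4 t) (at t)" for t
  proof -
    show "(?v has_real_derivative ?v1 t) (at t)"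
      using DERIV_cmult[OF cosh_powr_deriv[of \<nu> m t], of C] by (simp add: mult.assoc)
    show "(?v1 has_real_derivative ?v2 t) (at t)"
      using DERIV_cmult[OF cosh_powr_sinh_deriv[of \<nu> m t], of "C * (m * \<nu>)"] by (simp add: mult.assoc)
    show "(?v2 has_real_derivative ?v3 t) (at t)" by (intro DERIV_cmult DERIV_diff cosh_powr_deriv)
    show "(?v3 has_real_derivative ?v4 t) (at t)" by (intro DERIV_cmult DERIV_diff cosh_powr_sinh_deriv)
  qed
  have eq: "?v4 t = (k\<^sup>2 + l\<^sup>2) * ?v2 t - k\<^sup>2 * l\<^sup>2 * ?v t + ?v t powr p" for t
  proof -
    have c: "?c t > 0" by (rule cosh_real_pos)
    have "?v t powr p = C powr p * ?c t powr (m * p)" using C c by (simp add: powr_mult powr_powr)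
    also have "m * p = m - 4" using p(2) by (simp add: algebra_simps)
    also have "C powr p = C * C powr (p - 1)" using C by (simp add: powr_diff)
    finally have vp: "?v t powr p = C * (m * (m - 1) * (m - 2) * (m - 3) * \<nu> ^ 4) * ?c t powr (m - 4)"
      unfolding Cp .
    have m4: "m - 2 - 2 = m - 4" by simp
    have alg: "C * (m * \<nu>) * \<nu> * (m * (m * \<nu> * (\<nu> * (m * x - (m - 1) * y)))
       - (m - 1) * ((m - 2) * \<nu> * (\<nu> * ((m - 2) * y - (m - 2 - 1) * z))))
      = (m\<^sup>2 + (m - 2)\<^sup>2) * \<nu>\<^sup>2 * (C * (m * \<nu>) * \<nu> * (m * x - (m - 1) * y))
       - m\<^sup>2 * (m - 2)\<^sup>2 * \<nu> ^ 4 * (C * x) + C * (m * (m - 1) * (m - 2) * (m - 3) * \<nu> ^ 4) * z" for x y z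
      by algebra
    show ?thesis unfolding kl vp m4 by (rule alg)
  qed
  have lim: "(?v \<longlongrightarrow> 0) at_top"
  proof -
    have "filterlim (\<lambda>t. \<nu> * t) at_top at_top"
      by (rule filterlim_tendsto_pos_mult_at_top[OF tendsto_const \<nu> filterlim_ident])
    then have "filterlim ?c at_top at_top" by (rule filterlim_compose[OF cosh_real_at_top])
    then have "((\<lambda>t. ?c t powr m) \<longlongrightarrow> 0) at_top" by (rule tendsto_neg_powr[OF m])
    then show ?thesis using tendsto_mult_right_zero by blast
  qed
  have "((\<lambda>t. ?v (- t)) \<longlongrightarrow> 0) at_bot" by (rule filterlim_compose[OF lim filterlim_uminus_at_top_at_bot])
  then have lim': "(?v \<longlongrightarrow> 0) at_bot" by simp
  have "homoclinic_sol k l p ?v ?v1 ?v2 ?v3"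
    by (rule homoclinic_solI[OF _ D(1-3) _ lim lim' p(1)])
       (use C cosh_real_pos D(4) eq in \<open>simp_all add: mult_pos_pos\<close>)
  then show ?thesis by blast
qed

lemma explicit_profile:
  fixes x :: "real ^ 'n::finite"
  shows "C / 2 powr m * norm x powr (- (a + \<nu> * m)) * (1 + norm x powr (2 * \<nu>)) powr m
    = rad (- a) (\<lambda>t. C * cosh (\<nu> * t) powr m) x"
proof (cases "x = 0")
  case False
  then have r: "norm x > 0" by simp
  have "cosh (\<nu> * - ln (norm x)) = norm x powr (- \<nu>) * (1 + norm x powr (2 * \<nu>)) / 2"
    using r by (simp add: cosh_def powr_def exp_add[symmetric] algebra_simps)
  then have "cosh (\<nu> * - ln (norm x)) powr m = (norm x powr (- \<nu>) * (1 + norm x powr (2 * \<nu>)) / 2) powr m"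
    by (simp only:)
  also have "\<dots> = norm x powr (- (\<nu> * m)) * (1 + norm x powr (2 * \<nu>)) powr m / 2 powr m"
    by (simp add: powr_mult powr_divide powr_powr)
  finally have "cosh (\<nu> * - ln (norm x)) powr m = norm x powr (- (\<nu> * m)) * (1 + norm x powr (2 * \<nu>)) powr m / 2 powr m" .
  moreover have "norm x powr (- (a + \<nu> * m)) = norm x powr (- a) * norm x powr (- (\<nu> * m))"
    by (simp add: powr_add[symmetric])
  ultimately show ?thesis by (simp add: rad_def)
qed (simp add: rad_def)

text \<open>Here c is |2 + \<alpha>|, and m c and (m - 2) c are 2 a and 2 b up to order and sign.
  Stating only symmetric functions of them in \<open>mc\<close> covers (i) and (ii) at once. The
  choice of \<nu> makes the sum k^2 + l^2 right; \<open>quad\<close> is equivalent to the product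
  being right as well.\<close>

lemma explicit_solution:
  fixes a b c m \<nu> p \<beta> lam \<mu> :: real and N :: "(real ^ 'n::finite \<Rightarrow> real) set"
  assumes n: "real CARD('n) = a + b + 2" and p: "p > 1" "m * (p - 1) = - 4" and \<beta>: "\<beta> = a * p - b - 2"
    and ab: "a > 0" "b > 0" and m: "m < 0" and c: "c > 0"
    and mc: "(m\<^sup>2 + (m - 2)\<^sup>2) * c\<^sup>2 = 4 * (a\<^sup>2 + b\<^sup>2)" "m\<^sup>2 * (m - 2)\<^sup>2 * c ^ 4 = 16 * (a\<^sup>2 * b\<^sup>2)"
    and kl: "0 < k" "k \<le> l" "k\<^sup>2 + l\<^sup>2 = a\<^sup>2 + b\<^sup>2 - lam" "k\<^sup>2 * l\<^sup>2 = a\<^sup>2 * b\<^sup>2 - lam * a\<^sup>2 + \<mu>"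
    and \<nu>: "\<nu> = c / 2 * sqrt (1 - 2 * lam / ((a + b)\<^sup>2 + (b - a)\<^sup>2))"
    and quad: "a\<^sup>2 * b\<^sup>2 * lam\<^sup>2 - a\<^sup>2 * (b ^ 4 - a ^ 4) * lam = (a\<^sup>2 + b\<^sup>2)\<^sup>2 * \<mu>"
    and N: "N = {u. \<exists>\<phi>. test_Cauchy (b - a - 2) lam \<mu> \<phi> \<and> tendsto_L1loc \<phi> u}"
  shows "\<exists>C>0. C powr (p - 1) = m * (m - 1) * (m - 2) * (m - 3) * \<nu> ^ 4 \<and>
    unique_positive_solution_in N (b - a - 2) \<beta> lam \<mu> p
      (\<lambda>x. C / 2 powr m * norm x powr (- (a + \<nu> * m)) * (1 + norm x powr (2 * \<nu>)) powr m)"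
proof -
  let ?s = "a\<^sup>2 + b\<^sup>2" and ?A = "a\<^sup>2 + b\<^sup>2 - lam" and ?B = "a\<^sup>2 * b\<^sup>2 - lam * a\<^sup>2 + \<mu>"
  have s: "?s > 0" using ab by (simp add: add_pos_pos)
  have A: "?A > 0" unfolding kl(3)[symmetric] using kl(1,2) by (simp add: add_pos_pos)
  have in_sqrt: "1 - 2 * lam / ((a + b)\<^sup>2 + (b - a)\<^sup>2) = ?A / ?s"
  proof -
    have "(a + b)\<^sup>2 + (b - a)\<^sup>2 = 2 * ?s" by (simp add: power2_eq_square algebra_simps)
    moreover have "1 - 2 * lam / (2 * r) = (r - lam) / r" if "r > 0" for r :: real
      using that by (simp add: field_simps)
    ultimately show ?thesis using s by (simp only:)
  qed
  have As: "?A / ?s > 0" using A s by simp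
  have \<nu>0: "\<nu> > 0" unfolding \<nu> in_sqrt using c As by simp
  have \<nu>2: "\<nu>\<^sup>2 = c\<^sup>2 / 4 * (?A / ?s)"
    unfolding \<nu> in_sqrt using As by (simp add: power_mult_distrib power_divide)
  have \<nu>4: "\<nu> ^ 4 = c ^ 4 / 16 * (?A / ?s)\<^sup>2"
  proof -
    have "(c\<^sup>2 / 4 * r)\<^sup>2 = c ^ 4 / 16 * r\<^sup>2" for r :: real by (simp add: power_mult_distrib power_divide)
    moreover have "\<nu> ^ 4 = (\<nu>\<^sup>2)\<^sup>2" by simp
    ultimately show ?thesis unfolding \<nu>2 by (simp only:)
  qed
  have kl2: "k\<^sup>2 + l\<^sup>2 = (m\<^sup>2 + (m - 2)\<^sup>2) * \<nu>\<^sup>2"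
  proof -
    have "(m\<^sup>2 + (m - 2)\<^sup>2) * \<nu>\<^sup>2 = ((m\<^sup>2 + (m - 2)\<^sup>2) * c\<^sup>2) / 4 * (?A / ?s)" unfolding \<nu>2 by simp
    also have "\<dots> = ?s * (?A / ?s)" unfolding mc(1) by (simp only: nonzero_mult_div_cancel_left)
    also have "\<dots> = ?A"
      unfolding times_divide_eq_right by (rule nonzero_mult_div_cancel_left) (rule less_imp_neq[OF s, symmetric])
    finally show ?thesis using kl(3) by simp
  qed
  have kl4: "k\<^sup>2 * l\<^sup>2 = m\<^sup>2 * (m - 2)\<^sup>2 * \<nu> ^ 4"
  proof -
    have "m\<^sup>2 * (m - 2)\<^sup>2 * \<nu> ^ 4 = (m\<^sup>2 * (m - 2)\<^sup>2 * c ^ 4) / 16 * (?A / ?s)\<^sup>2" unfolding \<nu>4 by simp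
    also have "\<dots> = a\<^sup>2 * b\<^sup>2 * ?A\<^sup>2 / ?s\<^sup>2" unfolding mc(2) by (simp add: power_divide)
    also have "a\<^sup>2 * b\<^sup>2 * ?A\<^sup>2 = ?B * ?s\<^sup>2"
    proof -
      have "?B * ?s\<^sup>2 - a\<^sup>2 * b\<^sup>2 * ?A\<^sup>2
          = ?s\<^sup>2 * \<mu> - (a\<^sup>2 * b\<^sup>2 * lam\<^sup>2 - a\<^sup>2 * (b ^ 4 - a ^ 4) * lam)" by algebra
      then show ?thesis using quad by simp
    qed
    also have "?B * ?s\<^sup>2 / ?s\<^sup>2 = ?B"
      by (rule nonzero_mult_div_cancel_right) (rule power_not_zero[OF less_imp_neq[OF s, symmetric]])
    finally show ?thesis using kl(4) by simp
  qed
  define G where "G = m * (m - 1) * (m - 2) * (m - 3) * \<nu> ^ 4"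
  have "m * (m - 1) > 0" "(m - 2) * (m - 3) > 0" using m by (simp_all add: mult_neg_neg)
  then have "(m * (m - 1)) * ((m - 2) * (m - 3)) * \<nu> ^ 4 > 0"
    by (rule mult_pos_pos[OF mult_pos_pos zero_less_power[OF \<nu>0]])
  then have G: "G > 0" by (simp add: G_def mult.assoc)
  define C where "C = G powr (1 / (p - 1))"
  have C: "C > 0" "C powr (p - 1) = G" using G p(1) by (simp_all add: C_def powr_powr)
  obtain v1 v2 v3 where h: "homoclinic_sol k l p (\<lambda>t. C * cosh (\<nu> * t) powr m) v1 v2 v3"
    using explicit_homoclinic[OF m \<nu>0 C(1) p C(2)[unfolded G_def] kl2 kl4] by blast
  have "unique_positive_solution_in N (b - a - 2) \<beta> lam \<mu> p
      (\<lambda>x. C / 2 powr m * norm x powr (- (a + \<nu> * m)) * (1 + norm x powr (2 * \<nu>)) powr m)"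
    by (rule homoclinic_unique_positive_solution[OF n p(1) \<beta> kl h explicit_profile N])
  then show ?thesis using C G_def by blast
qed

lemma square_of_quadratic_root:
  fixes R :: real
  assumes "R \<ge> 0" "\<exists>s\<in>{1, -1}. x = (d + s * sqrt R) / e" "e \<noteq> 0"
  shows "(e * x - d)\<^sup>2 = R"
proof -
  obtain s where s: "s = 1 \<or> s = -1" "x = (d + s * sqrt R) / e" using assms(2) by blast
  then have "e * x - d = s * sqrt R" using assms(3) by simp
  then have "(e * x - d)\<^sup>2 = s\<^sup>2 * (sqrt R)\<^sup>2" by (simp only: power_mult_distrib)
  then show ?thesis using s(1) assms(1) by auto
qed

text \<open>Squaring removes the sign of the root and leaves a quadratic equation in X = lam / (a +
  b)^2. With P = p + 1, Q = p + 3 and S = a + b one has 2 b = a P and 2 S = a Q, and each side of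
  the claim is S^2 a^6 / 64 times the corresponding side of that equation.\<close>

lemma explicit_quadratic_1:
  fixes a b p lam \<mu> R :: real
  assumes ab: "a > 0" "b > 0" and p: "p > 1" and P: "a * (p + 1) = 2 * b"
    and R: "R = ((p + 1) ^ 4 - 16)\<^sup>2 + (p + 1)\<^sup>2 * (p + 3) ^ 4 * ((p + 1)\<^sup>2 + 4)\<^sup>2 * (\<mu> / (a + b) ^ 4)" "R \<ge> 0"
    and root: "\<exists>s\<in>{1, -1}. lam / (a + b)\<^sup>2 = ((p + 1) ^ 4 - 16 + s * sqrt R) / (2 * (p + 1)\<^sup>2 * (p + 3)\<^sup>2)"
  shows "a\<^sup>2 * b\<^sup>2 * lam\<^sup>2 - a\<^sup>2 * (b ^ 4 - a ^ 4) * lam = (a\<^sup>2 + b\<^sup>2)\<^sup>2 * \<mu>"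
proof -
  define P Q S X Y where "P = p + 1" and "Q = p + 3" and "S = a + b" and "X = lam / S\<^sup>2" and "Y = \<mu> / S ^ 4"
  note defs = P_def Q_def S_def X_def Y_def
  have pos: "P > 0" "Q > 0" "S > 0" using ab p by (simp_all add: defs)
  have "(2 * P\<^sup>2 * Q\<^sup>2 * X - (P ^ 4 - 16))\<^sup>2 = (P ^ 4 - 16)\<^sup>2 + P\<^sup>2 * Q ^ 4 * (P\<^sup>2 + 4)\<^sup>2 * Y"
    unfolding defs R(1)[symmetric] by (rule square_of_quadratic_root[OF R(2) root]) (use p in simp)
  then have "(P\<^sup>2 * Q\<^sup>2) * (4 * P\<^sup>2 * Q\<^sup>2 * X\<^sup>2 - 4 * (P ^ 4 - 16) * X) = (P\<^sup>2 * Q\<^sup>2) * (Q\<^sup>2 * (P\<^sup>2 + 4)\<^sup>2 * Y)"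
    by algebra
  then have "4 * P\<^sup>2 * Q\<^sup>2 * X\<^sup>2 - 4 * (P ^ 4 - 16) * X = Q\<^sup>2 * (P\<^sup>2 + 4)\<^sup>2 * Y"
    using pos by simp
  moreover have b: "2 * b = a * P" and S: "2 * S = a * Q" using P by (simp_all add: defs algebra_simps)
  have "64 * (a\<^sup>2 * b\<^sup>2 * (S\<^sup>2 * X)\<^sup>2 - a\<^sup>2 * (b ^ 4 - a ^ 4) * (S\<^sup>2 * X)) = S\<^sup>2 * a ^ 6 * (4 * P\<^sup>2 * Q\<^sup>2 * X\<^sup>2 - 4 * (P ^ 4 - 16) * X)"
    using b S by algebra
  moreover have "64 * ((a\<^sup>2 + b\<^sup>2)\<^sup>2 * (S ^ 4 * Y)) = S\<^sup>2 * a ^ 6 * (Q\<^sup>2 * (P\<^sup>2 + 4)\<^sup>2 * Y)"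
    using b S by algebra
  moreover have "S\<^sup>2 * X = lam" "S ^ 4 * Y = \<mu>" using pos by (simp_all add: X_def Y_def)
  ultimately show ?thesis by simp
qed

text \<open>The same reduction with a as the eliminated quantity: 2 a = b P and 2 S = b Q, with
  common factor S^2 b^6 / 64.\<close>

lemma explicit_quadratic_2:
  fixes a b p lam \<mu> R :: real
  assumes ab: "a > 0" "b > 0" and p: "p > 1" and P: "b * (p + 1) = 2 * a"
    and R: "R = (p + 1) ^ 4 * ((p + 1) ^ 4 - 16)\<^sup>2 + 16 * (p + 1)\<^sup>2 * (p + 3) ^ 4 * ((p + 1)\<^sup>2 + 4)\<^sup>2 * (\<mu> / (a + b) ^ 4)" "R \<ge> 0"
    and root: "\<exists>s\<in>{1, -1}. lam / (a + b)\<^sup>2 = ((p + 1)\<^sup>2 * (16 - (p + 1) ^ 4) + s * sqrt R) / (8 * (p + 1)\<^sup>2 * (p + 3)\<^sup>2)"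
  shows "a\<^sup>2 * b\<^sup>2 * lam\<^sup>2 - a\<^sup>2 * (b ^ 4 - a ^ 4) * lam = (a\<^sup>2 + b\<^sup>2)\<^sup>2 * \<mu>"
proof -
  define P Q S X Y where "P = p + 1" and "Q = p + 3" and "S = a + b" and "X = lam / S\<^sup>2" and "Y = \<mu> / S ^ 4"
  note defs = P_def Q_def S_def X_def Y_def
  have pos: "P > 0" "Q > 0" "S > 0" using ab p by (simp_all add: defs)
  have "(8 * P\<^sup>2 * Q\<^sup>2 * X - P\<^sup>2 * (16 - P ^ 4))\<^sup>2 = P ^ 4 * (P ^ 4 - 16)\<^sup>2 + 16 * P\<^sup>2 * Q ^ 4 * (P\<^sup>2 + 4)\<^sup>2 * Y"
    unfolding defs R(1)[symmetric] by (rule square_of_quadratic_root[OF R(2) root]) (use p in simp)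
  then have "(16 * (P\<^sup>2 * Q\<^sup>2)) * (4 * P\<^sup>2 * Q\<^sup>2 * X\<^sup>2 - P\<^sup>2 * (16 - P ^ 4) * X) = (16 * (P\<^sup>2 * Q\<^sup>2)) * (Q\<^sup>2 * (P\<^sup>2 + 4)\<^sup>2 * Y)"
    by algebra
  then have "4 * P\<^sup>2 * Q\<^sup>2 * X\<^sup>2 - P\<^sup>2 * (16 - P ^ 4) * X = Q\<^sup>2 * (P\<^sup>2 + 4)\<^sup>2 * Y"
    using pos by simp
  moreover have a: "2 * a = b * P" and S: "2 * S = b * Q" using P by (simp_all add: defs algebra_simps)
  have "64 * (a\<^sup>2 * b\<^sup>2 * (S\<^sup>2 * X)\<^sup>2 - a\<^sup>2 * (b ^ 4 - a ^ 4) * (S\<^sup>2 * X)) = S\<^sup>2 * b ^ 6 * (4 * P\<^sup>2 * Q\<^sup>2 * X\<^sup>2 - P\<^sup>2 * (16 - P ^ 4) * X)"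
    using a S by algebra
  moreover have "64 * ((a\<^sup>2 + b\<^sup>2)\<^sup>2 * (S ^ 4 * Y)) = S\<^sup>2 * b ^ 6 * (Q\<^sup>2 * (P\<^sup>2 + 4)\<^sup>2 * Y)"
    using a S by algebra
  moreover have "S\<^sup>2 * X = lam" "S ^ 4 * Y = \<mu>" using pos by (simp_all add: X_def Y_def)
  ultimately show ?thesis by simp
qed

theorem theorem1p1:
  fixes n :: nat and \<alpha> \<beta> p lam \<mu> :: real
    and N :: "(real ^ 'n::finite \<Rightarrow> real) set"
  assumes n: "n = CARD('n)" "n \<ge> 5"
    and alpha: "- real n < \<alpha>" "\<alpha> < real n - 4"
    and p: "p > 1"
    and hyperbola: "(real n + \<alpha>) / 2 + (real n + \<beta>) / (p + 1) = real n - 2"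
    and C123:
      "(\<mu> \<ge> 0 \<and> lam \<le> (real n - 2) * (2 + \<alpha>) - 2 * sqrt \<mu>) \<or>
       (0 \<le> \<mu> \<and> \<mu> \<le> ((real n - 4 - \<alpha>) / 2) ^ 4 \<and>
         (real n - 2) * (2 + \<alpha>) + 2 * sqrt \<mu> \<le> lam \<and>
         lam \<le> 4 * \<mu> / (real n - 4 - \<alpha>)\<^sup>2 + (real n + \<alpha>)\<^sup>2 / 4) \<or>
       (\<mu> \<le> 0 \<and> lam \<le> 4 * \<mu> / (real n - 4 - \<alpha>)\<^sup>2 + (real n + \<alpha>)\<^sup>2 / 4)"
    and N: "is_N2_rad \<alpha> lam \<mu> N"
  shows
    "(\<exists>u. unique_positive_solution_in N \<alpha> \<beta> lam \<mu> p u) \<and>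

     (let R = ((p + 1) ^ 4 - 16)\<^sup>2
            + (p + 1)\<^sup>2 * (p + 3) ^ 4 * ((p + 1)\<^sup>2 + 4)\<^sup>2 * (\<mu> / (real n - 2) ^ 4);
          m\<^sub>1 = - (real n - 4 - \<alpha>) / (2 + \<alpha>);
          \<nu>\<^sub>1 = (2 + \<alpha>) / 2 * sqrt (1 - 2 * lam / ((real n - 2)\<^sup>2 + (2 + \<alpha>)\<^sup>2))
      in \<alpha> = \<beta> \<and> \<alpha> > -2 \<and> R \<ge> 0 \<and>
         (\<exists>s\<in>{1, -1}. lam / (real n - 2)\<^sup>2 =
            ((p + 1) ^ 4 - 16 + s * sqrt R) / (2 * (p + 1)\<^sup>2 * (p + 3)\<^sup>2))
      \<longrightarrow> (\<exists>C\<^sub>1>0. C\<^sub>1 powr (p - 1) = m\<^sub>1 * (m\<^sub>1 - 1) * (m\<^sub>1 - 2) * (m\<^sub>1 - 3) * \<nu>\<^sub>1 ^ 4 \<and>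
            unique_positive_solution_in N \<alpha> \<beta> lam \<mu> p
              (\<lambda>x. C\<^sub>1 / 2 powr m\<^sub>1 * norm x powr (- ((real n - 4 - \<alpha>) / 2 + \<nu>\<^sub>1 * m\<^sub>1))
                   * (1 + norm x powr (2 * \<nu>\<^sub>1)) powr m\<^sub>1))) \<and>

     (let R = (p + 1) ^ 4 * ((p + 1) ^ 4 - 16)\<^sup>2
            + 16 * (p + 1)\<^sup>2 * (p + 3) ^ 4 * ((p + 1)\<^sup>2 + 4)\<^sup>2 * (\<mu> / (real n - 2) ^ 4);
          m\<^sub>2 = (real n + \<alpha>) / (2 + \<alpha>);
          \<nu>\<^sub>2 = - (2 + \<alpha>) / 2 * sqrt (1 - 2 * lam / ((real n - 2)\<^sup>2 + (2 + \<alpha>)\<^sup>2))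
      in (real n + \<alpha>) * (real n + \<beta>) = (real n - 4 - \<alpha>)\<^sup>2 \<and> \<alpha> < -2 \<and> R \<ge> 0 \<and>
         (\<exists>s\<in>{1, -1}. lam / (real n - 2)\<^sup>2 =
            ((p + 1)\<^sup>2 * (16 - (p + 1) ^ 4) + s * sqrt R) / (8 * (p + 1)\<^sup>2 * (p + 3)\<^sup>2))
      \<longrightarrow> (\<exists>C\<^sub>2>0. C\<^sub>2 powr (p - 1) = m\<^sub>2 * (m\<^sub>2 - 1) * (m\<^sub>2 - 2) * (m\<^sub>2 - 3) * \<nu>\<^sub>2 ^ 4 \<and>
            unique_positive_solution_in N \<alpha> \<beta> lam \<mu> p
              (\<lambda>x. C\<^sub>2 / 2 powr m\<^sub>2 * norm x powr (- ((real n - 4 - \<alpha>) / 2 + \<nu>\<^sub>2 * m\<^sub>2))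
                   * (1 + norm x powr (2 * \<nu>\<^sub>2)) powr m\<^sub>2)))"
proof -
  define a where "a = (real n - 4 - \<alpha>) / 2"
  define b where "b = (real n + \<alpha>) / 2"
  have ab: "a > 0" "b > 0" using alpha by (auto simp: a_def b_def)
  have rn: "real n = a + b + 2" and al: "\<alpha> = b - a - 2" by (simp_all add: a_def b_def field_simps)
  have nn: "real CARD('n) = a + b + 2" using rn n(1) by simp
  have e: "real n - 2 = a + b" "2 + \<alpha> = b - a" "real n - 4 - \<alpha> = 2 * a" "real n + \<alpha> = 2 * b"
    by (simp_all add: rn al)
  have hyp: "real n + \<beta> = a * (p + 1)"
    using hyperbola p unfolding e by (simp add: field_simps)
  then have be: "\<beta> = a * p - b - 2" by (simp add: rn algebra_simps)
  define A where "A = a\<^sup>2 + b\<^sup>2 - lam"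
  define B where "B = a\<^sup>2 * b\<^sup>2 - lam * a\<^sup>2 + \<mu>"
  have C: "(\<mu> \<ge> 0 \<and> lam \<le> b\<^sup>2 - a\<^sup>2 - 2 * sqrt \<mu>) \<or>
       (0 \<le> \<mu> \<and> \<mu> \<le> a ^ 4 \<and> b\<^sup>2 - a\<^sup>2 + 2 * sqrt \<mu> \<le> lam \<and> lam \<le> \<mu> / a\<^sup>2 + b\<^sup>2) \<or>
       (\<mu> \<le> 0 \<and> lam \<le> \<mu> / a\<^sup>2 + b\<^sup>2)"
  proof -
    have "(a + b) * (b - a) = b\<^sup>2 - a\<^sup>2" "(2 * a / 2) ^ 4 = a ^ 4" "4 * \<mu> / (2 * a)\<^sup>2 = \<mu> / a\<^sup>2" "(2 * b)\<^sup>2 / 4 = b\<^sup>2"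
      by (simp_all add: algebra_simps power2_eq_square)
    then show ?thesis using C123 unfolding e by simp
  qed
  note AB = characteristic_coefficients[OF ab C, folded A_def B_def]
  have NN: "N = {u. \<exists>\<phi>. test_Cauchy (b - a - 2) lam \<mu> \<phi> \<and> tendsto_L1loc \<phi> u}"
    using N unfolding is_N2_rad_def al by blast
  \<comment> \<open>B = 0 is equality in the upper bound for lam. Then some Cauchy sequence has no
    local L1 limit, contrary to what \<open>is_N2_rad\<close> grants for N.\<close>
  have Bpos: "B > 0"
  proof (rule ccontr)
    assume "\<not> B > 0"
    then have "B = 0" using AB(1) by simp
    then obtain \<phi> :: "nat \<Rightarrow> real ^ 'n \<Rightarrow> real" where "test_Cauchy (b - a - 2) lam \<mu> \<phi>" "\<not> (\<exists>u. tendsto_L1loc \<phi> u)"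
      using completion_degenerate[OF nn, of lam \<mu>] AB(2) unfolding A_def B_def by blast
    then show False using N unfolding is_N2_rad_def al by blast
  qed
  obtain k l where kl: "0 < k" "k \<le> l" "k\<^sup>2 + l\<^sup>2 = A" "k\<^sup>2 * l\<^sup>2 = B"
    by (rule characteristic_roots[OF AB(3)[OF Bpos] Bpos AB(4)])
  note kl' = kl(1,2) kl(3)[unfolded A_def] kl(4)[unfolded B_def]
  have existence: "\<exists>u. unique_positive_solution_in N \<alpha> \<beta> lam \<mu> p u"
  proof -
    have "l > 0" using kl by linarith
    then obtain v v1 v2 v3 where v: "\<And>t. v t > 0" "\<And>t. (v has_real_derivative v1 t) (at t)"
      "\<And>t. (v1 has_real_derivative v2 t) (at t)" "\<And>t. (v2 has_real_derivative v3 t) (at t)"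
      "\<And>t. (v3 has_real_derivative (k\<^sup>2 + l\<^sup>2) * v2 t - k\<^sup>2 * l\<^sup>2 * v t + v t powr p) (at t)"
      "(v \<longlongrightarrow> 0) at_top" "(v \<longlongrightarrow> 0) at_bot"
      using homoclinic_exists[OF kl(1) _ p] by metis
    have "homoclinic_sol k l p v v1 v2 v3" by (rule homoclinic_solI[OF v p])
    from homoclinic_unique_positive_solution[OF nn p be kl' this refl NN]
    show ?thesis unfolding al by blast
  qed
  show ?thesis
    unfolding Let_def
  proof (intro conjI impI existence, goal_cases)
    case 1
    then have eq: "\<alpha> = \<beta>" and gt: "\<alpha> > - 2" by simp_all
    \<comment> \<open>Equating \<alpha> = b - a - 2 with \<beta> = a p - b - 2.\<close>
    have P: "a * (p + 1) = 2 * b" using eq be al by (simp add: algebra_simps)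
    have quad: "a\<^sup>2 * b\<^sup>2 * lam\<^sup>2 - a\<^sup>2 * (b ^ 4 - a ^ 4) * lam = (a\<^sup>2 + b\<^sup>2)\<^sup>2 * \<mu>"
      by (rule explicit_quadratic_1[OF ab p P refl]) (use 1 in \<open>unfold e, blast+\<close>)
    define c where "c = 2 + \<alpha>"
    have c: "c > 0" "c = b - a" using gt al by (simp_all add: c_def)
    define m where "m = - (real n - 4 - \<alpha>) / c"
    define \<nu> where "\<nu> = c / 2 * sqrt (1 - 2 * lam / ((real n - 2)\<^sup>2 + c\<^sup>2))"
    have mc: "m * c = - (2 * a)" using c by (simp add: m_def e)
    then have mc2: "(m - 2) * c = - (2 * b)" using c(2) by (simp add: left_diff_distrib)
    have "(m * (p - 1)) * (a * c) = (m * c) * (a * (p + 1) - 2 * a)" by (simp add: algebra_simps)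
    also have "\<dots> = (- 4) * (a * c)" unfolding mc P by (simp add: c(2) algebra_simps)
    finally have mp: "m * (p - 1) = - 4" using ab c(1) by (subst (asm) mult_right_cancel) simp_all
    have m0: "m < 0" using ab c(1) by (simp add: m_def e divide_neg_pos)
    have mm: "(m\<^sup>2 + (m - 2)\<^sup>2) * c\<^sup>2 = 4 * (a\<^sup>2 + b\<^sup>2)" "m\<^sup>2 * (m - 2)\<^sup>2 * c ^ 4 = 16 * (a\<^sup>2 * b\<^sup>2)"
      using mc mc2 by algebra+
    have \<nu>: "\<nu> = c / 2 * sqrt (1 - 2 * lam / ((a + b)\<^sup>2 + (b - a)\<^sup>2))" by (simp add: \<nu>_def c(2) e)
    show ?case
      using explicit_solution[OF nn p mp be ab m0 c(1) mm kl' \<nu> quad NN]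
      unfolding al[symmetric] c_def[symmetric] m_def[symmetric] \<nu>_def[symmetric] a_def[symmetric] .
  next
    case 2
    then have pr: "(2 * b) * (real n + \<beta>) = (2 * a)\<^sup>2" and lt: "\<alpha> < - 2" unfolding e by blast+
    \<comment> \<open>The condition of (ii) reads 2 b times a (p + 1) = 4 a^2 once the hyperbola has
      replaced n + \<beta>.\<close>
    have "(b * (p + 1)) * a = (2 * a) * a" using pr unfolding hyp by (simp add: power2_eq_square)
    then have P: "b * (p + 1) = 2 * a" using ab by (subst (asm) mult_right_cancel) simp_all
    have quad: "a\<^sup>2 * b\<^sup>2 * lam\<^sup>2 - a\<^sup>2 * (b ^ 4 - a ^ 4) * lam = (a\<^sup>2 + b\<^sup>2)\<^sup>2 * \<mu>"
      by (rule explicit_quadratic_2[OF ab p P refl]) (use 2 in \<open>unfold e, blast+\<close>)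
    \<comment> \<open>Now 2 + \<alpha> is negative, so - d takes the place of the positive c of case
      (i).\<close>
    define d where "d = 2 + \<alpha>"
    have d: "- d > 0" "d = b - a" using lt al by (simp_all add: d_def)
    define m where "m = (real n + \<alpha>) / d"
    define \<nu> where "\<nu> = - d / 2 * sqrt (1 - 2 * lam / ((real n - 2)\<^sup>2 + d\<^sup>2))"
    have md: "m * d = 2 * b" using d by (simp add: m_def e)
    then have md2: "(m - 2) * d = 2 * a" using d(2) by (simp add: left_diff_distrib)
    have "(m * (p - 1)) * (b * d) = (m * d) * (b * (p + 1) - 2 * b)" by (simp add: algebra_simps)
    also have "\<dots> = (- 4) * (b * d)" unfolding md P by (simp add: d(2) algebra_simps)
    finally have mp: "m * (p - 1) = - 4" using ab d(1) by (subst (asm) mult_right_cancel) simp_all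
    have m0: "m < 0" using ab d(1) by (simp add: m_def e divide_pos_neg)
    have mm: "(m\<^sup>2 + (m - 2)\<^sup>2) * (- d)\<^sup>2 = 4 * (a\<^sup>2 + b\<^sup>2)" "m\<^sup>2 * (m - 2)\<^sup>2 * (- d) ^ 4 = 16 * (a\<^sup>2 * b\<^sup>2)"
      using md md2 by algebra+
    have \<nu>: "\<nu> = - d / 2 * sqrt (1 - 2 * lam / ((a + b)\<^sup>2 + (b - a)\<^sup>2))" by (simp add: \<nu>_def d(2) e)
    show ?case
      using explicit_solution[OF nn p mp be ab m0 d(1) mm kl' \<nu> quad NN]
      unfolding al[symmetric] d_def[symmetric] m_def[symmetric] \<nu>_def[symmetric] a_def[symmetric] .
  qed
qed

end
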